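(* There exists a data structure that, for a fully dynamic undirected graph (undergoing edge insertions and deletions) with $m$ edges, maintains a $(1+\varepsilon)$-approximation to the densest subgraph density $\rho$ of the current graph with worst-case update time $O\big((\rho\varepsilon^{-2}+\varepsilon^{-4})\,\rho\log^3 m\big)$, where in this time bound $\rho$ denotes a known upper bound on the densest subgraph density (valid throughout the update sequence).
   Context: For an undirected (multi)graph $G=(V,E)$, the densest subgraph density is $\rho(G)=\max_{\varnothing\neq S\subseteq V}\frac{|E(S)|}{|S|}$, where $E(S)$ is the set of edges with both endpoints in $S$. A $(1+\varepsilon)$-approximation to $\rho$ is a value $\tilde\rho$ with $\rho\le\tilde\rho\le(1+\varepsilon)\rho$ (or within a factor $1+\varepsilon$ of $\rho$). *)

theory Defs
  imports Complex_Main "HOL-Library.Multiset"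
begin

section \<open>Dynamic multigraphs and the densest subgraph density\<close>

text \<open>A loopless undirected multigraph on the vertex set \<open>V\<close> is given by the multiset of its
  edges, each edge being a two-element subset of \<open>V\<close>. Simple graphs are the special case in
  which all multiplicities are at most one.\<close>

type_synonym edges = "nat set multiset"

definition induced_edges :: "edges \<Rightarrow> nat set \<Rightarrow> edges" where
  "induced_edges E S = filter_mset (\<lambda>e. e \<subseteq> S) E"

definition max_density :: "nat set \<Rightarrow> edges \<Rightarrow> real" where
  "max_density V E =
     Max ((\<lambda>S. real (size (induced_edges E S)) / real (card S)) ` {S. S \<subseteq> V \<and> S \<noteq> {}})"

definition is_approx :: "real \<Rightarrow> real \<Rightarrow> real \<Rightarrow> bool" where
  "is_approx \<epsilon> \<rho> r \<longleftrightarrow> \<rho> \<le> r \<and> r \<le> (1 + \<epsilon>) * \<rho>"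

datatype update = Insert nat nat | Delete nat nat

fun apply_update :: "update \<Rightarrow> edges \<Rightarrow> edges" where
  "apply_update (Insert u v) E = add_mset {u, v} E"
| "apply_update (Delete u v) E = E - {#{u, v}#}"

fun valid_update :: "nat set \<Rightarrow> edges \<Rightarrow> update \<Rightarrow> bool" where
  "valid_update V E (Insert u v) \<longleftrightarrow> u \<in> V \<and> v \<in> V \<and> u \<noteq> v"
| "valid_update V E (Delete u v) \<longleftrightarrow> u \<in> V \<and> v \<in> V \<and> u \<noteq> v \<and> {u, v} \<in># E"

definition edges_after :: "update list \<Rightarrow> nat \<Rightarrow> edges" where
  "edges_after us i = fold apply_update (take i us) {#}"

definition valid_updates :: "nat set \<Rightarrow> update list \<Rightarrow> bool" where
  "valid_updates V us \<longleftrightarrow> (\<forall>i < length us. valid_update V (edges_after us i) (us ! i))"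


section \<open>A word RAM\<close>

text \<open>Programs are written in a small imperative language. A state consists of the named
  registers and a random-access memory, both holding words, i.e. naturals below \<open>2 ^ w\<close>, where
  the word size \<open>w\<close> is a parameter of the semantics and not of the program. A program mentions
  only finitely many registers; memory is addressed by words.\<close>

type_synonym state = "(string \<Rightarrow> nat) \<times> (nat \<Rightarrow> nat)"

datatype binop = Plus | Minus | Times | Div | Mod | Less | Equal

datatype exp = Const nat | Var string | Load exp | Bin binop exp exp

datatype com =
    Skip
  | Assign string exp
  | Store exp exp
  | Seq com com
  | Cond exp com com
  | While exp com

fun eval_binop :: "nat \<Rightarrow> binop \<Rightarrow> nat \<Rightarrow> nat \<Rightarrow> nat" where
  "eval_binop w Plus x y = (x + y) mod 2 ^ w"
| "eval_binop w Minus x y = (if y \<le> x then x - y else 2 ^ w + x - y)"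
| "eval_binop w Times x y = (x * y) mod 2 ^ w"
| "eval_binop w Div x y = x div y"
| "eval_binop w Mod x y = x mod y"
| "eval_binop w Less x y = (of_bool (x < y)) mod 2 ^ w"
| "eval_binop w Equal x y = (of_bool (x = y)) mod 2 ^ w"

fun eval :: "nat \<Rightarrow> exp \<Rightarrow> state \<Rightarrow> nat" where
  "eval w (Const c) s = c mod 2 ^ w"
| "eval w (Var x) s = fst s x"
| "eval w (Load a) s = snd s (eval w a s)"
| "eval w (Bin f a b) s = eval_binop w f (eval w a s) (eval w b s)"

fun exp_cost :: "exp \<Rightarrow> nat" where
  "exp_cost (Const c) = 1"
| "exp_cost (Var x) = 1"
| "exp_cost (Load a) = 1 + exp_cost a"
| "exp_cost (Bin f a b) = 1 + exp_cost a + exp_cost b"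

text \<open>\<open>exec w c s t s'\<close>: with word size \<open>w\<close>, the program \<open>c\<close> started in \<open>s\<close> terminates in \<open>s'\<close>
  after \<open>t\<close> unit-cost steps.\<close>

inductive exec :: "nat \<Rightarrow> com \<Rightarrow> state \<Rightarrow> nat \<Rightarrow> state \<Rightarrow> bool" for w :: nat where
  Skip: "exec w Skip s 1 s"
| Assign: "exec w (Assign x a) s (1 + exp_cost a) ((fst s)(x := eval w a s), snd s)"
| Store: "exec w (Store a b) s (1 + exp_cost a + exp_cost b)
            (fst s, (snd s)(eval w a s := eval w b s))"
| Seq: "exec w c1 s1 t1 s2 \<Longrightarrow> exec w c2 s2 t2 s3 \<Longrightarrow> exec w (Seq c1 c2) s1 (t1 + t2) s3"
| CondTrue: "eval w b s \<noteq> 0 \<Longrightarrow> exec w c1 s t s' \<Longrightarrow>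
     exec w (Cond b c1 c2) s (1 + exp_cost b + t) s'"
| CondFalse: "eval w b s = 0 \<Longrightarrow> exec w c2 s t s' \<Longrightarrow>
     exec w (Cond b c1 c2) s (1 + exp_cost b + t) s'"
| WhileFalse: "eval w b s = 0 \<Longrightarrow> exec w (While b c) s (1 + exp_cost b) s"
| WhileTrue: "eval w b s1 \<noteq> 0 \<Longrightarrow> exec w c s1 t1 s2 \<Longrightarrow> exec w (While b c) s2 t2 s3 \<Longrightarrow>
     exec w (While b c) s1 (1 + exp_cost b + t1 + t2) s3"


section \<open>Programs as dynamic data structures\<close>

text \<open>The data structure starts, without any preprocessing, from an all-zero state in which only
  the parameters are stored. The real parameters \<open>\<epsilon>\<close> and \<open>\<rho>\<close> are passed as the words
  \<open>\<lceil>1/\<epsilon>\<rceil>\<close> and \<open>\<lceil>\<rho>\<rceil>\<close>.\<close>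

definition init_state :: "nat \<Rightarrow> real \<Rightarrow> real \<Rightarrow> state" where
  "init_state n \<epsilon> \<rho> =
     ((\<lambda>_. 0)(''n'' := n, ''inv_eps'' := nat \<lceil>1 / \<epsilon>\<rceil>, ''rho'' := nat \<lceil>\<rho>\<rceil>), \<lambda>_. 0)"

text \<open>An update is announced by writing it to three registers; everything else persists from the
  end of the previous update.\<close>

fun announce :: "update \<Rightarrow> state \<Rightarrow> state" where
  "announce (Insert u v) s = ((fst s)(''op'' := 0, ''u'' := u, ''v'' := v), snd s)"
| "announce (Delete u v) s = ((fst s)(''op'' := 1, ''u'' := u, ''v'' := v), snd s)"

text \<open>The maintained value is a rational number. The successor in the denominator makes the
  all-zero registers denote \<open>0\<close>, the density of the initial empty graph.\<close>

definition estimate :: "state \<Rightarrow> real" where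
  "estimate s = real (fst s ''num'') / (real (fst s ''den'') + 1)"

text \<open>A transdichotomous word size: \<open>w\<close> is at least a constant times the logarithm of
  the vertex count, the largest number of edges ever present, and the parameters.\<close>

definition word_size_ok :: "nat \<Rightarrow> nat \<Rightarrow> nat \<Rightarrow> nat \<Rightarrow> real \<Rightarrow> real \<Rightarrow> bool" where
  "word_size_ok c w n M \<epsilon> \<rho> \<longleftrightarrow>
     real c * log 2 (real n + real M + 1 / \<epsilon> + \<rho> + 2) \<le> real w"

text \<open>Here \<open>m\<close> is the current number of edges; the shift by \<open>2\<close> keeps the logarithm away from
  \<open>0\<close> for \<open>m \<le> 1\<close> and changes it only by a constant factor for \<open>m \<ge> 2\<close>.\<close>

definition time_bound :: "real \<Rightarrow> real \<Rightarrow> nat \<Rightarrow> real" where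
  "time_bound \<epsilon> \<rho> m = (\<rho> / \<epsilon> ^ 2 + 1 / \<epsilon> ^ 4) * \<rho> * (log 2 (real m + 2)) ^ 3"

end

theory Submission
  imports Defs
begin

text \<open>Every edge is replaced by \<open>B\<close> parallel units, and every unit is oriented. The orientation
  is kept stable: an arc from \<open>u\<close> to \<open>v\<close> exists only while the out-degree of \<open>u\<close> exceeds that of
  \<open>v\<close> by at most a summand \<open>1\<close> and a factor \<open>1 + 1 / B\<close>. For \<open>B\<close> of order \<open>\<epsilon>\<^sup>-\<^sup>2 log m\<close> the largest
  out-degree divided by \<open>B\<close> is a \<open>(1 + \<epsilon>)\<close>-approximation to the density: it is an upper bound
  because every unit inside \<open>S\<close> leaves a vertex of \<open>S\<close>, and if it were too large, then the sets of
  vertices whose out-degree exceeds slowly decreasing thresholds would grow by a factor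
  \<open>1 + \<epsilon> / 4\<close> too often.

  Inserting or deleting a unit is repaired by reversing arcs along a chain. The factor
  \<open>1 + 1 / B\<close> makes the out-degrees grow geometrically along the chain, hence its length is
  \<open>O(B log m)\<close>. To find the next arc in time \<open>O(\<rho>)\<close>, the endpoint with the larger share of an edge
  owns the edge. A vertex owns \<open>O(\<rho>)\<close> edges, which are scanned; the other edges at a vertex are
  kept in lists according to the out-degree of the other endpoint, which the owner updates.

  Since \<open>B\<close> depends on \<open>log m\<close>, two orientations with different \<open>B\<close> are kept, and while \<open>m\<close>
  grows or shrinks by a factor \<open>4\<close> the edges are migrated from one to the other, a constant number
  per update.\<close>

section \<open>An ideal machine without overflow\<close>

text \<open>An edge operation treats B units one after another; each starts a chain of O(B log m)
  reversals, and each reversal costs O(\<rho>). With B of order \<epsilon>^-2 log m this multiplies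
  to \<rho> \<epsilon>^-4 log^3 m. For the logarithms to be in the current m, the expansion argument
  counts only vertices of positive out-degree, at most 2m of them, and out-degrees are bounded by
  order B m. The delicate point is the next arc at a vertex with many edges that it does not own.
  During a chain the out-degrees corrected by the unit in transit are constant and satisfy the
  stability condition. Hence a violating arc misses the condition only slightly, and its other end
  has one of at most two out-degrees. So besides the owned edges a constant number of lists is
  inspected, and any member of such a list serves. Reversals preserve the number of units on each
  pair, so between them only the edge being inserted or deleted can have a number that is not a
  multiple of B. This keeps the owned edges few throughout. There is no preprocessing, so every
  invariant is phrased to hold for zeroed memory.\<close>

text \<open>The cell \<open>mm h s (f, a, b, c)\<close> is entry \<open>(a, b, c)\<close> of field \<open>f\<close> in slot \<open>s\<close>. Slots 0 and 1
  each hold an orientation \<open>x\<close>, slot 2 holds the edge array. The fields of an orientation are: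
  0 the number of units \<open>x u v\<close>; 1 the class of \<open>v\<close> at \<open>u\<close> and 2 its position in the list of that
  class; 3 the lengths and 4 the entries of these lists; 5 the out-degrees; 6 the number of
  vertices of out-degree at least \<open>k\<close>; 7 the largest out-degree; 8 the number \<open>B\<close> of units per edge;
  9 the length of the prefix of the edge array that is present.\<close>

type_synonym bank = "nat \<times> nat \<times> nat \<times> nat \<Rightarrow> nat"
datatype hstate = HS (rg: "string \<Rightarrow> nat") (mm: "nat \<Rightarrow> bank")

datatype hexp = HC nat | HV string | HL nat hexp hexp hexp hexp | HB binop hexp hexp

fun hop :: "binop \<Rightarrow> nat \<Rightarrow> nat \<Rightarrow> nat" where
  "hop Plus x y = x + y"
| "hop Minus x y = x - y"
| "hop Times x y = x * y"
| "hop Div x y = x div y"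
| "hop Mod x y = x mod y"
| "hop Less x y = of_bool (x < y)"
| "hop Equal x y = of_bool (x = y)"

primrec hval :: "hexp \<Rightarrow> hstate \<Rightarrow> nat" where
  "hval (HC c) h = c"
| "hval (HV x) h = rg h x"
| "hval (HL f s a b c) h = mm h (hval s h) (f, hval a h, hval b h, hval c h)"
| "hval (HB g a b) h = hop g (hval a h) (hval b h)"

text \<open>Truncated subtraction agrees with subtraction modulo \<open>2 ^ w\<close> only without
  underflow, so this is demanded here. The index bounds ensure that different cells have different
  addresses.\<close>

primrec hok :: "nat \<Rightarrow> hexp \<Rightarrow> hstate \<Rightarrow> bool" where
  "hok n (HC c) h = True"
| "hok n (HV x) h = True"
| "hok n (HL f s a b c) h = (hok n s h \<and> hok n a h \<and> hok n b h \<and> hok n c h \<and>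
     hval s h < 4 \<and> hval a h < n \<and> hval b h < n)"
| "hok n (HB g a b) h = (hok n a h \<and> hok n b h \<and> (g = Minus \<longrightarrow> hval b h \<le> hval a h))"

text \<open>A number in mixed radix with digits \<open>f\<close>, \<open>s\<close>,
  \<open>a\<close>, \<open>b\<close> and leading digit \<open>c\<close>. Only the leading digit is
  unbounded, so \<open>c\<close> carries the indices that may exceed \<open>n\<close>: classes,
  degrees and positions in the edge array.\<close>

definition addr :: "nat \<Rightarrow> nat \<Rightarrow> nat \<Rightarrow> nat \<Rightarrow> nat \<Rightarrow> nat \<Rightarrow> nat" where
  "addr n f s a b c = (((c * n + b) * n + a) * 4 + s) * 16 + f"

definition addre :: "nat \<Rightarrow> exp \<Rightarrow> exp \<Rightarrow> exp \<Rightarrow> exp \<Rightarrow> exp" where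
  "addre f s a b c = Bin Plus (Bin Times (Bin Plus (Bin Times (Bin Plus (Bin Times
     (Bin Plus (Bin Times c (Var ''n'')) b) (Var ''n'')) a) (Const 4)) s) (Const 16)) (Const f)"

primrec hcomp :: "hexp \<Rightarrow> exp" where
  "hcomp (HC c) = Const c"
| "hcomp (HV x) = Var x"
| "hcomp (HL f s a b c) = Load (addre f (hcomp s) (hcomp a) (hcomp b) (hcomp c))"
| "hcomp (HB g a b) = Bin g (hcomp a) (hcomp b)"

text \<open>The 5 in a load stands for the ingredients of an address besides the indices: the
  factors \<open>n\<close>, \<open>n\<close>, 4 and 16 and the summand \<open>f\<close>.\<close>

primrec hsize :: "hexp \<Rightarrow> nat" where
  "hsize (HC c) = 1"
| "hsize (HV x) = 1"
| "hsize (HL f s a b c) = 5 + hsize s + hsize a + hsize b + hsize c"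
| "hsize (HB g a b) = hsize a + hsize b"

primrec hconst :: "hexp \<Rightarrow> bool" where
  "hconst (HC c) = (c \<le> 64)"
| "hconst (HV x) = True"
| "hconst (HL f s a b c) = (f < 16 \<and> hconst s \<and> hconst a \<and> hconst b \<and> hconst c)"
| "hconst (HB g a b) = (hconst a \<and> hconst b)"

text \<open>An expression of size \<open>s\<close> has a value of at most \<open>Z ^ s\<close> when all words are at most \<open>Z\<close>, so
  with \<open>Z ^ 60 < 2 ^ w\<close> none of its intermediate results overflows.\<close>

definition hstat :: "hexp \<Rightarrow> bool" where
  "hstat e \<longleftrightarrow> hsize e \<le> 60 \<and> hconst e"

lemma hsize_pos: "hsize e \<ge> 1"
  by (induction e) auto

lemma addr_inj:
  assumes "a < n" "b < n" "a' < n" "b' < n" "s < 4" "s' < 4" "f < 16" "f' < 16"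
    "addr n f s a b c = addr n f' s' a' b' c'"
  shows "f = f'" "s = s'" "a = a'" "b = b'" "c = c'"
proof -
  have split: "x = x' \<and> y = y'" if "x * k + y = x' * k + y'" "y < k" "y' < k" for x x' y y' k :: nat
  proof -
    have "(x * k + y) div k = x" using that(2) by simp
    moreover have "(x' * k + y') div k = x'" using that(3) by simp
    ultimately have "x = x'" using that(1) by simp
    with that show ?thesis by simp
  qed
  note e = assms(9)[unfolded addr_def]
  from split[OF e assms(7,8)] have 1: "((c * n + b) * n + a) * 4 + s = ((c' * n + b') * n + a') * 4 + s'"
    and "f = f'" by auto
  then show "f = f'" by simp
  from split[OF 1 assms(5,6)] have 2: "(c * n + b) * n + a = (c' * n + b') * n + a'" and "s = s'" by auto
  then show "s = s'" by simp
  from split[OF 2 assms(1,3)] have 3: "c * n + b = c' * n + b'" and "a = a'" by auto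
  then show "a = a'" by simp
  from split[OF 3 assms(2,4)] show "b = b'" "c = c'" by auto
qed

locale ram =
  fixes n w Z :: nat
  assumes n_pos: "0 < n" and n_le: "n \<le> Z" and Z_ge: "64 \<le> Z" and Z_pow: "Z ^ 60 < 2 ^ w"
begin

definition bounded :: "hstate \<Rightarrow> bool" where
  "bounded h \<longleftrightarrow> rg h ''n'' = n \<and> (\<forall>x. rg h x \<le> Z) \<and>
     (\<forall>s<4. \<forall>f<16. \<forall>a<n. \<forall>b<n. \<forall>c. mm h s (f, a, b, c) \<le> Z)"

definition rel :: "state \<Rightarrow> hstate \<Rightarrow> bool" where
  "rel s h \<longleftrightarrow> bounded h \<and> fst s = rg h \<and>
     (\<forall>sl<4. \<forall>f<16. \<forall>a<n. \<forall>b<n. \<forall>c. snd s (addr n f sl a b c) = mm h sl (f, a, b, c))"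

text \<open>The sum of two numbers that are at least 2 is at most their product. Hence an addition
  is charged like a multiplication, and the exponent of an expression is simply the sum over its
  parts.\<close>

lemma pow_add:
  assumes "x \<le> Z ^ i" "y \<le> Z ^ j" "i \<ge> 1" "j \<ge> 1"
  shows "x + y \<le> Z ^ (i + j)"
proof -
  have "2 \<le> Z ^ i" "2 \<le> Z ^ j"
    using Z_ge assms(3,4) self_le_power[of Z i] self_le_power[of Z j] by auto
  then have "Z ^ i + Z ^ j \<le> Z ^ i * Z ^ j"
  proof -
    obtain p r where "Z ^ i = p + 2" "Z ^ j = r + 2"
      using \<open>2 \<le> Z ^ i\<close> \<open>2 \<le> Z ^ j\<close> by (metis le_iff_add add.commute)
    then show ?thesis by (simp add: algebra_simps)
  qed
  then show ?thesis using assms by (simp add: power_add)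
qed

lemma pow_mult: "x \<le> Z ^ i \<Longrightarrow> y \<le> Z ^ j \<Longrightarrow> x * y \<le> Z ^ (i + j)"
  by (simp add: power_add mult_le_mono)

lemma pow_lt: "x \<le> Z ^ i \<Longrightarrow> i \<le> 60 \<Longrightarrow> x < 2 ^ w"
  using Z_pow Z_ge power_increasing[of i 60 Z] by linarith

lemma pow_weak: "x \<le> Z ^ i \<Longrightarrow> i \<le> j \<Longrightarrow> x \<le> Z ^ j"
  using Z_ge power_increasing[of i j Z] by linarith

lemma small_pow: "x \<le> Z \<Longrightarrow> 1 \<le> i \<Longrightarrow> x \<le> Z ^ i"
  using pow_weak[of x 1 i] by simp

lemma addre_eval:
  assumes s: "eval w s st = vs" "vs \<le> Z ^ is" "1 \<le> is"
    and a: "eval w a st = va" "va \<le> Z ^ ia" "1 \<le> ia"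
    and b: "eval w b st = vb" "vb \<le> Z ^ ib" "1 \<le> ib"
    and c: "eval w c st = vc" "vc \<le> Z ^ ic" "1 \<le> ic"
    and sz: "5 + is + ia + ib + ic \<le> 60" and f: "f < 16" and N: "fst st ''n'' = n"
  shows "eval w (addre f s a b c) st = addr n f vs va vb vc"
proof -
  have n1: "n \<le> Z ^ 1" and f1: "f \<le> Z ^ 1" and c4: "4 \<le> Z ^ 1" and c16: "16 \<le> Z ^ 1"
    using n_le f Z_ge by auto
  have 1: "vc * n \<le> Z ^ (ic + 1)" by (rule pow_mult[OF c(2) n1])
  have 2: "vc * n + vb \<le> Z ^ (ic + 1 + ib)" by (rule pow_add[OF 1 b(2)]) (use b c in auto)
  have 3: "(vc * n + vb) * n \<le> Z ^ (ic + 1 + ib + 1)" by (rule pow_mult[OF 2 n1])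
  have 4: "(vc * n + vb) * n + va \<le> Z ^ (ic + 1 + ib + 1 + ia)"
    by (rule pow_add[OF 3 a(2)]) (use a in auto)
  have 5: "((vc * n + vb) * n + va) * 4 \<le> Z ^ (ic + 1 + ib + 1 + ia + 1)" by (rule pow_mult[OF 4 c4])
  have 6: "((vc * n + vb) * n + va) * 4 + vs \<le> Z ^ (ic + 1 + ib + 1 + ia + 1 + is)"
    by (rule pow_add[OF 5 s(2)]) (use s in auto)
  have 65: "(((vc * n + vb) * n + va) * 4 + vs) * 16 \<le> Z ^ (ic + 1 + ib + 1 + ia + 1 + is + 1)"
    by (rule pow_mult[OF 6 c16])
  have 7: "(((vc * n + vb) * n + va) * 4 + vs) * 16 + f \<le> Z ^ (ic + 1 + ib + 1 + ia + 1 + is + 1 + 1)"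
    by (rule pow_add[OF 65 f1]) auto
  have "(((vc * n + vb) * n + va) * 4 + vs) * 16 + f \<le> Z ^ (ic + 1 + ib + 1 + ia + 1 + is + 1) + Z"
    using 65 f Z_ge by linarith
  have "(((vc * n + vb) * n + va) * 4 + vs) * 16 + f < 2 ^ w"
  proof -
    have "ic + 1 + ib + 1 + ia + 1 + is + 1 + 1 \<le> 60" using sz by linarith
    then show ?thesis using pow_lt[OF 7] by blast
  qed
  note l = pow_lt[OF 1] pow_lt[OF 2] pow_lt[OF 3] pow_lt[OF 4] pow_lt[OF 5] pow_lt[OF 6]  pow_lt[OF 65] this
  have "(4::nat) < 2 ^ w" "16 < (2::nat) ^ w" "f < 2 ^ w" using pow_lt[of _ 1] c4 c16 f1 by auto
  then show ?thesis unfolding addre_def addr_def using l sz N s(1) a(1) b(1) c(1) by simp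
qed

lemma hcomp_eval:
  assumes "rel st h"
  shows "hok n e h \<Longrightarrow> hsize e \<le> 60 \<Longrightarrow> hconst e \<Longrightarrow>
     eval w (hcomp e) st = hval e h \<and> hval e h \<le> Z ^ hsize e"
proof (induction e)
  case (HC c)
  then show ?case using Z_ge pow_lt[of c 1] by simp
next
  case (HV x)
  then show ?case using assms by (simp add: rel_def bounded_def)
next
  case (HL f s a b c)
  have "eval w (addre f (hcomp s) (hcomp a) (hcomp b) (hcomp c)) st =
     addr n f (hval s h) (hval a h) (hval b h) (hval c h)"
    by (rule addre_eval[of _ _ _ "hsize s" _ _ "hsize a" _ _ "hsize b" _ _ "hsize c"])
      (use HL hsize_pos assms in \<open>simp_all add: rel_def bounded_def\<close>)
  moreover have "mm h (hval s h) (f, hval a h, hval b h, hval c h) \<le> Z"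
    using HL.prems assms by (auto simp: rel_def bounded_def)
  ultimately show ?case using HL.prems assms
    by (auto simp: rel_def intro: small_pow)
next
  case (HB g a b)
  have IH: "eval w (hcomp a) st = hval a h" "hval a h \<le> Z ^ hsize a"
     "eval w (hcomp b) st = hval b h" "hval b h \<le> Z ^ hsize b" using HB by auto
  have pa: "1 \<le> hsize a" "1 \<le> hsize b" by (rule hsize_pos)+
  have one: "1 \<le> Z ^ (hsize a + hsize b)" "(1::nat) < 2 ^ w"
    using Z_ge pow_lt[of 1 1] by auto
  have wk: "x \<le> Z ^ (hsize a + hsize b)" if "x \<le> Z ^ hsize a" for x
    using pow_weak[OF that] by simp
  have lt: "x < 2 ^ w" if "x \<le> Z ^ (hsize a + hsize b)" for x
    using pow_lt[OF that] HB.prems by simp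
  show ?case
  proof (cases g)
    case Plus then show ?thesis using IH pow_add[OF IH(2) IH(4) pa] lt by simp
  next
    case Minus then show ?thesis using IH HB.prems wk by (simp add: le_diff_conv trans_le_add1)
  next
    case Times then show ?thesis using IH pow_mult[OF IH(2) IH(4)] lt by simp
  next
    case Div then show ?thesis using IH wk by (simp add: order.trans[OF div_le_dividend])
  next
    case Mod then show ?thesis using IH wk by (simp add: order.trans[OF mod_less_eq_dividend])
  next
    case Less then show ?thesis using IH one by simp
  next
    case Equal then show ?thesis using IH one by simp
  qed
qed

end

section \<open>Loop-free commands and weakest preconditions with running times\<close>

datatype scom = SN | SA string hexp | SS nat hexp hexp hexp hexp hexp | SQ scom scom | SI hexp scom scom

primrec scomp :: "scom \<Rightarrow> com" where
  "scomp SN = Skip"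
| "scomp (SA x e) = Assign x (hcomp e)"
| "scomp (SS f s a b c e) = Store (addre f (hcomp s) (hcomp a) (hcomp b) (hcomp c)) (hcomp e)"
| "scomp (SQ c d) = Seq (scomp c) (scomp d)"
| "scomp (SI e c d) = Cond (hcomp e) (scomp c) (scomp d)"

text \<open>A conditional is charged with both branches, so the time of a loop-free command is a
  constant independent of the state.\<close>

primrec stime :: "scom \<Rightarrow> nat" where
  "stime SN = 1"
| "stime (SA x e) = 1 + exp_cost (hcomp e)"
| "stime (SS f s a b c e) = 1 + exp_cost (addre f (hcomp s) (hcomp a) (hcomp b) (hcomp c)) + exp_cost (hcomp e)"
| "stime (SQ c d) = stime c + stime d"
| "stime (SI e c d) = 1 + exp_cost (hcomp e) + (stime c + stime d)"

primrec sstat :: "scom \<Rightarrow> bool" where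
  "sstat SN = True"
| "sstat (SA x e) = (hstat e \<and> x \<noteq> ''n'')"
| "sstat (SS f s a b c e) = (hstat (HL f s a b c) \<and> hstat e)"
| "sstat (SQ c d) = (sstat c \<and> sstat d)"
| "sstat (SI e c d) = (hstat e \<and> sstat c \<and> sstat d)"

definition setm :: "hstate \<Rightarrow> nat \<Rightarrow> nat \<times> nat \<times> nat \<times> nat \<Rightarrow> nat \<Rightarrow> hstate" where
  "setm h s k v = HS (rg h) ((mm h)(s := (mm h s)(k := v)))"

definition setr :: "hstate \<Rightarrow> string \<Rightarrow> nat \<Rightarrow> hstate" where
  "setr h x v = HS ((rg h)(x := v)) (mm h)"

lemma rg_setm [simp]: "rg (setm h s k v) = rg h"
  and mm_setr [simp]: "mm (setr h x v) = mm h"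
  and rg_setr: "rg (setr h x v) y = (if y = x then v else rg h y)"
  and mm_setm: "mm (setm h s k v) s' = (if s' = s then (mm h s)(k := v) else mm h s')"
  by (auto simp: setm_def setr_def)

context ram
begin

primrec wps :: "scom \<Rightarrow> (hstate \<Rightarrow> bool) \<Rightarrow> hstate \<Rightarrow> bool" where
  "wps SN Q h = Q h"
| "wps (SA x e) Q h = (hok n e h \<and> hval e h \<le> Z \<and> Q (setr h x (hval e h)))"
| "wps (SS f s a b c e) Q h = (hok n (HL f s a b c) h \<and> hok n e h \<and> hval e h \<le> Z \<and>
     Q (setm h (hval s h) (f, hval a h, hval b h, hval c h) (hval e h)))"
| "wps (SQ c d) Q h = wps c (wps d Q) h"
| "wps (SI e c d) Q h = (hok n e h \<and> (if hval e h \<noteq> 0 then wps c Q h else wps d Q h))"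

text \<open>Total correctness with a time bound, for every machine state that simulates
  \<open>h\<close>. Loop-free commands are treated by \<open>wps\<close>, which simplification
  evaluates; loops need this semantic form.\<close>

definition wp :: "com \<Rightarrow> nat \<Rightarrow> (hstate \<Rightarrow> bool) \<Rightarrow> hstate \<Rightarrow> bool" where
  "wp c T Q h \<longleftrightarrow> (\<forall>s. rel s h \<longrightarrow> (\<exists>t s' h'. exec w c s t s' \<and> t \<le> T \<and> rel s' h' \<and> Q h'))"

lemma wpI: "(\<And>s. rel s h \<Longrightarrow> \<exists>t s' h'. exec w c s t s' \<and> t \<le> T \<and> rel s' h' \<and> Q h') \<Longrightarrow> wp c T Q h"
  by (auto simp: wp_def)

lemma wp_scom:
  assumes "sstat c" "wps c Q h"
  shows "wp (scomp c) (stime c) Q h"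
  using assms
proof (induction c arbitrary: Q h)
  case SN
  show ?case
  proof (rule wpI)
    fix s assume r: "rel s h"
    have "Q h" using SN by simp
    with r show "\<exists>t s' h'. exec w (scomp SN) s t s' \<and> t \<le> stime SN \<and> rel s' h' \<and> Q h'"
      using exec.Skip[of w s] order_refl[of "1::nat"] unfolding scomp.simps stime.simps by blast
  qed
next
  case (SA x e)
  show ?case
  proof (rule wpI)
    fix s assume r: "rel s h"
    have ev: "eval w (hcomp e) s = hval e h" using hcomp_eval[OF r, of e] SA by (auto simp: hstat_def)
    have "rel ((fst s)(x := eval w (hcomp e) s), snd s) (setr h x (hval e h))"
      using r SA ev by (auto simp: rel_def bounded_def setr_def)
    then show "\<exists>t s' h'. exec w (scomp (SA x e)) s t s' \<and> t \<le> stime (SA x e) \<and> rel s' h' \<and> Q h'"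
      using SA(2) exec.Assign[of w x "hcomp e" s] unfolding scomp.simps stime.simps wps.simps by blast
  qed
next
  case (SS f sl a b c e)
  show ?case
  proof (rule wpI)
    fix s assume r: "rel s h"
    have ok: "hok n (HL f sl a b c) h" and f: "f < 16" and N: "fst s ''n'' = n" and
      sz: "5 + hsize sl + hsize a + hsize b + hsize c \<le> 60"
      using SS r by (auto simp: hstat_def rel_def bounded_def)
    have ev: "eval w (hcomp e) s = hval e h" using hcomp_eval[OF r, of e] SS by (auto simp: hstat_def)
    have ad: "eval w (addre f (hcomp sl) (hcomp a) (hcomp b) (hcomp c)) s =
       addr n f (hval sl h) (hval a h) (hval b h) (hval c h)"
      by (rule addre_eval[of _ _ _ "hsize sl" _ _ "hsize a" _ _ "hsize b" _ _ "hsize c"])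
        (use SS sz f N hsize_pos hcomp_eval[OF r, of sl] hcomp_eval[OF r, of a] hcomp_eval[OF r, of b] hcomp_eval[OF r, of c] in \<open>simp_all add: hstat_def\<close>)
    let ?A = "addr n f (hval sl h) (hval a h) (hval b h) (hval c h)"
    let ?h = "setm h (hval sl h) (f, hval a h, hval b h, hval c h) (hval e h)"
    have "bounded h" using r by (simp add: rel_def)
    moreover have "hval e h \<le> Z" using SS(2) by simp
    ultimately have "bounded ?h" by (simp add: bounded_def mm_setm)
    moreover have "((snd s)(?A := hval e h)) (addr n f' sl' a' b' c') = mm ?h sl' (f', a', b', c')"
      if "sl' < 4" "f' < 16" "a' < n" "b' < n" for f' sl' a' b' c'
    proof (cases "?A = addr n f' sl' a' b' c'")
      case True
      have "hval a h < n" "hval b h < n" "hval sl h < 4" using ok by auto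
      from addr_inj[OF this(1,2) that(3,4) this(3) that(1) f that(2) True]
      show ?thesis using True by (simp add: setm_def)
    next
      case False
      have "(f', a', b', c') = (f, hval a h, hval b h, hval c h) \<longrightarrow> sl' \<noteq> hval sl h"
        using False by auto
      then have "mm (setm h (hval sl h) (f, hval a h, hval b h, hval c h) (hval e h)) sl' (f', a', b', c')
        = mm h sl' (f', a', b', c')" by (auto simp: mm_setm)
      moreover have "snd s (addr n f' sl' a' b' c') = mm h sl' (f', a', b', c')"
        using r that unfolding rel_def by blast
      ultimately show ?thesis using False by (metis fun_upd_other)
    qed
    ultimately have "rel (fst s, (snd s)(?A := hval e h)) ?h"
      using r unfolding rel_def by (metis fst_conv rg_setm snd_conv)
    then show "\<exists>t s' h'. exec w (scomp (SS f sl a b c e)) s t s' \<and> t \<le> stime (SS f sl a b c e) \<and> rel s' h' \<and> Q h'"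
      using SS(2) exec.Store[of w "addre f (hcomp sl) (hcomp a) (hcomp b) (hcomp c)" "hcomp e" s]
      unfolding ad ev scomp.simps stime.simps wps.simps by blast
  qed
next
  case (SQ c d)
  show ?case
  proof (rule wpI)
    fix s assume r: "rel s h"
    have "wp (scomp c) (stime c) (wps d Q) h" using SQ by auto
    with r obtain t s1 h1 where 1: "exec w (scomp c) s t s1" "t \<le> stime c" "rel s1 h1" "wps d Q h1"
      unfolding wp_def by blast
    then have "wp (scomp d) (stime d) Q h1" using SQ by auto
    with 1 obtain t' s2 h2 where 2: "exec w (scomp d) s1 t' s2" "t' \<le> stime d" "rel s2 h2" "Q h2"
      unfolding wp_def by blast
    then show "\<exists>t s' h'. exec w (scomp (SQ c d)) s t s' \<and> t \<le> stime (SQ c d) \<and> rel s' h' \<and> Q h'"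
      using exec.Seq[OF 1(1) 2(1)] add_mono[OF 1(2) 2(2)] 2(3,4) by (simp only: scomp.simps stime.simps) blast
  qed
next
  case (SI e c d)
  show ?case
  proof (rule wpI)
    fix s assume r: "rel s h"
    have ev: "eval w (hcomp e) s = hval e h" using hcomp_eval[OF r, of e] SI by (auto simp: hstat_def)
    show "\<exists>t s' h'. exec w (scomp (SI e c d)) s t s' \<and> t \<le> stime (SI e c d) \<and> rel s' h' \<and> Q h'"
    proof (cases "hval e h = 0")
      case True
      then have "wp (scomp d) (stime d) Q h" using SI by auto
      with r obtain t s1 h1 where 1: "exec w (scomp d) s t s1" "t \<le> stime d" "rel s1 h1" "Q h1"
        unfolding wp_def by blast
      have "exec w (scomp (SI e c d)) s (1 + exp_cost (hcomp e) + t) s1"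
        using exec.CondFalse[OF _ 1(1), of "hcomp e" "scomp c"] ev True by simp
      moreover have "1 + exp_cost (hcomp e) + t \<le> stime (SI e c d)" using 1(2) by simp
      ultimately show ?thesis using 1 by blast
    next
      case False
      then have "wp (scomp c) (stime c) Q h" using SI by auto
      with r obtain t s1 h1 where 1: "exec w (scomp c) s t s1" "t \<le> stime c" "rel s1 h1" "Q h1"
        unfolding wp_def by blast
      have "exec w (scomp (SI e c d)) s (1 + exp_cost (hcomp e) + t) s1"
        using exec.CondTrue[OF _ 1(1), of "hcomp e" "scomp d"] ev False by simp
      moreover have "1 + exp_cost (hcomp e) + t \<le> stime (SI e c d)" using 1(2) by simp
      ultimately show ?thesis using 1 by blast
    qed
  qed
qed

lemma wp_bounded: "(bounded h \<Longrightarrow> wp c T Q h) \<Longrightarrow> wp c T Q h"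
  unfolding wp_def rel_def by blast

lemma wp_mono: "wp c T Q h \<Longrightarrow> T \<le> T' \<Longrightarrow> (\<And>h'. bounded h' \<Longrightarrow> Q h' \<Longrightarrow> Q' h') \<Longrightarrow> wp c T' Q' h"
proof (rule wpI)
  fix s assume a: "wp c T Q h" "T \<le> T'" "\<And>h'. bounded h' \<Longrightarrow> Q h' \<Longrightarrow> Q' h'" "rel s h"
  then obtain t s' h' where "exec w c s t s'" "t \<le> T" "rel s' h'" "Q h'" unfolding wp_def by blast
  moreover from this have "bounded h'" by (simp add: rel_def)
  ultimately show "\<exists>t s' h'. exec w c s t s' \<and> t \<le> T' \<and> rel s' h' \<and> Q' h'"
    using a(2,3) order.trans by blast
qed

lemma wp_seq:
  assumes "wp c T1 Q1 h" "\<And>h1. bounded h1 \<Longrightarrow> Q1 h1 \<Longrightarrow> wp d T2 Q h1"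
  shows "wp (Seq c d) (T1 + T2) Q h"
proof (rule wpI)
  fix s assume r: "rel s h"
  with assms(1) obtain t s1 h1 where 1: "exec w c s t s1" "t \<le> T1" "rel s1 h1" "Q1 h1"
    unfolding wp_def by blast
  then have "wp d T2 Q h1" using assms(2) by (auto simp: rel_def)
  with 1 obtain t' s2 h2 where 2: "exec w d s1 t' s2" "t' \<le> T2" "rel s2 h2" "Q h2"
    unfolding wp_def by blast
  then show "\<exists>t s' h'. exec w (Seq c d) s t s' \<and> t \<le> T1 + T2 \<and> rel s' h' \<and> Q h'"
    using exec.Seq[OF 1(1) 2(1)] add_mono[OF 1(2) 2(2)] 2(3,4) by blast
qed

lemma wp_cond:
  assumes "hstat e" "hok n e h" "hval e h \<noteq> 0 \<Longrightarrow> wp c T Q h" "hval e h = 0 \<Longrightarrow> wp d T Q h"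
  shows "wp (Cond (hcomp e) c d) (1 + exp_cost (hcomp e) + T) Q h"
proof (rule wpI)
  fix s assume r: "rel s h"
  have ev: "eval w (hcomp e) s = hval e h" using hcomp_eval[OF r, of e] assms by (auto simp: hstat_def)
  show "\<exists>t s' h'. exec w (Cond (hcomp e) c d) s t s' \<and> t \<le> 1 + exp_cost (hcomp e) + T \<and> rel s' h' \<and> Q h'"
  proof (cases "hval e h = 0")
    case True
    with r assms(4) obtain t s1 h1 where 1: "exec w d s t s1" "t \<le> T" "rel s1 h1" "Q h1"
      unfolding wp_def by blast
    have "exec w (Cond (hcomp e) c d) s (1 + exp_cost (hcomp e) + t) s1"
      using exec.CondFalse[OF _ 1(1), of "hcomp e" c] ev True by simp
    then show ?thesis using 1 add_left_mono[OF 1(2)] by blast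
  next
    case False
    with r assms(3) obtain t s1 h1 where 1: "exec w c s t s1" "t \<le> T" "rel s1 h1" "Q h1"
      unfolding wp_def by blast
    have "exec w (Cond (hcomp e) c d) s (1 + exp_cost (hcomp e) + t) s1"
      using exec.CondTrue[OF _ 1(1), of "hcomp e" d] ev False by simp
    then show ?thesis using 1 add_left_mono[OF 1(2)] by blast
  qed
qed

text \<open>The index of the invariant bounds the number of remaining iterations, which yields
  termination and the running time at once.\<close>

lemma wp_while:
  fixes I :: "nat \<Rightarrow> hstate \<Rightarrow> bool"
  assumes "hstat e" "I k h"
    and ok: "\<And>k h. I k h \<Longrightarrow> hok n e h"
    and step: "\<And>k h. bounded h \<Longrightarrow> I k h \<Longrightarrow> hval e h \<noteq> 0 \<Longrightarrow> k > 0 \<and> wp c T (I (k - 1)) h"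
    and fin: "\<And>k h. bounded h \<Longrightarrow> I k h \<Longrightarrow> hval e h = 0 \<Longrightarrow> Q h"
  shows "wp (While (hcomp e) c) (k * (T + 1 + exp_cost (hcomp e)) + 1 + exp_cost (hcomp e)) Q h"
  using assms(2)
proof (induction k arbitrary: h rule: less_induct)
  case (less k)
  show ?case
  proof (rule wpI)
    fix s assume r: "rel s h"
    have ev: "eval w (hcomp e) s = hval e h"
      using hcomp_eval[OF r, of e] ok[OF less.prems] assms(1) by (auto simp: hstat_def)
    show "\<exists>t s' h'. exec w (While (hcomp e) c) s t s' \<and>
        t \<le> k * (T + 1 + exp_cost (hcomp e)) + 1 + exp_cost (hcomp e) \<and> rel s' h' \<and> Q h'"
    proof (cases "hval e h = 0")
      case True
      then have "exec w (While (hcomp e) c) s (1 + exp_cost (hcomp e)) s"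
        using exec.WhileFalse[of w "hcomp e" s c] ev by simp
      moreover have "Q h" using fin[OF _ less.prems True] r by (simp add: rel_def)
      moreover have "1 + exp_cost (hcomp e) \<le> k * (T + 1 + exp_cost (hcomp e)) + 1 + exp_cost (hcomp e)" by simp
      ultimately show ?thesis using r by blast
    next
      case False
      then have k: "k > 0" "wp c T (I (k - 1)) h" using r step[OF _ less.prems] by (auto simp: rel_def)
      from k(2) r obtain t s1 h1 where 1: "exec w c s t s1" "t \<le> T" "rel s1 h1" "I (k - 1) h1"
        unfolding wp_def by blast
      have "k - 1 < k" using k by simp
      from less.IH[OF this 1(4)] 1(3) obtain t' s2 h2 where 2: "exec w (While (hcomp e) c) s1 t' s2"
        "t' \<le> (k - 1) * (T + 1 + exp_cost (hcomp e)) + 1 + exp_cost (hcomp e)" "rel s2 h2" "Q h2"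
        unfolding wp_def by blast
      have "exec w (While (hcomp e) c) s (1 + exp_cost (hcomp e) + t + t') s2"
        using exec.WhileTrue[OF _ 1(1) 2(1)] ev False by simp
      moreover have "1 + exp_cost (hcomp e) + t + t' \<le> k * (T + 1 + exp_cost (hcomp e)) + 1 + exp_cost (hcomp e)"
        using 1(2) 2(2) k(1) by (cases k) (simp_all add: algebra_simps)
      ultimately show ?thesis using 2(3,4) by blast
    qed
  qed
qed

end

section \<open>Stable orientations\<close>

type_synonym orient = "nat \<Rightarrow> nat \<Rightarrow> nat"

definition deg :: "nat \<Rightarrow> orient \<Rightarrow> nat \<Rightarrow> nat" where
  "deg n x u = (\<Sum>v<n. x u v)"

text \<open>The summand \<open>k div B\<close> costs a factor \<open>1 + 1 / B\<close> per level in the approximation, and is what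
  makes chains short.\<close>

definition cap :: "nat \<Rightarrow> nat \<Rightarrow> nat" where
  "cap B k = k + 1 + k div B"

definition bad :: "nat \<Rightarrow> nat \<Rightarrow> orient \<Rightarrow> nat \<Rightarrow> nat \<Rightarrow> bool" where
  "bad n B x u v \<longleftrightarrow> 0 < x u v \<and> cap B (deg n x v) < deg n x u"

definition good :: "nat \<Rightarrow> nat \<Rightarrow> orient \<Rightarrow> bool" where
  "good n B x \<longleftrightarrow> (\<forall>u v. \<not> bad n B x u v)"

definition inside :: "nat \<Rightarrow> orient \<Rightarrow> bool" where
  "inside n x \<longleftrightarrow> (\<forall>u v. 0 < x u v \<longrightarrow> u < n \<and> v < n \<and> u \<noteq> v)"

text \<open>The lower adjoint of \<open>cap B\<close>, that is, the least \<open>k\<close> with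
  \<open>y \<le> cap B k\<close>, in a form that a single division computes: for
  \<open>y - 1 = q * (B + 1) + r\<close> with \<open>r \<le> B\<close> it is
  \<open>q * B + r\<close>.\<close>

definition low :: "nat \<Rightarrow> nat \<Rightarrow> nat" where
  "low B y = (y - 1) - (y - 1) div (B + 1)"

lemma cap_mono: "i \<le> j \<Longrightarrow> cap B i \<le> cap B j"
  unfolding cap_def by (simp add: add_mono div_le_mono)

lemma cap_gt: "i < cap B i"
  unfolding cap_def by simp

lemma low_le_iff:
  assumes "0 < B"
  shows "low B y \<le> k \<longleftrightarrow> y \<le> cap B k"
proof (cases "y = 0")
  case True
  then show ?thesis by (simp add: low_def cap_def)
next
  case False
  define q r where "q = (y - 1) div (B + 1)" and "r = (y - 1) mod (B + 1)"
  have y: "y = q * (B + 1) + r + 1" and r: "r \<le> B"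
    using False mod_less_divisor[of "B + 1" "y - 1"] div_mult_mod_eq[of "y - 1" "B + 1"]
    unfolding q_def r_def by (simp, linarith)
  have low: "low B y = q * B + r"
    unfolding low_def q_def[symmetric] using y by (simp add: algebra_simps)
  have "q * B + r \<le> k \<longleftrightarrow> q * (B + 1) + r \<le> k + k div B"
  proof
    assume a: "q * B + r \<le> k"
    then have "q * B \<le> k" by simp
    then have "q \<le> k div B" using assms by (simp add: less_eq_div_iff_mult_less_eq)
    then show "q * (B + 1) + r \<le> k + k div B" using a by (simp add: algebra_simps)
  next
    assume a: "q * (B + 1) + r \<le> k + k div B"
    show "q * B + r \<le> k"
    proof (rule ccontr)
      assume "\<not> q * B + r \<le> k"
      then have k: "k < q * B + r" by simp
      then have "k < (q + 1) * B" using r by simp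
      then have "k div B < q + 1" using less_mult_imp_div_less by blast
      then show False using a k by (simp add: algebra_simps)
    qed
  qed
  then show ?thesis unfolding low using y by (simp add: cap_def)
qed

text \<open>\<open>cap B\<close> is strictly increasing, so at most one degree \<open>k\<close> fits
  these inequalities. This is why a search during an insertion probes a single class.\<close>

lemma cap_eq_low:
  assumes "0 < B" "cap B k < y" "y \<le> cap B k + 1"
  shows "k + 1 = low B y"
proof -
  have "\<not> low B y \<le> k" using assms low_le_iff by auto
  moreover have "cap B k + 1 \<le> cap B (k + 1)" unfolding cap_def by (simp add: div_le_mono)
  then have "low B y \<le> k + 1" using assms(3) low_le_iff[OF assms(1)] by (meson le_trans)
  ultimately show ?thesis by simp
qed

text \<open>A jump by 2 occurs when \<open>k + 1\<close> is a multiple of \<open>B\<close>. Because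
  of it, a search during a deletion has to allow for two degrees.\<close>

lemma cap_Suc_le:
  assumes "0 < B" shows "cap B (k + 1) \<le> cap B k + 2"
proof -
  have "(k + 1) div B \<le> (k + B) div B" using assms by (intro div_le_mono) simp
  then show ?thesis using assms by (simp add: cap_def)
qed

text \<open>Passing from a threshold \<open>t\<close> to the next one costs at most
  \<open>1 + t / B\<close>; summed over the levels this is the error of the estimate.\<close>

lemma low_bounds:
  assumes "0 < B"
  shows "real (low B t) \<ge> real t - 1 - real t / real B" "low B t \<le> t"
proof -
  have "real ((t - 1) div (B + 1)) \<le> real (t - 1) / real (B + 1)"
    by (metis of_nat_div_le_of_nat)
  also have "\<dots> \<le> real t / real B"
    using assms by (intro frac_le) auto
  finally have "real ((t - 1) div (B + 1)) \<le> real t / real B" .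
  moreover have "real (low B t) = real (t - 1) - real ((t - 1) div (B + 1))"
    unfolding low_def by (rule of_nat_diff) (rule div_le_dividend)
  ultimately show "real (low B t) \<ge> real t - 1 - real t / real B" by linarith
  show "low B t \<le> t" unfolding low_def by linarith
qed

text \<open>In a stable orientation the sets of vertices of degree at least \<open>t\<^sub>i\<close>, for a slowly
  decreasing sequence \<open>t\<^sub>i\<close> of thresholds, cannot all expand by a factor \<open>1 + 1 / q\<close>; where
  they do not, the threshold is bounded by the density.\<close>

lemma good_expansion:
  fixes G :: real
  assumes B: "0 < B" and q: "1 \<le> q" and g: "good n B x" and w: "inside n x"
    and dens: "\<And>S. S \<subseteq> {..<n} \<Longrightarrow> S \<noteq> {} \<Longrightarrow> real (\<Sum>u\<in>S. \<Sum>v\<in>S. x u v) \<le> G * real (card S)"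
    and supp: "card {u. u < n \<and> 0 < deg n x u} < 2 ^ l" and u0: "u0 < n"
  shows "real (deg n x u0) * (1 - real (q * l) / real B) - real (q * l) \<le> (1 + 1 / real q) * G"
proof -
  define D where "D = Max (deg n x ` {..<n})"
  have Dge: "deg n x u \<le> D" if "u < n" for u using that unfolding D_def by (intro Max_ge) auto
  have "D \<in> deg n x ` {..<n}" unfolding D_def using u0 by (intro Max_in) auto
  then obtain um where um: "um < n" "deg n x um = D" by auto
  \<comment> \<open>These thresholds make \<open>low_le_iff\<close> applicable: stability of an arc
    leaving \<open>S i\<close> says precisely that its head has degree at least
    \<open>t (Suc i)\<close>.\<close>
  define t where "t i = (low B ^^ i) D" for i
  define S where "S i = {u. u < n \<and> t i \<le> deg n x u}" for i
  define k where "k = q * l"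
  have tS: "t (Suc i) = low B (t i)" for i by (simp add: t_def)
  have tdec: "t (Suc i) \<le> t i" for i unfolding tS by (rule low_bounds[OF B])
  have tD: "t i \<le> D" for i
    by (induction i) (use tdec in \<open>auto simp: t_def[of 0] intro: order.trans\<close>)
  have tant: "t j \<le> t i" if "i \<le> j" for i j
    using that by (induction j rule: dec_induct) (use tdec order.trans in \<open>auto\<close>)
  have tlow: "real (t i) \<ge> real D - real i * (1 + real D / real B)" for i
  proof (induction i)
    case 0
    then show ?case by (simp add: t_def)
  next
    case (Suc i)
    have "real (t (Suc i)) \<ge> real (t i) - 1 - real (t i) / real B"
      unfolding tS by (rule low_bounds[OF B])
    moreover have "real (t i) / real B \<le> real D / real B"
      using tD by (intro divide_right_mono) auto
    ultimately have "real (t (Suc i)) \<ge> real (t i) - (1 + real D / real B)" by linarith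
    then show ?case using Suc by (simp add: algebra_simps add_divide_distrib)
  qed
  have step: "v \<in> S (Suc i)" if "u \<in> S i" "0 < x u v" for u v i
  proof -
    have "deg n x u \<le> cap B (deg n x v)" using g that(2) unfolding good_def bad_def by (meson not_le)
    then have "t i \<le> cap B (deg n x v)" using that(1) by (simp add: S_def)
    then show ?thesis using w that(2) low_le_iff[OF B] unfolding S_def tS inside_def by auto
  qed
  have fin: "finite (S i)" for i unfolding S_def by simp
  have mono: "S i \<subseteq> S (Suc i)" for i unfolding S_def using tdec[of i] by auto
  have sub: "S i \<subseteq> {..<n}" for i by (auto simp: S_def)
  have ne: "um \<in> S i" for i unfolding S_def using um tD by auto
  have cpos: "0 < card (S i)" for i using ne fin card_gt_0_iff by blast
  have "real (\<Sum>u\<in>{u0}. \<Sum>v\<in>{u0}. x u v) \<le> G * real (card {u0})" using u0 by (intro dens) auto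
  then have "real (x u0 u0) \<le> G" by simp
  then have "0 \<le> G" using of_nat_0_le_iff order.trans by blast
  have Dk: "real D - real k * (1 + real D / real B) \<le> (1 + 1 / real q) * G"
  \<comment> \<open>For \<open>t k = 0\<close> the set \<open>S k\<close> contains vertices of
    degree 0 and escapes the bound on the support. But then the loss over the \<open>k\<close>
    levels is at least \<open>D\<close>, so the left side is not positive.\<close>
  proof (cases "t k = 0")
    case True
    then have "real D - real k * (1 + real D / real B) \<le> 0" using tlow[of k] by simp
    also have "0 \<le> (1 + 1 / real q) * G" using \<open>0 \<le> G\<close> by simp
    finally show ?thesis .
  next
    case False
    have "\<exists>i<k. real (card (S (Suc i))) < (1 + 1 / real q) * real (card (S i))"
    proof (rule ccontr)
      assume "\<not> ?thesis"
      then have grow: "i < k \<Longrightarrow> (1 + 1 / real q) * real (card (S i)) \<le> real (card (S (Suc i)))" for i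
        by force
      have "i \<le> k \<Longrightarrow> (1 + 1 / real q) ^ i \<le> real (card (S i))" for i
      proof (induction i)
        case 0
        then show ?case using cpos[of 0] by simp
      next
        case (Suc i)
        have "(1 + 1 / real q) ^ Suc i \<le> (1 + 1 / real q) * real (card (S i))"
          using Suc by (simp del: of_nat_Suc) (intro mult_left_mono, auto)
        then show ?case using grow[of i] Suc.prems by simp
      qed
      from this[of k] have "(1 + 1 / real q) ^ k \<le> real (card (S k))" by simp
      \<comment> \<open>By Bernoulli's inequality \<open>q\<close> levels of growth double the set,
        so \<open>k = q * l\<close> levels of growth would exceed the support.\<close>
      moreover have "2 ^ l \<le> ((1 + 1 / real q) ^ q) ^ l"
      proof (rule power_mono)
        have "1 + real q * (1 / real q) \<le> (1 + 1 / real q) ^ q"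
          by (rule Bernoulli_inequality) (use q in \<open>simp add: order.trans[of _ 0]\<close>)
        then show "2 \<le> (1 + 1 / real q) ^ q" using q by simp
      qed simp
      moreover have "(1 + 1 / real q) ^ k = ((1 + 1 / real q) ^ q) ^ l" by (simp add: k_def power_mult)
      ultimately have "real (2 ^ l) \<le> real (card (S k))"
        by (simp only: of_nat_power of_nat_numeral)
      then have "2 ^ l \<le> card (S k)" unfolding of_nat_le_iff .
      moreover have "S k \<subseteq> {u. u < n \<and> 0 < deg n x u}" unfolding S_def using False by auto
      then have "card (S k) \<le> card {u. u < n \<and> 0 < deg n x u}" by (intro card_mono) auto
      ultimately show False using supp by linarith
    qed
    then obtain i where i: "i < k" "real (card (S (Suc i))) < (1 + 1 / real q) * real (card (S i))" by auto
    \<comment> \<open>Each vertex of \<open>S i\<close> has at least \<open>t i\<close> outgoing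
      units, all of which end in \<open>S (Suc i)\<close>. That set is hardly larger than
      \<open>S i\<close>, and the density bound is applied to it.\<close>
    have "real (t i) * real (card (S i)) = real (\<Sum>u\<in>S i. t i)"
      unfolding sum_constant of_nat_id of_nat_mult by (rule mult.commute)
    also have "\<dots> \<le> real (\<Sum>u\<in>S i. deg n x u)"
      by (intro of_nat_mono sum_mono) (simp add: S_def)
    also have "(\<Sum>u\<in>S i. deg n x u) = (\<Sum>u\<in>S i. \<Sum>v\<in>S (Suc i). x u v)"
      unfolding deg_def
    proof (rule sum.cong[OF refl])
      fix u assume u: "u \<in> S i"
      have "x u v = 0" if "v \<notin> S (Suc i)" for v
        using step[OF u, of v] that by blast
      then show "(\<Sum>v<n. x u v) = (\<Sum>v\<in>S (Suc i). x u v)"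
        by (intro sum.mono_neutral_right sub finite_lessThan) simp
    qed
    also have "real \<dots> \<le> real (\<Sum>u\<in>S (Suc i). \<Sum>v\<in>S (Suc i). x u v)"
      by (intro of_nat_mono sum_mono2 fin mono) simp
    also have "\<dots> \<le> G * real (card (S (Suc i)))"
      by (rule dens[OF sub]) (use ne[of "Suc i"] in auto)
    also have "\<dots> \<le> G * ((1 + 1 / real q) * real (card (S i)))"
      by (rule mult_left_mono[OF less_imp_le[OF i(2)] \<open>0 \<le> G\<close>])
    finally have "real (t i) * real (card (S i)) \<le> ((1 + 1 / real q) * G) * real (card (S i))"
      by (simp only: ac_simps)
    then have "real (t i) \<le> (1 + 1 / real q) * G"
      using cpos[of i] by (metis mult_le_cancel_right_pos of_nat_0_less_iff)
    moreover have "real i * (1 + real D / real B) \<le> real k * (1 + real D / real B)"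
      by (rule mult_right_mono) (use i(1) in simp_all)
    ultimately show ?thesis using tlow[of i] by linarith
  qed
  have "real D - real k * (1 + real D / real B) = real D * (1 - real k / real B) - real k"
    by (simp add: algebra_simps)
  then have Dk': "real D * (1 - real k / real B) - real k \<le> (1 + 1 / real q) * G" using Dk by simp
  show ?thesis
  proof (cases "1 - real k / real B \<ge> 0")
    case True
    then have "real (deg n x u0) * (1 - real k / real B) \<le> real D * (1 - real k / real B)"
      using Dge[OF u0] by (intro mult_right_mono) auto
    then show ?thesis using Dk' unfolding k_def by linarith
  next
    case False
    then have "real (deg n x u0) * (1 - real k / real B) \<le> 0" by (simp add: mult_nonneg_nonpos)
    moreover have "0 \<le> (1 + 1 / real q) * G" using \<open>0 \<le> G\<close> by simp
    ultimately show ?thesis unfolding k_def by linarith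
  qed
qed

text \<open>With \<open>q = 4 * K\<close> there are \<open>4 * K * l\<close> levels, which explains
  the constant 32: the multiplicative loss is \<open>1 / (8 * K)\<close> and the additive loss is
  \<open>B / (8 * K)\<close>, which \<open>B \<le> 2 * G\<close> turns into
  \<open>G / (4 * K)\<close>. Together with the \<open>1 / q\<close> from the expansion this stays
  within the factor \<open>1 + 1 / K\<close>.\<close>

lemma good_deg_le:
  fixes G :: real
  assumes K: "1 \<le> K" and l: "1 \<le> l" and B: "B = 32 * K ^ 2 * l" and g: "good n B x" and w: "inside n x"
    and dens: "\<And>S. S \<subseteq> {..<n} \<Longrightarrow> S \<noteq> {} \<Longrightarrow> real (\<Sum>u\<in>S. \<Sum>v\<in>S. x u v) \<le> G * real (card S)"
    and supp: "card {u. u < n \<and> 0 < deg n x u} < 2 ^ l" and u0: "u0 < n" and BG: "real B \<le> 2 * G"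
  shows "real (deg n x u0) \<le> (1 + 1 / real K) * G"
proof -
  have K0: "0 < real K" and l0: "0 < real l" and B0: "0 < B" using K l B by auto
  have kB: "real (4 * K * l) / real B = 1 / (8 * real K)" using K0 l0 unfolding B
    by (simp add: field_simps power2_eq_square)
  have k: "real (4 * K * l) = real B / (8 * real K)" using K0 unfolding B
    by (simp add: field_simps power2_eq_square)
  have "real (deg n x u0) * (1 - real (4 * K * l) / real B) - real (4 * K * l) \<le> (1 + 1 / real (4 * K)) * G"
    by (rule good_expansion[OF B0 _ g w dens supp u0]) (use K in auto)
  then have 1: "real (deg n x u0) * (1 - 1 / (8 * real K)) \<le> (1 + 1 / (4 * real K)) * G + real B / (8 * real K)"
    unfolding kB k using K0 B0 by (simp add: algebra_simps)
  have "real B / (8 * real K) \<le> 2 * G / (8 * real K)" using BG K0 by (intro divide_right_mono) auto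
  with 1 have 2: "real (deg n x u0) * (1 - 1 / (8 * real K)) \<le> (1 + 1 / (2 * real K)) * G"
    by (simp add: algebra_simps)
  have G0: "0 \<le> G" using BG by simp
  have "1 + 1 / (2 * real K) \<le> (1 + 1 / real K) * (1 - 1 / (8 * real K))"
    using K by (simp add: field_simps)
  from mult_right_mono[OF this G0]
  have "(1 + 1 / (2 * real K)) * G \<le> ((1 + 1 / real K) * G) * (1 - 1 / (8 * real K))"
    by (simp only: ac_simps)
  with 2 have "real (deg n x u0) * (1 - 1 / (8 * real K)) \<le> ((1 + 1 / real K) * G) * (1 - 1 / (8 * real K))"
    by linarith
  moreover have "0 < 1 - 1 / (8 * real K)" using K by (simp add: field_simps)
  ultimately show ?thesis by (metis mult_le_cancel_right_pos)
qed

text \<open>A logarithm scaled so that one step of a chain changes it by at least 1; its value at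
  the largest degree bounds the length of a chain. The 1 inside the logarithm covers degrees below
  \<open>B\<close>, where only the summand 1 of \<open>cap\<close> forces growth.\<close>

definition pot :: "nat \<Rightarrow> nat \<Rightarrow> real" where
  "pot B d = 3 * real B * ln (1 + real d / real B)"

lemma pot_mono: "0 < B \<Longrightarrow> d \<le> d' \<Longrightarrow> pot B d \<le> pot B d'"
  unfolding pot_def by (auto intro!: mult_left_mono divide_right_mono simp: add_pos_nonneg)

lemma pot_nonneg: "0 < B \<Longrightarrow> 0 \<le> pot B d"
  unfolding pot_def by simp

text \<open>One step of a chain multiplies \<open>1 + d / B\<close> by at least \<open>1 + 1 / (2 * B)\<close>.\<close>

lemma pot_step:
  assumes B: "0 < B" and "cap B a \<le> b"
  shows "pot B a + 1 \<le> pot B b"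
proof -
  define r where "r = real B"
  have r: "1 \<le> r" using B by (simp add: r_def)
  have "real a / r < real (a div B) + 1"
  proof -
    have "a < (a div B + 1) * B" using dividend_less_div_times[OF B, of a] by (simp add: algebra_simps)
    then have "real a < (real (a div B) + 1) * r"
      unfolding r_def by (metis of_nat_1 of_nat_add of_nat_less_iff of_nat_mult)
    then show ?thesis using r by (simp add: divide_less_eq)
  qed
  then have "1 + real a / r \<le> 2 * (1 + real (a div B))" using r by simp
  moreover have "real a + 1 + real (a div B) \<le> real b"
    using of_nat_mono[OF assms(2)[unfolded cap_def], where 'a = real]
    by (simp only: of_nat_add of_nat_1)
  moreover have "a' + (1 + y) / 2 \<le> b'" if "1 + y \<le> 2 * (1 + d)" "a' + 1 + d \<le> b'" for a' y d b' :: real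
    using that by (simp add: field_simps)
  ultimately have 1: "real a + (1 + real a / r) / 2 \<le> real b" by blast
  have "(1 + real a / r) * (1 + 1 / (2 * r)) = 1 + (real a + (1 + real a / r) / 2) / r"
    using r by (simp add: field_simps)
  also have "\<dots> \<le> 1 + real b / r" using 1 r by (simp add: divide_right_mono)
  finally have 2: "(1 + real a / r) * (1 + 1 / (2 * r)) \<le> 1 + real b / r" .
  have pa: "0 < 1 + real a / r" and pc: "0 < 1 + 1 / (2 * r)"
    by (rule add_pos_nonneg; use r in simp)+
  have "ln (1 + real a / r) + ln (1 + 1 / (2 * r)) = ln ((1 + real a / r) * (1 + 1 / (2 * r)))"
    by (rule ln_mult_pos[OF pa pc, symmetric])
  also have "\<dots> \<le> ln (1 + real b / r)"
    by (rule ln_mono) (use 2 mult_pos_pos[OF pa pc] in auto)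
  finally have 3: "ln (1 + real a / r) + ln (1 + 1 / (2 * r)) \<le> ln (1 + real b / r)" .
  \<comment> \<open>Applied to the reciprocal, \<open>ln y \<le> y - 1\<close> becomes a lower bound
    for the logarithm, namely \<open>1 / (2 * r + 1)\<close>, which is at least
    \<open>1 / (3 * r)\<close>. Hence the factor 3 in \<open>pot\<close>.\<close>
  have "ln (1 / (1 + 1 / (2 * r))) \<le> 1 / (1 + 1 / (2 * r)) - 1"
    using pc by (intro ln_le_minus_one) simp
  then have "1 - 1 / (1 + 1 / (2 * r)) \<le> ln (1 + 1 / (2 * r))" using pc by (simp add: ln_div)
  moreover have "1 / (3 * r) \<le> 1 - 1 / (1 + 1 / (2 * r))" using r by (simp add: field_simps)
  ultimately have 4: "1 / (3 * r) \<le> ln (1 + 1 / (2 * r))" by linarith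
  have "3 * r * (ln (1 + real a / r) + 1 / (3 * r)) \<le> 3 * r * ln (1 + real b / r)"
    using 3 4 r by (intro mult_left_mono) auto
  then show ?thesis unfolding pot_def r_def[symmetric] using r by (simp add: algebra_simps)
qed

section \<open>Single changes of an orientation and the invariants of a chain\<close>

definition addarc :: "orient \<Rightarrow> nat \<Rightarrow> nat \<Rightarrow> orient" where
  "addarc x a b = (\<lambda>u v. if u = a \<and> v = b then x u v + 1 else x u v)"

definition remarc :: "orient \<Rightarrow> nat \<Rightarrow> nat \<Rightarrow> orient" where
  "remarc x a b = (\<lambda>u v. if u = a \<and> v = b then x u v - 1 else x u v)"

lemma deg_addarc: "b < n \<Longrightarrow> deg n (addarc x a b) u = deg n x u + of_bool (u = a)"
  unfolding deg_def addarc_def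
  by (cases "u = a") (simp_all add: sum.remove[of "{..<n}" b])

lemma deg_remarc:
  assumes "b < n" "0 < x a b"
  shows "deg n (remarc x a b) u = deg n x u - of_bool (u = a)" "0 < deg n x a"
proof -
  have "deg n x a = x a b + (\<Sum>v\<in>{..<n} - {b}. x a v)"
    unfolding deg_def using assms by (simp add: sum.remove[of "{..<n}" b])
  moreover have "deg n (remarc x a b) a = x a b - 1 + (\<Sum>v\<in>{..<n} - {b}. x a v)"
    unfolding deg_def using assms by (simp add: sum.remove[of "{..<n}" b] remarc_def)
  moreover have "deg n (remarc x a b) u = deg n x u" if "u \<noteq> a"
    unfolding deg_def remarc_def using that by simp
  ultimately show "deg n (remarc x a b) u = deg n x u - of_bool (u = a)" "0 < deg n x a"
    using assms(2) by (cases "u = a"; simp)+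
qed

lemma inside_addarc: "inside n x \<Longrightarrow> a < n \<Longrightarrow> b < n \<Longrightarrow> a \<noteq> b \<Longrightarrow> inside n (addarc x a b)"
  unfolding inside_def addarc_def by auto

lemma inside_remarc: "inside n x \<Longrightarrow> inside n (remarc x a b)"
proof -
  assume w: "inside n x"
  have "0 < x u v" if "0 < remarc x a b u v" for u v
    using that by (simp add: remarc_def split: if_splits)
  with w show ?thesis unfolding inside_def by blast
qed

text \<open>During a chain at \<open>c\<close>, the degrees with the unit in transit left out (insertion) or put
  back (deletion) are a fixed function \<open>e\<close> that satisfies the stability condition.\<close>

definition ins_chain :: "nat \<Rightarrow> nat \<Rightarrow> (nat \<Rightarrow> nat) \<Rightarrow> orient \<Rightarrow> nat \<Rightarrow> bool" where
  "ins_chain n B e x c \<longleftrightarrow> inside n x \<and> c < n \<and> (\<forall>u. deg n x u = e u + of_bool (u = c)) \<and>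
     (\<forall>u v. 0 < x u v \<longrightarrow> e u \<le> cap B (e v))"

definition del_chain :: "nat \<Rightarrow> nat \<Rightarrow> (nat \<Rightarrow> nat) \<Rightarrow> orient \<Rightarrow> nat \<Rightarrow> bool" where
  "del_chain n B e x c \<longleftrightarrow> inside n x \<and> c < n \<and> (\<forall>u. e u = deg n x u + of_bool (u = c)) \<and>
     (\<forall>u v. 0 < x u v \<longrightarrow> e u \<le> cap B (e v))"

lemma goodD: "good n B x \<Longrightarrow> 0 < x u v \<Longrightarrow> deg n x u \<le> cap B (deg n x v)"
  unfolding good_def bad_def by (meson not_le)

text \<open>Directing the new unit away from the endpoint of smaller degree makes it satisfy the
  stability condition with respect to the old degrees.\<close>

lemma ins_chain_start:
  assumes "good n B x" "inside n x" "a < n" "b < n" "a \<noteq> b" "deg n x a \<le> deg n x b"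
  shows "ins_chain n B (deg n x) (addarc x a b) a"
proof -
  have "deg n x u \<le> cap B (deg n x v)" if "0 < addarc x a b u v" for u v
  proof (cases "u = a \<and> v = b")
    case True
    then show ?thesis using assms(6) cap_gt[of "deg n x b" B] by simp
  next
    case False
    then show ?thesis using that goodD[OF assms(1)] by (auto simp: addarc_def)
  qed
  then show ?thesis
    unfolding ins_chain_def using assms inside_addarc deg_addarc by simp
qed

text \<open>Only at \<open>c\<close> does the degree exceed \<open>e\<close>; a larger degree at the
  head of an arc does no harm, so every violation has its tail at \<open>c\<close>.\<close>

lemma ins_chain_bad: "ins_chain n B e x c \<Longrightarrow> bad n B x u v \<Longrightarrow> u = c"
proof (rule ccontr)
  assume a: "ins_chain n B e x c" "bad n B x u v" "u \<noteq> c"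
  then have "e u \<le> cap B (e v)" "e u = deg n x u" "e v \<le> deg n x v"
    by (auto simp: ins_chain_def bad_def)
  then show False using a(2) cap_mono[of "e v" "deg n x v" B] unfolding bad_def by simp
qed

lemma ins_chain_end: "ins_chain n B e x c \<Longrightarrow> (\<And>y. \<not> bad n B x c y) \<Longrightarrow> good n B x"
  using ins_chain_bad unfolding good_def by blast

lemma xfer_deg:
  assumes "inside n x" "0 < x a b"
  shows "deg n (addarc (remarc x a b) b a) u + of_bool (u = a) = deg n x u + of_bool (u = b)"
    "deg n (addarc (remarc x a b) b a) u = deg n x u - of_bool (u = a) + of_bool (u = b)"
proof -
  have n: "a < n" "b < n" "a \<noteq> b" using assms unfolding inside_def by auto
  note d = deg_addarc[OF n(1), of "remarc x a b" b] deg_remarc[of b n x a, OF n(2) assms(2)]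
  show "deg n (addarc (remarc x a b) b a) u + of_bool (u = a) = deg n x u + of_bool (u = b)"
    using d n by auto
  show "deg n (addarc (remarc x a b) b a) u = deg n x u - of_bool (u = a) + of_bool (u = b)"
    using d n by auto
qed

text \<open>The surplus moves from \<open>c\<close> to \<open>y\<close> while \<open>e\<close> stays
  the same; the reversed arc is safe because \<open>e y < e c\<close>. The inequality for
  \<open>e\<close> is the geometric decrease that bounds the chain.\<close>

lemma ins_chain_step:
  assumes i: "ins_chain n B e x c" and b: "bad n B x c y"
  shows "ins_chain n B e (addarc (remarc x c y) y c) y" "cap B (e y) \<le> e c"
proof -
  have w: "inside n x" and pos: "0 < x c y" and lt: "cap B (deg n x y) < deg n x c"
    using i b by (auto simp: ins_chain_def bad_def)
  have n: "c < n" "y < n" "c \<noteq> y" using w pos unfolding inside_def by auto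
  show l: "cap B (e y) \<le> e c" using i lt n by (auto simp: ins_chain_def)
  have "deg n (addarc (remarc x c y) y c) u = e u + of_bool (u = y)" for u
    using xfer_deg(1)[OF w pos, of u] i n by (auto simp: ins_chain_def)
  moreover have "e u \<le> cap B (e v)" if "0 < addarc (remarc x c y) y c u v" for u v
  proof (cases "u = y \<and> v = c")
    case True
    then show ?thesis using l cap_gt[of "e y" B] cap_gt[of "e c" B] by simp
  next
    case False
    then have "0 < x u v" using that by (auto simp: addarc_def remarc_def split: if_splits)
    then show ?thesis using i unfolding ins_chain_def by blast
  qed
  ultimately show "ins_chain n B e (addarc (remarc x c y) y c) y"
    unfolding ins_chain_def using inside_addarc[OF inside_remarc[OF w]] n by auto
qed

lemma del_chain_start:
  assumes "good n B x" "inside n x" "0 < x a b"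
  shows "del_chain n B (deg n x) (remarc x a b) a"
proof -
  have n: "a < n" "b < n" "a \<noteq> b" using assms unfolding inside_def by auto
  have "deg n x u \<le> cap B (deg n x v)" if "0 < remarc x a b u v" for u v
    using that goodD[OF assms(1)] by (auto simp: remarc_def split: if_splits)
  then show ?thesis
    unfolding del_chain_def using n(1) inside_remarc[OF assms(2)] deg_remarc[of b n x a, OF n(2) assms(3)]
    by (intro conjI allI impI) (simp_all add: of_bool_def)
qed

lemma del_chain_bad: "del_chain n B e x c \<Longrightarrow> bad n B x u v \<Longrightarrow> v = c"
proof (rule ccontr)
  assume a: "del_chain n B e x c" "bad n B x u v" "v \<noteq> c"
  then have "0 < x u v" by (simp add: bad_def)
  then have "e u \<le> cap B (e v)" using a(1) unfolding del_chain_def by blast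
  moreover have "e v = deg n x v" "deg n x u \<le> e u" using a by (auto simp: del_chain_def)
  ultimately have "e u \<le> cap B (e v)" "e v = deg n x v" "deg n x u \<le> e u" by auto
  then show False using a(2) unfolding bad_def by simp
qed

lemma del_chain_end: "del_chain n B e x c \<Longrightarrow> (\<And>y. \<not> bad n B x y c) \<Longrightarrow> good n B x"
  using del_chain_bad unfolding good_def by blast

text \<open>The deficit moves from \<open>c\<close> to \<open>y\<close>. The actual degree of
  \<open>c\<close> is \<open>e c - 1\<close>, so it is \<open>e - 1\<close> rather than
  \<open>e\<close> that grows by \<open>cap\<close> with each step.\<close>

lemma del_chain_step:
  assumes i: "del_chain n B e x c" and b: "bad n B x y c"
  shows "del_chain n B e (addarc (remarc x y c) c y) y" "cap B (e c - 1) \<le> e y - 1"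
proof -
  have w: "inside n x" and pos: "0 < x y c" and lt: "cap B (deg n x c) < deg n x y"
    using i b by (auto simp: del_chain_def bad_def)
  have n: "c < n" "y < n" "c \<noteq> y" using w pos unfolding inside_def by auto
  show l: "cap B (e c - 1) \<le> e y - 1" using i lt n by (auto simp: del_chain_def)
  have dy: "0 < deg n x y" using lt by simp
  have "e u = deg n (addarc (remarc x y c) c y) u + of_bool (u = y)" for u
    using xfer_deg(1)[OF w pos, of u] i n by (auto simp: del_chain_def)
  moreover have "e u \<le> cap B (e v)" if "0 < addarc (remarc x y c) c y u v" for u v
  proof (cases "u = c \<and> v = y")
    case True
    have "deg n x c + 1 \<le> deg n x y" using lt cap_gt[of "deg n x c" B] by simp
    then have "e c \<le> e y" using i n by (auto simp: del_chain_def)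
    then show ?thesis using True cap_gt[of "e y" B] by simp
  next
    case False
    then have "0 < x u v" using that by (auto simp: addarc_def remarc_def split: if_splits)
    then show ?thesis using i unfolding del_chain_def by blast
  qed
  ultimately show "del_chain n B e (addarc (remarc x y c) c y) y"
    unfolding del_chain_def using inside_addarc[OF inside_remarc[OF w]] n by auto
qed

section \<open>Ownership and neighbour classes\<close>

text \<open>The endpoint with the larger share of an edge owns it (on a tie, both do).\<close>

definition own :: "nat \<Rightarrow> orient \<Rightarrow> nat \<Rightarrow> nat set" where
  "own n x u = {w. w < n \<and> 0 < x u w + x w u \<and> x w u \<le> x u w}"

text \<open>The pair \<open>{s, h}\<close> is the edge under insertion or deletion. Its units come
  and go one by one, so it alone may have a positive number of units below \<open>B\<close>.\<close>

definition heavy :: "nat \<Rightarrow> orient \<Rightarrow> nat \<Rightarrow> nat \<Rightarrow> bool" where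
  "heavy B x s h \<longleftrightarrow> (\<forall>u v. {u, v} \<noteq> {s, h} \<longrightarrow> 0 < x u v + x v u \<longrightarrow> B \<le> x u v + x v u)"

lemma finite_own: "finite (own n x u)"
  by (simp add: own_def)

text \<open>An owner holds at least half of at least \<open>B\<close> units, except possibly on the
  pair \<open>{s, h}\<close>, which accounts for the summand 1.\<close>

lemma card_own:
  assumes B: "0 < B" and hv: "heavy B x s h"
  shows "card (own n x u) \<le> 2 * deg n x u div B + 1"
proof -
  define r where "r = (if u = s then h else s)"
  define A where "A = own n x u - {r}"
  have A: "finite A" "A \<subseteq> {..<n}" unfolding A_def own_def by auto
  have "B \<le> 2 * x u w" if w: "w \<in> A" for w
  proof -
    have wr: "w \<noteq> r" and pos: "0 < x u w + x w u" and "x w u \<le> x u w"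
      using w by (simp_all add: A_def own_def)
    have ne: "{u, w} \<noteq> {s, h}" using wr unfolding r_def doubleton_eq_iff by (metis (full_types))
    have "B \<le> x u w + x w u" using hv[unfolded heavy_def, rule_format, OF ne pos] .
    then show ?thesis using \<open>x w u \<le> x u w\<close> by linarith
  qed
  then have "of_nat (card A) * B \<le> (\<Sum>w\<in>A. 2 * x u w)" by (rule sum_bounded_below)
  also have "\<dots> \<le> (\<Sum>w<n. 2 * x u w)" by (rule sum_mono2) (use A in simp_all)
  also have "\<dots> = 2 * deg n x u" by (simp add: deg_def sum_distrib_left)
  finally have "card A * B \<le> 2 * deg n x u" by simp
  then have "card A \<le> 2 * deg n x u div B" unfolding less_eq_div_iff_mult_less_eq[OF B] .
  moreover have "card (own n x u) \<le> card A + 1"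
    unfolding A_def using finite_own[of n x u] by (cases "r \<in> own n x u") (simp_all add: card_Diff_singleton)
  ultimately show ?thesis by simp
qed

text \<open>Class 0 means no edge and class 1 an owned edge; the parity of the other classes tells
  whether \<open>x u w\<close> is positive. All neighbours in one class of the last kind have the same degree.\<close>

definition kap :: "nat \<Rightarrow> orient \<Rightarrow> nat \<Rightarrow> nat \<Rightarrow> nat" where
  "kap n x u w = (if x u w + x w u = 0 then 0 else if x w u \<le> x u w then 1
     else 2 * deg n x w + 2 + of_bool (0 < x u w))"

lemma kap_own: "w < n \<Longrightarrow> kap n x u w = 1 \<longleftrightarrow> w \<in> own n x u"
  unfolding kap_def own_def by (cases "x u w + x w u = 0"; cases "x w u \<le> x u w") simp_all

lemma kap_bucket: "kap n x u w = 2 * k + 2 + of_bool b \<longleftrightarrow>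
   x u w < x w u \<and> deg n x w = k \<and> (b \<longleftrightarrow> 0 < x u w)"
proof (cases "x u w < x w u")
  case True
  then have "kap n x u w = 2 * deg n x w + 2 + of_bool (0 < x u w)" by (simp add: kap_def)
  moreover have "2 * d + 2 + of_bool c = 2 * k + 2 + of_bool b \<longleftrightarrow> d = k \<and> (b \<longleftrightarrow> c)" for d c
    by (cases b; cases c; simp; arith)
  ultimately show ?thesis using True by simp
next
  case False
  then have "kap n x u w \<le> 1" by (simp add: kap_def)
  then show ?thesis using False by simp
qed

text \<open>The class at \<open>(p, q)\<close> depends on the degree of \<open>q\<close> only if
  \<open>p\<close> does not own the edge. A new degree of \<open>a\<close> therefore matters only to
  neighbours in \<open>own n x' a\<close>, which are few enough to be notified.\<close>

lemma kap_unchanged: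
  assumes x': "\<And>u v. (u, v) \<noteq> (a, b) \<Longrightarrow> x' u v = x u v"
    and pq: "(p, q) \<noteq> (a, b)" "(p, q) \<noteq> (b, a)" and "q = a \<Longrightarrow> p \<notin> own n x' a" "p < n"
  shows "kap n x' p q = kap n x p q"
proof -
  have e: "x' p q = x p q" "x' q p = x q p" using x' pq by auto
  show ?thesis
  proof (cases "q = a")
    case True
    have "\<not> (0 < x' a p + x' p a \<and> x' p a \<le> x' a p)"
      using assms(4)[OF True] assms(5) by (simp add: own_def)
    then have "x p q + x q p = 0 \<or> x q p \<le> x p q" using e True by simp linarith?
    then show ?thesis unfolding kap_def e by (elim disjE) simp_all
  next
    case False
    then have "deg n x' q = deg n x q" unfolding deg_def using x' by simp
    then show ?thesis unfolding kap_def e by simp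
  qed
qed

text \<open>On each list field 2 inverts field 4, so an element is removed without a search. Class 0
  has no list, and thus zeroed memory is valid for the class function that is 0 everywhere.\<close>

definition lists :: "nat \<Rightarrow> bank \<Rightarrow> orient \<Rightarrow> bool" where
  "lists n b C \<longleftrightarrow>
     (\<forall>u<n. \<forall>v<n. C u v \<noteq> 0 \<longrightarrow>
        b (2, u, v, 0) < b (3, u, 0, C u v) \<and> b (4, u, b (2, u, v, 0), C u v) = v) \<and>
     (\<forall>u<n. \<forall>k. k \<noteq> 0 \<longrightarrow> (\<forall>i < b (3, u, 0, k).
        b (4, u, i, k) < n \<and> C u (b (4, u, i, k)) = k \<and> b (2, u, b (4, u, i, k), 0) = i))"

definition classes :: "nat \<Rightarrow> bank \<Rightarrow> orient \<Rightarrow> bool" where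
  "classes n b C \<longleftrightarrow> (\<forall>u<n. \<forall>v<n. b (1, u, v, 0) = C u v) \<and> lists n b C"

lemma listsD1:
  assumes "lists n b C" "u < n" "v < n" "C u v \<noteq> 0"
  shows "b (2, u, v, 0) < b (3, u, 0, C u v)" "b (4, u, b (2, u, v, 0), C u v) = v"
  using assms unfolding lists_def by auto

lemma listsD2:
  assumes "lists n b C" "u < n" "k \<noteq> 0" "i < b (3, u, 0, k)"
  shows "b (4, u, i, k) < n" "C u (b (4, u, i, k)) = k" "b (2, u, b (4, u, i, k), 0) = i"
  using assms unfolding lists_def by auto

lemma lists_range:
  assumes "lists n b C" "u < n" "k \<noteq> 0"
  shows "(\<lambda>i. b (4, u, i, k)) ` {..<b (3, u, 0, k)} = {v. v < n \<and> C u v = k}"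
proof (intro equalityI subsetI)
  fix v assume "v \<in> {v. v < n \<and> C u v = k}"
  then show "v \<in> (\<lambda>i. b (4, u, i, k)) ` {..<b (3, u, 0, k)}"
    using listsD1[OF assms(1,2), of v] assms(3) by (intro image_eqI[of _ _ "b (2, u, v, 0)"]) auto
qed (use listsD2[OF assms] in auto)

lemma lists_card:
  assumes "lists n b C" "u < n" "k \<noteq> 0"
  shows "b (3, u, 0, k) = card {v. v < n \<and> C u v = k}"
proof -
  have "inj_on (\<lambda>i. b (4, u, i, k)) {..<b (3, u, 0, k)}"
    by (rule inj_on_inverseI[where g = "\<lambda>v. b (2, u, v, 0)"]) (use listsD2[OF assms] in auto)
  then show ?thesis using card_image lists_range[OF assms] by fastforce
qed

lemma lists_card_le: "lists n b C \<Longrightarrow> u < n \<Longrightarrow> k \<noteq> 0 \<Longrightarrow> b (3, u, 0, k) \<le> n"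
  using lists_card card_mono[of "{..<n}" "{v. v < n \<and> C u v = k}"] by fastforce

lemma lists_card_less:
  assumes "lists n b C" "u < n" "k \<noteq> 0" "v < n" "C u v \<noteq> k"
  shows "b (3, u, 0, k) < n"
proof -
  have "card {v. v < n \<and> C u v = k} < card {..<n}"
    by (rule psubset_card_mono) (use assms in auto)
  then show ?thesis using lists_card[OF assms(1-3)] by simp
qed

definition upd :: "orient \<Rightarrow> nat \<Rightarrow> nat \<Rightarrow> nat \<Rightarrow> orient" where
  "upd C p q k = (\<lambda>u v. if u = p \<and> v = q then k else C u v)"

lemma lists_cong:
  assumes "lists n b C" "\<And>u v. u < n \<Longrightarrow> v < n \<Longrightarrow> C' u v = C u v"
    and "\<And>f u i k. f \<in> {2, 3, 4} \<Longrightarrow> b' (f, u, i, k) = b (f, u, i, k)"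
  shows "lists n b' C'"
  using assms unfolding lists_def by simp

text \<open>The last entry of the list fills the gap. If that entry is \<open>q\<close> itself, the
  cells written are stale but harmless: \<open>q\<close> now has class 0, and position
  \<open>z\<close> lies beyond the new length.\<close>

lemma lists_remove:
  assumes L: "lists n b C" and pq: "p < n" "q < n" and ol: "C p q = ol" "ol \<noteq> 0"
    and i: "i = b (2, p, q, 0)" and z: "z = b (3, p, 0, ol) - 1" and r: "r = b (4, p, z, ol)"
    and b': "b' = b((3, p, 0, ol) := z, (4, p, i, ol) := r, (2, p, r, 0) := i)"
  shows "lists n b' (upd C p q 0)" "i < n" "z < n" "r < n" "0 < b (3, p, 0, ol)" "i \<le> z"
proof -
  have il: "i < b (3, p, 0, ol)" and iq: "b (4, p, i, ol) = q"
    using listsD1[OF L pq] ol i by auto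
  have siz: "b (3, p, 0, ol) \<le> n" using lists_card_le[OF L pq(1) ol(2)] .
  show "i < n" "z < n" "0 < b (3, p, 0, ol)" "i \<le> z" using il siz z by auto
  have zl: "z < b (3, p, 0, ol)" using il z by auto
  have r2: "r < n" "C p r = ol" "b (2, p, r, 0) = z" using listsD2[OF L pq(1) ol(2) zl] r by auto
  then show "r < n" by simp
  have A: "b' (2, u, v, 0) < b' (3, u, 0, upd C p q 0 u v) \<and> b' (4, u, b' (2, u, v, 0), upd C p q 0 u v) = v"
    if u: "u < n" "v < n" "upd C p q 0 u v \<noteq> 0" for u v
  proof -
    have nq: "\<not> (u = p \<and> v = q)" and Cu: "upd C p q 0 u v = C u v" "C u v \<noteq> 0"
      using u(3) by (auto simp: upd_def split: if_splits)
    note D = listsD1[OF L u(1,2) Cu(2)]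
    show ?thesis
    proof (cases "u = p \<and> C u v = ol")
      case False
      then have "v \<noteq> r \<or> u \<noteq> p" using r2 by auto
      then show ?thesis using D False unfolding Cu(1) b' by auto
    next
      case True
      show ?thesis
      proof (cases "v = r")
        case vr: True
        have "i \<noteq> z"
        proof
          assume "i = z"
          then have "r = q" using iq r by simp
          then show False using nq True vr by simp
        qed
        then show ?thesis using True vr il z unfolding Cu(1) b' by auto
      next
        case False
        have "b (2, u, v, 0) \<noteq> z" using D False True r by auto
        moreover have "b (2, u, v, 0) \<noteq> i" using D True iq nq by auto
        ultimately show ?thesis using D True False z unfolding Cu(1) b' by auto
      qed
    qed
  qed
  have B: "b' (4, u, j, k) < n \<and> upd C p q 0 u (b' (4, u, j, k)) = k \<and> b' (2, u, b' (4, u, j, k), 0) = j"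
    if u: "u < n" "k \<noteq> 0" "j < b' (3, u, 0, k)" for u k j
  proof (cases "u = p \<and> k = ol")
    case False
    then have j: "j < b (3, u, 0, k)" using u(3) unfolding b' by auto
    note D = listsD2[OF L u(1,2) j]
    have e: "b' (4, u, j, k) = b (4, u, j, k)" using False unfolding b' by auto
    have "\<not> (u = p \<and> b (4, u, j, k) = q)" "\<not> (u = p \<and> b (4, u, j, k) = r)"
      using False D(2) ol r2 by auto
    then show ?thesis unfolding e using D by (auto simp: upd_def b')
  next
    case True
    then have jz: "j < z" using u(3) unfolding b' by auto
    then have j: "j < b (3, p, 0, ol)" using z by auto
    note D = listsD2[OF L pq(1) ol(2) j]
    show ?thesis
    proof (cases "j = i")
      case ji: True
      have "r \<noteq> q" using r2 i ji jz by auto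
      then show ?thesis using True ji r2 unfolding b' by (auto simp: upd_def)
    next
      case False
      have e: "b' (4, u, j, k) = b (4, p, j, ol)" using True False unfolding b' by auto
      have "b (4, p, j, ol) \<noteq> r" using D(3) r2(3) jz by auto
      moreover have "b (4, p, j, ol) \<noteq> q" using D(3) i False by auto
      ultimately show ?thesis unfolding e using True D by (auto simp: upd_def b')
    qed
  qed
  show "lists n b' (upd C p q 0)" unfolding lists_def using A B by blast
qed

lemma lists_add:
  assumes L: "lists n b C" and pq: "p < n" "q < n" and ol: "C p q = 0" "k \<noteq> 0"
    and i: "i = b (3, p, 0, k)"
    and b': "b' = b((4, p, i, k) := q, (2, p, q, 0) := i, (3, p, 0, k) := i + 1)"
  shows "lists n b' (upd C p q k)" "i < n"
proof -
  show "i < n" using lists_card_less[OF L pq(1) ol(2) pq(2)] ol i by auto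
  have A: "b' (2, u, v, 0) < b' (3, u, 0, upd C p q k u v) \<and> b' (4, u, b' (2, u, v, 0), upd C p q k u v) = v"
    if u: "u < n" "v < n" "upd C p q k u v \<noteq> 0" for u v
  proof (cases "u = p \<and> v = q")
    case True
    then show ?thesis by (auto simp: upd_def b' i)
  next
    case False
    then have Cu: "upd C p q k u v = C u v" "C u v \<noteq> 0" using u(3) by (auto simp: upd_def split: if_splits)
    note D = listsD1[OF L u(1,2) Cu(2)]
    show ?thesis using D False i unfolding Cu(1) b' by auto
  qed
  have B: "b' (4, u, j, l) < n \<and> upd C p q k u (b' (4, u, j, l)) = l \<and> b' (2, u, b' (4, u, j, l), 0) = j"
    if u: "u < n" "l \<noteq> 0" "j < b' (3, u, 0, l)" for u l j
  proof (cases "u = p \<and> l = k \<and> j = i")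
    case True
    then show ?thesis using pq by (auto simp: upd_def b')
  next
    case False
    then have j: "j < b (3, u, 0, l)" using u(3) i unfolding b' by (auto split: if_splits)
    note D = listsD2[OF L u(1,2) j]
    have e: "b' (4, u, j, l) = b (4, u, j, l)" using False unfolding b' by auto
    have "\<not> (u = p \<and> b (4, u, j, l) = q)" using D(2) ol u(2) by auto
    then show ?thesis unfolding e using D by (auto simp: upd_def b')
  qed
  show "lists n b' (upd C p q k)" unfolding lists_def using A B by blast
qed

section \<open>Programs that keep the classes up to date\<close>

abbreviation fld :: "nat \<Rightarrow> hexp \<Rightarrow> hexp \<Rightarrow> hexp \<Rightarrow> hexp" where
  "fld f a b c \<equiv> HL f (HV ''sl'') a b c"
abbreviation put :: "nat \<Rightarrow> hexp \<Rightarrow> hexp \<Rightarrow> hexp \<Rightarrow> hexp \<Rightarrow> scom" where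
  "put f a b c e \<equiv> SS f (HV ''sl'') a b c e"
abbreviation "hplus a b \<equiv> HB Plus a b"
abbreviation "hminus a b \<equiv> HB Minus a b"
abbreviation "htimes a b \<equiv> HB Times a b"
abbreviation "hless a b \<equiv> HB Less a b"
abbreviation "heq a b \<equiv> HB Equal a b"
abbreviation "hdiv a b \<equiv> HB Div a b"

text \<open>Recompute the class of the entry \<open>(p, q)\<close> and move it to the list of its new class.\<close>

definition key_code :: scom where
  "key_code = SQ
     (SI (heq (hplus (fld 0 (HV ''p'') (HV ''q'') (HC 0)) (fld 0 (HV ''q'') (HV ''p'') (HC 0))) (HC 0))
       (SA ''k'' (HC 0))
       (SI (hless (fld 0 (HV ''p'') (HV ''q'') (HC 0)) (fld 0 (HV ''q'') (HV ''p'') (HC 0)))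
         (SA ''k'' (hplus (hplus (htimes (HC 2) (fld 5 (HV ''q'') (HC 0) (HC 0))) (HC 2))
            (hless (HC 0) (fld 0 (HV ''p'') (HV ''q'') (HC 0)))))
         (SA ''k'' (HC 1))))
     (SA ''o'' (fld 1 (HV ''p'') (HV ''q'') (HC 0)))"

definition unlist_code :: scom where
  "unlist_code = SI (HV ''o'')
     (SQ (SA ''i'' (fld 2 (HV ''p'') (HV ''q'') (HC 0)))
     (SQ (put 3 (HV ''p'') (HC 0) (HV ''o'') (hminus (fld 3 (HV ''p'') (HC 0) (HV ''o'')) (HC 1)))
     (SQ (SA ''r'' (fld 4 (HV ''p'') (fld 3 (HV ''p'') (HC 0) (HV ''o'')) (HV ''o'')))
     (SQ (put 4 (HV ''p'') (HV ''i'') (HV ''o'') (HV ''r''))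
         (put 2 (HV ''p'') (HV ''r'') (HC 0) (HV ''i'')))))) SN"

definition enlist_code :: scom where
  "enlist_code = SI (HV ''k'')
     (SQ (SA ''i'' (fld 3 (HV ''p'') (HC 0) (HV ''k'')))
     (SQ (put 4 (HV ''p'') (HV ''i'') (HV ''k'') (HV ''q''))
     (SQ (put 2 (HV ''p'') (HV ''q'') (HC 0) (HV ''i''))
         (put 3 (HV ''p'') (HC 0) (HV ''k'') (hplus (HV ''i'') (HC 1)))))) SN"

definition fix_code :: scom where
  "fix_code = SQ key_code (SQ unlist_code (SQ enlist_code (put 1 (HV ''p'') (HV ''q'') (HC 0) (HV ''k''))))"

text \<open>The value of \<open>kap\<close> as the program computes it from the cells of a bank;
  \<open>keyf_xrep\<close> shows the agreement.\<close>

definition keyf :: "bank \<Rightarrow> nat \<Rightarrow> nat \<Rightarrow> nat" where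
  "keyf b p q = (if b (0, p, q, 0) + b (0, q, p, 0) = 0 then 0
     else if b (0, q, p, 0) \<le> b (0, p, q, 0) then 1
     else 2 * b (5, q, 0, 0) + 2 + of_bool (0 < b (0, p, q, 0)))"

definition frame :: "string set \<Rightarrow> nat \<Rightarrow> nat set \<Rightarrow> hstate \<Rightarrow> hstate \<Rightarrow> bool" where
  "frame R s F h h' \<longleftrightarrow> (\<forall>x. x \<notin> R \<longrightarrow> rg h' x = rg h x) \<and> (\<forall>t. t \<noteq> s \<longrightarrow> mm h' t = mm h t) \<and>
     (\<forall>f a b c. f \<notin> F \<longrightarrow> mm h' s (f, a, b, c) = mm h s (f, a, b, c))"

lemma frame_trans:
  "frame R s F h h1 \<Longrightarrow> frame R' s F' h1 h2 \<Longrightarrow> R \<union> R' \<subseteq> S \<Longrightarrow> F \<union> F' \<subseteq> G \<Longrightarrow> frame S s G h h2"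
  unfolding frame_def Un_subset_iff by (simp add: subset_iff) metis

lemma frame_reg: "frame R s F h h' \<Longrightarrow> x \<notin> R \<Longrightarrow> rg h' x = rg h x"
  and frame_slot: "frame R s F h h' \<Longrightarrow> t \<noteq> s \<Longrightarrow> mm h' t = mm h t"
  and frame_fld: "frame R s F h h' \<Longrightarrow> f \<notin> F \<Longrightarrow> mm h' s (f, a, b, c) = mm h s (f, a, b, c)"
  unfolding frame_def by blast+

context ram
begin

lemma wps_mono: "wps c Q h \<Longrightarrow> (\<And>h'. Q h' \<Longrightarrow> Q' h') \<Longrightarrow> wps c Q' h"
proof (induction c arbitrary: h Q Q')
  case (SQ c d)
  show ?case using SQ.IH(1)[of "wps d Q" h "wps d Q'"] SQ.IH(2)[of Q _ Q'] SQ.prems by simp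
next
  case (SI e c d)
  show ?case using SI.IH(1)[of Q h Q'] SI.IH(2)[of Q h Q'] SI.prems by (simp split: if_splits)
qed simp_all

lemma boundedD:
  assumes "bounded h"
  shows "rg h ''n'' = n" "rg h x \<le> Z" "s < 4 \<Longrightarrow> f < 16 \<Longrightarrow> a < n \<Longrightarrow> b < n \<Longrightarrow> mm h s (f, a, b, c) \<le> Z"
  using assms unfolding bounded_def by simp_all

text \<open>Every write concerns cells of \<open>p\<close>. The last conjunct records this, because
  the code is also run in a loop that walks through a list of another vertex.\<close>

lemma fix_wps:
  assumes sl: "rg h ''sl'' = s" "s < 4" and p: "rg h ''p'' = p" "p < n" and q: "rg h ''q'' = q" "q < n"
    and C: "classes n (mm h s) C" and Zk: "2 * mm h s (5, q, 0, 0) + 3 \<le> Z" and oZ: "C p q \<le> Z"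
  shows "wps fix_code (\<lambda>h'. classes n (mm h' s) (upd C p q (keyf (mm h s) p q)) \<and>
     frame {''k'', ''o'', ''i'', ''r''} s {1, 2, 3, 4} h h' \<and>
     (\<forall>f a b c. a \<noteq> p \<longrightarrow> mm h' s (f, a, b, c) = mm h s (f, a, b, c))) h"
proof -
  define k where "k = keyf (mm h s) p q"
  have kZ: "k \<le> Z" using Zk unfolding k_def keyf_def by simp
  have ZZ: "1 \<le> Z" "n \<le> Z" using Z_ge n_le by linarith+
  have L: "lists n (mm h s) C" and cls: "mm h s (1, p, q, 0) = C p q"
    using C p(2) q(2) by (simp_all add: classes_def)
  let ?b = "mm h s"
  \<comment> \<open>The bank after the removal from the old list, in closed form so that
    simplification can match the stores against it.\<close>
  let ?b1 = "if C p q = 0 then ?b else ?b((3, p, 0, C p q) := ?b (3, p, 0, C p q) - 1,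
     (4, p, ?b (2, p, q, 0), C p q) := ?b (4, p, ?b (3, p, 0, C p q) - 1, C p q),
     (2, p, ?b (4, p, ?b (3, p, 0, C p q) - 1, C p q), 0) := ?b (2, p, q, 0))"
  have L1: "lists n ?b1 (upd C p q 0)"
  proof (cases "C p q = 0")
    case True
    then have "upd C p q 0 = C" by (auto simp: upd_def fun_eq_iff)
    then show ?thesis using L True by simp
  next
    case False
    then show ?thesis using lists_remove(1)[OF L p(2) q(2) refl False refl refl refl refl] by simp
  qed
  let ?P = "\<lambda>h'. mm h' s = ?b1 \<and> rg h' ''k'' = k \<and> rg h' ''sl'' = s \<and> rg h' ''p'' = p \<and> rg h' ''q'' = q \<and>
     frame {''k'', ''o'', ''i'', ''r''} s {1, 2, 3, 4} h h'"
  have 1: "wps key_code (\<lambda>h'. mm h' = mm h \<and> rg h' ''k'' = k \<and> rg h' ''o'' = C p q \<and>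
      rg h' ''sl'' = s \<and> rg h' ''p'' = p \<and> rg h' ''q'' = q \<and> frame {''k'', ''o'', ''i'', ''r''} s {1, 2, 3, 4} h h') h"
    using sl p q kZ oZ cls n_pos ZZ Zk unfolding k_def
    by (cases "?b (0, p, q, 0) + ?b (0, q, p, 0) = 0"; cases "?b (0, q, p, 0) \<le> ?b (0, p, q, 0)";
        cases "?b (0, p, q, 0) = 0")
      (simp_all add: key_code_def keyf_def rg_setr frame_def)
  have 2: "wps unlist_code ?P h1"
    if h1: "mm h1 = mm h \<and> rg h1 ''k'' = k \<and> rg h1 ''o'' = C p q \<and>
      rg h1 ''sl'' = s \<and> rg h1 ''p'' = p \<and> rg h1 ''q'' = q \<and> frame {''k'', ''o'', ''i'', ''r''} s {1, 2, 3, 4} h h1" for h1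
  proof (cases "C p q = 0")
    case True
    then show ?thesis using h1 by (simp add: unlist_code_def)
  next
    case False
    note R = lists_remove[OF L p(2) q(2) refl False refl refl refl refl]
    have nn: "?b (2, p, q, 0) \<le> Z" "?b (3, p, 0, C p q) - 1 \<le> Z" "?b (4, p, ?b (3, p, 0, C p q) - 1, C p q) \<le> Z"
      using R ZZ by auto
    have fr: "\<forall>x. x \<notin> {''k'', ''o'', ''i'', ''r''} \<longrightarrow> rg h1 x = rg h x" using h1 unfolding frame_def by blast
    show ?thesis using h1 False R(2-5) nn p q sl fr n_pos
      by (simp add: unlist_code_def rg_setr mm_setm frame_def)
  qed
  have 3: "wps (SQ enlist_code (put 1 (HV ''p'') (HV ''q'') (HC 0) (HV ''k'')))
     (\<lambda>h'. classes n (mm h' s) (upd C p q k) \<and>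
     frame {''k'', ''o'', ''i'', ''r''} s {1, 2, 3, 4} h h' \<and>
     (\<forall>f a b c. a \<noteq> p \<longrightarrow> mm h' s (f, a, b, c) = mm h s (f, a, b, c))) h1" if h1: "?P h1" for h1
  proof (cases "k = 0")
    case True
    define b1 where "b1 = ?b1"
    have "lists n (b1((1, p, q, 0) := k)) (upd C p q k)"
      by (rule lists_cong[OF L1[folded b1_def]]) (auto simp: True)
    moreover have "b1 (1, u, v, 0) = ?b (1, u, v, 0)" for u v by (simp add: b1_def)
    ultimately have cl: "classes n (b1((1, p, q, 0) := k)) (upd C p q k)"
      using C unfolding classes_def by (simp add: upd_def)
    have h1b: "mm h1 s = b1" using h1 by (simp add: b1_def)
    have b1o: "a \<noteq> p \<Longrightarrow> b1 (f, a, b, c) = ?b (f, a, b, c)" for f a b c by (simp add: b1_def)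
    have frm: "\<forall>x. x \<notin> {''k'', ''o'', ''i'', ''r''} \<longrightarrow> rg h1 x = rg h x" "\<forall>t. t \<noteq> s \<longrightarrow> mm h1 t = mm h t"
       "\<forall>f a b c. f \<notin> {1,2,3,4} \<longrightarrow> b1 (f, a, b, c) = ?b (f, a, b, c)"
      using h1 h1b unfolding frame_def by blast+
    have r1: "rg h1 ''k'' = 0" "rg h1 ''sl'' = s" "rg h1 ''p'' = p" "rg h1 ''q'' = q"
      using h1 True by blast+
    show ?thesis using r1 h1b cl[unfolded True] True p(2) q(2) sl(2) n_pos b1o frm(2,3)
      by (simp add: enlist_code_def frame_def mm_setm frm(1))
  next
    case False
    define b1 where "b1 = ?b1"
    define i where "i = b1 (3, p, 0, k)"
    define b2 where "b2 = b1((4, p, i, k) := q, (2, p, q, 0) := i, (3, p, 0, k) := i + 1)"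
    have c0: "upd C p q 0 p q = 0" by (simp add: upd_def)
    note A = lists_add[OF L1[folded b1_def] p(2) q(2) c0 False i_def b2_def]
    have uu: "upd (upd C p q 0) p q k = upd C p q k" by (auto simp: upd_def fun_eq_iff)
    have "lists n (b2((1, p, q, 0) := k)) (upd C p q k)"
      by (rule lists_cong[OF A(1)[unfolded uu]]) auto
    then have cl: "classes n (b2((1, p, q, 0) := k)) (upd C p q k)"
      using C unfolding classes_def by (auto simp: upd_def b2_def b1_def)
    have iZ: "i + 1 \<le> Z" "i \<le> Z" using A(2) ZZ by auto
    have h1b: "mm h1 s = b1" using h1 by (simp add: b1_def)
    have b1o: "a \<noteq> p \<Longrightarrow> b1 (f, a, b, c) = ?b (f, a, b, c)" for f a b c by (simp add: b1_def)
    have frm: "\<forall>x. x \<notin> {''k'', ''o'', ''i'', ''r''} \<longrightarrow> rg h1 x = rg h x" "\<forall>t. t \<noteq> s \<longrightarrow> mm h1 t = mm h t"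
       "\<forall>f a b c. f \<notin> {1,2,3,4} \<longrightarrow> b1 (f, a, b, c) = ?b (f, a, b, c)"
      using h1 h1b unfolding frame_def by blast+
    have r1: "rg h1 ''k'' = k" "rg h1 ''sl'' = s" "rg h1 ''p'' = p" "rg h1 ''q'' = q"
      using h1 by blast+
    have "wps (SQ enlist_code (put 1 (HV ''p'') (HV ''q'') (HC 0) (HV ''k'')))
      (\<lambda>h'. mm h' s = b2((1, p, q, 0) := k) \<and> (\<forall>t. t \<noteq> s \<longrightarrow> mm h' t = mm h1 t) \<and>
        (\<forall>x. x \<noteq> ''i'' \<longrightarrow> rg h' x = rg h1 x)) h1"
      using r1 h1b False p(2) q(2) sl(2) kZ iZ A(2) ZZ n_pos i_def
      by (simp add: enlist_code_def rg_setr mm_setm b2_def)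
    then show ?thesis
    proof (rule wps_mono)
      fix h' assume h': "mm h' s = b2((1, p, q, 0) := k) \<and> (\<forall>t. t \<noteq> s \<longrightarrow> mm h' t = mm h1 t) \<and>
        (\<forall>x. x \<noteq> ''i'' \<longrightarrow> rg h' x = rg h1 x)"
      have "frame {''k'', ''o'', ''i'', ''r''} s {1, 2, 3, 4} h h'"
        unfolding frame_def
      proof (intro conjI allI impI)
        fix x assume "x \<notin> {''k'', ''o'', ''i'', ''r''}"
        then show "rg h' x = rg h x" using h' frm(1) by simp
      next
        fix t assume "t \<noteq> s"
        then show "mm h' t = mm h t" using h' frm(2) by simp
      next
        fix f a b c assume "f \<notin> {1, 2, 3, 4 :: nat}"
        then show "mm h' s (f, a, b, c) = ?b (f, a, b, c)" using h' frm(3) by (simp add: b2_def)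
      qed
      then show "classes n (mm h' s) (upd C p q k) \<and> frame {''k'', ''o'', ''i'', ''r''} s {1, 2, 3, 4} h h' \<and>
        (\<forall>f a b c. a \<noteq> p \<longrightarrow> mm h' s (f, a, b, c) = mm h s (f, a, b, c))"
        using cl h' b1o by (simp add: b2_def)
    qed
  qed
  show ?thesis unfolding fix_code_def k_def[symmetric] wps.simps(4)
    by (rule wps_mono[OF 1], rule wps_mono[OF 2], assumption, rule 3[unfolded wps.simps(4)], assumption)
qed

end

lemma fix_sstat [simp]: "sstat fix_code"
  by (simp add: fix_code_def key_code_def unlist_code_def enlist_code_def hstat_def)

text \<open>The counts in field 6 are what makes the maximum in field 7 maintainable when degrees
  fall. Threshold 0 is left out of them: its count would be \<open>n\<close>, not the initial
  0.\<close>

definition xrep :: "nat \<Rightarrow> bank \<Rightarrow> orient \<Rightarrow> bool" where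
  "xrep n b x \<longleftrightarrow> (\<forall>u<n. \<forall>v<n. b (0, u, v, 0) = x u v) \<and> (\<forall>u<n. b (5, u, 0, 0) = deg n x u) \<and>
     (\<forall>k>0. b (6, 0, 0, k) = card {u. u < n \<and> k \<le> deg n x u}) \<and>
     (\<forall>u<n. deg n x u \<le> b (7, 0, 0, 0)) \<and> (0 < b (7, 0, 0, 0) \<longrightarrow> (\<exists>u<n. deg n x u = b (7, 0, 0, 0)))"

definition rep :: "nat \<Rightarrow> bank \<Rightarrow> orient \<Rightarrow> bool" where
  "rep n b x \<longleftrightarrow> xrep n b x \<and> classes n b (kap n x)"

lemma xrep_frame:
  assumes "xrep n (mm h s) x" "frame R s F h h'" "F \<inter> {0, 5, 6, 7} = {}"
  shows "xrep n (mm h' s) x"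
proof -
  have "0 \<notin> F" "5 \<notin> F" "6 \<notin> F" "7 \<notin> F" using assms(3) by auto
  note F = this[THEN frame_fld[OF assms(2)]]
  show ?thesis using assms(1) unfolding xrep_def F .
qed

lemma keyf_xrep: "xrep n b x \<Longrightarrow> p < n \<Longrightarrow> q < n \<Longrightarrow> keyf b p q = kap n x p q"
  unfolding xrep_def keyf_def kap_def by simp

lemma classes_frame:
  assumes "classes n (mm h s) C" "frame R s F h h'" "F \<inter> {1, 2, 3, 4} = {}"
  shows "classes n (mm h' s) C"
proof -
  have "1 \<notin> F" "2 \<notin> F" "3 \<notin> F" "4 \<notin> F" using assms(3) by auto
  note F = this[THEN frame_fld[OF assms(2)]]
  show ?thesis using assms(1) unfolding classes_def lists_def F .
qed

lemma classes_cong: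
  assumes "classes n b C" "\<And>u v. u < n \<Longrightarrow> v < n \<Longrightarrow> C' u v = C u v"
  shows "classes n b C'"
  using assms(1) lists_cong[of n b C C' b] assms(2) unfolding classes_def by simp

lemma frame_refl: "frame R s F h h"
  by (simp add: frame_def)

lemma frame_mono: "frame R s F h h' \<Longrightarrow> R \<subseteq> R' \<Longrightarrow> F \<subseteq> F' \<Longrightarrow> frame R' s F' h h'"
  using frame_trans[OF frame_refl[of R s F h]] by simp

text \<open>After \<open>x\<close> has changed at \<open>(a, b)\<close>, and with it the degree of \<open>a\<close>, only the classes of
  \<open>(a, b)\<close>, \<open>(b, a)\<close> and of the entries \<open>(p, a)\<close> with \<open>p\<close> owned by \<open>a\<close> are out of date.\<close>

definition fixab_code :: scom where
  "fixab_code = SQ (SA ''p'' (HV ''a'')) (SQ (SA ''q'' (HV ''b'')) (SQ fix_code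
     (SQ (SA ''p'' (HV ''b'')) (SQ (SA ''q'' (HV ''a'')) (SQ fix_code (SA ''g'' (HC 0)))))))"

definition notify_guard :: hexp where
  "notify_guard = hless (HV ''g'') (fld 3 (HV ''a'') (HC 0) (HC 1))"

definition notify_body :: scom where
  "notify_body = SQ (SA ''p'' (fld 4 (HV ''a'') (HV ''g'') (HC 1))) (SQ (SA ''q'' (HV ''a''))
     (SQ fix_code (SA ''g'' (hplus (HV ''g'') (HC 1)))))"

definition tail_code :: com where
  "tail_code = Seq (scomp fixab_code) (While (hcomp notify_guard) (scomp notify_body))"

definition tail_time :: "nat \<Rightarrow> nat" where
  "tail_time k = stime fixab_code + (k * (stime notify_body + 1 + exp_cost (hcomp notify_guard)) + 1 +
     exp_cost (hcomp notify_guard))"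

lemma tail_time_mono: "k \<le> k' \<Longrightarrow> tail_time k \<le> tail_time k'"
  unfolding tail_time_def by (intro add_mono mult_le_mono1 order_refl)

definition tmps :: "string set" where
  "tmps = {''k'', ''o'', ''i'', ''r'', ''p'', ''q'', ''g'', ''e''}"

lemma fixab_sstat [simp]: "sstat fixab_code" "sstat notify_body" "hstat notify_guard"
  by (simp_all add: fixab_code_def notify_body_def notify_guard_def hstat_def)

context ram
begin

lemma fixab_wps:
  assumes sl: "rg h ''sl'' = s" "s < 4" and a: "rg h ''a'' = a" "a < n" and b: "rg h ''b'' = b" "b < n"
    and ab: "a \<noteq> b" and X: "xrep n (mm h s) x'" and C: "classes n (mm h s) (kap n x)"
    and Z1: "\<And>u v. u < n \<Longrightarrow> v < n \<Longrightarrow> kap n x u v \<le> Z" and Z2: "\<And>u. u < n \<Longrightarrow> 2 * deg n x' u + 3 \<le> Z"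
  shows "wps fixab_code (\<lambda>h'. classes n (mm h' s) (upd (upd (kap n x) a b (kap n x' a b)) b a (kap n x' b a)) \<and>
     frame tmps s {1, 2, 3, 4} h h' \<and> rg h' ''g'' = 0) h"
proof -
  have ZZ: "a \<le> Z" "b \<le> Z" using a b n_le by auto
  let ?R = "{''k'', ''o'', ''i'', ''r''}"
  let ?F = "{1, 2, 3, 4 :: nat}"
  define h1 where "h1 = setr (setr h ''p'' a) ''q'' b"
  have h1: "rg h1 ''sl'' = s" "rg h1 ''p'' = a" "rg h1 ''q'' = b" "rg h1 ''a'' = a" "rg h1 ''b'' = b" "mm h1 = mm h"
    using sl a b by (simp_all add: h1_def rg_setr)
  have f1: "frame tmps s ?F h h1" by (auto simp: h1_def frame_def rg_setr tmps_def)
  have k1: "keyf (mm h1 s) a b = kap n x' a b" using keyf_xrep[OF X a(2) b(2)] h1 by simp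
  have d1: "2 * mm h1 s (5, b, 0, 0) + 3 \<le> Z" using X Z2[OF b(2)] b h1 by (simp add: xrep_def)
  have 1: "wps fix_code (\<lambda>h'. classes n (mm h' s) (upd (kap n x) a b (kap n x' a b)) \<and> frame ?R s ?F h1 h' \<and>
      (\<forall>f a' b c. a' \<noteq> a \<longrightarrow> mm h' s (f, a', b, c) = mm h1 s (f, a', b, c))) h1"
    using fix_wps[OF h1(1) sl(2) h1(2) a(2) h1(3) b(2) _ d1, of "kap n x"] C Z1 a b k1 h1(6) by simp
  have 2: "wps fix_code (\<lambda>h'. classes n (mm h' s) (upd (upd (kap n x) a b (kap n x' a b)) b a (kap n x' b a)) \<and>
      frame ?R s ?F h3 h') h3 \<and> frame tmps s ?F h h3"
    if h2: "classes n (mm h2 s) (upd (kap n x) a b (kap n x' a b))" "frame ?R s ?F h1 h2"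
      and h3: "h3 = setr (setr h2 ''p'' b) ''q'' a" for h2 h3
  proof -
    have r: "rg h3 ''sl'' = s" "rg h3 ''p'' = b" "rg h3 ''q'' = a" "mm h3 = mm h2"
      using h1 frame_reg[OF h2(2)] by (simp_all add: h3 rg_setr)
    have f13: "frame tmps s ?F h h2" by (rule frame_trans[OF f1 h2(2)]) (auto simp: tmps_def)
    then have f3: "frame tmps s ?F h h3" by (simp add: h3 frame_def rg_setr tmps_def)
    have X3: "xrep n (mm h3 s) x'" by (rule xrep_frame[OF X f3]) auto
    have k3: "keyf (mm h3 s) b a = kap n x' b a" using keyf_xrep[OF X3 b(2) a(2)] .
    have d3: "2 * mm h3 s (5, a, 0, 0) + 3 \<le> Z" using X3 Z2[OF a(2)] a by (simp add: xrep_def)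
    have c3: "classes n (mm h3 s) (upd (kap n x) a b (kap n x' a b))" using h2 r by simp
    have z3: "upd (kap n x) a b (kap n x' a b) b a \<le> Z" using ab Z1[OF b(2) a(2)] by (simp add: upd_def)
    show ?thesis
      using wps_mono[OF fix_wps[OF r(1) sl(2) r(2) b(2) r(3) a(2) c3 d3 z3]] k3 f3 by simp
  qed
  have 3: "wps (SQ (SA ''p'' (HV ''b'')) (SQ (SA ''q'' (HV ''a'')) (SQ fix_code (SA ''g'' (HC 0)))))
     (\<lambda>h'. classes n (mm h' s) (upd (upd (kap n x) a b (kap n x' a b)) b a (kap n x' b a)) \<and>
     frame tmps s ?F h h' \<and> rg h' ''g'' = 0) h2"
    if h2: "classes n (mm h2 s) (upd (kap n x) a b (kap n x' a b))" "frame ?R s ?F h1 h2" for h2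
  proof -
    have r: "rg h2 ''a'' = a" "rg h2 ''b'' = b" using h1 frame_reg[OF h2(2)] by simp_all
    define h3 where "h3 = setr (setr h2 ''p'' b) ''q'' a"
    note W = 2[OF h2 h3_def]
    have "wps fix_code (wps (SA ''g'' (HC 0)) (\<lambda>h'. classes n (mm h' s) (upd (upd (kap n x) a b (kap n x' a b)) b a (kap n x' b a)) \<and>
     frame tmps s ?F h h' \<and> rg h' ''g'' = 0)) h3"
    proof (rule wps_mono[OF conjunct1[OF W]])
      fix h' assume h': "classes n (mm h' s) (upd (upd (kap n x) a b (kap n x' a b)) b a (kap n x' b a)) \<and> frame ?R s ?F h3 h'"
      have "frame tmps s ?F h h'" by (rule frame_trans[OF conjunct2[OF W] conjunct2[OF h']]) (auto simp: tmps_def)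
      then have "frame tmps s ?F h (setr h' ''g'' 0)" by (simp add: frame_def rg_setr tmps_def)
      then show "wps (SA ''g'' (HC 0)) (\<lambda>h'. classes n (mm h' s) (upd (upd (kap n x) a b (kap n x' a b)) b a (kap n x' b a)) \<and>
         frame tmps s ?F h h' \<and> rg h' ''g'' = 0) h'"
        using h' by (simp add: rg_setr)
    qed
    then show ?thesis using r ZZ by (simp add: h3_def rg_setr)
  qed
  have "wps fix_code (wps (SQ (SA ''p'' (HV ''b'')) (SQ (SA ''q'' (HV ''a'')) (SQ fix_code (SA ''g'' (HC 0)))))
     (\<lambda>h'. classes n (mm h' s) (upd (upd (kap n x) a b (kap n x' a b)) b a (kap n x' b a)) \<and>
     frame tmps s ?F h h' \<and> rg h' ''g'' = 0)) h1"
    by (rule wps_mono[OF 1], rule 3) auto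
  then show ?thesis unfolding fixab_code_def using a b ZZ by (simp add: h1_def rg_setr)
qed

lemma tail_wp:
  assumes sl: "rg h ''sl'' = s" "s < 4" and a: "rg h ''a'' = a" "a < n" and b: "rg h ''b'' = b" "b < n"
    and ab: "a \<noteq> b" and X: "xrep n (mm h s) x'" and C: "classes n (mm h s) (kap n x)"
    and Z1: "\<And>u v. u < n \<Longrightarrow> v < n \<Longrightarrow> kap n x u v \<le> Z" and Z2: "\<And>u. u < n \<Longrightarrow> 2 * deg n x' u + 3 \<le> Z"
    and x': "\<And>u v. (u, v) \<noteq> (a, b) \<Longrightarrow> x' u v = x u v" and diag: "x a a = 0"
    and own: "card (own n x' a) \<le> Ob"
  shows "wp tail_code (tail_time Ob) (\<lambda>h'. rep n (mm h' s) x' \<and> frame tmps s {1, 2, 3, 4} h h') h"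
proof -
  let ?F = "{1, 2, 3, 4 :: nat}"
  define C2 where "C2 = upd (upd (kap n x) a b (kap n x' a b)) b a (kap n x' b a)"
  have diag': "x' a a = 0" using diag x'[of a a] ab by simp
  have aown: "a \<notin> own n x' a" using diag' by (simp add: own_def)
  have C2a: "C2 a v = kap n x' a v" if "v < n" for v
  proof (cases "v = b")
    case True
    then show ?thesis using ab by (simp add: C2_def upd_def)
  next
    case False
    have "kap n x' a v = kap n x a v"
      by (rule kap_unchanged[of a b x' x, OF x' _ _ aown a(2)]) (use False ab in simp_all)
    then show ?thesis using False ab by (simp add: C2_def upd_def)
  qed
  have C2u: "C2 u v = kap n x' u v" if uv: "u < n" "v < n" "v = a \<Longrightarrow> u \<notin> own n x' a" for u v
  proof (cases "u = a \<and> v = b \<or> u = b \<and> v = a")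
    case True
    then show ?thesis using ab unfolding C2_def upd_def by (elim disjE conjE) simp_all
  next
    case False
    have "kap n x' u v = kap n x u v"
    proof (rule kap_unchanged[of a b x' x u v n])
      show "(u, v) \<noteq> (a, b)" "(u, v) \<noteq> (b, a)" using False by simp_all
      show "u < n" by (rule uv(1))
      show "v = a \<Longrightarrow> u \<notin> own n x' a" by (rule uv(3))
      show "\<And>u v. (u, v) \<noteq> (a, b) \<Longrightarrow> x' u v = x u v" by (rule x')
    qed
    moreover have "\<not> (u = a \<and> v = b)" "\<not> (u = b \<and> v = a)" using False by blast+
    then have "C2 u v = kap n x u v" unfolding C2_def upd_def by (simp only: if_False)
    ultimately show ?thesis by simp
  qed
  have 2: "wp (While (hcomp notify_guard) (scomp notify_body))
      (Ob * (stime notify_body + 1 + exp_cost (hcomp notify_guard)) + 1 + exp_cost (hcomp notify_guard))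
      (\<lambda>h'. rep n (mm h' s) x' \<and> frame tmps s ?F h h') h1"
    if h1: "classes n (mm h1 s) C2" "frame tmps s ?F h h1" "rg h1 ''g'' = 0" for h1
  proof -
    define arr where "arr i = mm h1 s (4, a, i, 1)" for i
    define sz where "sz = mm h1 s (3, a, 0, 1)"
    have L: "lists n (mm h1 s) C2" using h1 by (simp add: classes_def)
    have ownset: "{v. v < n \<and> C2 a v = 1} = own n x' a"
      using C2a kap_own[of _ n x' a] by (auto simp: own_def)
    have arr_own: "arr ` {..<sz} = own n x' a"
      using lists_range[OF L a(2), of 1] ownset by (simp add: arr_def sz_def)
    have szO: "sz \<le> Ob" using lists_card[OF L a(2), of 1] ownset own by (simp add: sz_def)
    have szn: "sz \<le> n" using lists_card_le[OF L a(2), of 1] by (simp add: sz_def)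
    define Cg where "Cg g = (\<lambda>u v. if v = a \<and> u \<in> arr ` {..<g} then kap n x' u v else C2 u v)" for g
    \<comment> \<open>The loop walks through the list of neighbours owned by \<open>a\<close> while
      classes are being changed. It only alters cells of vertices \<open>p \<noteq> a\<close>, so
      the list itself stays fixed, which the equation for \<open>mm h1\<close> records.\<close>
    define I where "I k h2 \<longleftrightarrow> (\<exists>g. rg h2 ''g'' = g \<and> g \<le> sz \<and> k = sz - g \<and> frame tmps s ?F h h2 \<and>
       (\<forall>f b c. mm h2 s (f, a, b, c) = mm h1 s (f, a, b, c)) \<and> classes n (mm h2 s) (Cg g))" for k h2
    have regs: "rg h2 ''sl'' = s" "rg h2 ''a'' = a" if "frame tmps s ?F h h2" for h2
      using frame_reg[OF that] sl a by (simp_all add: tmps_def)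
    have "wp (While (hcomp notify_guard) (scomp notify_body))
      (sz * (stime notify_body + 1 + exp_cost (hcomp notify_guard)) + 1 + exp_cost (hcomp notify_guard))
      (\<lambda>h'. rep n (mm h' s) x' \<and> frame tmps s ?F h h') h1"
    proof (rule wp_while[where I = I])
      show "hstat notify_guard" by simp
      show "I sz h1" unfolding I_def using h1 by (simp add: Cg_def)
      show "hok n notify_guard h2" if I: "I k h2" for k h2
      proof -
        have "frame tmps s ?F h h2" using I unfolding I_def by blast
        from regs[OF this] show ?thesis using sl a n_pos by (simp add: notify_guard_def)
      qed
    next
      fix k h2 assume bd: "bounded h2" and I: "I k h2" and gd: "hval notify_guard h2 \<noteq> 0"
      then obtain g where g: "rg h2 ''g'' = g" "g \<le> sz" "k = sz - g" "frame tmps s ?F h h2"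
        "\<forall>f b c. mm h2 s (f, a, b, c) = mm h1 s (f, a, b, c)" "classes n (mm h2 s) (Cg g)"
        unfolding I_def by blast
      note R = regs[OF g(4)]
      have gs: "g < sz" using gd R g(1,5) by (simp add: notify_guard_def sz_def split: if_splits)
      define p where "p = arr g"
      have p: "p \<in> own n x' a" using arr_own gs by (auto simp: p_def)
      then have pn: "p < n" "p \<noteq> a" using aown by (auto simp: own_def)
      have arr2: "mm h2 s (4, a, g, 1) = p" using g(5) by (simp add: p_def arr_def)
      define h3 where "h3 = setr (setr h2 ''p'' p) ''q'' a"
      have r3: "rg h3 ''sl'' = s" "rg h3 ''p'' = p" "rg h3 ''q'' = a" "mm h3 = mm h2" "rg h3 ''g'' = g"
        using R g by (simp_all add: h3_def rg_setr)
      have f3: "frame tmps s ?F h h3" using g(4) by (simp add: h3_def frame_def rg_setr tmps_def)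
      have X3: "xrep n (mm h3 s) x'" by (rule xrep_frame[OF X f3]) auto
      have k3: "keyf (mm h3 s) p a = kap n x' p a" using keyf_xrep[OF X3 pn(1) a(2)] .
      have d3: "2 * mm h3 s (5, a, 0, 0) + 3 \<le> Z" using X3 Z2[OF a(2)] a by (simp add: xrep_def)
      have c3: "classes n (mm h3 s) (Cg g)" using g r3 by simp
      have kz: "kap n x' u v \<le> Z" if "v < n" for u v
        using Z2[OF that] by (auto simp: kap_def of_bool_def)
      have z3: "Cg g p a \<le> Z"
        using kz[OF a(2)] kz[OF b(2)] Z1[OF pn(1) a(2)] by (simp add: Cg_def C2_def upd_def)
      have e: "upd (Cg g) p a (kap n x' p a) = Cg (Suc g)"
        by (auto simp: upd_def Cg_def fun_eq_iff lessThan_Suc p_def)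
      have "wps fix_code (wps (SA ''g'' (hplus (HV ''g'') (HC 1))) (I (k - 1))) h3"
      proof (rule wps_mono[OF fix_wps[OF r3(1) sl(2) r3(2) pn(1) r3(3) a(2) c3 d3 z3]])
        fix h4 assume h4: "classes n (mm h4 s) (upd (Cg g) p a (keyf (mm h3 s) p a)) \<and>
          frame {''k'', ''o'', ''i'', ''r''} s ?F h3 h4 \<and>
          (\<forall>f a b c. a \<noteq> p \<longrightarrow> mm h4 s (f, a, b, c) = mm h3 s (f, a, b, c))"
        have f4: "frame tmps s ?F h h4" by (rule frame_trans[OF f3]) (use h4 in \<open>auto simp: tmps_def\<close>)
        then have f5: "frame tmps s ?F h (setr h4 ''g'' v)" for v by (simp add: frame_def rg_setr tmps_def)
        have g4: "rg h4 ''g'' = g" using h4 r3 frame_reg[of "{''k'', ''o'', ''i'', ''r''}" s ?F h3 h4 "''g''"] by simp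
        have "I (k - 1) (setr h4 ''g'' (g + 1))"
          unfolding I_def
        proof (intro exI[of _ "Suc g"] conjI)
          show "classes n (mm (setr h4 ''g'' (g + 1)) s) (Cg (Suc g))" using h4 k3 e by simp
          show "\<forall>f b c. mm (setr h4 ''g'' (g + 1)) s (f, a, b, c) = mm h1 s (f, a, b, c)"
            using h4 pn g(5) r3(4) by simp
        qed (use gs g(3) f5 in \<open>simp_all add: rg_setr\<close>)
        then show "wps (SA ''g'' (hplus (HV ''g'') (HC 1))) (I (k - 1)) h4"
          using g4 gs szn n_le by simp
      qed
      then have "wps notify_body (I (k - 1)) h2"
        unfolding notify_body_def
        using R g(1) gs szn n_pos n_le a sl arr2 pn by (simp add: h3_def rg_setr)
      then show "k > 0 \<and> wp (scomp notify_body) (stime notify_body) (I (k - 1)) h2"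
        using wp_scom gs g(3) by simp
    next
      fix k h2 assume bd: "bounded h2" and I: "I k h2" and gd: "hval notify_guard h2 = 0"
      then obtain g where g: "rg h2 ''g'' = g" "g \<le> sz" "k = sz - g" "frame tmps s ?F h h2"
        "\<forall>f b c. mm h2 s (f, a, b, c) = mm h1 s (f, a, b, c)" "classes n (mm h2 s) (Cg g)"
        unfolding I_def by blast
      note R = regs[OF g(4)]
      have gs: "g = sz" using gd R g(1,2,5) by (simp add: notify_guard_def sz_def split: if_splits)
      have "classes n (mm h2 s) (kap n x')"
      proof (rule classes_cong[OF g(6)])
        fix u v assume "u < n" "v < n"
        then show "kap n x' u v = Cg g u v" using C2u[of u v] arr_own by (simp add: Cg_def gs)
      qed
      moreover have "xrep n (mm h2 s) x'" by (rule xrep_frame[OF X g(4)]) auto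
      ultimately show "rep n (mm h2 s) x' \<and> frame tmps s ?F h h2" using g(4) by (simp add: rep_def)
    qed
    then show ?thesis by (rule wp_mono) (intro add_mono mult_le_mono1 order_refl szO)
  qed
  have 1: "wp (scomp fixab_code) (stime fixab_code) (\<lambda>h'. classes n (mm h' s) C2 \<and>
     frame tmps s ?F h h' \<and> rg h' ''g'' = 0) h"
    unfolding C2_def
    by (rule wp_scom[OF _ fixab_wps[OF sl a b ab X C Z1 Z2]]) auto
  show ?thesis unfolding tail_code_def tail_time_def
    by (rule wp_seq[OF 1]) (use 2 in blast)
qed

end

section \<open>Adding and removing one unit\<close>

definition addu_code :: scom where
  "addu_code =
     SQ (put 0 (HV ''a'') (HV ''b'') (HC 0) (hplus (fld 0 (HV ''a'') (HV ''b'') (HC 0)) (HC 1)))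
    (SQ (SA ''e'' (hplus (fld 5 (HV ''a'') (HC 0) (HC 0)) (HC 1)))
    (SQ (put 5 (HV ''a'') (HC 0) (HC 0) (HV ''e''))
    (SQ (put 6 (HC 0) (HC 0) (HV ''e'') (hplus (fld 6 (HC 0) (HC 0) (HV ''e'')) (HC 1)))
        (SI (hless (fld 7 (HC 0) (HC 0) (HC 0)) (HV ''e'')) (put 7 (HC 0) (HC 0) (HC 0) (HV ''e'')) SN))))"

text \<open>If the count of vertices of degree at least \<open>e\<close> drops to 0, the maximum was
  \<open>e\<close>, and the vertex \<open>a\<close>, now of degree \<open>e - 1\<close>, attains the
  new one. So the maximum falls by one at a time and is never searched for.\<close>

definition remu_code :: scom where
  "remu_code =
     SQ (put 0 (HV ''a'') (HV ''b'') (HC 0) (hminus (fld 0 (HV ''a'') (HV ''b'') (HC 0)) (HC 1)))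
    (SQ (SA ''e'' (fld 5 (HV ''a'') (HC 0) (HC 0)))
    (SQ (put 5 (HV ''a'') (HC 0) (HC 0) (hminus (HV ''e'') (HC 1)))
    (SQ (put 6 (HC 0) (HC 0) (HV ''e'') (hminus (fld 6 (HC 0) (HC 0) (HV ''e'')) (HC 1)))
        (SI (fld 6 (HC 0) (HC 0) (HV ''e'')) SN (put 7 (HC 0) (HC 0) (HC 0) (hminus (HV ''e'') (HC 1)))))))"

definition add_com :: com where "add_com = Seq (scomp addu_code) tail_code"
definition rem_com :: com where "rem_com = Seq (scomp remu_code) tail_code"

text \<open>Both codes are charged, so that one bound serves additions and removals.\<close>

definition arc_time :: "nat \<Rightarrow> nat" where
  "arc_time k = stime addu_code + stime remu_code + tail_time k"

lemma addu_sstat [simp]: "sstat addu_code" "sstat remu_code"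
  by (simp_all add: addu_code_def remu_code_def hstat_def)

lemma card_deg_incr:
  fixes a :: nat and d d' :: "nat \<Rightarrow> nat"
  assumes "a < n" "\<And>u. d' u = d u + of_bool (u = a)"
  shows "card {u. u < n \<and> k \<le> d' u} = card {u. u < n \<and> k \<le> d u} + of_bool (k = d a + (1 :: nat))"
proof (cases "k = d a + 1")
  case True
  have "{u. u < n \<and> k \<le> d' u} = insert a {u. u < n \<and> k \<le> d u}"
    using assms True by (auto split: if_splits)
  moreover have "a \<notin> {u. u < n \<and> k \<le> d u}" using True by simp
  moreover have "finite {u. u < n \<and> k \<le> d u}" by simp
  ultimately show ?thesis using True by (simp only: card_insert_disjoint) simp
next
  case False
  have "k \<le> d' u \<longleftrightarrow> k \<le> d u" for u using assms(2)[of u] False by (cases "u = a") auto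
  then show ?thesis using False by simp
qed

lemma xrep_addarc:
  assumes X: "xrep n b x" and ac: "a < n" "c < n"
    and b0: "\<And>u v. b' (0, u, v, 0) = (if u = a \<and> v = c then x a c + 1 else b (0, u, v, 0))"
    and b5: "\<And>u. b' (5, u, 0, 0) = (if u = a then deg n x a + 1 else b (5, u, 0, 0))"
    and b6: "\<And>k. b' (6, 0, 0, k) = (if k = deg n x a + 1 then b (6, 0, 0, k) + 1 else b (6, 0, 0, k))"
    and b7: "b' (7, 0, 0, 0) = (if b (7, 0, 0, 0) < deg n x a + 1 then deg n x a + 1 else b (7, 0, 0, 0))"
  shows "xrep n b' (addarc x a c)"
proof -
  note d = deg_addarc[OF ac(2), of x a]
  note card = card_deg_incr[of a n "deg n (addarc x a c)" "deg n x", OF ac(1) d]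
  have 7: "deg n x u \<le> b (7, 0, 0, 0)" if "u < n" for u using X that by (simp add: xrep_def)
  have "deg n (addarc x a c) u \<le> b' (7, 0, 0, 0)" if "u < n" for u
    using 7[OF that] by (simp add: d b7)
  moreover have "\<exists>u<n. deg n (addarc x a c) u = b' (7, 0, 0, 0)"  if "0 < b' (7, 0, 0, 0)"
  proof (cases "b (7, 0, 0, 0) < deg n x a + 1")
    case True
    then show ?thesis using ac(1) by (intro exI[of _ a]) (simp add: d b7)
  next
    case False
    then have "0 < b (7, 0, 0, 0)" by simp
    then obtain u where u: "u < n" "deg n x u = b (7, 0, 0, 0)" using X by (auto simp: xrep_def)
    then have "u \<noteq> a" using False by auto
    then show ?thesis using u False by (intro exI[of _ u]) (simp add: d b7)
  qed
  moreover have "b' (0, u, v, 0) = addarc x a c u v" if "u < n" "v < n" for u v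
    using X that by (simp add: xrep_def b0 addarc_def)
  moreover have "b' (5, u, 0, 0) = deg n (addarc x a c) u" if "u < n" for u
    using X that by (simp add: xrep_def b5 d)
  moreover have "b' (6, 0, 0, k) = card {u. u < n \<and> k \<le> deg n (addarc x a c) u}" if "0 < k" for k
    using X that unfolding card by (simp add: xrep_def b6)
  ultimately show ?thesis unfolding xrep_def by blast
qed

lemma xrep_remarc:
  assumes X: "xrep n b x" and ac: "a < n" "c < n" and pos: "0 < x a c"
    and b0: "\<And>u v. b' (0, u, v, 0) = (if u = a \<and> v = c then x a c - 1 else b (0, u, v, 0))"
    and b5: "\<And>u. b' (5, u, 0, 0) = (if u = a then deg n x a - 1 else b (5, u, 0, 0))"
    and b6: "\<And>k. b' (6, 0, 0, k) = (if k = deg n x a then b (6, 0, 0, k) - 1 else b (6, 0, 0, k))"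
    and b7: "b' (7, 0, 0, 0) = (if b' (6, 0, 0, deg n x a) = 0 then deg n x a - 1 else b (7, 0, 0, 0))"
  shows "xrep n b' (remarc x a c)"
proof -
  note d = deg_remarc[of c n x a, OF ac(2) pos]
  have dd: "deg n x u = deg n (remarc x a c) u + of_bool (u = a)" for u
    using d by (cases "u = a") simp_all
  note card = card_deg_incr[of a n "deg n x" "deg n (remarc x a c)", OF ac(1) dd]
  have da: "deg n (remarc x a c) a + 1 = deg n x a" using dd[of a] by simp
  have 7: "deg n x u \<le> b (7, 0, 0, 0)" if "u < n" for u using X that by (simp add: xrep_def)
  have C: "b' (6, 0, 0, k) = card {u. u < n \<and> k \<le> deg n (remarc x a c) u}" if "0 < k" for k
    using X that card[of k] da by (cases "k = deg n x a") (simp_all add: xrep_def b6)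
  have none: "deg n (remarc x a c) u \<le> deg n x a - 1" if "b' (6, 0, 0, deg n x a) = 0" "u < n" for u
  proof -
    have "{u. u < n \<and> deg n x a \<le> deg n (remarc x a c) u} = {}" using C[OF d(2)] that(1) by simp
    then show ?thesis using that(2) d(2) by force
  qed
  have "deg n (remarc x a c) u \<le> b' (7, 0, 0, 0)" if "u < n" for u
    using 7[OF that] none that dd[of u] by (simp add: b7)
  moreover have "\<exists>u<n. deg n (remarc x a c) u = b' (7, 0, 0, 0)"  if p: "0 < b' (7, 0, 0, 0)"
  proof (cases "b' (6, 0, 0, deg n x a) = 0")
    case True
    then show ?thesis using ac(1) da by (intro exI[of _ a]) (simp add: b7)
  next
    case False
    then have "{u. u < n \<and> deg n x a \<le> deg n (remarc x a c) u} \<noteq> {}"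
      unfolding C[OF d(2)] using card_gt_0_iff by fastforce
    then obtain w where w: "w < n" "deg n x a \<le> deg n (remarc x a c) w" by auto
    have p': "0 < b (7, 0, 0, 0)" using p False by (simp add: b7)
    then obtain u where u: "u < n" "deg n x u = b (7, 0, 0, 0)" using X by (auto simp: xrep_def)
    show ?thesis
    proof (cases "u = a")
      case True
      then have "deg n (remarc x a c) w = b (7, 0, 0, 0)"
        using u w 7[OF w(1)] dd[of w] by simp
      then show ?thesis using w False by (intro exI[of _ w]) (simp add: b7)
    next
      case ua: False
      then show ?thesis using u False dd[of u] by (intro exI[of _ u]) (simp add: b7)
    qed
  qed
  moreover have "b' (0, u, v, 0) = remarc x a c u v" if "u < n" "v < n" for u v
    using X that by (simp add: xrep_def b0 remarc_def)
  moreover have "b' (5, u, 0, 0) = deg n (remarc x a c) u" if "u < n" for u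
    using X that by (simp add: xrep_def b5 d)
  ultimately show ?thesis using C unfolding xrep_def by blast
qed

lemma le_deg: "v < n \<Longrightarrow> x u v \<le> deg n x u"
  unfolding deg_def by (rule member_le_sum) simp_all

abbreviation F8 :: "nat set" where "F8 \<equiv> {0, 1, 2, 3, 4, 5, 6, 7}"

context ram
begin

lemma kap_le: "deg n x v \<le> D \<Longrightarrow> 2 * D + 3 \<le> Z \<Longrightarrow> kap n x u v \<le> Z"
  unfolding kap_def by (simp add: of_bool_def)

lemma addu_wps:
  assumes sl: "rg h ''sl'' = s" "s < 4" and a: "rg h ''a'' = a" "a < n" and b: "rg h ''b'' = b" "b < n"
    and X: "xrep n (mm h s) x" and D: "deg n x a + 1 \<le> Z"
  shows "wps addu_code (\<lambda>h'. xrep n (mm h' s) (addarc x a b) \<and> frame tmps s {0, 5, 6, 7} h h') h"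
proof -
  have v: "mm h s (0, a, b, 0) = x a b" "mm h s (5, a, 0, 0) = deg n x a"
    "mm h s (6, 0, 0, Suc (deg n x a)) = card {u. u < n \<and> deg n x a + 1 \<le> deg n x u}"
    using X a b by (simp_all add: xrep_def)
  have "{u. u < n \<and> deg n x a + 1 \<le> deg n x u} \<subseteq> {..<n} - {a}" by auto
  then have "card {u. u < n \<and> deg n x a + 1 \<le> deg n x u} \<le> card ({..<n} - {a})"
    by (rule card_mono[rotated]) simp
  then have "card {u. u < n \<and> deg n x a + 1 \<le> deg n x u} < n" using a by simp
  then have c: "Suc (mm h s (6, 0, 0, Suc (deg n x a))) \<le> Z" unfolding v(3) using n_le by linarith
  have xz: "Suc (x a b) \<le> Z" using le_deg[OF b(2), of x a] D by simp
  define b' where "b' = (let b1 = (mm h s)((0, a, b, 0) := Suc (x a b), (5, a, 0, 0) := Suc (deg n x a),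
     (6, 0, 0, Suc (deg n x a)) := Suc (mm h s (6, 0, 0, Suc (deg n x a)))) in
     if mm h s (7, 0, 0, 0) < Suc (deg n x a) then b1((7, 0, 0, 0) := Suc (deg n x a)) else b1)"
  have "wps addu_code (\<lambda>h'. mm h' s = b' \<and> (\<forall>t. t \<noteq> s \<longrightarrow> mm h' t = mm h t) \<and>
      (\<forall>y. y \<noteq> ''e'' \<longrightarrow> rg h' y = rg h y)) h"
    using sl a b v(1,2) D c xz n_pos
    by (cases "mm h s (7, 0, 0, 0) < Suc (deg n x a)") (simp_all add: addu_code_def rg_setr mm_setm b'_def)
  then show ?thesis
  proof (rule wps_mono)
    fix h' assume h': "mm h' s = b' \<and> (\<forall>t. t \<noteq> s \<longrightarrow> mm h' t = mm h t) \<and> (\<forall>y. y \<noteq> ''e'' \<longrightarrow> rg h' y = rg h y)"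
    have "xrep n b' (addarc x a b)"
      by (rule xrep_addarc[OF X a(2) b(2)]) (simp_all add: b'_def Let_def)
    moreover have "frame tmps s {0, 5, 6, 7} h h'"
      using h' by (simp add: frame_def tmps_def b'_def Let_def)
    ultimately show "xrep n (mm h' s) (addarc x a b) \<and> frame tmps s {0, 5, 6, 7} h h'" using h' by simp
  qed
qed

lemma remu_wps:
  assumes sl: "rg h ''sl'' = s" "s < 4" and a: "rg h ''a'' = a" "a < n" and b: "rg h ''b'' = b" "b < n"
    and X: "xrep n (mm h s) x" and D: "deg n x a + 1 \<le> Z" and pos: "0 < x a b"
  shows "wps remu_code (\<lambda>h'. xrep n (mm h' s) (remarc x a b) \<and> frame tmps s {0, 5, 6, 7} h h') h"
proof -
  have dp: "0 < deg n x a" using pos le_deg[OF b(2), of x a] by simp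
  have v: "mm h s (0, a, b, 0) = x a b" "mm h s (5, a, 0, 0) = deg n x a"
    "mm h s (6, 0, 0, deg n x a) = card {u. u < n \<and> deg n x a \<le> deg n x u}"
    using X a b dp by (simp_all add: xrep_def)
  have "card {u. u < n \<and> deg n x a \<le> deg n x u} \<le> card {..<n}"
    by (intro card_mono) auto
  then have c: "mm h s (6, 0, 0, deg n x a) - 1 \<le> Z" using v(3) n_le by simp
  have "a \<in> {u. u < n \<and> deg n x a \<le> deg n x u}" using a by simp
  then have c1: "Suc 0 \<le> mm h s (6, 0, 0, deg n x a)" unfolding v(3) by (simp add: Suc_le_eq card_gt_0_iff) blast
  have xz: "x a b - 1 \<le> Z" "deg n x a \<le> Z" "deg n x a - 1 \<le> Z" using le_deg[OF b(2), of x a] D by simp_all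
  have p1: "Suc 0 \<le> x a b" "Suc 0 \<le> deg n x a" using pos dp by simp_all
  define b' where "b' = (let b1 = (mm h s)((0, a, b, 0) := x a b - 1, (5, a, 0, 0) := deg n x a - 1,
     (6, 0, 0, deg n x a) := mm h s (6, 0, 0, deg n x a) - 1) in
     if mm h s (6, 0, 0, deg n x a) - 1 = 0 then b1((7, 0, 0, 0) := deg n x a - 1) else b1)"
  have "wps remu_code (\<lambda>h'. mm h' s = b' \<and> (\<forall>t. t \<noteq> s \<longrightarrow> mm h' t = mm h t) \<and>
      (\<forall>y. y \<noteq> ''e'' \<longrightarrow> rg h' y = rg h y)) h"
    using sl a b v(1,2) xz c n_pos c1 p1
    by (cases "mm h s (6, 0, 0, deg n x a) - 1 = 0") (simp_all add: remu_code_def rg_setr mm_setm b'_def)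
  then show ?thesis
  proof (rule wps_mono)
    fix h' assume h': "mm h' s = b' \<and> (\<forall>t. t \<noteq> s \<longrightarrow> mm h' t = mm h t) \<and> (\<forall>y. y \<noteq> ''e'' \<longrightarrow> rg h' y = rg h y)"
    have "xrep n b' (remarc x a b)"
      by (rule xrep_remarc[OF X a(2) b(2) pos]) (simp_all add: b'_def Let_def)
    moreover have "frame tmps s {0, 5, 6, 7} h h'"
      using h' by (simp add: frame_def tmps_def b'_def Let_def)
    ultimately show "xrep n (mm h' s) (remarc x a b) \<and> frame tmps s {0, 5, 6, 7} h h'" using h' by simp
  qed
qed

lemma add_wp:
  assumes sl: "rg h ''sl'' = s" "s < 4" and a: "rg h ''a'' = a" "a < n" and b: "rg h ''b'' = b" "b < n"
    and ab: "a \<noteq> b" and X: "rep n (mm h s) x" and w: "inside n x"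
    and D: "\<And>u. u < n \<Longrightarrow> deg n x u \<le> Dm" "2 * Dm + 5 \<le> Z"
    and own: "card (own n (addarc x a b) a) \<le> Ob"
  shows "wp add_com (arc_time Ob) (\<lambda>h'. rep n (mm h' s) (addarc x a b) \<and> frame tmps s F8 h h') h"
proof -
  have X': "xrep n (mm h s) x" "classes n (mm h s) (kap n x)" using X by (simp_all add: rep_def)
  have 1: "wp (scomp addu_code) (stime addu_code)
     (\<lambda>h'. xrep n (mm h' s) (addarc x a b) \<and> frame tmps s {0, 5, 6, 7} h h') h"
    by (rule wp_scom[OF _ addu_wps[OF sl a b X'(1)]]) (use D(1)[OF a(2)] D(2) in simp_all)
  have "wp add_com (stime addu_code + tail_time Ob)
     (\<lambda>h'. rep n (mm h' s) (addarc x a b) \<and> frame tmps s F8 h h') h"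
    unfolding add_com_def
  proof (rule wp_seq[OF 1])
    fix h1 assume h1: "xrep n (mm h1 s) (addarc x a b) \<and> frame tmps s {0, 5, 6, 7} h h1"
    then have f: "frame tmps s {0, 5, 6, 7} h h1" by blast
    have r: "rg h1 ''sl'' = s" "rg h1 ''a'' = a" "rg h1 ''b'' = b"
      using frame_reg[OF f] sl a b by (simp_all add: tmps_def)
    have C: "classes n (mm h1 s) (kap n x)" by (rule classes_frame[OF X'(2) f]) auto
    have "wp tail_code (tail_time Ob) (\<lambda>h'. rep n (mm h' s) (addarc x a b) \<and> frame tmps s {1, 2, 3, 4} h1 h') h1"
    proof (rule tail_wp[OF r(1) sl(2) r(2) a(2) r(3) b(2) ab conjunct1[OF h1] C _ _ _ _ own])
      show "kap n x u v \<le> Z" if "v < n" for u v by (rule kap_le[OF D(1)[OF that]]) (use D(2) in simp)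
      show "2 * deg n (addarc x a b) u + 3 \<le> Z" if "u < n" for u
        using D(1)[OF that] D(2) deg_addarc[OF b(2), of x a u] by (cases "u = a") simp_all
      show "addarc x a b u v = x u v" if "(u, v) \<noteq> (a, b)" for u v using that by (auto simp: addarc_def)
      show "x a a = 0" using w by (auto simp: inside_def)
    qed
    then show "wp tail_code (tail_time Ob) (\<lambda>h'. rep n (mm h' s) (addarc x a b) \<and> frame tmps s F8 h h') h1"
    proof (rule wp_mono)
      fix h' assume "rep n (mm h' s) (addarc x a b) \<and> frame tmps s {1, 2, 3, 4} h1 h'"
      then show "rep n (mm h' s) (addarc x a b) \<and> frame tmps s F8 h h'"
        using frame_trans[OF f, of tmps "{1, 2, 3, 4}" h' tmps F8] by simp
    qed simp
  qed
  then show ?thesis by (rule wp_mono) (simp_all add: arc_time_def)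
qed

lemma rem_wp:
  assumes sl: "rg h ''sl'' = s" "s < 4" and a: "rg h ''a'' = a" "a < n" and b: "rg h ''b'' = b" "b < n"
    and X: "rep n (mm h s) x" and w: "inside n x" and pos: "0 < x a b"
    and D: "\<And>u. u < n \<Longrightarrow> deg n x u \<le> Dm" "2 * Dm + 5 \<le> Z"
    and own: "card (own n (remarc x a b) a) \<le> Ob"
  shows "wp rem_com (arc_time Ob) (\<lambda>h'. rep n (mm h' s) (remarc x a b) \<and> frame tmps s F8 h h') h"
proof -
  have ab: "a \<noteq> b" using w pos by (auto simp: inside_def)
  have X': "xrep n (mm h s) x" "classes n (mm h s) (kap n x)" using X by (simp_all add: rep_def)
  have 1: "wp (scomp remu_code) (stime remu_code)
     (\<lambda>h'. xrep n (mm h' s) (remarc x a b) \<and> frame tmps s {0, 5, 6, 7} h h') h"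
    by (rule wp_scom[OF _ remu_wps[OF sl a b X'(1) _ pos]]) (use D(1)[OF a(2)] D(2) in simp_all)
  have "wp rem_com (stime remu_code + tail_time Ob)
     (\<lambda>h'. rep n (mm h' s) (remarc x a b) \<and> frame tmps s F8 h h') h"
    unfolding rem_com_def
  proof (rule wp_seq[OF 1])
    fix h1 assume h1: "xrep n (mm h1 s) (remarc x a b) \<and> frame tmps s {0, 5, 6, 7} h h1"
    then have f: "frame tmps s {0, 5, 6, 7} h h1" by blast
    have r: "rg h1 ''sl'' = s" "rg h1 ''a'' = a" "rg h1 ''b'' = b"
      using frame_reg[OF f] sl a b by (simp_all add: tmps_def)
    have C: "classes n (mm h1 s) (kap n x)" by (rule classes_frame[OF X'(2) f]) auto
    have "wp tail_code (tail_time Ob) (\<lambda>h'. rep n (mm h' s) (remarc x a b) \<and> frame tmps s {1, 2, 3, 4} h1 h') h1"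
    proof (rule tail_wp[OF r(1) sl(2) r(2) a(2) r(3) b(2) ab conjunct1[OF h1] C _ _ _ _ own])
      show "kap n x u v \<le> Z" if "v < n" for u v by (rule kap_le[OF D(1)[OF that]]) (use D(2) in simp)
      show "2 * deg n (remarc x a b) u + 3 \<le> Z" if "u < n" for u
        using D(1)[OF that] D(2) deg_remarc(1)[of b n x a u, OF b(2) pos] by simp
      show "remarc x a b u v = x u v" if "(u, v) \<noteq> (a, b)" for u v using that by (auto simp: remarc_def)
      show "x a a = 0" using w by (auto simp: inside_def)
    qed
    then show "wp tail_code (tail_time Ob) (\<lambda>h'. rep n (mm h' s) (remarc x a b) \<and> frame tmps s F8 h h') h1"
    proof (rule wp_mono)
      fix h' assume "rep n (mm h' s) (remarc x a b) \<and> frame tmps s {1, 2, 3, 4} h1 h'"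
      then show "rep n (mm h' s) (remarc x a b) \<and> frame tmps s F8 h h'"
        using frame_trans[OF f, of tmps "{1, 2, 3, 4}" h' tmps F8] by simp
    qed simp
  qed
  then show ?thesis by (rule wp_mono) (simp_all add: arc_time_def)
qed

end

section \<open>Searching for the next arc of a chain\<close>

definition cape :: "hexp \<Rightarrow> hexp" where
  "cape e = hplus (hplus e (HC 1)) (hdiv e (HV ''B''))"

lemma cape_simps [simp]:
  "hval (cape e) h = cap (rg h ''B'') (hval e h)" "hok n (cape e) h \<longleftrightarrow> hok n e h"
  "hsize (cape e) = 2 * hsize e + 2" "hconst (cape e) \<longleftrightarrow> hconst e"
  by (auto simp: cape_def cap_def)

definition scan_guard :: hexp where
  "scan_guard = hless (HV ''g'') (fld 3 (HV ''c'') (HC 0) (HC 1))"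

definition scan_init :: scom where
  "scan_init = SQ (SA ''z'' (HC 0)) (SA ''g'' (HC 0))"

definition found_code :: scom where
  "found_code = SQ (SA ''y'' (HV ''r'')) (SA ''z'' (HC 1))"

definition scan_ins :: scom where
  "scan_ins = SQ (SA ''r'' (fld 4 (HV ''c'') (HV ''g'') (HC 1)))
     (SQ (SI (hless (cape (fld 5 (HV ''r'') (HC 0) (HC 0))) (fld 5 (HV ''c'') (HC 0) (HC 0))) found_code SN)
         (SA ''g'' (hplus (HV ''g'') (HC 1))))"

definition scan_del :: scom where
  "scan_del = SQ (SA ''r'' (fld 4 (HV ''c'') (HV ''g'') (HC 1)))
     (SQ (SI (hless (cape (fld 5 (HV ''c'') (HC 0) (HC 0))) (fld 5 (HV ''r'') (HC 0) (HC 0)))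
           (SI (fld 0 (HV ''r'') (HV ''c'') (HC 0)) found_code SN) SN)
         (SA ''g'' (hplus (HV ''g'') (HC 1))))"

definition probe_code :: scom where
  "probe_code = SI (fld 3 (HV ''c'') (HC 0) (HV ''k''))
     (SQ (SA ''y'' (fld 4 (HV ''c'') (HC 0) (HV ''k''))) (SA ''z'' (HC 1))) SN"

text \<open>Register \<open>e\<close> becomes \<open>low B\<close> of the degree of
  \<open>c\<close>, by \<open>cap_eq_low\<close> one more than the degree of the target sought. The
  class of that degree with a positive share of \<open>c\<close> has number
  \<open>2 * e + 1\<close>. For \<open>e = 0\<close> this number would denote the class of owned
  edges, hence the test.\<close>

definition probe_ins :: scom where
  "probe_ins = SQ (SA ''e'' (hminus (fld 5 (HV ''c'') (HC 0) (HC 0)) (HC 1)))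
     (SQ (SA ''e'' (hminus (HV ''e'') (hdiv (HV ''e'') (hplus (HV ''B'') (HC 1)))))
       (SI (HV ''e'') (SQ (SA ''k'' (hplus (htimes (HC 2) (HV ''e'')) (HC 1))) probe_code) SN))"

definition probe_next :: scom where
  "probe_next = SQ probe_code (SA ''k'' (hplus (HV ''k'') (HC 1)))"

text \<open>Let \<open>T\<close> be \<open>cap B\<close> of the degree of \<open>c\<close>. A
  violating in-neighbour not owned by \<open>c\<close> has degree \<open>T + 1\<close> or
  \<open>T + 2\<close>, and the share of \<open>c\<close> in the edge is zero or positive. These
  four classes have the consecutive numbers \<open>2 * T + 4\<close> to
  \<open>2 * T + 7\<close>.\<close>

definition probe_del :: scom where
  "probe_del = SQ (SA ''k'' (hplus (htimes (HC 2) (cape (fld 5 (HV ''c'') (HC 0) (HC 0)))) (HC 4)))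
     (SQ probe_next (SQ probe_next (SQ probe_next probe_next)))"

definition search_com :: "scom \<Rightarrow> scom \<Rightarrow> com" where
  "search_com body probe = Seq (scomp scan_init)
     (Seq (While (hcomp scan_guard) (scomp body)) (scomp probe))"

definition search_time :: "nat \<Rightarrow> nat" where
  "search_time k = stime scan_init +
     (k * (stime scan_ins + stime scan_del + 1 + exp_cost (hcomp scan_guard)) + 1 + exp_cost (hcomp scan_guard) +
      stime probe_ins + stime probe_del)"

lemma search_sstat [simp]:
  "hstat scan_guard" "sstat scan_init" "sstat scan_ins" "sstat scan_del" "sstat probe_ins" "sstat probe_del"
  by (simp_all add: scan_guard_def scan_init_def scan_ins_def scan_del_def probe_ins_def probe_del_def
      probe_next_def probe_code_def found_code_def hstat_def)

definition stmps :: "string set" where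
  "stmps = insert ''y'' (insert ''z'' tmps)"

text \<open>A search leaves in \<open>y\<close> a vertex satisfying \<open>P\<close>, or sets \<open>z\<close> to \<open>0\<close> if there is none.\<close>

definition searched :: "nat \<Rightarrow> nat \<Rightarrow> (nat \<Rightarrow> bool) \<Rightarrow> hstate \<Rightarrow> bool" where
  "searched n s P h \<longleftrightarrow> (rg h ''z'' \<noteq> 0 \<longrightarrow> P (rg h ''y'')) \<and> (rg h ''z'' = 0 \<longrightarrow> (\<forall>y<n. \<not> P y))"

context ram
begin

lemma wp_assoc:
  assumes "wp (Seq (Seq c1 c2) c3) T Q h"
  shows "wp (Seq c1 (Seq c2 c3)) T Q h"
proof (rule wpI)
  fix s assume "rel s h"
  with assms obtain t s' h' where e: "exec w (Seq (Seq c1 c2) c3) s t s'" "t \<le> T" "rel s' h'" "Q h'"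
    unfolding wp_def by blast
  from e(1) obtain s2 t12 t3 where 12: "exec w (Seq c1 c2) s t12 s2" "exec w c3 s2 t3 s'" "t = t12 + t3"
    by (cases rule: exec.cases) auto
  from 12(1) obtain s1 t1 t2 where "exec w c1 s t1 s1" "exec w c2 s1 t2 s2" "t12 = t1 + t2"
    by (cases rule: exec.cases) auto
  then have "exec w (Seq c1 (Seq c2 c3)) s t s'"
    using exec.Seq[OF _ exec.Seq[OF _ 12(2)]] 12(3) by (simp add: add.assoc)
  then show "\<exists>t s' h'. exec w (Seq c1 (Seq c2 c3)) s t s' \<and> t \<le> T \<and> rel s' h' \<and> Q h'" using e by blast
qed

lemma scan_wp:
  assumes sl: "rg h ''sl'' = s" "s < 4" and c: "rg h ''c'' = c" "c < n"
    and X: "rep n (mm h s) x" and own: "card (own n x c) \<le> Ob"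
    and st: "sstat body"
    and body: "\<And>g h1. g < n \<Longrightarrow> frame stmps s {} h h1 \<Longrightarrow> rg h1 ''g'' = g \<Longrightarrow> mm h s (4, c, g, 1) \<in> own n x c \<Longrightarrow>
       wps body (\<lambda>h'. frame stmps s {} h h' \<and> rg h' ''g'' = g + 1 \<and>
         (if P (mm h s (4, c, g, 1)) then rg h' ''y'' = mm h s (4, c, g, 1) \<and> rg h' ''z'' = 1
          else rg h' ''y'' = rg h1 ''y'' \<and> rg h' ''z'' = rg h1 ''z'')) h1"
  shows "wp (Seq (scomp scan_init) (While (hcomp scan_guard) (scomp body)))
    (stime scan_init + (Ob * (stime body + 1 + exp_cost (hcomp scan_guard)) + 1 + exp_cost (hcomp scan_guard)))
    (\<lambda>h'. frame stmps s {} h h' \<and> (rg h' ''z'' \<noteq> 0 \<longrightarrow> P (rg h' ''y'')) \<and>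
       (rg h' ''z'' = 0 \<longrightarrow> (\<forall>y\<in>own n x c. \<not> P y))) h"
proof -
  define arr where "arr i = mm h s (4, c, i, 1)" for i
  define sz where "sz = mm h s (3, c, 0, 1)"
  have L: "lists n (mm h s) (kap n x)" using X by (simp add: rep_def classes_def)
  have ownset: "{v. v < n \<and> kap n x c v = 1} = own n x c"
    using kap_own[of _ n x c] by (auto simp: own_def)
  have arr_own: "arr ` {..<sz} = own n x c"
    using lists_range[OF L c(2), of 1] ownset by (simp add: arr_def sz_def)
  have szO: "sz \<le> Ob" using lists_card[OF L c(2), of 1] ownset own by (simp add: sz_def)
  have szn: "sz \<le> n" using lists_card_le[OF L c(2), of 1] by (simp add: sz_def)
  define I where "I k h2 \<longleftrightarrow> (\<exists>g. rg h2 ''g'' = g \<and> g \<le> sz \<and> k = sz - g \<and> frame stmps s {} h h2 \<and>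
     (rg h2 ''z'' \<noteq> 0 \<longrightarrow> P (rg h2 ''y'')) \<and> (rg h2 ''z'' = 0 \<longrightarrow> (\<forall>i<g. \<not> P (arr i))))" for k h2
  have regs: "rg h2 ''sl'' = s" "rg h2 ''c'' = c" "mm h2 s (f, u, v, j) = mm h s (f, u, v, j)"
    if "frame stmps s {} h h2" for h2 f u v j
    using frame_reg[OF that] frame_fld[OF that] sl c by (simp_all add: stmps_def tmps_def)
  have 1: "wp (scomp scan_init) (stime scan_init) (I sz) h"
  proof (rule wp_scom)
    show "wps scan_init (I sz) h"
      by (simp add: scan_init_def I_def rg_setr frame_def stmps_def tmps_def)
  qed simp
  have 2: "wp (While (hcomp scan_guard) (scomp body))
     (sz * (stime body + 1 + exp_cost (hcomp scan_guard)) + 1 + exp_cost (hcomp scan_guard))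
     (\<lambda>h'. frame stmps s {} h h' \<and> (rg h' ''z'' \<noteq> 0 \<longrightarrow> P (rg h' ''y'')) \<and>
       (rg h' ''z'' = 0 \<longrightarrow> (\<forall>y\<in>own n x c. \<not> P y))) h1" if "I sz h1" for h1
  proof (rule wp_while[where I = I])
    show "hstat scan_guard" by simp
    show "I sz h1" by fact
    show "hok n scan_guard h2" if I: "I k h2" for k h2
    proof -
      have "frame stmps s {} h h2" using I unfolding I_def by blast
      from regs[OF this] show ?thesis using sl c n_pos by (simp add: scan_guard_def)
    qed
  next
    fix k h2 assume bd: "bounded h2" and I: "I k h2" and gd: "hval scan_guard h2 \<noteq> 0"
    from I obtain g where gg: "rg h2 ''g'' = g \<and> g \<le> sz \<and> k = sz - g \<and> frame stmps s {} h h2 \<and>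
      (rg h2 ''z'' \<noteq> 0 \<longrightarrow> P (rg h2 ''y'')) \<and> (rg h2 ''z'' = 0 \<longrightarrow> (\<forall>i<g. \<not> P (arr i)))"
      unfolding I_def by (elim exE)
    have g: "rg h2 ''g'' = g" "g \<le> sz" "k = sz - g" "frame stmps s {} h h2"
      "rg h2 ''z'' \<noteq> 0 \<longrightarrow> P (rg h2 ''y'')" "rg h2 ''z'' = 0 \<longrightarrow> (\<forall>i<g. \<not> P (arr i))"
      using gg by - (elim conjE, assumption)+
    note R = regs[OF g(4)]
    have gs: "g < sz" using gd R g(1) by (simp add: scan_guard_def sz_def split: if_splits)
    have ao: "arr g \<in> own n x c" using arr_own gs by auto
    have "wps body (I (k - 1)) h2"
    proof (rule wps_mono[OF body[OF _ g(4) g(1) ao[unfolded arr_def]]])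
      show "g < n" using gs szn by simp
      fix h' assume h': "frame stmps s {} h h' \<and> rg h' ''g'' = g + 1 \<and>
         (if P (mm h s (4, c, g, 1)) then rg h' ''y'' = mm h s (4, c, g, 1) \<and> rg h' ''z'' = 1
          else rg h' ''y'' = rg h2 ''y'' \<and> rg h' ''z'' = rg h2 ''z'')"
      show "I (k - 1) h'" unfolding I_def
      proof (intro exI[of _ "g + 1"] conjI)
        show "rg h' ''z'' \<noteq> 0 \<longrightarrow> P (rg h' ''y'')"
          using h' g(5) by (cases "P (mm h s (4, c, g, 1))") simp_all
        show "rg h' ''z'' = 0 \<longrightarrow> (\<forall>i<g + 1. \<not> P (arr i))"
        proof (cases "P (arr g)")
          case True
          then show ?thesis using h' by (simp add: arr_def)
        next
          case False
          then have "rg h' ''z'' = rg h2 ''z''" using h' by (simp add: arr_def)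
          then show ?thesis using g(6) False less_Suc_eq by simp
        qed
      qed (use h' gs g(3) in simp_all)
    qed
    then show "k > 0 \<and> wp (scomp body) (stime body) (I (k - 1)) h2"
      using wp_scom[OF st] gs g(3) by simp
  next
    fix k h2 assume bd: "bounded h2" and I: "I k h2" and gd: "hval scan_guard h2 = 0"
    from I obtain g where gg: "rg h2 ''g'' = g \<and> g \<le> sz \<and> k = sz - g \<and> frame stmps s {} h h2 \<and>
      (rg h2 ''z'' \<noteq> 0 \<longrightarrow> P (rg h2 ''y'')) \<and> (rg h2 ''z'' = 0 \<longrightarrow> (\<forall>i<g. \<not> P (arr i)))"
      unfolding I_def by (elim exE)
    have g: "rg h2 ''g'' = g" "g \<le> sz" "k = sz - g" "frame stmps s {} h h2"
      "rg h2 ''z'' \<noteq> 0 \<longrightarrow> P (rg h2 ''y'')" "rg h2 ''z'' = 0 \<longrightarrow> (\<forall>i<g. \<not> P (arr i))"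
      using gg by - (elim conjE, assumption)+
    note R = regs[OF g(4)]
    have gs: "g = sz" using gd R g(1,2) by (simp add: scan_guard_def sz_def split: if_splits)
    show "frame stmps s {} h h2 \<and> (rg h2 ''z'' \<noteq> 0 \<longrightarrow> P (rg h2 ''y'')) \<and>
       (rg h2 ''z'' = 0 \<longrightarrow> (\<forall>y\<in>own n x c. \<not> P y))"
      using g(4-6) unfolding gs arr_own[symmetric] by (simp only: ball_simps lessThan_iff) blast
  qed
  have "wp (Seq (scomp scan_init) (While (hcomp scan_guard) (scomp body)))
     (stime scan_init + (sz * (stime body + 1 + exp_cost (hcomp scan_guard)) + 1 + exp_cost (hcomp scan_guard)))
     (\<lambda>h'. frame stmps s {} h h' \<and> (rg h' ''z'' \<noteq> 0 \<longrightarrow> P (rg h' ''y'')) \<and>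
       (rg h' ''z'' = 0 \<longrightarrow> (\<forall>y\<in>own n x c. \<not> P y))) h"
    by (rule wp_seq[OF 1], rule 2)
  then show ?thesis by (rule wp_mono) (intro add_mono mult_le_mono1 order_refl szO)
qed

text \<open>A target is either owned by \<open>c\<close> and met by the scan, or it has the larger
  share of the edge and lies in the probed class. All members of that class are targets, so its
  first entry is as good as any.\<close>

lemma search_ins_wp:
  assumes sl: "rg h ''sl'' = s" "s < 4" and c: "rg h ''c'' = c" "c < n"
    and X: "rep n (mm h s) x" and own: "card (own n x c) \<le> Ob"
    and B: "rg h ''B'' = B" "0 < B" and i: "ins_chain n B e x c"
    and D: "\<And>u. u < n \<Longrightarrow> deg n x u \<le> Dm" "4 * Dm + 16 \<le> Z"
  shows "wp (search_com scan_ins probe_ins) (search_time Ob)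
    (\<lambda>h'. frame stmps s {} h h' \<and> searched n s (bad n B x c) h') h"
proof -
  let ?P = "bad n B x c"
  have d: "mm h s (5, u, 0, 0) = deg n x u" if "u < n" for u using X that by (simp add: rep_def xrep_def)
  have L: "lists n (mm h s) (kap n x)" using X by (simp add: rep_def classes_def)
  have w: "inside n x" using i by (simp add: ins_chain_def)
  have dc: "deg n x c = e c + 1" using i by (simp add: ins_chain_def)
  have regs: "rg h2 ''sl'' = s" "rg h2 ''c'' = c" "rg h2 ''B'' = B" "mm h2 s (f, u, v, j) = mm h s (f, u, v, j)"
    if "frame stmps s {} h h2" for h2 f u v j
    using frame_reg[OF that] frame_fld[OF that] sl c B by (simp_all add: stmps_def tmps_def)
  have fset: "frame stmps s {} h (setr h2 y v)" if "frame stmps s {} h h2" "y \<in> stmps" for h2 y v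
    using that by (simp add: frame_def rg_setr)
  have st: "''r'' \<in> stmps" "''g'' \<in> stmps" "''y'' \<in> stmps" "''z'' \<in> stmps" "''e'' \<in> stmps" "''k'' \<in> stmps"
    by (simp_all add: stmps_def tmps_def)
  have 1: "wp (Seq (scomp scan_init) (While (hcomp scan_guard) (scomp scan_ins)))
    (stime scan_init + (Ob * (stime scan_ins + 1 + exp_cost (hcomp scan_guard)) + 1 + exp_cost (hcomp scan_guard)))
    (\<lambda>h'. frame stmps s {} h h' \<and> (rg h' ''z'' \<noteq> 0 \<longrightarrow> ?P (rg h' ''y'')) \<and>
       (rg h' ''z'' = 0 \<longrightarrow> (\<forall>y\<in>own n x c. \<not> ?P y))) h"
  proof (rule scan_wp[OF sl c X own])
    fix g h1 assume g: "g < n" and f: "frame stmps s {} h h1" and rg: "rg h1 ''g'' = g"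
      and r: "mm h s (4, c, g, 1) \<in> own n x c"
    note R = regs[OF f]
    define r where "r = mm h s (4, c, g, 1)"
    have rn: "r < n" "0 < x c r" using r unfolding own_def r_def[symmetric] by (simp, force)
    have P: "?P r \<longleftrightarrow> cap B (deg n x r) < deg n x c" using rn by (simp add: bad_def)
    show "wps scan_ins (\<lambda>h'. frame stmps s {} h h' \<and> rg h' ''g'' = g + 1 \<and>
         (if ?P (mm h s (4, c, g, 1)) then rg h' ''y'' = mm h s (4, c, g, 1) \<and> rg h' ''z'' = 1
          else rg h' ''y'' = rg h1 ''y'' \<and> rg h' ''z'' = rg h1 ''z'')) h1"
      unfolding r_def[symmetric] P
      using R rg g rn d[OF rn(1)] d[OF c(2)] sl(2) c(2) n_pos n_le Z_ge r_def f st
      by (cases "cap B (deg n x r) < deg n x c")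
        (simp_all add: scan_ins_def found_code_def rg_setr fset)
  qed simp
  have 2: "wps probe_ins (\<lambda>h'. frame stmps s {} h h' \<and> searched n s ?P h') h2"
    if h2: "frame stmps s {} h h2" "rg h2 ''z'' \<noteq> 0 \<longrightarrow> ?P (rg h2 ''y'')"
       "rg h2 ''z'' = 0 \<longrightarrow> (\<forall>y\<in>own n x c. \<not> ?P y)" for h2
  proof -
    note R = regs[OF h2(1)]
    define l where "l = low B (deg n x c)"
    define K where "K = 2 * l + 1"
    have l': "deg n x c - 1 - (deg n x c - 1) div (B + 1) = l" by (simp add: l_def low_def)
    have K: "K = 2 * (l - 1) + 2 + of_bool True" if "l \<noteq> 0" using that by (simp add: K_def)
    have lD: "l \<le> deg n x c" unfolding l_def by (rule low_bounds[OF B(2)])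
    have KZ: "K \<le> Z" "l \<le> Z" "deg n x c - 1 \<le> Z" using lD D(1)[OF c(2)] D(2) by (simp_all add: K_def)
    have fnd: "?P (mm h s (4, c, 0, K))" "mm h s (4, c, 0, K) < n" if "0 < mm h s (3, c, 0, K)" "l \<noteq> 0"
    proof -
      note M = listsD2[OF L c(2) _ that(1)]
      show "mm h s (4, c, 0, K) < n" using M(1) by (simp add: K_def)
      have "kap n x c (mm h s (4, c, 0, K)) = 2 * (l - 1) + 2 + of_bool True"
        using M(2) K[OF that(2)] by (simp add: K_def)
      then have k: "0 < x c (mm h s (4, c, 0, K))" "deg n x (mm h s (4, c, 0, K)) = l - 1"
        unfolding kap_bucket by simp_all
      have "\<not> l \<le> l - 1" using that(2) by arith
      then have "\<not> deg n x c \<le> cap B (l - 1)" using low_le_iff[OF B(2), of "deg n x c" "l - 1"]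
        unfolding l_def[symmetric] by blast
      then show "?P (mm h s (4, c, 0, K))" using k by (simp add: bad_def)
    qed
    have none: "\<forall>y<n. \<not> ?P y" if "rg h2 ''z'' = 0" "l = 0 \<or> mm h s (3, c, 0, K) = 0"
    proof (intro allI impI notI)
      fix y assume y: "y < n" "?P y"
      then have xy: "0 < x c y" and lt: "cap B (deg n x y) < deg n x c" by (simp_all add: bad_def)
      have "y \<noteq> c" using xy w by (auto simp: inside_def)
      \<comment> \<open>Apart from \<open>c\<close> the degrees agree with \<open>e\<close>, and the
        degree of \<open>c\<close> is larger by 1. So a violation exceeds the permitted value by
        exactly 1, which determines the degree of \<open>y\<close>.\<close>
      then have "e c \<le> cap B (deg n x y)" using i xy unfolding ins_chain_def by fastforce
      then have l1: "deg n x y + 1 = l" using cap_eq_low[OF B(2) lt] dc by (simp add: l_def)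
      have "y \<notin> own n x c" using h2(3) that(1) y(2) by blast
      then have "x c y < x y c" using xy y(1) by (simp add: own_def)
      then have "kap n x c y = 2 * (l - 1) + 2 + of_bool True" unfolding kap_bucket using xy l1 by simp
      then have "kap n x c y = K" using K l1 by simp
      then have "0 < mm h s (3, c, 0, K)" using listsD1(1)[OF L c(2) y(1)] by (simp add: K_def)
      then show False using that(2) l1 by simp
    qed
    have "searched n s ?P (setr (setr (setr (setr h2 ''e'' l) ''k'' K) ''y'' (mm h s (4, c, 0, K))) ''z'' 1)"
      if "0 < mm h s (3, c, 0, K)" "l \<noteq> 0" using fnd[OF that] by (simp add: searched_def rg_setr)
    moreover have "searched n s ?P h'" if "rg h' ''z'' = rg h2 ''z''" "rg h' ''y'' = rg h2 ''y''"
      "l = 0 \<or> mm h s (3, c, 0, K) = 0" for h'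
      using h2(2) none that by (auto simp: searched_def)
    moreover have e1: "(deg n x c - 1) div (B + 1) \<le> deg n x c - 1" by (rule div_le_dividend)
    moreover have "Suc 0 \<le> deg n x c" using dc by simp
    moreover have "mm h s (4, c, 0, K) \<le> Z" if "0 < mm h s (3, c, 0, K)" "l \<noteq> 0"
      using fnd(2)[OF that] n_le by simp
    ultimately show ?thesis
      using R d[OF c(2)] sl(2) c(2) n_pos KZ l' Z_ge h2(1) fset st
      by (cases "l = 0"; cases "mm h s (3, c, 0, K) = 0")
        (simp_all add: probe_ins_def probe_code_def rg_setr K_def searched_def)
  qed
  have 3: "wp (Seq (Seq (scomp scan_init) (While (hcomp scan_guard) (scomp scan_ins))) (scomp probe_ins))
    (stime scan_init + (Ob * (stime scan_ins + 1 + exp_cost (hcomp scan_guard)) + 1 + exp_cost (hcomp scan_guard)) + stime probe_ins)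
    (\<lambda>h'. frame stmps s {} h h' \<and> searched n s ?P h') h"
    by (rule wp_seq[OF 1], rule wp_scom) (use 2 in simp_all)
  show ?thesis unfolding search_com_def
    by (rule wp_mono[OF wp_assoc[OF 3]]) (simp_all add: search_time_def algebra_simps)
qed

text \<open>As for insertions, but the violating arcs enter \<open>c\<close>. The scan therefore has
  to test that the arc exists, whereas in the probed classes the other endpoint has the larger share
  and the arc into \<open>c\<close> is certain.\<close>

lemma search_del_wp:
  assumes sl: "rg h ''sl'' = s" "s < 4" and c: "rg h ''c'' = c" "c < n"
    and X: "rep n (mm h s) x" and own: "card (own n x c) \<le> Ob"
    and B: "rg h ''B'' = B" "0 < B" and i: "del_chain n B e x c"
    and D: "\<And>u. u < n \<Longrightarrow> deg n x u \<le> Dm" "4 * Dm + 16 \<le> Z"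
  shows "wp (search_com scan_del probe_del) (search_time Ob)
    (\<lambda>h'. frame stmps s {} h h' \<and> searched n s (\<lambda>y. bad n B x y c) h') h"
proof -
  let ?P = "\<lambda>y. bad n B x y c"
  have d: "mm h s (5, u, 0, 0) = deg n x u" if "u < n" for u using X that by (simp add: rep_def xrep_def)
  have dx: "mm h s (0, u, v, 0) = x u v" if "u < n" "v < n" for u v using X that by (simp add: rep_def xrep_def)
  have L: "lists n (mm h s) (kap n x)" using X by (simp add: rep_def classes_def)
  have w: "inside n x" using i by (simp add: del_chain_def)
  have dc: "e c = deg n x c + 1" using i by (simp add: del_chain_def)
  have regs: "rg h2 ''sl'' = s" "rg h2 ''c'' = c" "rg h2 ''B'' = B" "mm h2 s (f, u, v, j) = mm h s (f, u, v, j)"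
    if "frame stmps s {} h h2" for h2 f u v j
    using frame_reg[OF that] frame_fld[OF that] sl c B by (simp_all add: stmps_def tmps_def)
  have fset: "frame stmps s {} h (setr h2 y v)" if "frame stmps s {} h h2" "y \<in> stmps" for h2 y v
    using that by (simp add: frame_def rg_setr)
  have st: "''r'' \<in> stmps" "''g'' \<in> stmps" "''y'' \<in> stmps" "''z'' \<in> stmps" "''e'' \<in> stmps" "''k'' \<in> stmps"
    by (simp_all add: stmps_def tmps_def)
  have 1: "wp (Seq (scomp scan_init) (While (hcomp scan_guard) (scomp scan_del)))
    (stime scan_init + (Ob * (stime scan_del + 1 + exp_cost (hcomp scan_guard)) + 1 + exp_cost (hcomp scan_guard)))
    (\<lambda>h'. frame stmps s {} h h' \<and> (rg h' ''z'' \<noteq> 0 \<longrightarrow> ?P (rg h' ''y'')) \<and>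
       (rg h' ''z'' = 0 \<longrightarrow> (\<forall>y\<in>own n x c. \<not> ?P y))) h"
  proof (rule scan_wp[OF sl c X own])
    fix g h1 assume g: "g < n" and f: "frame stmps s {} h h1" and rg: "rg h1 ''g'' = g"
      and r: "mm h s (4, c, g, 1) \<in> own n x c"
    note R = regs[OF f]
    define r where "r = mm h s (4, c, g, 1)"
    have rn: "r < n" using r unfolding own_def r_def[symmetric] by simp
    have P: "?P r \<longleftrightarrow> 0 < x r c \<and> cap B (deg n x c) < deg n x r" by (simp add: bad_def)
    show "wps scan_del (\<lambda>h'. frame stmps s {} h h' \<and> rg h' ''g'' = g + 1 \<and>
         (if ?P (mm h s (4, c, g, 1)) then rg h' ''y'' = mm h s (4, c, g, 1) \<and> rg h' ''z'' = 1
          else rg h' ''y'' = rg h1 ''y'' \<and> rg h' ''z'' = rg h1 ''z'')) h1"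
      unfolding r_def[symmetric] P
      using R rg g rn d[OF rn] d[OF c(2)] dx[OF rn c(2)] sl(2) c(2) n_pos n_le Z_ge r_def f st
      by (cases "cap B (deg n x c) < deg n x r"; cases "x r c = 0")
        (simp_all add: scan_del_def found_code_def rg_setr fset)
  qed simp
  define T where "T = cap B (deg n x c)"
  define q where "q = deg n x c div B"
  have "q \<le> deg n x c" unfolding q_def by (rule div_le_dividend)
  then have TZ: "2 * T + 8 \<le> Z" using D(1)[OF c(2)] D(2) unfolding T_def cap_def q_def[symmetric] by simp
  define Pr where "Pr j h2 \<longleftrightarrow> frame stmps s {} h h2 \<and> rg h2 ''k'' = 2 * T + 4 + j \<and>
     (rg h2 ''z'' \<noteq> 0 \<longrightarrow> ?P (rg h2 ''y'')) \<and>
     (rg h2 ''z'' = 0 \<longrightarrow> (\<forall>y\<in>own n x c. \<not> ?P y) \<and> (\<forall>i<j. mm h s (3, c, 0, 2 * T + 4 + i) = 0))"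
    for j :: nat and h2
  have fnd: "?P (mm h s (4, c, 0, 2 * T + 4 + j))" "mm h s (4, c, 0, 2 * T + 4 + j) < n"
    if "0 < mm h s (3, c, 0, 2 * T + 4 + j)" for j
  proof -
    note M = listsD2[OF L c(2) _ that]
    show "mm h s (4, c, 0, 2 * T + 4 + j) < n" using M(1) by simp
    define y where "y = mm h s (4, c, 0, 2 * T + 4 + j)"
    have "2 * T + 4 + j = 2 * (T + 1 + j div 2) + 2 + of_bool (odd j)"
      using div_mult_mod_eq[of j 2] by (cases "odd j") (simp_all add: odd_iff_mod_2_eq_one even_iff_mod_2_eq_zero)
    then have "kap n x c y = 2 * (T + 1 + j div 2) + 2 + of_bool (odd j)"
      using M(2) by (simp add: y_def)
    then have k: "x c y < x y c" "deg n x y = T + 1 + j div 2"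
      unfolding kap_bucket by simp_all
    have "?P y" unfolding bad_def T_def[symmetric] using k by simp
    then show "?P (mm h s (4, c, 0, 2 * T + 4 + j))" unfolding y_def .
  qed
  have next_step: "wps probe_next (Pr (Suc j)) h2" if h2: "Pr j h2" and j: "j < 4" for j h2
  proof -
    from h2 have f: "frame stmps s {} h h2" and k: "rg h2 ''k'' = 2 * T + 4 + j"
      unfolding Pr_def by - (elim conjE, assumption)+
    note R = regs[OF f]
    show ?thesis
    proof (cases "mm h s (3, c, 0, 2 * T + 4 + j) = 0")
      case True
      have "Pr (Suc j) (setr h2 ''k'' (Suc (2 * T + 4 + j)))"
        using h2 True fset[OF f st(6)] unfolding Pr_def by (simp add: rg_setr less_Suc_eq)
      then show ?thesis
        using True R k sl(2) c(2) n_pos j TZ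
        by (simp add: probe_next_def probe_code_def rg_setr)
    next
      case False
      then have p: "0 < mm h s (3, c, 0, 2 * T + 4 + j)" by simp
      note fn = fnd[OF p]
      have "Pr (Suc j) (setr (setr (setr h2 ''y'' (mm h s (4, c, 0, 2 * T + 4 + j))) ''z'' 1) ''k'' (Suc (2 * T + 4 + j)))"
        using fset[OF fset[OF fset[OF f st(3)] st(4)] st(6)] fn(1) unfolding Pr_def by (simp add: rg_setr)
      then show ?thesis
        using False R k sl(2) c(2) n_pos n_le fn(2) j TZ Z_ge
        by (simp add: probe_next_def probe_code_def rg_setr)
    qed
  qed
  have 2: "wps probe_del (\<lambda>h'. frame stmps s {} h h' \<and> searched n s ?P h') h2"
    if h2: "frame stmps s {} h h2" "rg h2 ''z'' \<noteq> 0 \<longrightarrow> ?P (rg h2 ''y'')"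
       "rg h2 ''z'' = 0 \<longrightarrow> (\<forall>y\<in>own n x c. \<not> ?P y)" for h2
  proof -
    note R = regs[OF h2(1)]
    have P0: "Pr 0 (setr h2 ''k'' (2 * T + 4))"
      using h2 fset[OF h2(1) st(6)] unfolding Pr_def by (simp add: rg_setr)
    have fin: "frame stmps s {} h h' \<and> searched n s ?P h'" if h': "Pr 4 h'" for h'
    proof -
      have none: "\<forall>y<n. \<not> ?P y" if own: "\<forall>y\<in>own n x c. \<not> ?P y"
        and sz: "\<forall>i<4. mm h s (3, c, 0, 2 * T + 4 + i) = 0"
      proof (intro allI impI notI)
        fix y assume y: "y < n" "?P y"
        then have xy: "0 < x y c" and lt: "T < deg n x y" by (simp_all add: bad_def T_def)
        have "y \<noteq> c" using xy w by (auto simp: inside_def)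
        \<comment> \<open>Stability with respect to \<open>e\<close>, where \<open>e c\<close>
          includes the missing unit, bounds the degree of \<open>y\<close> by
          \<open>cap B (deg n x c + 1)\<close>, which is at most \<open>T + 2\<close>.\<close>
        then have "deg n x y \<le> e y" using i unfolding del_chain_def by simp
        also have "e y \<le> cap B (e c)" using i xy unfolding del_chain_def by blast
        finally have up: "deg n x y \<le> T + 2" using cap_Suc_le[OF B(2), of "deg n x c"] dc by (simp add: T_def)
        have "y \<notin> own n x c" using own y(2) by blast
        then have "x c y < x y c" using xy y(1) unfolding own_def by simp
        then have kp: "kap n x c y = 2 * deg n x y + 2 + of_bool (0 < x c y)" by (simp add: kap_def)
        define j where "j = 2 * (deg n x y - T - 1) + of_bool (0 < x c y)"
        obtain i where i: "deg n x y = T + 1 + i" using lt less_iff_Suc_add by auto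
        have "i < 2" using up i by simp
        then have "j < 4" unfolding j_def i by (cases "0 < x c y") simp_all
        moreover have "kap n x c y = 2 * T + 4 + j" using kp unfolding j_def i by simp
        moreover have "0 < mm h s (3, c, 0, kap n x c y)"
          using listsD1(1)[OF L c(2) y(1)] kp by fastforce
        ultimately show False using sz by simp
      qed
      from h' have "frame stmps s {} h h'" "rg h' ''z'' \<noteq> 0 \<longrightarrow> ?P (rg h' ''y'')"
        "rg h' ''z'' = 0 \<longrightarrow> (\<forall>y\<in>own n x c. \<not> ?P y) \<and> (\<forall>i<4. mm h s (3, c, 0, 2 * T + 4 + i) = 0)"
        unfolding Pr_def by - (elim conjE, assumption)+
      then show ?thesis unfolding searched_def using none by blast
    qed
    have "wps (SQ probe_next (SQ probe_next (SQ probe_next probe_next)))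
       (\<lambda>h'. frame stmps s {} h h' \<and> searched n s ?P h') (setr h2 ''k'' (2 * T + 4))"
      unfolding wps.simps(4)
      apply (rule wps_mono[OF next_step[OF P0]], simp)
      apply (rule wps_mono[OF next_step], assumption, simp)
      apply (rule wps_mono[OF next_step], assumption, simp)
      apply (rule wps_mono[OF next_step], assumption, simp)
      apply (rule fin, simp add: numeral_eq_Suc)
      done
    then show ?thesis using R d[OF c(2)] sl(2) c(2) n_pos TZ
      by (simp add: probe_del_def T_def)
  qed
  have 3: "wp (Seq (Seq (scomp scan_init) (While (hcomp scan_guard) (scomp scan_del))) (scomp probe_del))
    (stime scan_init + (Ob * (stime scan_del + 1 + exp_cost (hcomp scan_guard)) + 1 + exp_cost (hcomp scan_guard)) + stime probe_del)
    (\<lambda>h'. frame stmps s {} h h' \<and> searched n s ?P h') h"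
    by (rule wp_seq[OF 1], rule wp_scom) (use 2 in simp_all)
  show ?thesis unfolding search_com_def
    by (rule wp_mono[OF wp_assoc[OF 3]]) (simp_all add: search_time_def algebra_simps)
qed

end

section \<open>Chains of reversals\<close>

definition ctmps :: "string set" where
  "ctmps = {''a'', ''b'', ''c''} \<union> stmps"

text \<open>Reverse one unit of the arc from register \<open>p\<close> to register \<open>q\<close> and continue at \<open>y\<close>.\<close>

definition xfer1 :: "string \<Rightarrow> string \<Rightarrow> scom" where
  "xfer1 p q = SQ (SA ''a'' (HV p)) (SA ''b'' (HV q))"

definition xfer_com :: "string \<Rightarrow> string \<Rightarrow> com" where
  "xfer_com p q = Seq (scomp (xfer1 p q)) (Seq rem_com (Seq (scomp (xfer1 q p))
     (Seq add_com (scomp (SA ''c'' (HV ''y''))))))"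

definition xfer_time :: "nat \<Rightarrow> nat" where
  "xfer_time k = stime (xfer1 ''c'' ''y'') + (arc_time k + (stime (xfer1 ''c'' ''y'') + (arc_time k +
     stime (SA ''c'' (HV ''y'')))))"

definition chain_com :: "string \<Rightarrow> string \<Rightarrow> com \<Rightarrow> com" where
  "chain_com p q search = Seq search (While (hcomp (HV ''z'')) (Seq (xfer_com p q) search))"

definition chain_time :: "nat \<Rightarrow> nat \<Rightarrow> nat" where
  "chain_time k N = search_time k + (N * (xfer_time k + search_time k + 1 + exp_cost (hcomp (HV ''z''))) + 1 +
     exp_cost (hcomp (HV ''z'')))"

lemma xfer1_sstat [simp]: "sstat (xfer1 p q)"
  by (simp add: xfer1_def hstat_def)

lemma stime_xfer1: "stime (xfer1 p q) = stime (xfer1 p' q')"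
  by (simp add: xfer1_def)

lemma own_remarc_subset: "own n (remarc x a b) a \<subseteq> own n x a" if "inside n x"
proof
  fix w assume w: "w \<in> own n (remarc x a b) a"
  have "x a a = 0" using that unfolding inside_def by blast
  show "w \<in> own n x a"
  proof (cases "w = a")
    case True
    then show ?thesis using w \<open>x a a = 0\<close> by (simp add: own_def remarc_def split: if_splits)
  next
    case False
    then have "remarc x a b w a = x w a" "remarc x a b a w \<le> x a w" by (simp_all add: remarc_def)
    then show ?thesis using w unfolding own_def mem_Collect_eq by linarith
  qed
qed

context ram
begin

lemma frame_ctmps: "frame tmps s F h h' \<Longrightarrow> frame ctmps s F h h'"
  by (erule frame_mono) (auto simp: ctmps_def stmps_def)

lemma xfer_wp:
  assumes sl: "rg h ''sl'' = s" "s < 4" and y: "rg h ''y'' = y" and p: "rg h p = P" and q: "rg h q = Q"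
    and pq: "{p, q} = {''c'', ''y''}" and PQ: "P < n" "Q < n"
    and X: "rep n (mm h s) x" and w: "inside n x" and pos: "0 < x P Q"
    and D: "\<And>u. u < n \<Longrightarrow> deg n x u \<le> Dm" "4 * Dm + 16 \<le> Z"
    and own: "card (own n x P) \<le> Ob" "card (own n (addarc (remarc x P Q) Q P) Q) \<le> Ob"
  shows "wp (xfer_com p q) (xfer_time Ob)
    (\<lambda>h'. rep n (mm h' s) (addarc (remarc x P Q) Q P) \<and> rg h' ''c'' = y \<and> frame ctmps s F8 h h') h"
proof -
  have cy: "p = ''c'' \<and> q = ''y'' \<or> p = ''y'' \<and> q = ''c''" using pq unfolding doubleton_eq_iff .
  have nab: "p \<noteq> ''a''" "q \<noteq> ''a''" "p \<noteq> ''b''" "q \<noteq> ''b''" "p \<notin> tmps - {}"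
    using cy by (elim disjE conjE; simp add: tmps_def)+
  have ZZ: "P \<le> Z" "Q \<le> Z" using PQ n_le by simp_all
  have yZ: "y \<le> Z" using cy p q y ZZ by (elim disjE conjE) simp_all
  have ne: "P \<noteq> Q" using w pos unfolding inside_def by blast
  let ?x1 = "remarc x P Q" and ?x2 = "addarc (remarc x P Q) Q P"
  have w1: "inside n ?x1" by (rule inside_remarc[OF w])
  have keep: "rg h2 ''sl'' = s \<and> rg h2 ''y'' = y \<and> rg h2 p = P \<and> rg h2 q = Q"
    if "\<forall>x. x \<notin> tmps \<and> x \<noteq> ''a'' \<and> x \<noteq> ''b'' \<longrightarrow> rg h2 x = rg h x" for h2
    using that sl y p q cy by (elim disjE conjE) (simp_all add: tmps_def)
  have 1: "wp (scomp (xfer1 p q)) (stime (xfer1 p q)) (\<lambda>h'. h' = setr (setr h ''a'' P) ''b'' Q) h"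
    by (rule wp_scom) (use p q ZZ nab in \<open>simp_all add: xfer1_def rg_setr hstat_def\<close>)
  define h1 where "h1 = setr (setr h ''a'' P) ''b'' Q"
  have k1: "rg h1 ''sl'' = s" "rg h1 ''a'' = P" "rg h1 ''b'' = Q" "mm h1 = mm h"
    using sl by (simp_all add: h1_def rg_setr)
  have X1: "rep n (mm h1 s) x" using X k1 by simp
  \<comment> \<open>Halfway through the reversal the pair has one unit less, so \<open>heavy\<close>
    may fail. The owned edges of \<open>P\<close> are therefore compared with those before the
    removal.\<close>
  have own1: "card (own n ?x1 P) \<le> Ob"
    using card_mono[OF finite_own own_remarc_subset[OF w]] own(1) by (rule le_trans)
  have 2: "wp rem_com (arc_time Ob) (\<lambda>h'. rep n (mm h' s) ?x1 \<and> frame tmps s F8 h1 h') h1"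
    by (rule rem_wp[OF k1(1) sl(2) k1(2) PQ(1) k1(3) PQ(2) X1 w pos D(1) _ own1]) (use D(2) in simp_all)
  have 3: "wp (Seq (scomp (xfer1 q p)) (Seq add_com (scomp (SA ''c'' (HV ''y'')))))
     (stime (xfer1 q p) + (arc_time Ob + stime (SA ''c'' (HV ''y''))))
     (\<lambda>h'. rep n (mm h' s) ?x2 \<and> rg h' ''c'' = y \<and> frame ctmps s F8 h h') h2"
    if h2: "rep n (mm h2 s) ?x1 \<and> frame tmps s F8 h1 h2" for h2
  proof -
    have f2: "frame tmps s F8 h1 h2" using h2 ..
    have "\<forall>x. x \<notin> tmps \<and> x \<noteq> ''a'' \<and> x \<noteq> ''b'' \<longrightarrow> rg h2 x = rg h x"
      using frame_reg[OF f2] by (simp add: h1_def rg_setr)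
    note k2 = keep[OF this]
    have fc2: "frame ctmps s F8 h h2"
    proof (rule frame_trans[of ctmps s F8 h h1])
      show "frame ctmps s F8 h h1" by (simp add: h1_def frame_def rg_setr ctmps_def)
      show "frame ctmps s F8 h1 h2" by (rule frame_ctmps[OF f2])
    qed simp_all
    define h3 where "h3 = setr (setr h2 ''a'' Q) ''b'' P"
    have 31: "wp (scomp (xfer1 q p)) (stime (xfer1 q p)) (\<lambda>h'. h' = h3) h2"
      by (rule wp_scom) (use k2 ZZ nab in \<open>simp_all add: xfer1_def rg_setr h3_def hstat_def\<close>)
    have k3: "rg h3 ''sl'' = s" "rg h3 ''a'' = Q" "rg h3 ''b'' = P" "rg h3 ''y'' = y" "mm h3 = mm h2"
      using k2 by (simp_all add: h3_def rg_setr)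
    have X3: "rep n (mm h3 s) ?x1" using h2 k3 by simp
    have D1: "deg n ?x1 u \<le> Dm" if "u < n" for u
      using D(1)[OF that] deg_remarc(1)[of Q n x P u, OF PQ(2) pos] by simp
    have 32: "wp add_com (arc_time Ob) (\<lambda>h'. rep n (mm h' s) ?x2 \<and> frame tmps s F8 h3 h') h3"
      by (rule add_wp[OF k3(1) sl(2) k3(2) PQ(2) k3(3) PQ(1) ne[symmetric] X3 w1 D1 _ own(2)]) (use D(2) in simp_all)
    have 33: "wp (scomp (SA ''c'' (HV ''y''))) (stime (SA ''c'' (HV ''y'')))
      (\<lambda>h'. rep n (mm h' s) ?x2 \<and> rg h' ''c'' = y \<and> frame ctmps s F8 h h') h4"
      if h4: "rep n (mm h4 s) ?x2 \<and> frame tmps s F8 h3 h4" for h4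
    proof (rule wp_scom)
      have f4: "frame tmps s F8 h3 h4" using h4 ..
      have y4: "rg h4 ''y'' = y" using frame_reg[OF f4, of "''y''"] k3 by (simp add: tmps_def)
      have fc3: "frame ctmps s F8 h2 h3" by (simp add: h3_def frame_def rg_setr ctmps_def)
      have fc23: "frame ctmps s F8 h h3" by (rule frame_trans[OF fc2 fc3]) simp_all
      have "frame ctmps s F8 h h4"
        by (rule frame_trans[OF fc23 frame_ctmps[OF f4]]) simp_all
      then have "frame ctmps s F8 h (setr h4 ''c'' y)" by (simp add: frame_def rg_setr ctmps_def)
      then show "wps (SA ''c'' (HV ''y'')) (\<lambda>h'. rep n (mm h' s) ?x2 \<and> rg h' ''c'' = y \<and> frame ctmps s F8 h h') h4"
        using h4 y4 yZ by (simp add: rg_setr)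
    qed (simp add: hstat_def)
    have 34: "wp (Seq add_com (scomp (SA ''c'' (HV ''y'')))) (arc_time Ob + stime (SA ''c'' (HV ''y'')))
      (\<lambda>h'. rep n (mm h' s) ?x2 \<and> rg h' ''c'' = y \<and> frame ctmps s F8 h h') h3"
      by (rule wp_seq[OF 32], rule 33)
    show ?thesis by (rule wp_seq[OF 31]) (simp only: 34)
  qed
  have 4: "wp (Seq rem_com (Seq (scomp (xfer1 q p)) (Seq add_com (scomp (SA ''c'' (HV ''y''))))))
     (arc_time Ob + (stime (xfer1 q p) + (arc_time Ob + stime (SA ''c'' (HV ''y'')))))
     (\<lambda>h'. rep n (mm h' s) ?x2 \<and> rg h' ''c'' = y \<and> frame ctmps s F8 h h') h1"
    by (rule wp_seq[OF 2], rule 3)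
  have "wp (xfer_com p q) (stime (xfer1 p q) + (arc_time Ob + (stime (xfer1 q p) + (arc_time Ob + stime (SA ''c'' (HV ''y''))))))
     (\<lambda>h'. rep n (mm h' s) ?x2 \<and> rg h' ''c'' = y \<and> frame ctmps s F8 h h') h"
    unfolding xfer_com_def by (rule wp_seq[OF 1]) (simp only: 4[unfolded h1_def])
  then show ?thesis unfolding xfer_time_def stime_xfer1[of p q "''c''" "''y''"] stime_xfer1[of q p "''c''" "''y''"] .
qed

text \<open>Insertion and deletion differ in the invariant \<open>J\<close>, the violation
  \<open>P\<close> and the measure \<open>mu\<close>. As \<open>mu\<close> is nonnegative and drops
  by at least 1 with each reversal, its initial value bounds the number of iterations.\<close>

lemma chain_wp:
  fixes mu :: "nat \<Rightarrow> real"
  assumes search: "\<And>h x c. rg h ''sl'' = s \<Longrightarrow> rg h ''B'' = B \<Longrightarrow> rg h ''c'' = c \<Longrightarrow> rep n (mm h s) x \<Longrightarrow> J x c \<Longrightarrow>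
      wp search (search_time Ob) (\<lambda>h'. frame stmps s {} h h' \<and> searched n s (P x c) h') h"
    and step: "\<And>h x c y. rg h ''sl'' = s \<Longrightarrow> rg h ''B'' = B \<Longrightarrow> rg h ''c'' = c \<Longrightarrow> rg h ''y'' = y \<Longrightarrow>
      rep n (mm h s) x \<Longrightarrow> J x c \<Longrightarrow> P x c y \<Longrightarrow>
      wp (xfer_com p q) (xfer_time Ob) (\<lambda>h'. (\<exists>x'. rep n (mm h' s) x' \<and> J x' y) \<and> rg h' ''c'' = y \<and> frame ctmps s F8 h h') h"
    and mu: "\<And>x c y. J x c \<Longrightarrow> P x c y \<Longrightarrow> mu y + 1 \<le> mu c" "\<And>c. 0 \<le> mu c"
    and h: "rg h ''sl'' = s" "rg h ''B'' = B" "rg h ''c'' = c" "rep n (mm h s) x" "J x c" "mu c \<le> real N"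
  shows "wp (chain_com p q search) (chain_time Ob N)
    (\<lambda>h'. \<exists>x' c'. rep n (mm h' s) x' \<and> J x' c' \<and> (\<forall>y<n. \<not> P x' c' y) \<and> frame ctmps s F8 h h') h"
proof -
  define I where "I k h2 \<longleftrightarrow> (\<exists>x c. frame ctmps s F8 h h2 \<and> rg h2 ''c'' = c \<and> rep n (mm h2 s) x \<and> J x c \<and>
     searched n s (P x c) h2 \<and> mu c \<le> real k)" for k h2
  have sf: "frame ctmps s F8 h1 h2" if "frame stmps s {} h1 h2" for h1 h2
    using that by (rule frame_mono) (auto simp: ctmps_def)
  have keep: "rg h2 ''sl'' = s" "rg h2 ''B'' = B" if "frame ctmps s F8 h h2" for h2
    using frame_reg[OF that] h(1,2) by (simp_all add: ctmps_def stmps_def tmps_def)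
  have repS: "rep n (mm h2 s) x'" if "rep n (mm h1 s) x'" "frame stmps s {} h1 h2" for h1 h2 x'
  proof -
    have "mm h2 s = mm h1 s" using frame_fld[OF that(2)] by (auto simp: fun_eq_iff)
    then show ?thesis using that(1) by simp
  qed
  have srch: "wp search (search_time Ob) (I k) h2"
    if "frame ctmps s F8 h h2" "rg h2 ''c'' = c'" "rep n (mm h2 s) x'" "J x' c'" "mu c' \<le> real k" for h2 c' x' k
  proof (rule wp_mono[OF search[OF keep[OF that(1)] that(2-4)]])
    fix h3 assume h3: "frame stmps s {} h2 h3 \<and> searched n s (P x' c') h3"
    have f: "frame ctmps s F8 h h3"
      by (rule frame_trans[OF that(1) sf[OF conjunct1[OF h3]]]) simp_all
    have "rg h3 ''c'' = c'"
      using frame_reg[OF conjunct1[OF h3], of "''c''"] that(2) by (simp add: stmps_def tmps_def)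
    then show "I k h3" unfolding I_def using f h3 repS[OF that(3)] that(4,5) by blast
  qed simp
  have 1: "wp search (search_time Ob) (I N) h"
    by (rule srch[OF frame_refl h(3-6)])
  have 2: "wp (While (hcomp (HV ''z'')) (Seq (xfer_com p q) search))
     (N * (xfer_time Ob + search_time Ob + 1 + exp_cost (hcomp (HV ''z''))) + 1 + exp_cost (hcomp (HV ''z'')))
     (\<lambda>h'. \<exists>x' c'. rep n (mm h' s) x' \<and> J x' c' \<and> (\<forall>y<n. \<not> P x' c' y) \<and> frame ctmps s F8 h h') h1"
    if "I N h1" for h1
  proof (rule wp_while[where I = I, OF _ that])
    show "hstat (HV ''z'')" by (simp add: hstat_def)
    show "\<And>k h. I k h \<Longrightarrow> hok n (HV ''z'') h" by simp
  next
    fix k h2 assume I: "I k h2" and gd: "hval (HV ''z'') h2 \<noteq> 0"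
    from I obtain x1 c1 where "frame ctmps s F8 h h2 \<and> rg h2 ''c'' = c1 \<and> rep n (mm h2 s) x1 \<and> J x1 c1 \<and>
       searched n s (P x1 c1) h2 \<and> mu c1 \<le> real k" unfolding I_def by (elim exE)
    then have a: "frame ctmps s F8 h h2" "rg h2 ''c'' = c1" "rep n (mm h2 s) x1" "J x1 c1"
       "searched n s (P x1 c1) h2" "mu c1 \<le> real k" by - (elim conjE, assumption)+
    define y where "y = rg h2 ''y''"
    have Py: "P x1 c1 y" using a(5) gd by (simp add: searched_def y_def)
    note m = mu(1)[OF a(4) Py] mu(2)[of y]
    have k: "k > 0" using m a(6) by (cases k) simp_all
    have my: "mu y \<le> real (k - 1)" using m a(6) k by (simp add: of_nat_diff)
    have "wp (Seq (xfer_com p q) search) (xfer_time Ob + search_time Ob) (I (k - 1)) h2"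
    proof (rule wp_seq[OF step[OF keep[OF a(1)] a(2) y_def[symmetric] a(3,4) Py]])
      fix h3 assume h3: "(\<exists>x'. rep n (mm h3 s) x' \<and> J x' y) \<and> rg h3 ''c'' = y \<and> frame ctmps s F8 h2 h3"
      then obtain x' where x': "rep n (mm h3 s) x'" "J x' y" by blast
      have f: "frame ctmps s F8 h h3"
        by (rule frame_trans[OF a(1), of ctmps F8]) (use h3 in simp_all)
      show "wp search (search_time Ob) (I (k - 1)) h3"
        by (rule srch[OF f _ x' my]) (use h3 in simp)
    qed
    then show "k > 0 \<and> wp (Seq (xfer_com p q) search) (xfer_time Ob + search_time Ob) (I (k - 1)) h2"
      using k by simp
  next
    fix k h2 assume I: "I k h2" and gd: "hval (HV ''z'') h2 = 0"
    from I obtain x1 c1 where "frame ctmps s F8 h h2 \<and> rg h2 ''c'' = c1 \<and> rep n (mm h2 s) x1 \<and> J x1 c1 \<and>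
       searched n s (P x1 c1) h2 \<and> mu c1 \<le> real k" unfolding I_def by (elim exE)
    then have a: "frame ctmps s F8 h h2" "rg h2 ''c'' = c1" "rep n (mm h2 s) x1" "J x1 c1"
       "searched n s (P x1 c1) h2" "mu c1 \<le> real k" by - (elim conjE, assumption)+
    show "\<exists>x' c'. rep n (mm h2 s) x' \<and> J x' c' \<and> (\<forall>y<n. \<not> P x' c' y) \<and> frame ctmps s F8 h h2"
      by (rule exI[of _ x1], rule exI[of _ c1]) (use a gd in \<open>simp add: searched_def\<close>)
  qed
  show ?thesis unfolding chain_com_def chain_time_def by (rule wp_seq[OF 1], rule 2)
qed

end

section \<open>Inserting and deleting an edge\<close>

text \<open>The units on a pair irrespective of direction. Reversals leave this number unchanged, so
  it is what ties an orientation to the edge multiset.\<close>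

definition wt :: "orient \<Rightarrow> nat \<Rightarrow> nat \<Rightarrow> nat" where
  "wt x u v = x u v + x v u"

lemma heavy_wt: "heavy B x u v \<longleftrightarrow> (\<forall>p q. {p, q} \<noteq> {u, v} \<longrightarrow> 0 < wt x p q \<longrightarrow> B \<le> wt x p q)"
  by (simp add: heavy_def wt_def)

lemma wt_addarc: "a \<noteq> b \<Longrightarrow> wt (addarc x a b) p q = wt x p q + of_bool ({p, q} = {a, b})"
  unfolding wt_def addarc_def doubleton_eq_iff by (cases "p = a"; cases "q = b"; cases "p = b"; cases "q = a") simp_all

lemma wt_remarc: "a \<noteq> b \<Longrightarrow> 0 < x a b \<Longrightarrow> wt (remarc x a b) p q = wt x p q - of_bool ({p, q} = {a, b})"
  unfolding wt_def remarc_def doubleton_eq_iff by (cases "p = a"; cases "q = b"; cases "p = b"; cases "q = a") simp_all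

lemma wt_xfer: "a \<noteq> b \<Longrightarrow> 0 < x a b \<Longrightarrow> wt (addarc (remarc x a b) b a) = wt x"
  unfolding wt_def addarc_def remarc_def fun_eq_iff
  by (intro allI) (auto simp: add.commute)

definition pick_ins :: scom where
  "pick_ins = SI (hless (fld 5 (HV ''h'') (HC 0) (HC 0)) (fld 5 (HV ''s'') (HC 0) (HC 0)))
     (SQ (SA ''a'' (HV ''h'')) (SA ''b'' (HV ''s''))) (SQ (SA ''a'' (HV ''s'')) (SA ''b'' (HV ''h'')))"

text \<open>Any unit of the edge may be taken: the repair starts at its tail in either case.\<close>

definition pick_del :: scom where
  "pick_del = SI (fld 0 (HV ''s'') (HV ''h'') (HC 0))
     (SQ (SA ''a'' (HV ''s'')) (SA ''b'' (HV ''h''))) (SQ (SA ''a'' (HV ''h'')) (SA ''b'' (HV ''s'')))"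

definition unit_ins :: com where
  "unit_ins = Seq (scomp pick_ins) (Seq add_com (Seq (scomp (SA ''c'' (HV ''a'')))
     (chain_com ''c'' ''y'' (search_com scan_ins probe_ins))))"

definition unit_del :: com where
  "unit_del = Seq (scomp pick_del) (Seq rem_com (Seq (scomp (SA ''c'' (HV ''a'')))
     (chain_com ''y'' ''c'' (search_com scan_del probe_del))))"

definition pick_time :: nat where
  "pick_time = stime pick_ins + stime pick_del + stime (SA ''c'' (HV ''a''))"

definition unit_time :: "nat \<Rightarrow> nat \<Rightarrow> nat" where
  "unit_time k N = pick_time + (arc_time k + (pick_time + chain_time k N))"

lemma pick_sstat [simp]: "sstat pick_ins" "sstat pick_del" "sstat (SA ''c'' (HV ''a''))"
  by (simp_all add: pick_ins_def pick_del_def hstat_def)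

context ram
begin

lemma chain_ins_wp:
  assumes h: "rg h ''sl'' = s" "s < 4" "rg h ''B'' = B" "0 < B" "rg h ''c'' = c" "rep n (mm h s) x"
    and J: "ins_chain n B e x c" and hv: "heavy B x u v" and e: "\<And>u. u < n \<Longrightarrow> e u + 1 \<le> Dm" and Z4: "4 * Dm + 16 \<le> Z"
    and Ob: "2 * Dm div B + 1 \<le> Ob" and N: "pot B Dm \<le> real N"
  shows "wp (chain_com ''c'' ''y'' (search_com scan_ins probe_ins)) (chain_time Ob N)
    (\<lambda>h'. \<exists>x'. rep n (mm h' s) x' \<and> inside n x' \<and> good n B x' \<and> wt x' = wt x \<and> frame ctmps s F8 h h') h"
proof -
  define JJ where "JJ x' c' \<longleftrightarrow> ins_chain n B e x' c' \<and> wt x' = wt x" for x' c'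
  have JD: "deg n x' u \<le> Dm" if "JJ x' c'" "u < n" for x' c' u
    using e[OF that(2)] that(1) unfolding JJ_def ins_chain_def by (cases "u = c'") simp_all
  have Jw: "inside n x'" "c' < n" if "JJ x' c'" for x' c'
    using that unfolding JJ_def ins_chain_def by simp_all
  have ow: "card (own n x' a) \<le> Ob" if "inside n x'" "wt x' = wt x" "\<And>u. u < n \<Longrightarrow> deg n x' u \<le> Dm" "a < n" for x' a
  proof -
    have "heavy B x' u v" using hv unfolding heavy_wt that(2) .
    from card_own[OF h(4) this, of n a] have "card (own n x' a) \<le> 2 * deg n x' a div B + 1" .
    also have "\<dots> \<le> 2 * Dm div B + 1" using that(3)[OF that(4)] by (simp add: div_le_mono)
    finally show ?thesis using Ob by simp
  qed
  have "wp (chain_com ''c'' ''y'' (search_com scan_ins probe_ins)) (chain_time Ob N)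
    (\<lambda>h'. \<exists>x' c'. rep n (mm h' s) x' \<and> JJ x' c' \<and> (\<forall>y<n. \<not> bad n B x' c' y) \<and> frame ctmps s F8 h h') h"
  proof (rule chain_wp[where mu = "\<lambda>c. pot B (if c < n then e c else 0)" and P = "\<lambda>x c y. bad n B x c y"])
    fix h1 x1 c1 assume a: "rg h1 ''sl'' = s" "rg h1 ''B'' = B" "rg h1 ''c'' = c1" "rep n (mm h1 s) x1" "JJ x1 c1"
    have i1: "ins_chain n B e x1 c1" "wt x1 = wt x" using a(5) unfolding JJ_def by simp_all
    show "wp (search_com scan_ins probe_ins) (search_time Ob)
       (\<lambda>h'. frame stmps s {} h1 h' \<and> searched n s (bad n B x1 c1) h') h1"
      by (rule search_ins_wp[OF a(1) h(2) a(3) Jw(2)[OF a(5)] a(4) _ a(2) h(4) i1(1) JD[OF a(5)] Z4])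
        (rule ow[OF Jw(1)[OF a(5)] i1(2) JD[OF a(5)] Jw(2)[OF a(5)]])
  next
    fix h1 x1 c1 y assume a: "rg h1 ''sl'' = s" "rg h1 ''B'' = B" "rg h1 ''c'' = c1" "rg h1 ''y'' = y"
      "rep n (mm h1 s) x1" "JJ x1 c1" "bad n B x1 c1 y"
    have i1: "ins_chain n B e x1 c1" "wt x1 = wt x" using a(6) unfolding JJ_def by simp_all
    have pos: "0 < x1 c1 y" using a(7) by (simp add: bad_def)
    have y: "y < n" "c1 \<noteq> y" using Jw(1)[OF a(6)] pos unfolding inside_def by blast+
    let ?x2 = "addarc (remarc x1 c1 y) y c1"
    have "ins_chain n B e ?x2 y" by (rule ins_chain_step[OF i1(1) a(7)])
    moreover have "wt ?x2 = wt x" using wt_xfer[of c1 y x1, OF y(2) pos] i1(2) by simp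
    ultimately have J2: "JJ ?x2 y" by (simp add: JJ_def)
    have o2: "card (own n ?x2 y) \<le> Ob"
      by (rule ow[OF Jw(1)[OF J2] _ JD[OF J2] y(1)]) (use J2 in \<open>simp add: JJ_def\<close>)
    have o1: "card (own n x1 c1) \<le> Ob"
      by (rule ow[OF Jw(1)[OF a(6)] i1(2) JD[OF a(6)] Jw(2)[OF a(6)]])
    have "wp (xfer_com ''c'' ''y'') (xfer_time Ob)
      (\<lambda>h'. rep n (mm h' s) ?x2 \<and> rg h' ''c'' = y \<and> frame ctmps s F8 h1 h') h1"
      by (rule xfer_wp[OF a(1) h(2) a(4) a(3) a(4) refl Jw(2)[OF a(6)] y(1) a(5) Jw(1)[OF a(6)] pos JD[OF a(6)] Z4 o1 o2])
    then show "wp (xfer_com ''c'' ''y'') (xfer_time Ob)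
      (\<lambda>h'. (\<exists>x'. rep n (mm h' s) x' \<and> JJ x' y) \<and> rg h' ''c'' = y \<and> frame ctmps s F8 h1 h') h1"
      by (rule wp_mono) (use J2 in blast)+
  next
    fix x1 c1 y assume a: "JJ x1 c1" "bad n B x1 c1 y"
    have i1: "ins_chain n B e x1 c1" using a(1) unfolding JJ_def by simp
    have "y < n" using a(2) Jw(1)[OF a(1)] unfolding inside_def bad_def by blast
    then show "pot B (if y < n then e y else 0) + 1 \<le> pot B (if c1 < n then e c1 else 0)"
      using pot_step[OF h(4) ins_chain_step(2)[OF i1 a(2)]] Jw(2)[OF a(1)] by simp
  next
    show "0 \<le> pot B (if c < n then e c else 0)" for c by (rule pot_nonneg[OF h(4)])
    have c: "c < n" using J by (simp add: ins_chain_def)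
    show "JJ x c" using J by (simp add: JJ_def)
    have "pot B (e c) \<le> pot B Dm" using e[OF c] by (intro pot_mono[OF h(4)]) simp
    then show "pot B (if c < n then e c else 0) \<le> real N" using c N by simp
  qed (use h in simp_all)
  then show ?thesis
  proof (rule wp_mono)
    fix h' assume "\<exists>x' c'. rep n (mm h' s) x' \<and> JJ x' c' \<and> (\<forall>y<n. \<not> bad n B x' c' y) \<and> frame ctmps s F8 h h'"
    then obtain x' c' where a: "rep n (mm h' s) x' \<and> JJ x' c' \<and> (\<forall>y<n. \<not> bad n B x' c' y) \<and> frame ctmps s F8 h h'"
      by (elim exE)
    then have i1: "ins_chain n B e x' c'" "wt x' = wt x" and J': "JJ x' c'" unfolding JJ_def by simp_all
    have "good n B x'"
    proof (rule ins_chain_end[OF i1(1)])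
      show "\<not> bad n B x' c' y" for y
        using a Jw(1)[OF J'] unfolding bad_def inside_def by blast
    qed
    then show "\<exists>x'. rep n (mm h' s) x' \<and> inside n x' \<and> good n B x' \<and> wt x' = wt x \<and> frame ctmps s F8 h h'"
      by (intro exI[of _ x']) (use a i1 Jw(1)[OF J'] in simp)
  qed simp
qed

lemma chain_del_wp:
  assumes h: "rg h ''sl'' = s" "s < 4" "rg h ''B'' = B" "0 < B" "rg h ''c'' = c" "rep n (mm h s) x"
    and J: "del_chain n B e x c" and hv: "heavy B x u v" and e: "\<And>u. u < n \<Longrightarrow> e u \<le> Dm" and Z4: "4 * Dm + 16 \<le> Z"
    and Ob: "2 * Dm div B + 1 \<le> Ob" and N: "pot B Dm \<le> real N"
  shows "wp (chain_com ''y'' ''c'' (search_com scan_del probe_del)) (chain_time Ob N)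
    (\<lambda>h'. \<exists>x'. rep n (mm h' s) x' \<and> inside n x' \<and> good n B x' \<and> wt x' = wt x \<and> frame ctmps s F8 h h') h"
proof -
  define JJ where "JJ x' c' \<longleftrightarrow> del_chain n B e x' c' \<and> wt x' = wt x" for x' c'
  have JD: "deg n x' u \<le> Dm" if "JJ x' c'" "u < n" for x' c' u
    using e[OF that(2)] that(1) unfolding JJ_def del_chain_def by simp
  have Jw: "inside n x'" "c' < n" if "JJ x' c'" for x' c'
    using that unfolding JJ_def del_chain_def by simp_all
  have ow: "card (own n x' a) \<le> Ob" if "inside n x'" "wt x' = wt x" "\<And>u. u < n \<Longrightarrow> deg n x' u \<le> Dm" "a < n" for x' a
  proof -
    have "heavy B x' u v" using hv unfolding heavy_wt that(2) .
    from card_own[OF h(4) this, of n a] have "card (own n x' a) \<le> 2 * deg n x' a div B + 1" .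
    also have "\<dots> \<le> 2 * Dm div B + 1" using that(3)[OF that(4)] by (simp add: div_le_mono)
    finally show ?thesis using Ob by simp
  qed
  \<comment> \<open>Along a deletion chain the degrees rise, so the measure is the distance to the
    potential of the largest degree \<open>Dm\<close>. The default 0 outside the vertex range keeps
    it nonnegative there.\<close>
  let ?mu = "\<lambda>c. pot B Dm - pot B (if c < n then e c - 1 else 0)"
  have "wp (chain_com ''y'' ''c'' (search_com scan_del probe_del)) (chain_time Ob N)
    (\<lambda>h'. \<exists>x' c'. rep n (mm h' s) x' \<and> JJ x' c' \<and> (\<forall>y<n. \<not> bad n B x' y c') \<and> frame ctmps s F8 h h') h"
  proof (rule chain_wp[where mu = ?mu and P = "\<lambda>x c y. bad n B x y c"])
    fix h1 x1 c1 assume a: "rg h1 ''sl'' = s" "rg h1 ''B'' = B" "rg h1 ''c'' = c1" "rep n (mm h1 s) x1" "JJ x1 c1"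
    have i1: "del_chain n B e x1 c1" "wt x1 = wt x" using a(5) unfolding JJ_def by simp_all
    show "wp (search_com scan_del probe_del) (search_time Ob)
       (\<lambda>h'. frame stmps s {} h1 h' \<and> searched n s (\<lambda>y. bad n B x1 y c1) h') h1"
      by (rule search_del_wp[OF a(1) h(2) a(3) Jw(2)[OF a(5)] a(4) _ a(2) h(4) i1(1) JD[OF a(5)] Z4])
        (rule ow[OF Jw(1)[OF a(5)] i1(2) JD[OF a(5)] Jw(2)[OF a(5)]])
  next
    fix h1 x1 c1 y assume a: "rg h1 ''sl'' = s" "rg h1 ''B'' = B" "rg h1 ''c'' = c1" "rg h1 ''y'' = y"
      "rep n (mm h1 s) x1" "JJ x1 c1" "bad n B x1 y c1"
    have i1: "del_chain n B e x1 c1" "wt x1 = wt x" using a(6) unfolding JJ_def by simp_all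
    have pos: "0 < x1 y c1" using a(7) by (simp add: bad_def)
    have y: "y < n" "y \<noteq> c1" using Jw(1)[OF a(6)] pos unfolding inside_def by blast+
    let ?x2 = "addarc (remarc x1 y c1) c1 y"
    have "del_chain n B e ?x2 y" by (rule del_chain_step[OF i1(1) a(7)])
    moreover have "wt ?x2 = wt x" using wt_xfer[of y c1 x1, OF y(2) pos] i1(2) by simp
    ultimately have J2: "JJ ?x2 y" by (simp add: JJ_def)
    have o2: "card (own n ?x2 c1) \<le> Ob"
      by (rule ow[OF Jw(1)[OF J2] _ JD[OF J2] Jw(2)[OF a(6)]]) (use J2 in \<open>simp add: JJ_def\<close>)
    have o1: "card (own n x1 y) \<le> Ob"
      by (rule ow[OF Jw(1)[OF a(6)] i1(2) JD[OF a(6)] y(1)])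
    have cy: "{''y'', ''c''} = {''c'', ''y''}" by (rule insert_commute)
    have "wp (xfer_com ''y'' ''c'') (xfer_time Ob)
      (\<lambda>h'. rep n (mm h' s) ?x2 \<and> rg h' ''c'' = y \<and> frame ctmps s F8 h1 h') h1"
      by (rule xfer_wp[OF a(1) h(2) a(4) a(4) a(3) cy y(1) Jw(2)[OF a(6)] a(5) Jw(1)[OF a(6)] pos JD[OF a(6)] Z4 o1 o2])
    then show "wp (xfer_com ''y'' ''c'') (xfer_time Ob)
      (\<lambda>h'. (\<exists>x'. rep n (mm h' s) x' \<and> JJ x' y) \<and> rg h' ''c'' = y \<and> frame ctmps s F8 h1 h') h1"
      by (rule wp_mono) (use J2 in blast)+
  next
    fix x1 c1 y assume a: "JJ x1 c1" "bad n B x1 y c1"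
    have i1: "del_chain n B e x1 c1" using a(1) unfolding JJ_def by simp
    have "y < n" using a(2) Jw(1)[OF a(1)] unfolding inside_def bad_def by blast
    then show "?mu y + 1 \<le> ?mu c1"
      using pot_step[OF h(4) del_chain_step(2)[OF i1 a(2)]] Jw(2)[OF a(1)] by simp
  next
    show "0 \<le> ?mu c" for c
      using pot_mono[OF h(4), of "if c < n then e c - 1 else 0" Dm] e[of c] by (cases "c < n") simp_all
    show "JJ x c" using J by (simp add: JJ_def)
    show "?mu c \<le> real N" using N pot_nonneg[OF h(4), of "if c < n then e c - 1 else 0"] by linarith
  qed (use h in simp_all)
  then show ?thesis
  proof (rule wp_mono)
    fix h' assume "\<exists>x' c'. rep n (mm h' s) x' \<and> JJ x' c' \<and> (\<forall>y<n. \<not> bad n B x' y c') \<and> frame ctmps s F8 h h'"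
    then obtain x' c' where a: "rep n (mm h' s) x' \<and> JJ x' c' \<and> (\<forall>y<n. \<not> bad n B x' y c') \<and> frame ctmps s F8 h h'"
      by (elim exE)
    then have i1: "del_chain n B e x' c'" "wt x' = wt x" and J': "JJ x' c'" unfolding JJ_def by simp_all
    have "good n B x'"
    proof (rule del_chain_end[OF i1(1)])
      show "\<not> bad n B x' y c'" for y
        using a Jw(1)[OF J'] unfolding bad_def inside_def by blast
    qed
    then show "\<exists>x'. rep n (mm h' s) x' \<and> inside n x' \<and> good n B x' \<and> wt x' = wt x \<and> frame ctmps s F8 h h'"
      by (intro exI[of _ x']) (use a i1 Jw(1)[OF J'] in simp)
  qed simp
qed

lemma heavy_own:
  assumes "0 < B" "heavy B x u v" "deg n x a \<le> Dm" "2 * Dm div B + 1 \<le> Ob"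
  shows "card (own n x a) \<le> Ob"
proof -
  have "card (own n x a) \<le> 2 * deg n x a div B + 1" by (rule card_own[OF assms(1,2)])
  also have "\<dots> \<le> 2 * Dm div B + 1" using assms(3) by (simp add: div_le_mono)
  finally show ?thesis using assms(4) by simp
qed

lemma ctmps_facts: "''a'' \<in> ctmps" "''b'' \<in> ctmps" "''c'' \<in> ctmps" "''sl'' \<notin> ctmps" "''B'' \<notin> ctmps"
  "''s'' \<notin> ctmps" "''h'' \<notin> ctmps" "''t'' \<notin> ctmps"
  by (simp_all add: ctmps_def stmps_def tmps_def)

text \<open>The degree bound leaves room for one more unit, because the degrees of the chain are
  those before the insertion plus the unit in transit.\<close>

lemma unit_ins_wp:
  assumes sl: "rg h ''sl'' = s" "s < 4" and B: "rg h ''B'' = B" "0 < B"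
    and u: "rg h ''s'' = u" "u < n" and v: "rg h ''h'' = v" "v < n" and uv: "u \<noteq> v"
    and X: "rep n (mm h s) x" and w: "inside n x" and g: "good n B x" and hv: "heavy B x u v"
    and D: "\<And>u. u < n \<Longrightarrow> deg n x u + 1 \<le> Dm" and Z4: "4 * Dm + 16 \<le> Z"
    and Ob: "2 * Dm div B + 1 \<le> Ob" and N: "pot B Dm \<le> real N"
  shows "wp unit_ins (unit_time Ob N)
    (\<lambda>h'. \<exists>x'. rep n (mm h' s) x' \<and> inside n x' \<and> good n B x' \<and>
       (\<forall>p q. wt x' p q = wt x p q + of_bool ({p, q} = {u, v})) \<and> frame ctmps s F8 h h') h"
proof -
  define a b where "a = (if deg n x v < deg n x u then v else u)" and "b = (if deg n x v < deg n x u then u else v)"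
  have ab: "{a, b} = {u, v}" "a < n" "b < n" "a \<noteq> b" "deg n x a \<le> deg n x b" "a \<le> Z" "b \<le> Z"
    using u v uv n_le unfolding a_def b_def by (simp_all add: insert_commute)
  have d: "mm h s (5, u, 0, 0) = deg n x u" "mm h s (5, v, 0, 0) = deg n x v"
    using X u v by (simp_all add: rep_def xrep_def)
  have 1: "wp (scomp pick_ins) (stime pick_ins) (\<lambda>h'. h' = setr (setr h ''a'' a) ''b'' b) h"
    by (rule wp_scom) (use d sl u v n_pos n_le in \<open>simp_all add: pick_ins_def rg_setr a_def b_def hstat_def\<close>)
  define h1 where "h1 = setr (setr h ''a'' a) ''b'' b"
  have k1: "rg h1 ''sl'' = s" "rg h1 ''a'' = a" "rg h1 ''b'' = b" "rg h1 ''B'' = B" "mm h1 = mm h"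
    using sl B by (simp_all add: h1_def rg_setr)
  have X1: "rep n (mm h1 s) x" using X k1 by simp
  let ?x = "addarc x a b"
  have hv1: "heavy B ?x u v" using hv wt_addarc[OF ab(4), of x] ab(1) unfolding heavy_wt by simp
  have Da: "deg n ?x p \<le> Dm" if "p < n" for p
    using D[OF that] deg_addarc[OF ab(3), of x a p] by (cases "p = a") simp_all
  have o1: "card (own n ?x a) \<le> Ob" by (rule heavy_own[OF B(2) hv1 Da[OF ab(2)] Ob])
  have D1: "deg n x p \<le> Dm" if "p < n" for p using D[OF that] by simp
  have 2: "wp add_com (arc_time Ob) (\<lambda>h'. rep n (mm h' s) ?x \<and> frame tmps s F8 h1 h') h1"
    by (rule add_wp[OF k1(1) sl(2) k1(2) ab(2) k1(3) ab(3,4) X1 w D1 _ o1]) (use Z4 in simp_all)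
  have f1: "frame ctmps s F8 h h1" by (simp add: h1_def frame_def rg_setr ctmps_def)
  have wx: "wt ?x p q = wt x p q + of_bool ({p, q} = {u, v})" for p q
    using wt_addarc[OF ab(4), of x p q] ab(1) by simp
  have 3: "wp (Seq (scomp (SA ''c'' (HV ''a''))) (chain_com ''c'' ''y'' (search_com scan_ins probe_ins)))
    (stime (SA ''c'' (HV ''a'')) + chain_time Ob N)
    (\<lambda>h'. \<exists>x'. rep n (mm h' s) x' \<and> inside n x' \<and> good n B x' \<and>
       (\<forall>p q. wt x' p q = wt x p q + of_bool ({p, q} = {u, v})) \<and> frame ctmps s F8 h h') h2"
    if h2: "rep n (mm h2 s) ?x \<and> frame tmps s F8 h1 h2" for h2
  proof -
    have f2: "frame tmps s F8 h1 h2" using h2 ..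
    define h3 where "h3 = setr h2 ''c'' a"
    have "rg h2 ''a'' = a" using frame_reg[OF f2, of "''a''"] k1 by (simp add: tmps_def)
    then have 31: "wp (scomp (SA ''c'' (HV ''a''))) (stime (SA ''c'' (HV ''a''))) (\<lambda>h'. h' = h3) h2"
      by (intro wp_scom) (use ab in \<open>simp_all add: h3_def hstat_def\<close>)
    have k3: "rg h3 ''sl'' = s" "rg h3 ''B'' = B" "rg h3 ''c'' = a" "mm h3 = mm h2"
      using frame_reg[OF f2] k1 by (simp_all add: h3_def rg_setr tmps_def)
    have X3: "rep n (mm h3 s) ?x" using h2 k3 by simp
    have f12: "frame ctmps s F8 h h2" by (rule frame_trans[OF f1 frame_ctmps[OF f2]]) simp_all
    have f3: "frame ctmps s F8 h h3" using f12 by (simp add: h3_def frame_def rg_setr ctmps_def)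
    have "wp (chain_com ''c'' ''y'' (search_com scan_ins probe_ins)) (chain_time Ob N)
      (\<lambda>h'. \<exists>x'. rep n (mm h' s) x' \<and> inside n x' \<and> good n B x' \<and> wt x' = wt ?x \<and> frame ctmps s F8 h3 h') h3"
      by (rule chain_ins_wp[OF k3(1) sl(2) k3(2) B(2) k3(3) X3 ins_chain_start[OF g w ab(2-5)] hv1 D Z4 Ob N])
    then have 32: "wp (chain_com ''c'' ''y'' (search_com scan_ins probe_ins)) (chain_time Ob N)
      (\<lambda>h'. \<exists>x'. rep n (mm h' s) x' \<and> inside n x' \<and> good n B x' \<and>
       (\<forall>p q. wt x' p q = wt x p q + of_bool ({p, q} = {u, v})) \<and> frame ctmps s F8 h h') h3"
    proof (rule wp_mono)
      fix h' assume "\<exists>x'. rep n (mm h' s) x' \<and> inside n x' \<and> good n B x' \<and> wt x' = wt ?x \<and> frame ctmps s F8 h3 h'"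
      then obtain x' where x': "rep n (mm h' s) x' \<and> inside n x' \<and> good n B x' \<and> wt x' = wt ?x \<and> frame ctmps s F8 h3 h'"
        by (elim exE)
      then have "frame ctmps s F8 h3 h'" by simp
      then have "frame ctmps s F8 h h'" by (rule frame_trans[OF f3]) simp_all
      then show "\<exists>x'. rep n (mm h' s) x' \<and> inside n x' \<and> good n B x' \<and>
       (\<forall>p q. wt x' p q = wt x p q + of_bool ({p, q} = {u, v})) \<and> frame ctmps s F8 h h'"
        by (intro exI[of _ x']) (use x' wx in simp)
    qed simp
    show ?thesis by (rule wp_seq[OF 31]) (simp only: 32)
  qed
  have 4: "wp (Seq add_com (Seq (scomp (SA ''c'' (HV ''a''))) (chain_com ''c'' ''y'' (search_com scan_ins probe_ins))))
    (arc_time Ob + (stime (SA ''c'' (HV ''a'')) + chain_time Ob N))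
    (\<lambda>h'. \<exists>x'. rep n (mm h' s) x' \<and> inside n x' \<and> good n B x' \<and>
       (\<forall>p q. wt x' p q = wt x p q + of_bool ({p, q} = {u, v})) \<and> frame ctmps s F8 h h') h1"
    by (rule wp_seq[OF 2], rule 3)
  have "wp unit_ins (stime pick_ins + (arc_time Ob + (stime (SA ''c'' (HV ''a'')) + chain_time Ob N)))
    (\<lambda>h'. \<exists>x'. rep n (mm h' s) x' \<and> inside n x' \<and> good n B x' \<and>
       (\<forall>p q. wt x' p q = wt x p q + of_bool ({p, q} = {u, v})) \<and> frame ctmps s F8 h h') h"
    unfolding unit_ins_def by (rule wp_seq[OF 1]) (simp only: 4[unfolded h1_def])
  then show ?thesis by (rule wp_mono) (simp_all add: unit_time_def pick_time_def)
qed

lemma unit_del_wp: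
  assumes sl: "rg h ''sl'' = s" "s < 4" and B: "rg h ''B'' = B" "0 < B"
    and u: "rg h ''s'' = u" "u < n" and v: "rg h ''h'' = v" "v < n" and uv: "u \<noteq> v"
    and X: "rep n (mm h s) x" and w: "inside n x" and g: "good n B x" and hv: "heavy B x u v"
    and pw: "0 < wt x u v"
    and D: "\<And>u. u < n \<Longrightarrow> deg n x u \<le> Dm" and Z4: "4 * Dm + 16 \<le> Z"
    and Ob: "2 * Dm div B + 1 \<le> Ob" and N: "pot B Dm \<le> real N"
  shows "wp unit_del (unit_time Ob N)
    (\<lambda>h'. \<exists>x'. rep n (mm h' s) x' \<and> inside n x' \<and> good n B x' \<and>
       (\<forall>p q. wt x' p q = wt x p q - of_bool ({p, q} = {u, v})) \<and> frame ctmps s F8 h h') h"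
proof -
  define a b where "a = (if x u v = 0 then v else u)" and "b = (if x u v = 0 then u else v)"
  have ab: "{a, b} = {u, v}" "a < n" "b < n" "a \<noteq> b" "a \<le> Z" "b \<le> Z" and pos: "0 < x a b"
    using u v uv n_le pw unfolding a_def b_def wt_def by (cases "x u v = 0"; simp add: insert_commute)+
  have d: "mm h s (0, u, v, 0) = x u v"
    using X u v by (simp add: rep_def xrep_def)
  have 1: "wp (scomp pick_del) (stime pick_del) (\<lambda>h'. h' = setr (setr h ''a'' a) ''b'' b) h"
    by (rule wp_scom) (use d sl u v n_pos n_le in \<open>simp_all add: pick_del_def rg_setr a_def b_def hstat_def\<close>)
  define h1 where "h1 = setr (setr h ''a'' a) ''b'' b"
  have k1: "rg h1 ''sl'' = s" "rg h1 ''a'' = a" "rg h1 ''b'' = b" "rg h1 ''B'' = B" "mm h1 = mm h"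
    using sl B by (simp_all add: h1_def rg_setr)
  have X1: "rep n (mm h1 s) x" using X k1 by simp
  let ?x = "remarc x a b"
  have wx: "wt ?x p q = wt x p q - of_bool ({p, q} = {u, v})" for p q
    using wt_remarc[of a b x, OF ab(4) pos] ab(1) by simp
  have hv1: "heavy B ?x u v" using hv wx unfolding heavy_wt by simp
  have Da: "deg n ?x p \<le> Dm" if "p < n" for p
    using D[OF that] deg_remarc(1)[of b n x a p, OF ab(3) pos] by simp
  have o1: "card (own n ?x a) \<le> Ob" by (rule heavy_own[OF B(2) hv1 Da[OF ab(2)] Ob])
  have 2: "wp rem_com (arc_time Ob) (\<lambda>h'. rep n (mm h' s) ?x \<and> frame tmps s F8 h1 h') h1"
    by (rule rem_wp[OF k1(1) sl(2) k1(2) ab(2) k1(3) ab(3) X1 w pos D _ o1]) (use Z4 in simp_all)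
  have f1: "frame ctmps s F8 h h1" by (simp add: h1_def frame_def rg_setr ctmps_def)
  have 3: "wp (Seq (scomp (SA ''c'' (HV ''a''))) (chain_com ''y'' ''c'' (search_com scan_del probe_del)))
    (stime (SA ''c'' (HV ''a'')) + chain_time Ob N)
    (\<lambda>h'. \<exists>x'. rep n (mm h' s) x' \<and> inside n x' \<and> good n B x' \<and>
       (\<forall>p q. wt x' p q = wt x p q - of_bool ({p, q} = {u, v})) \<and> frame ctmps s F8 h h') h2"
    if h2: "rep n (mm h2 s) ?x \<and> frame tmps s F8 h1 h2" for h2
  proof -
    have f2: "frame tmps s F8 h1 h2" using h2 ..
    define h3 where "h3 = setr h2 ''c'' a"
    have "rg h2 ''a'' = a" using frame_reg[OF f2, of "''a''"] k1 by (simp add: tmps_def)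
    then have 31: "wp (scomp (SA ''c'' (HV ''a''))) (stime (SA ''c'' (HV ''a''))) (\<lambda>h'. h' = h3) h2"
      by (intro wp_scom) (use ab in \<open>simp_all add: h3_def hstat_def\<close>)
    have k3: "rg h3 ''sl'' = s" "rg h3 ''B'' = B" "rg h3 ''c'' = a" "mm h3 = mm h2"
      using frame_reg[OF f2] k1 by (simp_all add: h3_def rg_setr tmps_def)
    have X3: "rep n (mm h3 s) ?x" using h2 k3 by simp
    have f12: "frame ctmps s F8 h h2" by (rule frame_trans[OF f1 frame_ctmps[OF f2]]) simp_all
    have f3: "frame ctmps s F8 h h3" using f12 by (simp add: h3_def frame_def rg_setr ctmps_def)
    have "wp (chain_com ''y'' ''c'' (search_com scan_del probe_del)) (chain_time Ob N)
      (\<lambda>h'. \<exists>x'. rep n (mm h' s) x' \<and> inside n x' \<and> good n B x' \<and> wt x' = wt ?x \<and> frame ctmps s F8 h3 h') h3"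
      by (rule chain_del_wp[OF k3(1) sl(2) k3(2) B(2) k3(3) X3 del_chain_start[OF g w pos] hv1 D Z4 Ob N])
    then have 32: "wp (chain_com ''y'' ''c'' (search_com scan_del probe_del)) (chain_time Ob N)
      (\<lambda>h'. \<exists>x'. rep n (mm h' s) x' \<and> inside n x' \<and> good n B x' \<and>
       (\<forall>p q. wt x' p q = wt x p q - of_bool ({p, q} = {u, v})) \<and> frame ctmps s F8 h h') h3"
    proof (rule wp_mono)
      fix h' assume "\<exists>x'. rep n (mm h' s) x' \<and> inside n x' \<and> good n B x' \<and> wt x' = wt ?x \<and> frame ctmps s F8 h3 h'"
      then obtain x' where x': "rep n (mm h' s) x' \<and> inside n x' \<and> good n B x' \<and> wt x' = wt ?x \<and> frame ctmps s F8 h3 h'"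
        by (elim exE)
      then have "frame ctmps s F8 h3 h'" by simp
      then have "frame ctmps s F8 h h'" by (rule frame_trans[OF f3]) simp_all
      then show "\<exists>x'. rep n (mm h' s) x' \<and> inside n x' \<and> good n B x' \<and>
       (\<forall>p q. wt x' p q = wt x p q - of_bool ({p, q} = {u, v})) \<and> frame ctmps s F8 h h'"
        by (intro exI[of _ x']) (use x' wx in simp)
    qed simp
    show ?thesis by (rule wp_seq[OF 31]) (simp only: 32)
  qed
  have 4: "wp (Seq rem_com (Seq (scomp (SA ''c'' (HV ''a''))) (chain_com ''y'' ''c'' (search_com scan_del probe_del))))
    (arc_time Ob + (stime (SA ''c'' (HV ''a'')) + chain_time Ob N))
    (\<lambda>h'. \<exists>x'. rep n (mm h' s) x' \<and> inside n x' \<and> good n B x' \<and>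
       (\<forall>p q. wt x' p q = wt x p q - of_bool ({p, q} = {u, v})) \<and> frame ctmps s F8 h h') h1"
    by (rule wp_seq[OF 2], rule 3)
  have "wp unit_del (stime pick_del + (arc_time Ob + (stime (SA ''c'' (HV ''a'')) + chain_time Ob N)))
    (\<lambda>h'. \<exists>x'. rep n (mm h' s) x' \<and> inside n x' \<and> good n B x' \<and>
       (\<forall>p q. wt x' p q = wt x p q - of_bool ({p, q} = {u, v})) \<and> frame ctmps s F8 h h') h"
    unfolding unit_del_def by (rule wp_seq[OF 1]) (simp only: 4[unfolded h1_def])
  then show ?thesis by (rule wp_mono) (simp_all add: unit_time_def pick_time_def)
qed

end

section \<open>Banks, and what their largest degree says about the density\<close>

definition edges_ok :: "nat \<Rightarrow> edges \<Rightarrow> bool" where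
  "edges_ok n E \<longleftrightarrow> (\<forall>e\<in>#E. \<exists>u v. u < n \<and> v < n \<and> u \<noteq> v \<and> e = {u, v})"

definition dense_le :: "nat \<Rightarrow> edges \<Rightarrow> real \<Rightarrow> bool" where
  "dense_le n E \<rho> \<longleftrightarrow> (\<forall>S. S \<subseteq> {..<n} \<longrightarrow> S \<noteq> {} \<longrightarrow>
     real (size (induced_edges E S)) \<le> \<rho> * real (card S))"

text \<open>Which stable orientation the bank holds is left open, since it depends on the history of
  updates.\<close>

definition bankst :: "nat \<Rightarrow> nat \<Rightarrow> bank \<Rightarrow> edges \<Rightarrow> bool" where
  "bankst n B b E \<longleftrightarrow> (\<exists>x. rep n b x \<and> inside n x \<and> good n B x \<and> (\<forall>p q. wt x p q = B * count E {p, q}))"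

lemma sum_pair_indicator:
  assumes "finite S" "a \<noteq> b"
  shows "(\<Sum>u\<in>S. \<Sum>v\<in>S. of_bool ({u, v} = {a, b}) :: nat) = 2 * of_bool ({a, b} \<subseteq> S)"
proof -
  have e: "(of_bool ({u, v} = {a, b}) :: nat) =
     of_bool (u = a) * of_bool (v = b) + of_bool (u = b) * of_bool (v = a)" for u v
    using assms(2) unfolding doubleton_eq_iff by (cases "u = a"; cases "v = b"; cases "u = b"; cases "v = a") simp_all
  have s: "(\<Sum>v\<in>S. of_bool (v = c) :: nat) = of_bool (c \<in> S)" for c
    using assms(1) by (simp add: of_bool_def)
  show ?thesis unfolding e sum.distrib sum_distrib_left[symmetric] sum_distrib_right[symmetric] s
    by (cases "a \<in> S"; cases "b \<in> S") simp_all
qed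

lemma sum_count_pairs:
  assumes "edges_ok n E" "finite S"
  shows "(\<Sum>u\<in>S. \<Sum>v\<in>S. count E {u, v}) = 2 * size (induced_edges E S)"
  using assms(1)
proof (induction E)
  case empty
  then show ?case by (simp add: induced_edges_def)
next
  case (add e E)
  obtain a b where ab: "a \<noteq> b" "e = {a, b}" using add.prems by (auto simp: edges_ok_def)
  have ok: "edges_ok n E" using add.prems by (simp add: edges_ok_def)
  have c: "count (add_mset e E) {u, v} = count E {u, v} + of_bool ({u, v} = {a, b})" for u v
    by (simp add: ab(2) eq_commute[of "{a, b}"])
  have "(\<Sum>u\<in>S. \<Sum>v\<in>S. count (add_mset e E) {u, v}) = 2 * size (induced_edges E S) + 2 * of_bool ({a, b} \<subseteq> S)"
    unfolding c sum.distrib sum_pair_indicator[OF assms(2) ab(1)] add.IH[OF ok] ..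
  also have "\<dots> = 2 * size (induced_edges (add_mset e E) S)"
    unfolding ab(2) induced_edges_def by (cases "{a, b} \<subseteq> S") simp_all
  finally show ?case .
qed

lemma sum_wt: "(\<Sum>u\<in>S. \<Sum>v\<in>S. wt x u v) = 2 * (\<Sum>u\<in>S. \<Sum>v\<in>S. x u v)"
proof -
  have "(\<Sum>u\<in>S. \<Sum>v\<in>S. x v u) = (\<Sum>u\<in>S. \<Sum>v\<in>S. x u v)" by (rule sum.swap)
  then show ?thesis unfolding wt_def sum.distrib by simp
qed

text \<open>An inequality for the units, rather than an equation, covers the moments at which an
  edge is only partly present.\<close>

lemma sum_arcs_le:
  assumes "edges_ok n E" "finite S" "\<And>p q. wt x p q \<le> B * count E {p, q}"
  shows "(\<Sum>u\<in>S. \<Sum>v\<in>S. x u v) \<le> B * size (induced_edges E S)"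
proof -
  have "(\<Sum>u\<in>S. \<Sum>v\<in>S. wt x u v) \<le> (\<Sum>u\<in>S. \<Sum>v\<in>S. B * count E {u, v})"
    by (intro sum_mono assms(3))
  also have "\<dots> = B * (2 * size (induced_edges E S))"
    unfolding sum_distrib_left[symmetric] sum_count_pairs[OF assms(1,2)] ..
  finally show ?thesis unfolding sum_wt by simp
qed

lemma sum_arcs_eq:
  assumes "edges_ok n E" "finite S" "\<And>p q. wt x p q = B * count E {p, q}"
  shows "(\<Sum>u\<in>S. \<Sum>v\<in>S. x u v) = B * size (induced_edges E S)"
proof -
  have "(\<Sum>u\<in>S. \<Sum>v\<in>S. wt x u v) = B * (2 * size (induced_edges E S))"
    unfolding assms(3) sum_distrib_left[symmetric] sum_count_pairs[OF assms(1,2)] ..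
  then show ?thesis unfolding sum_wt by simp
qed

text \<open>Only vertices that meet an edge can take part in the expansion. Their number is what
  turns a logarithm of \<open>n\<close> into a logarithm of the number of edges.\<close>

lemma card_support:
  assumes "edges_ok n E"
  shows "finite (\<Union> (set_mset E))" "card (\<Union> (set_mset E)) \<le> 2 * size E"
  using assms
proof (induction E)
  case (add e E)
  { case 1
    obtain a b where "e = {a, b}" using 1 by (auto simp: edges_ok_def)
    then show ?case using add.IH(1) 1 by (simp add: edges_ok_def) }
  { case 2
    obtain a b where e: "e = {a, b}" using 2 by (auto simp: edges_ok_def)
    have "card (e \<union> \<Union> (set_mset E)) \<le> card e + card (\<Union> (set_mset E))" by (rule card_Un_le)
    also have "card e \<le> 2" unfolding e by (rule card_insert_le_m1) simp_all
    finally show ?case using add.IH(2) 2 by (simp add: edges_ok_def) }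
qed simp_all

text \<open>This is \<open>good_deg_le\<close> with \<open>G = B * \<rho>\<close>. The assumption
  \<open>1 / 2 \<le> \<rho>\<close> gives \<open>B \<le> 2 * G\<close>, by which the additive loss
  is absorbed.\<close>

lemma deg_upper:
  assumes K: "1 \<le> K" "1 \<le> l" "B = 32 * K ^ 2 * l" and E: "edges_ok n E" "dense_le n E \<rho>" "1 / 2 \<le> \<rho>"
    "2 * size E < 2 ^ l" and x: "inside n x" "good n B x" "\<And>p q. wt x p q \<le> B * count E {p, q}" and u: "u < n"
  shows "real (deg n x u) \<le> (1 + 1 / real K) * (real B * \<rho>)"
proof (rule good_deg_le[OF K x(2,1) _ _ u])
  fix S assume S: "S \<subseteq> {..<n}" "S \<noteq> {}"
  have fS: "finite S" using S(1) finite_subset by blast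
  have "real (\<Sum>u\<in>S. \<Sum>v\<in>S. x u v) \<le> real (B * size (induced_edges E S))"
    by (rule of_nat_mono) (rule sum_arcs_le[OF E(1) fS x(3)])
  also have "\<dots> = real B * real (size (induced_edges E S))" by simp
  also have "\<dots> \<le> real B * (\<rho> * real (card S))"
    by (rule mult_left_mono) (use E(2) S in \<open>simp_all add: dense_le_def\<close>)
  finally show "real (\<Sum>u\<in>S. \<Sum>v\<in>S. x u v) \<le> real B * \<rho> * real (card S)" by (simp add: mult.assoc)
next
  have "{u. u < n \<and> 0 < deg n x u} \<subseteq> \<Union> (set_mset E)"
  proof
    fix u assume "u \<in> {u. u < n \<and> 0 < deg n x u}"
    then have "(\<Sum>v<n. x u v) \<noteq> 0" unfolding deg_def mem_Collect_eq by linarith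
    from sum.not_neutral_contains_not_neutral[OF this] obtain v where "0 < x u v" by blast
    then have "0 < wt x u v" by (simp add: wt_def)
    then have "0 < B * count E {u, v}" using x(3)[of u v] by (rule less_le_trans)
    then have "{u, v} \<in># E" by simp
    then show "u \<in> \<Union> (set_mset E)" by blast
  qed
  then have "card {u. u < n \<and> 0 < deg n x u} \<le> card (\<Union> (set_mset E))"
    by (rule card_mono[OF card_support(1)[OF E(1)]])
  then show "card {u. u < n \<and> 0 < deg n x u} < 2 ^ l" using card_support(2)[OF E(1)] E(4) by simp
next
  show "real B \<le> 2 * (real B * \<rho>)" using mult_left_mono[OF E(3), of "2 * real B"] by simp
qed

lemma bankst_lower:
  assumes b: "bankst n B b E" and E: "edges_ok n E" and S: "S \<subseteq> {..<n}"
  shows "B * size (induced_edges E S) \<le> b (7, 0, 0, 0) * card S"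
proof -
  obtain x where x: "rep n b x" "inside n x" "\<And>p q. wt x p q = B * count E {p, q}"
    using b unfolding bankst_def by blast
  have fS: "finite S" using S finite_subset by blast
  have D: "deg n x u \<le> b (7, 0, 0, 0)" if "u < n" for u using x(1) that by (simp add: rep_def xrep_def)
  have "B * size (induced_edges E S) = (\<Sum>u\<in>S. \<Sum>v\<in>S. x u v)"
    by (rule sum_arcs_eq[OF E fS x(3), symmetric])
  also have "\<dots> \<le> (\<Sum>u\<in>S. deg n x u)"
    unfolding deg_def by (intro sum_mono sum_mono2) (use S in auto)
  also have "\<dots> \<le> (\<Sum>u\<in>S. b (7, 0, 0, 0))" by (intro sum_mono D) (use S in auto)
  finally show ?thesis by (simp add: mult.commute)
qed

lemma bankst_upper:
  assumes b: "bankst n B b E" and K: "1 \<le> K" "1 \<le> l" "B = 32 * K ^ 2 * l"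
    and E: "edges_ok n E" "dense_le n E \<rho>" "1 / 2 \<le> \<rho>" "2 * size E < 2 ^ l"
  shows "real (b (7, 0, 0, 0)) \<le> (1 + 1 / real K) * (real B * \<rho>)"
proof (cases "b (7, 0, 0, 0) = 0")
  case True
  then show ?thesis using E(3) by simp
next
  case False
  obtain x where x: "rep n b x" "inside n x" "good n B x" "\<And>p q. wt x p q = B * count E {p, q}"
    using b unfolding bankst_def by blast
  obtain u where u: "u < n" "deg n x u = b (7, 0, 0, 0)" using x(1) False unfolding rep_def xrep_def by blast
  show ?thesis using deg_upper[OF K E x(2,3) _ u(1)] x(4) u(2) by simp
qed

text \<open>Without edges there are no units, so stability holds for every parameter. This lets an
  emptied slot be reused with a different \<open>B\<close>.\<close>

lemma bankst_zero:
  assumes "bankst n B b {#}"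
  shows "b (7, 0, 0, 0) = 0" "bankst n B' b {#}"
proof -
  obtain x where x: "rep n b x" "inside n x" "good n B x" "\<And>p q. wt x p q = B * count {#} {p, q}"
    using assms unfolding bankst_def by blast
  have 0: "x = (\<lambda>_ _. 0)" using x(4) by (simp add: wt_def fun_eq_iff)
  have d: "deg n x u = 0" for u by (simp add: deg_def 0)
  show "b (7, 0, 0, 0) = 0" using x(1) d unfolding rep_def xrep_def by force
  have "good n B' x" by (simp add: good_def bad_def 0)
  then show "bankst n B' b {#}" unfolding bankst_def using x by (intro exI[of _ x]) (simp add: 0 wt_def)
qed

lemma bankst_init: "bankst n B (\<lambda>_. 0) {#}"
proof -
  let ?x = "\<lambda>_ _. 0 :: nat"
  have d: "deg n ?x u = 0" for u by (simp add: deg_def)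
  have "rep n (\<lambda>_. 0) ?x" by (simp add: rep_def xrep_def classes_def lists_def kap_def d)
  then show ?thesis unfolding bankst_def
    by (intro exI[of _ ?x]) (simp add: inside_def good_def bad_def wt_def)
qed

section \<open>Repeating a unit operation for a whole edge\<close>

definition loop_guard :: hexp where "loop_guard = hless (HV ''t'') (HV ''B'')"

definition loop_step :: scom where "loop_step = SA ''t'' (hplus (HV ''t'') (HC 1))"

definition edge_com :: "com \<Rightarrow> com" where
  "edge_com unit = Seq (scomp (SA ''t'' (HC 0))) (While (hcomp loop_guard) (Seq unit (scomp loop_step)))"

definition edge_time :: "nat \<Rightarrow> nat \<Rightarrow> nat \<Rightarrow> nat" where
  "edge_time k N B = stime (SA ''t'' (HC 0)) + (B * (unit_time k N + stime loop_step + 1 + exp_cost (hcomp loop_guard)) +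
     1 + exp_cost (hcomp loop_guard))"

definition etmps :: "string set" where "etmps = insert ''t'' ctmps"

lemma loop_sstat [simp]: "hstat loop_guard" "sstat loop_step"
  by (simp_all add: loop_guard_def loop_step_def hstat_def)

context ram
begin

text \<open>\<open>W t\<close> prescribes the units on each pair after \<open>t\<close> repetitions;
  adding or subtracting \<open>t\<close> on the pair in question gives the cases of insertion and
  deletion.\<close>

lemma edge_wp:
  fixes W :: "nat \<Rightarrow> nat \<Rightarrow> nat \<Rightarrow> nat"
  assumes h: "rg h ''sl'' = s" "rg h ''B'' = B" "rg h ''s'' = u" "rg h ''h'' = v"
    and X: "rep n (mm h s) x" "inside n x" "good n B x" "wt x = W 0"
    and unit: "\<And>h x t. rg h ''sl'' = s \<Longrightarrow> rg h ''B'' = B \<Longrightarrow> rg h ''s'' = u \<Longrightarrow> rg h ''h'' = v \<Longrightarrow>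
      rep n (mm h s) x \<Longrightarrow> inside n x \<Longrightarrow> good n B x \<Longrightarrow> wt x = W t \<Longrightarrow> t < B \<Longrightarrow>
      wp unit (unit_time Ob N) (\<lambda>h'. \<exists>x'. rep n (mm h' s) x' \<and> inside n x' \<and> good n B x' \<and>
        wt x' = W (Suc t) \<and> frame ctmps s F8 h h') h"
  shows "wp (edge_com unit) (edge_time Ob N B) (\<lambda>h'. (\<exists>x'. rep n (mm h' s) x' \<and> inside n x' \<and> good n B x' \<and>
    wt x' = W B) \<and> frame etmps s F8 h h') h"
proof -
  define I where "I k h2 \<longleftrightarrow> (\<exists>x. k \<le> B \<and> rg h2 ''t'' = B - k \<and> frame etmps s F8 h h2 \<and>
     rep n (mm h2 s) x \<and> inside n x \<and> good n B x \<and> wt x = W (B - k))" for k h2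
  have keep: "rg h2 ''sl'' = s" "rg h2 ''B'' = B" "rg h2 ''s'' = u" "rg h2 ''h'' = v" if "frame etmps s F8 h h2" for h2
    using frame_reg[OF that] h(1-4) by (simp_all add: etmps_def ctmps_def stmps_def tmps_def)
  have 1: "wp (scomp (SA ''t'' (HC 0))) (stime (SA ''t'' (HC 0))) (I B) h"
  proof (rule wp_scom)
    have "I B (setr h ''t'' 0)" unfolding I_def
      by (intro exI[of _ x]) (use X in \<open>simp add: rg_setr frame_def etmps_def\<close>)
    then show "wps (SA ''t'' (HC 0)) (I B) h" by simp
  qed (simp add: hstat_def)
  have 2: "wp (While (hcomp loop_guard) (Seq unit (scomp loop_step)))
    (B * (unit_time Ob N + stime loop_step + 1 + exp_cost (hcomp loop_guard)) + 1 + exp_cost (hcomp loop_guard))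
    (\<lambda>h'. (\<exists>x'. rep n (mm h' s) x' \<and> inside n x' \<and> good n B x' \<and> wt x' = W B) \<and> frame etmps s F8 h h') h1"
    if "I B h1" for h1
  proof (rule wp_while[where I = I, OF _ that])
    show "hstat loop_guard" by simp
    show "\<And>k h. I k h \<Longrightarrow> hok n loop_guard h" by (simp add: loop_guard_def)
  next
    fix k h2 assume bd: "bounded h2" and I: "I k h2" and gd: "hval loop_guard h2 \<noteq> 0"
    from I obtain x2 where "k \<le> B \<and> rg h2 ''t'' = B - k \<and> frame etmps s F8 h h2 \<and>
       rep n (mm h2 s) x2 \<and> inside n x2 \<and> good n B x2 \<and> wt x2 = W (B - k)" unfolding I_def by (elim exE)
    then have a: "k \<le> B" "rg h2 ''t'' = B - k" "frame etmps s F8 h h2" "rep n (mm h2 s) x2" "inside n x2"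
      "good n B x2" "wt x2 = W (B - k)" by - (elim conjE, assumption)+
    note K = keep[OF a(3)]
    have tB: "B - k < B" using gd a(2) K(2) by (simp add: loop_guard_def split: if_splits)
    then have k: "k > 0" and Suc: "Suc (B - k) = B - (k - 1)" using a(1) by simp_all
    have BZ: "B \<le> Z" using boundedD(2)[OF bd, of "''B''"] K(2) by simp
    have "wp (Seq unit (scomp loop_step)) (unit_time Ob N + stime loop_step) (I (k - 1)) h2"
    proof (rule wp_seq[OF unit[OF K a(4-7) tB]])
      fix h3 assume "\<exists>x'. rep n (mm h3 s) x' \<and> inside n x' \<and> good n B x' \<and> wt x' = W (Suc (B - k)) \<and> frame ctmps s F8 h2 h3"
      then obtain x3 where x3: "rep n (mm h3 s) x3 \<and> inside n x3 \<and> good n B x3 \<and> wt x3 = W (Suc (B - k)) \<and> frame ctmps s F8 h2 h3"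
        by (elim exE)
      then have f: "frame ctmps s F8 h2 h3" by simp
      have t3: "rg h3 ''t'' = B - k" using frame_reg[OF f ctmps_facts(8)] a(2) by simp
      have "frame etmps s F8 h h3" by (rule frame_trans[OF a(3) f]) (auto simp: etmps_def)
      then have "frame etmps s F8 h (setr h3 ''t'' (Suc (B - k)))" by (simp add: frame_def rg_setr etmps_def)
      then have "I (k - 1) (setr h3 ''t'' (Suc (B - k)))" unfolding I_def
        by (intro exI[of _ x3]) (use x3 a(1) k Suc in \<open>simp add: rg_setr\<close>)
      then show "wp (scomp loop_step) (stime loop_step) (I (k - 1)) h3"
        by (intro wp_scom) (use t3 tB BZ in \<open>simp_all add: loop_step_def hstat_def\<close>)
    qed
    then show "k > 0 \<and> wp (Seq unit (scomp loop_step)) (unit_time Ob N + stime loop_step) (I (k - 1)) h2"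
      using k by simp
  next
    fix k h2 assume bd: "bounded h2" and I: "I k h2" and gd: "hval loop_guard h2 = 0"
    from I obtain x2 where "k \<le> B \<and> rg h2 ''t'' = B - k \<and> frame etmps s F8 h h2 \<and>
       rep n (mm h2 s) x2 \<and> inside n x2 \<and> good n B x2 \<and> wt x2 = W (B - k)" unfolding I_def by (elim exE)
    then have a: "k \<le> B" "rg h2 ''t'' = B - k" "frame etmps s F8 h h2" "rep n (mm h2 s) x2" "inside n x2"
      "good n B x2" "wt x2 = W (B - k)" by - (elim conjE, assumption)+
    note K = keep[OF a(3)]
    have kB: "B - k = B" using gd a(2) K(2) by (simp add: loop_guard_def split: if_splits)
    show "(\<exists>x'. rep n (mm h2 s) x' \<and> inside n x' \<and> good n B x' \<and> wt x' = W B) \<and> frame etmps s F8 h h2"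
      using a(3) a(4-6) a(7)[unfolded kB] by (intro conjI exI[of _ x2])
  qed
  show ?thesis unfolding edge_com_def edge_time_def by (rule wp_seq[OF 1], rule 2)
qed

text \<open>The orientations on the way are not known explicitly, so the degree bound
  \<open>D\<close> is required of every stable orientation whose units do not exceed those of the
  final graph.\<close>

lemma edge_ins_wp:
  assumes sl: "rg h ''sl'' = s" "s < 4" and B: "rg h ''B'' = B" "0 < B"
    and u: "rg h ''s'' = u" "u < n" and v: "rg h ''h'' = v" "v < n" and uv: "u \<noteq> v"
    and b: "bankst n B (mm h s) E"
    and D: "\<And>x p. inside n x \<Longrightarrow> good n B x \<Longrightarrow> (\<And>p q. wt x p q \<le> B * count (add_mset {u, v} E) {p, q}) \<Longrightarrow>
      p < n \<Longrightarrow> deg n x p + 1 \<le> Dm"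
    and Z4: "4 * Dm + 16 \<le> Z" and Ob: "2 * Dm div B + 1 \<le> Ob" and N: "pot B Dm \<le> real N"
  shows "wp (edge_com unit_ins) (edge_time Ob N B)
    (\<lambda>h'. bankst n B (mm h' s) (add_mset {u, v} E) \<and> frame etmps s F8 h h') h"
proof -
  obtain x where x: "rep n (mm h s) x" "inside n x" "good n B x" "\<And>p q. wt x p q = B * count E {p, q}"
    using b unfolding bankst_def by blast
  define W where "W t p q = B * count E {p, q} + t * of_bool ({p, q} = {u, v})" for t p q
  have W0: "wt x = W 0" by (simp add: fun_eq_iff x(4) W_def)
  have cnt: "count (add_mset {u, v} E) {p, q} = count E {p, q} + of_bool ({p, q} = {u, v})" for p q
    by (simp add: eq_commute[of "{u, v}"])
  have WB: "W B p q = B * count (add_mset {u, v} E) {p, q}" for p q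
    unfolding cnt W_def by (simp only: distrib_left)
  have "wp (edge_com unit_ins) (edge_time Ob N B) (\<lambda>h'. (\<exists>x'. rep n (mm h' s) x' \<and> inside n x' \<and> good n B x' \<and>
    wt x' = W B) \<and> frame etmps s F8 h h') h"
  proof (rule edge_wp[where W = W, OF sl(1) B(1) u(1) v(1) x(1-3) W0])
    fix h1 x1 t assume a: "rg h1 ''sl'' = s" "rg h1 ''B'' = B" "rg h1 ''s'' = u" "rg h1 ''h'' = v"
      "rep n (mm h1 s) x1" "inside n x1" "good n B x1" "wt x1 = W t" "t < B"
    have hv: "heavy B x1 u v"
      unfolding heavy_wt a(8) W_def by simp
    have le: "wt x1 p q \<le> B * count (add_mset {u, v} E) {p, q}" for p q
      unfolding WB[symmetric] a(8) W_def using a(9) by simp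
    have "wp unit_ins (unit_time Ob N) (\<lambda>h'. \<exists>x'. rep n (mm h' s) x' \<and> inside n x' \<and> good n B x' \<and>
       (\<forall>p q. wt x' p q = wt x1 p q + of_bool ({p, q} = {u, v})) \<and> frame ctmps s F8 h1 h') h1"
      by (rule unit_ins_wp[OF a(1) sl(2) a(2) B(2) a(3) u(2) a(4) v(2) uv a(5-7) hv D[OF a(6,7) le] Z4 Ob N])
    then show "wp unit_ins (unit_time Ob N) (\<lambda>h'. \<exists>x'. rep n (mm h' s) x' \<and> inside n x' \<and> good n B x' \<and>
        wt x' = W (Suc t) \<and> frame ctmps s F8 h1 h') h1"
    proof (rule wp_mono)
      fix h' assume "\<exists>x'. rep n (mm h' s) x' \<and> inside n x' \<and> good n B x' \<and>
       (\<forall>p q. wt x' p q = wt x1 p q + of_bool ({p, q} = {u, v})) \<and> frame ctmps s F8 h1 h'"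
      then obtain x' where x': "rep n (mm h' s) x' \<and> inside n x' \<and> good n B x' \<and>
       (\<forall>p q. wt x' p q = wt x1 p q + of_bool ({p, q} = {u, v})) \<and> frame ctmps s F8 h1 h'" by (elim exE)
      then have "\<forall>p q. wt x' p q = wt x1 p q + of_bool ({p, q} = {u, v})" by simp
      then have "wt x' = W (Suc t)" unfolding fun_eq_iff a(8) W_def by simp
      then show "\<exists>x'. rep n (mm h' s) x' \<and> inside n x' \<and> good n B x' \<and>
        wt x' = W (Suc t) \<and> frame ctmps s F8 h1 h'" using x' by (intro exI[of _ x']) simp
    qed simp
  qed
  then show ?thesis
  proof (rule wp_mono)
    fix h' assume a: "(\<exists>x'. rep n (mm h' s) x' \<and> inside n x' \<and> good n B x' \<and> wt x' = W B) \<and> frame etmps s F8 h h'"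
    from conjunct1[OF a] obtain x' where "rep n (mm h' s) x' \<and> inside n x' \<and> good n B x' \<and> wt x' = W B"
      by (elim exE)
    then have "bankst n B (mm h' s) (add_mset {u, v} E)" unfolding bankst_def
      by (intro exI[of _ x']) (simp only: WB simp_thms)
    then show "bankst n B (mm h' s) (add_mset {u, v} E) \<and> frame etmps s F8 h h'" using a by simp
  qed simp
qed

lemma edge_del_wp:
  assumes sl: "rg h ''sl'' = s" "s < 4" and B: "rg h ''B'' = B" "0 < B"
    and u: "rg h ''s'' = u" "u < n" and v: "rg h ''h'' = v" "v < n" and uv: "u \<noteq> v"
    and b: "bankst n B (mm h s) E" and E: "{u, v} \<in># E"
    and D: "\<And>x p. inside n x \<Longrightarrow> good n B x \<Longrightarrow> (\<And>p q. wt x p q \<le> B * count E {p, q}) \<Longrightarrow>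
      p < n \<Longrightarrow> deg n x p + 1 \<le> Dm"
    and Z4: "4 * Dm + 16 \<le> Z" and Ob: "2 * Dm div B + 1 \<le> Ob" and N: "pot B Dm \<le> real N"
  shows "wp (edge_com unit_del) (edge_time Ob N B)
    (\<lambda>h'. bankst n B (mm h' s) (E - {#{u, v}#}) \<and> frame etmps s F8 h h') h"
proof -
  obtain x where x: "rep n (mm h s) x" "inside n x" "good n B x" "\<And>p q. wt x p q = B * count E {p, q}"
    using b unfolding bankst_def by blast
  define W where "W t p q = B * count E {p, q} - t * of_bool ({p, q} = {u, v})" for t p q
  have W0: "wt x = W 0" by (simp add: fun_eq_iff x(4) W_def)
  have cnt: "count (E - {#{u, v}#}) {p, q} = count E {p, q} - of_bool ({p, q} = {u, v})" for p q
    by (simp add: eq_commute[of "{u, v}"])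
  have WB: "W B p q = B * count (E - {#{u, v}#}) {p, q}" for p q
    unfolding cnt W_def by (simp only: diff_mult_distrib2)
  have "wp (edge_com unit_del) (edge_time Ob N B) (\<lambda>h'. (\<exists>x'. rep n (mm h' s) x' \<and> inside n x' \<and> good n B x' \<and>
    wt x' = W B) \<and> frame etmps s F8 h h') h"
  proof (rule edge_wp[where W = W, OF sl(1) B(1) u(1) v(1) x(1-3) W0])
    fix h1 x1 t assume a: "rg h1 ''sl'' = s" "rg h1 ''B'' = B" "rg h1 ''s'' = u" "rg h1 ''h'' = v"
      "rep n (mm h1 s) x1" "inside n x1" "good n B x1" "wt x1 = W t" "t < B"
    have hv: "heavy B x1 u v"
      unfolding heavy_wt a(8) W_def by simp
    have le: "wt x1 p q \<le> B * count E {p, q}" for p q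
      unfolding a(8) W_def by simp
    \<comment> \<open>After \<open>t < B\<close> removals a unit is left, since even a single copy
      of the edge contributes \<open>B\<close> units.\<close>
    have "1 \<le> count E {u, v}" using E by (simp add: Suc_le_eq)
    then have "B * 1 \<le> B * count E {u, v}" by (rule mult_le_mono2)
    then have "t < B * count E {u, v}" using a(9) by linarith
    then have pw: "0 < wt x1 u v" unfolding a(8) W_def by (simp only: simp_thms of_bool_eq mult_1_right zero_less_diff)
    have D': "deg n x1 p \<le> Dm" if "p < n" for p using D[OF a(6,7) le that] by simp
    have "wp unit_del (unit_time Ob N) (\<lambda>h'. \<exists>x'. rep n (mm h' s) x' \<and> inside n x' \<and> good n B x' \<and>
       (\<forall>p q. wt x' p q = wt x1 p q - of_bool ({p, q} = {u, v})) \<and> frame ctmps s F8 h1 h') h1"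
      by (rule unit_del_wp[OF a(1) sl(2) a(2) B(2) a(3) u(2) a(4) v(2) uv a(5-7) hv pw D' Z4 Ob N])
    then show "wp unit_del (unit_time Ob N) (\<lambda>h'. \<exists>x'. rep n (mm h' s) x' \<and> inside n x' \<and> good n B x' \<and>
        wt x' = W (Suc t) \<and> frame ctmps s F8 h1 h') h1"
    proof (rule wp_mono)
      fix h' assume "\<exists>x'. rep n (mm h' s) x' \<and> inside n x' \<and> good n B x' \<and>
       (\<forall>p q. wt x' p q = wt x1 p q - of_bool ({p, q} = {u, v})) \<and> frame ctmps s F8 h1 h'"
      then obtain x' where x': "rep n (mm h' s) x' \<and> inside n x' \<and> good n B x' \<and>
       (\<forall>p q. wt x' p q = wt x1 p q - of_bool ({p, q} = {u, v})) \<and> frame ctmps s F8 h1 h'" by (elim exE)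
      then have "\<forall>p q. wt x' p q = wt x1 p q - of_bool ({p, q} = {u, v})" by simp
      then have "wt x' = W (Suc t)" unfolding fun_eq_iff a(8) W_def by simp
      then show "\<exists>x'. rep n (mm h' s) x' \<and> inside n x' \<and> good n B x' \<and>
        wt x' = W (Suc t) \<and> frame ctmps s F8 h1 h'" using x' by (intro exI[of _ x']) simp
    qed simp
  qed
  then show ?thesis
  proof (rule wp_mono)
    fix h' assume a: "(\<exists>x'. rep n (mm h' s) x' \<and> inside n x' \<and> good n B x' \<and> wt x' = W B) \<and> frame etmps s F8 h h'"
    from conjunct1[OF a] obtain x' where "rep n (mm h' s) x' \<and> inside n x' \<and> good n B x' \<and> wt x' = W B"
      by (elim exE)
    then have "bankst n B (mm h' s) (E - {#{u, v}#})" unfolding bankst_def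
      by (intro exI[of _ x']) (simp only: WB simp_thms)
    then show "bankst n B (mm h' s) (E - {#{u, v}#}) \<and> frame etmps s F8 h h'" using a by simp
  qed simp
qed

end

section \<open>The edge array and its prefixes\<close>

type_synonym elist = "(nat \<times> nat) list"

definition eset :: "nat \<times> nat \<Rightarrow> nat set" where
  "eset e = {fst e, snd e}"

definition cont :: "elist \<Rightarrow> nat \<Rightarrow> edges" where
  "cont L f = mset (map eset (take f L))"

text \<open>Increasing pairs give every edge a unique index in the tables of copies.\<close>

definition pairs_ok :: "nat \<Rightarrow> elist \<Rightarrow> bool" where
  "pairs_ok n L \<longleftrightarrow> (\<forall>e\<in>set L. fst e < snd e \<and> snd e < n)"

text \<open>The edge array: position \<open>p\<close> holds the \<open>k\<close>-th copy of the pair \<open>L ! p\<close>, and the positions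
  of all copies of a pair can be looked up.\<close>

definition arr :: "nat \<Rightarrow> bank \<Rightarrow> elist \<Rightarrow> bool" where
  "arr n G L \<longleftrightarrow> pairs_ok n L \<and>
     (\<forall>p<length L. G (0, 0, 0, p) = fst (L ! p) \<and> G (1, 0, 0, p) = snd (L ! p) \<and>
        G (2, 0, 0, p) < G (3, fst (L ! p), snd (L ! p), 0) \<and>
        G (4, fst (L ! p), snd (L ! p), G (2, 0, 0, p)) = p) \<and>
     (\<forall>u<n. \<forall>v<n. \<forall>k < G (3, u, v, 0). G (4, u, v, k) < length L \<and> L ! G (4, u, v, k) = (u, v) \<and>
        G (2, 0, 0, G (4, u, v, k)) = k)"

lemma arrD1:
  assumes "arr n G L" "p < length L"
  shows "G (0, 0, 0, p) = fst (L ! p)" "G (1, 0, 0, p) = snd (L ! p)"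
    "G (2, 0, 0, p) < G (3, fst (L ! p), snd (L ! p), 0)" "G (4, fst (L ! p), snd (L ! p), G (2, 0, 0, p)) = p"
    "fst (L ! p) < n" "snd (L ! p) < n" "fst (L ! p) < snd (L ! p)"
proof -
  have "L ! p \<in> set L" using assms(2) by simp
  then have "fst (L ! p) < snd (L ! p) \<and> snd (L ! p) < n" using assms(1) unfolding arr_def pairs_ok_def by blast
  then show "fst (L ! p) < n" "snd (L ! p) < n" "fst (L ! p) < snd (L ! p)" by simp_all
qed (use assms in \<open>simp_all add: arr_def\<close>)

lemma arrD2:
  assumes "arr n G L" "u < n" "v < n" "k < G (3, u, v, 0)"
  shows "G (4, u, v, k) < length L" "L ! G (4, u, v, k) = (u, v)" "G (2, 0, 0, G (4, u, v, k)) = k"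
  using assms by (simp_all add: arr_def)

text \<open>Field 2 inverts field 4, so different copies of a pair occupy different positions of the
  array.\<close>

lemma arr_mult_le:
  assumes "arr n G L" "u < n" "v < n"
  shows "G (3, u, v, 0) \<le> length L"
proof -
  have "inj_on (\<lambda>k. G (4, u, v, k)) {..<G (3, u, v, 0)}"
    by (rule inj_on_inverseI[where g = "\<lambda>p. G (2, 0, 0, p)"]) (use arrD2[OF assms] in simp)
  moreover have "(\<lambda>k. G (4, u, v, k)) ` {..<G (3, u, v, 0)} \<subseteq> {..<length L}"
    using arrD2(1)[OF assms] by (simp add: image_subset_iff)
  ultimately have "card {..<G (3, u, v, 0)} \<le> card {..<length L}" by (rule card_inj_on_le) simp
  then show ?thesis by simp
qed

lemma arr_snoc:
  assumes A: "arr n G L" and uv: "u < v" "v < n"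
    and G': "G' = G((0, 0, 0, length L) := u, (1, 0, 0, length L) := v, (2, 0, 0, length L) := G (3, u, v, 0),
      (4, u, v, G (3, u, v, 0)) := length L, (3, u, v, 0) := Suc (G (3, u, v, 0)))"
  shows "arr n G' (L @ [(u, v)])"
proof -
  define K where "K = G (3, u, v, 0)"
  have ok: "pairs_ok n (L @ [(u, v)])" using A uv by (simp add: arr_def pairs_ok_def)
  have 1: "G' (0, 0, 0, p) = fst ((L @ [(u, v)]) ! p) \<and> G' (1, 0, 0, p) = snd ((L @ [(u, v)]) ! p) \<and>
        G' (2, 0, 0, p) < G' (3, fst ((L @ [(u, v)]) ! p), snd ((L @ [(u, v)]) ! p), 0) \<and>
        G' (4, fst ((L @ [(u, v)]) ! p), snd ((L @ [(u, v)]) ! p), G' (2, 0, 0, p)) = p"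
    if "p < length (L @ [(u, v)])" for p
  proof (cases "p = length L")
    case True
    then show ?thesis by (simp add: G' nth_append)
  next
    case False
    then have p: "p < length L" using that by simp
    note a = arrD1[OF A p]
    have n1: "(L @ [(u, v)]) ! p = L ! p" using p by (simp add: nth_append)
    have g2: "G' (2, 0, 0, p) = G (2, 0, 0, p)" using p by (simp add: G')
    have g3: "G (3, fst (L ! p), snd (L ! p), 0) \<le> G' (3, fst (L ! p), snd (L ! p), 0)"
      by (cases "fst (L ! p) = u"; cases "snd (L ! p) = v") (simp_all add: G')
    have g4: "G' (4, fst (L ! p), snd (L ! p), G (2, 0, 0, p)) = p"
    proof (cases "fst (L ! p) = u \<and> snd (L ! p) = v \<and> G (2, 0, 0, p) = K")
      case True
      then show ?thesis using a(3) by (simp add: K_def)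
    next
      case False
      then have "(4, fst (L ! p), snd (L ! p), G (2, 0, 0, p)) \<noteq> (4 :: nat, u, v, K)" by blast
      then have "G' (4, fst (L ! p), snd (L ! p), G (2, 0, 0, p)) = G (4, fst (L ! p), snd (L ! p), G (2, 0, 0, p))"
        unfolding G' K_def[symmetric] by auto
      then show ?thesis using a(4) by simp
    qed
    have g01: "G' (0, 0, 0, p) = G (0, 0, 0, p)" "G' (1, 0, 0, p) = G (1, 0, 0, p)" using p by (simp_all add: G')
    show ?thesis unfolding n1 g2 g01 using g3 g4 a(1-3) by simp
  qed
  have 2: "G' (4, u', v', k) < length (L @ [(u, v)]) \<and> (L @ [(u, v)]) ! G' (4, u', v', k) = (u', v') \<and>
        G' (2, 0, 0, G' (4, u', v', k)) = k" if "u' < n" "v' < n" "k < G' (3, u', v', 0)" for u' v' k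
  proof (cases "u' = u \<and> v' = v \<and> k = K")
    case True
    then show ?thesis by (simp add: G' K_def nth_append)
  next
    case False
    then have g4: "G' (4, u', v', k) = G (4, u', v', k)" unfolding G' K_def[symmetric] by auto
    have k: "k < G (3, u', v', 0)"
    proof (cases "u' = u \<and> v' = v")
      case True
      then have "k < Suc K" using that(3) by (simp add: G' K_def)
      then show ?thesis using True False by (simp add: K_def)
    next
      case F: False
      then have "(3 :: nat, u', v', 0 :: nat) \<noteq> (3, u, v, 0)" by blast
      then show ?thesis using that(3) F unfolding G' by (auto split: if_splits)
    qed
    note a = arrD2[OF A that(1,2) k]
    show ?thesis unfolding g4 using a by (simp add: nth_append G')
  qed
  show ?thesis unfolding arr_def using ok 1 2 by blast
qed

definition del_at :: "elist \<Rightarrow> nat \<Rightarrow> elist" where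
  "del_at L x = butlast (L[x := last L])"

text \<open>The last copy of \<open>(u, v)\<close> is removed and the last entry of the array moves
  to its position \<open>x\<close>, so nothing else shifts. The moved entry may be another copy of
  \<open>(u, v)\<close>, or the removed entry itself; hence the case distinctions.\<close>

lemma arr_del:
  assumes A: "arr n G L" and uv: "u < n" "v < n" and K: "Suc K = G (3, u, v, 0)" and x: "x = G (4, u, v, K)"
    and m: "Suc m = length L" and a: "a = G (0, 0, 0, m)" and b: "b = G (1, 0, 0, m)" and k: "k = G (2, 0, 0, m)"
    and G': "G' = G((3, u, v, 0) := K, (0, 0, 0, x) := a, (1, 0, 0, x) := b, (2, 0, 0, x) := k, (4, a, b, k) := x)"
  shows "arr n G' (del_at L x)"
proof -
  note e = arrD2[OF A uv, of K, unfolded K[symmetric], OF lessI, folded x]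
  have mL: "m < length L" using m by simp
  note z = arrD1[OF A mL, folded a b k]
  have ab: "fst (L ! m) = a" "snd (L ! m) = b" "a < n" "b < n" using z a b by simp_all
  have Lm: "L ! m = (a, b)" using ab by (metis prod.collapse)
  have k4: "G (4, a, b, k) = m" "k < G (3, a, b, 0)" using z(3,4) ab by simp_all
  have len: "length (del_at L x) = m" using m by (simp add: del_at_def)
  have lst: "last L = (a, b)" using Lm m by (metis diff_Suc_1 last_conv_nth length_0_conv nat.distinct(1))
  have nthd: "del_at L x ! p = (if p = x then (a, b) else L ! p)" if "p < m" for p
    using that m e(1) by (simp add: del_at_def nth_butlast nth_list_update lst)
  have ok: "pairs_ok n (del_at L x)"
    unfolding pairs_ok_def
  proof
    fix w assume "w \<in> set (del_at L x)"
    then obtain p where p: "p < m" "w = del_at L x ! p" by (metis in_set_conv_nth len)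
    have "w = (if p = x then L ! m else L ! p)" using p nthd[OF p(1)] Lm by simp
    moreover have "L ! m \<in> set L" "L ! p \<in> set L" using mL p(1) by simp_all
    ultimately have "w \<in> set L" by simp
    then show "fst w < snd w \<and> snd w < n" using A unfolding arr_def pairs_ok_def by blast
  qed
  have 1: "G' (0, 0, 0, p) = fst (del_at L x ! p) \<and> G' (1, 0, 0, p) = snd (del_at L x ! p) \<and>
        G' (2, 0, 0, p) < G' (3, fst (del_at L x ! p), snd (del_at L x ! p), 0) \<and>
        G' (4, fst (del_at L x ! p), snd (del_at L x ! p), G' (2, 0, 0, p)) = p" if p: "p < length (del_at L x)" for p
  proof (cases "p = x")
    case True
    have d: "del_at L x ! p = (a, b)" using nthd p len True by simp
    have xm: "x \<noteq> m" using p len True by simp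
    have "k < G' (3, a, b, 0)"
    proof (cases "a = u \<and> b = v")
      case T: True
      then have "k \<noteq> K" using k4(1) x xm by auto
      then show ?thesis using k4(2) T K by (simp add: G')
    next
      case False
      then have "(3 :: nat, a, b, 0 :: nat) \<noteq> (3, u, v, 0)" by blast
      then have "G' (3, a, b, 0) = G (3, a, b, 0)" unfolding G' by auto
      then show ?thesis using k4(2) by simp
    qed
    then show ?thesis unfolding d using True by (simp add: G')
  next
    case False
    have pm: "p < m" using p len by simp
    then have pL: "p < length L" using m by simp
    have d: "del_at L x ! p = L ! p" using nthd[OF pm] False by simp
    note y = arrD1[OF A pL]
    have g012: "G' (0, 0, 0, p) = G (0, 0, 0, p)" "G' (1, 0, 0, p) = G (1, 0, 0, p)" "G' (2, 0, 0, p) = G (2, 0, 0, p)"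
      using False by (simp_all add: G')
    have g4: "G' (4, fst (L ! p), snd (L ! p), G (2, 0, 0, p)) = p"
    proof (cases "fst (L ! p) = a \<and> snd (L ! p) = b \<and> G (2, 0, 0, p) = k")
      case True
      then have "p = m" using y(4) k4(1) by simp
      then show ?thesis using pm by simp
    next
      case F: False
      then have "(4, fst (L ! p), snd (L ! p), G (2, 0, 0, p)) \<noteq> (4 :: nat, a, b, k)" by blast
      then have "G' (4, fst (L ! p), snd (L ! p), G (2, 0, 0, p)) = G (4, fst (L ! p), snd (L ! p), G (2, 0, 0, p))"
        unfolding G' by auto
      then show ?thesis using y(4) by simp
    qed
    have g3: "G (2, 0, 0, p) < G' (3, fst (L ! p), snd (L ! p), 0)"
    proof (cases "fst (L ! p) = u \<and> snd (L ! p) = v")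
      case True
      then have "G (2, 0, 0, p) \<noteq> K" using y(4) x False by auto
      then show ?thesis using y(3) True K by (simp add: G')
    next
      case F: False
      then have "(3 :: nat, fst (L ! p), snd (L ! p), 0 :: nat) \<noteq> (3, u, v, 0)" by blast
      then have "G' (3, fst (L ! p), snd (L ! p), 0) = G (3, fst (L ! p), snd (L ! p), 0)" unfolding G' by auto
      then show ?thesis using y(3) by simp
    qed
    show ?thesis unfolding d g012 using g3 g4 y(1,2) by simp
  qed
  have 2: "G' (4, u', v', l) < length (del_at L x) \<and> del_at L x ! G' (4, u', v', l) = (u', v') \<and>
        G' (2, 0, 0, G' (4, u', v', l)) = l" if q: "u' < n" "v' < n" "l < G' (3, u', v', 0)" for u' v' l
  proof -
    have l: "l < G (3, u', v', 0) \<and> \<not> (u' = u \<and> v' = v \<and> l = K)"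
    proof (cases "u' = u \<and> v' = v")
      case True
      then have "l < K" using q(3) by (simp add: G')
      then show ?thesis using True K[symmetric] by simp
    next
      case F: False
      then have "(3 :: nat, u', v', 0 :: nat) \<noteq> (3, u, v, 0)" by blast
      then have "G' (3, u', v', 0) = G (3, u', v', 0)" unfolding G' by auto
      then show ?thesis using q(3) F by auto
    qed
    note y = arrD2[OF A q(1,2) conjunct1[OF l]]
    have yx: "G (4, u', v', l) \<noteq> x"
    proof
      assume "G (4, u', v', l) = x"
      then have "(u', v') = (u, v)" "l = K" using y e by simp_all
      then show False using l by simp
    qed
    show ?thesis
    proof (cases "u' = a \<and> v' = b \<and> l = k")
      case True
      then have "G (4, u', v', l) = m" using k4 by simp
      then have "x \<noteq> m" using yx by simp
      then have xm: "x < m" using e(1) m by simp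
      have g: "G' (4, u', v', l) = x" using True by (simp add: G')
      show ?thesis unfolding g using True xm nthd[OF xm] len by (simp add: G')
    next
      case False
      then have "(4, u', v', l) \<noteq> (4 :: nat, a, b, k)" by blast
      then have g: "G' (4, u', v', l) = G (4, u', v', l)" unfolding G' by auto
      have "G (4, u', v', l) \<noteq> m"
      proof
        assume y': "G (4, u', v', l) = m"
        then have "(u', v') = (a, b)" "l = k" using y Lm k by simp_all
        then show False using False by simp
      qed
      then have ym: "G (4, u', v', l) < m" using y(1) m by simp
      show ?thesis unfolding g using ym nthd[OF ym] yx y len by (simp add: G')
    qed
  qed
  show ?thesis unfolding arr_def using ok 1 2 by blast
qed

lemma cont_Suc: "f < length L \<Longrightarrow> cont L (Suc f) = add_mset (eset (L ! f)) (cont L f)"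
  by (simp add: cont_def take_Suc_conv_app_nth)

lemma cont_append: "f \<le> length L \<Longrightarrow> cont (L @ K) f = cont L f"
  by (simp add: cont_def)

lemma cont_mono: "f \<le> g \<Longrightarrow> cont L f \<subseteq># cont L g"
  unfolding cont_def
  by (metis le_add_diff_inverse map_append mset_append mset_subset_eq_add_left take_add)

text \<open>A prefix that contains position \<open>x\<close> but not the last entry exchanges one
  edge for another, and a shorter prefix is unaffected. So a partly filled bank follows with one
  deletion and one insertion.\<close>

lemma cont_del_le:
  assumes "Suc m = length L" "f \<le> m" "x < length L"
  shows "cont (del_at L x) f = (if x < f then add_mset (eset (L ! m)) (cont L f - {#eset (L ! x)#}) else cont L f)"
proof -
  have "L \<noteq> []" using assms(1) by auto
  then have lst: "last L = L ! m" using last_conv_nth[of L] assms(1)[symmetric] by simp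
  have t: "take f (del_at L x) = take f (L[x := L ! m])"
    using assms lst by (simp add: del_at_def take_butlast)
  show ?thesis
  proof (cases "x < f")
    case True
    have "map eset (take f (L[x := L ! m])) = (map eset (take f L))[x := eset (L ! m)]"
      by (simp add: take_update_swap map_update)
    then have "cont (del_at L x) f = mset ((map eset (take f L))[x := eset (L ! m)])" by (simp add: cont_def t)
    also have "\<dots> = add_mset (eset (L ! m)) (mset (map eset (take f L)) - {#map eset (take f L) ! x#})"
      by (rule mset_update) (use True assms in simp)
    finally show ?thesis using True assms by (simp add: cont_def)
  next
    case False
    then show ?thesis by (simp add: cont_def t)
  qed
qed

lemma cont_all: "cont L (length L) = mset (map eset L)"
  by (simp add: cont_def)

lemma cont_edges_ok:
  assumes "pairs_ok n L"
  shows "edges_ok n (cont L f)"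
  unfolding edges_ok_def
proof
  fix e assume "e \<in># cont L f"
  then obtain w where w: "w \<in> set (take f L)" "e = eset w" by (auto simp: cont_def)
  have "w \<in> set L" using in_set_takeD[OF w(1)] .
  then have "fst w < snd w" "snd w < n" using assms unfolding pairs_ok_def by simp_all
  then show "\<exists>u v. u < n \<and> v < n \<and> u \<noteq> v \<and> e = {u, v}"
    using w(2) by (intro exI[of _ "fst w"] exI[of _ "snd w"]) (simp add: eset_def)
qed

lemma size_cont: "f \<le> length L \<Longrightarrow> size (cont L f) = f"
  by (simp add: cont_def)

section \<open>Growing and shrinking the prefix held by a bank\<close>

definition gl :: "nat \<Rightarrow> hexp \<Rightarrow> hexp" where
  "gl f p = HL f (HC 2) (HC 0) (HC 0) p"

definition load_code :: "hexp \<Rightarrow> scom" where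
  "load_code p = SQ (SA ''l'' p) (SQ (SA ''s'' (gl 0 (HV ''l''))) (SQ (SA ''h'' (gl 1 (HV ''l'')))
     (SA ''B'' (fld 8 (HC 0) (HC 0) (HC 0)))))"

abbreviation "fill \<equiv> fld 9 (HC 0) (HC 0) (HC 0)"

definition set_fill :: "hexp \<Rightarrow> scom" where
  "set_fill e = put 9 (HC 0) (HC 0) (HC 0) e"

definition grow_com :: com where
  "grow_com = While (hcomp (hless fill (HV ''T''))) (Seq (scomp (load_code fill))
     (Seq (edge_com unit_ins) (scomp (set_fill (hplus fill (HC 1))))))"

definition shrink_com :: com where
  "shrink_com = While (hcomp (hless (HV ''T'') fill)) (Seq (scomp (load_code (hminus fill (HC 1))))
     (Seq (edge_com unit_del) (scomp (set_fill (hminus fill (HC 1))))))"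

definition step_time :: "nat \<Rightarrow> nat" where
  "step_time te = stime (load_code (hminus fill (HC 1))) + stime (load_code fill) + te +
     stime (set_fill (hplus fill (HC 1))) + stime (set_fill (hminus fill (HC 1))) + 1 +
     exp_cost (hcomp (hless fill (HV ''T''))) + exp_cost (hcomp (hless (HV ''T'') fill))"

definition gtmps :: "string set" where
  "gtmps = {''l'', ''s'', ''h'', ''B''} \<union> etmps"

definition F9 :: "nat set" where "F9 = insert 9 F8"

definition bnk :: "nat \<Rightarrow> hstate \<Rightarrow> nat \<Rightarrow> elist \<Rightarrow> nat \<Rightarrow> nat \<Rightarrow> bool" where
  "bnk n h s L f B \<longleftrightarrow> mm h s (9, 0, 0, 0) = f \<and> mm h s (8, 0, 0, 0) = B \<and> f \<le> length L \<and>
     bankst n B (mm h s) (cont L f)"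

lemma bankst_cong:
  assumes "bankst n B b E" "\<And>f u v k. f < 8 \<Longrightarrow> b' (f, u, v, k) = b (f, u, v, k)"
  shows "bankst n B b' E"
proof -
  have "rep n b' x \<longleftrightarrow> rep n b x" for x
    unfolding rep_def xrep_def classes_def lists_def using assms(2) by simp
  then show ?thesis using assms(1) unfolding bankst_def by simp
qed

lemma gl_simps [simp]: "hval (gl f p) h = mm h 2 (f, 0, 0, hval p h)" "hok n (gl f p) h \<longleftrightarrow> hok n p h \<and> 0 < n"
  "hsize (gl f p) = 8 + hsize p" "hconst (gl f p) \<longleftrightarrow> f < 16 \<and> hconst p"
  by (auto simp: gl_def)

lemma load_sstat [simp]: "sstat (load_code fill)" "sstat (load_code (hminus fill (HC 1)))"
  "sstat (set_fill (hplus fill (HC 1)))" "sstat (set_fill (hminus fill (HC 1)))"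
  "hstat (hless fill (HV ''T''))" "hstat (hless (HV ''T'') fill)" "sstat (load_code (HV x))"
  by (simp_all add: load_code_def set_fill_def hstat_def)

lemma gtmps_facts: "''sl'' \<notin> gtmps" "''T'' \<notin> gtmps" "''m'' \<notin> gtmps" "''x'' \<notin> gtmps"
  "etmps \<subseteq> gtmps" "''l'' \<in> gtmps" "''s'' \<in> gtmps" "''h'' \<in> gtmps" "''B'' \<in> gtmps"
  by (auto simp: gtmps_def etmps_def ctmps_def stmps_def tmps_def)

text \<open>\<open>te\<close> bounds the time of one edge operation on a bank with parameter \<open>B\<close> and at most the
  edges \<open>E\<close>.\<close>

definition okB :: "nat \<Rightarrow> nat \<Rightarrow> nat \<Rightarrow> nat \<Rightarrow> edges \<Rightarrow> bool" where
  "okB n Z te B E \<longleftrightarrow> (\<exists>Dm Ob N. 0 < B \<and> 4 * Dm + 16 \<le> Z \<and> 2 * Dm div B + 1 \<le> Ob \<and> pot B Dm \<le> real N \<and>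
     edge_time Ob N B \<le> te \<and>
     (\<forall>x p. inside n x \<longrightarrow> good n B x \<longrightarrow> (\<forall>p q. wt x p q \<le> B * count E {p, q}) \<longrightarrow> p < n \<longrightarrow> deg n x p + 1 \<le> Dm))"

text \<open>Fewer edges admit fewer orientations to be bounded. So a bound for the whole array pays
  for the operations on all its prefixes.\<close>

lemma okB_mono:
  assumes "okB n Z te B E'" "E \<subseteq># E'"
  shows "okB n Z te B E"
proof -
  have "B * count E e \<le> B * count E' e" for e using assms(2) by (simp add: subseteq_mset_def)
  then have "(\<forall>p q. wt x p q \<le> B * count E {p, q}) \<longrightarrow> (\<forall>p q. wt x p q \<le> B * count E' {p, q})" for x
    by (meson order.trans)
  then show ?thesis using assms(1) unfolding okB_def by metis
qed

context ram
begin

lemma okB_ins_wp: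
  assumes h: "rg h ''sl'' = s" "s < 4" "rg h ''B'' = B" "rg h ''s'' = u" "u < n" "rg h ''h'' = v" "v < n" "u \<noteq> v"
    and b: "bankst n B (mm h s) E" and ok: "okB n Z te B (add_mset {u, v} E)"
  shows "wp (edge_com unit_ins) te (\<lambda>h'. bankst n B (mm h' s) (add_mset {u, v} E) \<and> frame etmps s F8 h h') h"
proof -
  obtain Dm Ob N where o: "0 < B \<and> 4 * Dm + 16 \<le> Z \<and> 2 * Dm div B + 1 \<le> Ob \<and> pot B Dm \<le> real N \<and>
     edge_time Ob N B \<le> te \<and>
     (\<forall>x p. inside n x \<longrightarrow> good n B x \<longrightarrow> (\<forall>p q. wt x p q \<le> B * count (add_mset {u, v} E) {p, q}) \<longrightarrow> p < n \<longrightarrow> deg n x p + 1 \<le> Dm)"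
    using ok unfolding okB_def by (elim exE)
  then have B: "0 < B" "4 * Dm + 16 \<le> Z" "2 * Dm div B + 1 \<le> Ob" "pot B Dm \<le> real N" "edge_time Ob N B \<le> te"
    by simp_all
  have D: "deg n x p + 1 \<le> Dm" if "inside n x" "good n B x"
    "\<And>p q. wt x p q \<le> B * count (add_mset {u, v} E) {p, q}" "p < n" for x p
    using o that by simp
  show ?thesis
    by (rule wp_mono[OF edge_ins_wp[OF h(1,2,3) B(1) h(4-8) b D B(2-4)] B(5)])
qed

lemma okB_del_wp:
  assumes h: "rg h ''sl'' = s" "s < 4" "rg h ''B'' = B" "rg h ''s'' = u" "u < n" "rg h ''h'' = v" "v < n" "u \<noteq> v"
    and b: "bankst n B (mm h s) E" and E: "{u, v} \<in># E" and ok: "okB n Z te B E"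
  shows "wp (edge_com unit_del) te (\<lambda>h'. bankst n B (mm h' s) (E - {#{u, v}#}) \<and> frame etmps s F8 h h') h"
proof -
  obtain Dm Ob N where o: "0 < B \<and> 4 * Dm + 16 \<le> Z \<and> 2 * Dm div B + 1 \<le> Ob \<and> pot B Dm \<le> real N \<and>
     edge_time Ob N B \<le> te \<and>
     (\<forall>x p. inside n x \<longrightarrow> good n B x \<longrightarrow> (\<forall>p q. wt x p q \<le> B * count E {p, q}) \<longrightarrow> p < n \<longrightarrow> deg n x p + 1 \<le> Dm)"
    using ok unfolding okB_def by (elim exE)
  then have B: "0 < B" "4 * Dm + 16 \<le> Z" "2 * Dm div B + 1 \<le> Ob" "pot B Dm \<le> real N" "edge_time Ob N B \<le> te"
    by simp_all
  have D: "deg n x p + 1 \<le> Dm" if "inside n x" "good n B x"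
    "\<And>p q. wt x p q \<le> B * count E {p, q}" "p < n" for x p
    using o that by simp
  show ?thesis
    by (rule wp_mono[OF edge_del_wp[OF h(1,2,3) B(1) h(4-8) b E D B(2-4)] B(5)])
qed

lemma load_wps:
  assumes sl: "rg h ''sl'' = s" "s < 4" and p: "hok n pe h" "hval pe h = p" "p < length L" "length L \<le> Z"
    and A: "arr n (mm h 2) L" and B: "mm h s (8, 0, 0, 0) = B" "B \<le> Z"
  shows "wps (load_code pe) (\<lambda>h'. rg h' ''s'' = fst (L ! p) \<and> rg h' ''h'' = snd (L ! p) \<and> rg h' ''B'' = B \<and>
     mm h' = mm h \<and> (\<forall>x. x \<notin> {''l'', ''s'', ''h'', ''B''} \<longrightarrow> rg h' x = rg h x)) h"
proof -
  note a = arrD1[OF A p(3)]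
  have "fst (L ! p) \<le> Z" "snd (L ! p) \<le> Z" "p \<le> Z" using a(5,6) n_le p(3,4) by simp_all
  then show ?thesis using sl p(1,2) a(1,2) B n_pos by (simp add: load_code_def rg_setr)
qed

lemma frame_load:
  assumes "mm h' = mm h" "\<forall>x. x \<notin> {''l'', ''s'', ''h'', ''B''} \<longrightarrow> rg h' x = rg h x"
  shows "frame gtmps s F9 h h'"
  using assms by (simp add: frame_def gtmps_def)

lemma frame_fill: "frame gtmps s F9 h (setm h s (9, 0, 0, 0) v)"
  by (simp add: frame_def F9_def mm_setm)

lemma frame_e: "frame etmps s F8 h h' \<Longrightarrow> frame gtmps s F9 h h'"
  by (erule frame_mono) (auto simp: gtmps_def F9_def)

lemma bankst_set_fill: "bankst n B ((mm h s)((9, 0, 0, 0) := v)) E \<longleftrightarrow> bankst n B (mm h s) E"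
proof
  assume "bankst n B ((mm h s)((9, 0, 0, 0) := v)) E"
  then show "bankst n B (mm h s) E" by (rule bankst_cong) simp
next
  assume "bankst n B (mm h s) E"
  then show "bankst n B ((mm h s)((9, 0, 0, 0) := v)) E" by (rule bankst_cong) simp
qed

text \<open>All contents met on the way are contained in \<open>cont L T\<close>, so a single
  instance of \<open>okB\<close> pays for every insertion.\<close>

lemma grow_wp:
  assumes sl: "rg h ''sl'' = s" "s < 2" and T: "rg h ''T'' = T" "T \<le> length L" "length L \<le> Z"
    and A: "arr n (mm h 2) L" and b: "bnk n h s L f B" and B: "B \<le> Z"
    and ok: "f < T \<Longrightarrow> okB n Z te B (cont L T)" and k: "T - f \<le> k"
  shows "wp grow_com ((k + 1) * step_time te) (\<lambda>h'. bnk n h' s L (max f T) B \<and> frame gtmps s F9 h h') h"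
proof -
  define I where "I k' h2 \<longleftrightarrow> (\<exists>f'. k' = T - f' \<and> f \<le> f' \<and> f' \<le> max f T \<and> frame gtmps s F9 h h2 \<and> bnk n h2 s L f' B)" for k' h2
  have keep: "rg h2 ''sl'' = s" "rg h2 ''T'' = T" "mm h2 2 = mm h 2" if "frame gtmps s F9 h h2" for h2
    using frame_reg[OF that gtmps_facts(1)] frame_reg[OF that gtmps_facts(2)] frame_slot[OF that, of 2] sl T by simp_all
  define tb where "tb = stime (load_code fill) + (te + stime (set_fill (hplus fill (HC 1))))"
  have "wp grow_com ((T - f) * (tb + 1 + exp_cost (hcomp (hless fill (HV ''T'')))) + 1 + exp_cost (hcomp (hless fill (HV ''T''))))
    (\<lambda>h'. bnk n h' s L (max f T) B \<and> frame gtmps s F9 h h') h"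
    unfolding grow_com_def
  proof (rule wp_while[where I = I])
    show "hstat (hless fill (HV ''T''))" by simp
    show "I (T - f) h" unfolding I_def by (intro exI[of _ f]) (simp add: b frame_refl)
    show "hok n (hless fill (HV ''T'')) h2" if I: "I k' h2" for k' h2
    proof -
      have "frame gtmps s F9 h h2" using I unfolding I_def by blast
      from keep[OF this] show ?thesis using sl n_pos by simp
    qed
  next
    fix k' h2 assume I: "I k' h2" and gd: "hval (hless fill (HV ''T'')) h2 \<noteq> 0"
    from I obtain f' where a: "k' = T - f' \<and> f \<le> f' \<and> f' \<le> max f T \<and> frame gtmps s F9 h h2 \<and> bnk n h2 s L f' B"
      unfolding I_def by (elim exE)
    then have fr: "frame gtmps s F9 h h2" and bk: "bnk n h2 s L f' B" by simp_all
    note K = keep[OF fr]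
    have f9: "mm h2 s (9, 0, 0, 0) = f'" "mm h2 s (8, 0, 0, 0) = B" "bankst n B (mm h2 s) (cont L f')"
      using bk by (simp_all add: bnk_def)
    have fT: "f' < T" using gd K f9 by (simp split: if_splits)
    then have k'0: "k' > 0" and fL: "f' < length L" using a T by simp_all
    have A2: "arr n (mm h2 2) L" using A K by simp
    note e = arrD1[OF A fL]
    have s4: "s < 4" using sl by simp
    have 1: "wp (scomp (load_code fill)) (stime (load_code fill))
     (\<lambda>h'. rg h' ''s'' = fst (L ! f') \<and> rg h' ''h'' = snd (L ! f') \<and> rg h' ''B'' = B \<and>
     mm h' = mm h2 \<and> (\<forall>x. x \<notin> {''l'', ''s'', ''h'', ''B''} \<longrightarrow> rg h' x = rg h2 x)) h2"
      by (rule wp_scom[OF _ load_wps[OF K(1) s4 _ _ fL T(3) A2 f9(2) B]]) (use K f9 n_pos s4 in simp_all)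
    have 2: "wp (Seq (edge_com unit_ins) (scomp (set_fill (hplus fill (HC 1))))) (te + stime (set_fill (hplus fill (HC 1)))) (I (k' - 1)) h3"
      if h3: "rg h3 ''s'' = fst (L ! f') \<and> rg h3 ''h'' = snd (L ! f') \<and> rg h3 ''B'' = B \<and>
        mm h3 = mm h2 \<and> (\<forall>x. x \<notin> {''l'', ''s'', ''h'', ''B''} \<longrightarrow> rg h3 x = rg h2 x)" for h3
    proof -
      have r3: "rg h3 ''s'' = fst (L ! f')" "rg h3 ''h'' = snd (L ! f')" "rg h3 ''B'' = B" "mm h3 = mm h2"
        "\<forall>x. x \<notin> {''l'', ''s'', ''h'', ''B''} \<longrightarrow> rg h3 x = rg h2 x" using h3 by - (elim conjE, assumption)+
      have s3: "rg h3 ''sl'' = s" using r3(5) K(1) by simp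
      have fr3: "frame gtmps s F9 h h3"
        by (rule frame_trans[OF fr frame_load[OF r3(4,5), of s]]) simp_all
      have es: "add_mset {fst (L ! f'), snd (L ! f')} (cont L f') = cont L (Suc f')"
        using cont_Suc[OF fL] by (simp add: eset_def)
      have "okB n Z te B (cont L (Suc f'))"
        by (rule okB_mono[OF ok cont_mono]) (use fT a in simp_all)
      then have okS: "okB n Z te B (add_mset {fst (L ! f'), snd (L ! f')} (cont L f'))" unfolding es .
      have b3: "bankst n B (mm h3 s) (cont L f')" using f9 r3 by simp
      have ne: "fst (L ! f') \<noteq> snd (L ! f')" using e(7) by simp
      have 21: "wp (edge_com unit_ins) te (\<lambda>h'. bankst n B (mm h' s) (cont L (Suc f')) \<and> frame etmps s F8 h3 h') h3"
        using okB_ins_wp[OF s3 s4 r3(3,1) e(5) r3(2) e(6) ne b3 okS] unfolding es .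
      show ?thesis
      proof (rule wp_seq[OF 21])
        fix h4 assume h4: "bankst n B (mm h4 s) (cont L (Suc f')) \<and> frame etmps s F8 h3 h4"
        then have f34: "frame etmps s F8 h3 h4" and b4: "bankst n B (mm h4 s) (cont L (Suc f'))" by simp_all
        have fr4: "frame gtmps s F9 h h4" by (rule frame_trans[OF fr3 frame_e[OF f34]]) simp_all
        have v4: "mm h4 s (9, 0, 0, 0) = f'" "mm h4 s (8, 0, 0, 0) = B"
          using frame_fld[OF f34, of 9] frame_fld[OF f34, of 8] f9 r3 by simp_all
        define h5 where "h5 = setm h4 s (9, 0, 0, 0) (Suc f')"
        have fr5: "frame gtmps s F9 h h5" unfolding h5_def by (rule frame_trans[OF fr4 frame_fill]) simp_all
        have "bnk n h5 s L (Suc f') B" unfolding bnk_def h5_def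
          using v4 fL b4 by (simp add: mm_setm bankst_set_fill)
        then have "I (k' - 1) h5" unfolding I_def
          by (intro exI[of _ "Suc f'"]) (use fr5 a fT in simp)
        then show "wp (scomp (set_fill (hplus fill (HC 1)))) (stime (set_fill (hplus fill (HC 1)))) (I (k' - 1)) h4"
          by (intro wp_scom) (use keep[OF fr4] v4 s4 n_pos fL T in \<open>simp_all add: set_fill_def h5_def hstat_def\<close>)
      qed
    qed
    have "wp (Seq (scomp (load_code fill)) (Seq (edge_com unit_ins) (scomp (set_fill (hplus fill (HC 1)))))) tb (I (k' - 1)) h2"
      unfolding tb_def by (rule wp_seq[OF 1], rule 2)
    then show "k' > 0 \<and> wp (Seq (scomp (load_code fill)) (Seq (edge_com unit_ins) (scomp (set_fill (hplus fill (HC 1)))))) tb (I (k' - 1)) h2"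
      using k'0 by simp
  next
    fix k' h2 assume I: "I k' h2" and gd: "hval (hless fill (HV ''T'')) h2 = 0"
    from I obtain f' where a: "k' = T - f' \<and> f \<le> f' \<and> f' \<le> max f T \<and> frame gtmps s F9 h h2 \<and> bnk n h2 s L f' B"
      unfolding I_def by (elim exE)
    then have fr: "frame gtmps s F9 h h2" and bk: "bnk n h2 s L f' B" by simp_all
    have "\<not> f' < T" using gd keep[OF fr] bk by (simp add: bnk_def split: if_splits)
    moreover have "f \<le> f'" "f' \<le> max f T" using a by simp_all
    ultimately have "f' = max f T" by linarith
    then show "bnk n h2 s L (max f T) B \<and> frame gtmps s F9 h h2" using bk fr by simp
  qed
  then show ?thesis
  proof (rule wp_mono)
    let ?c = "tb + 1 + exp_cost (hcomp (hless fill (HV ''T'')))"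
    have c: "?c \<le> step_time te" by (simp add: tb_def step_time_def)
    have "(T - f) * ?c + 1 + exp_cost (hcomp (hless fill (HV ''T''))) \<le> (T - f) * ?c + ?c" by simp
    also have "\<dots> \<le> k * step_time te + step_time te" by (intro add_mono mult_le_mono k c)
    finally show "(T - f) * ?c + 1 + exp_cost (hcomp (hless fill (HV ''T''))) \<le> (k + 1) * step_time te" by simp
  qed
qed

lemma shrink_wp:
  assumes sl: "rg h ''sl'' = s" "s < 2" and T: "rg h ''T'' = T" "length L \<le> Z"
    and A: "arr n (mm h 2) L" and b: "bnk n h s L f B" and B: "B \<le> Z"
    and ok: "T < f \<Longrightarrow> okB n Z te B (cont L f)" and k: "f - T \<le> k"
  shows "wp shrink_com ((k + 1) * step_time te) (\<lambda>h'. bnk n h' s L (min f T) B \<and> frame gtmps s F9 h h') h"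
proof -
  define I where "I k' h2 \<longleftrightarrow> (\<exists>f'. k' = f' - T \<and> f' \<le> f \<and> min f T \<le> f' \<and> frame gtmps s F9 h h2 \<and> bnk n h2 s L f' B)" for k' h2
  have keep: "rg h2 ''sl'' = s" "rg h2 ''T'' = T" "mm h2 2 = mm h 2" if "frame gtmps s F9 h h2" for h2
    using frame_reg[OF that gtmps_facts(1)] frame_reg[OF that gtmps_facts(2)] frame_slot[OF that, of 2] sl T by simp_all
  define tb where "tb = stime (load_code (hminus fill (HC 1))) + (te + stime (set_fill (hminus fill (HC 1))))"
  have "wp shrink_com ((f - T) * (tb + 1 + exp_cost (hcomp (hless (HV ''T'') fill))) + 1 + exp_cost (hcomp (hless (HV ''T'') fill)))
    (\<lambda>h'. bnk n h' s L (min f T) B \<and> frame gtmps s F9 h h') h"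
    unfolding shrink_com_def
  proof (rule wp_while[where I = I])
    show "hstat (hless (HV ''T'') fill)" by simp
    show "I (f - T) h" unfolding I_def by (intro exI[of _ f]) (simp add: b frame_refl)
    show "hok n (hless (HV ''T'') fill) h2" if I: "I k' h2" for k' h2
    proof -
      have "frame gtmps s F9 h h2" using I unfolding I_def by blast
      from keep[OF this] show ?thesis using sl n_pos by simp
    qed
  next
    fix k' h2 assume I: "I k' h2" and gd: "hval (hless (HV ''T'') fill) h2 \<noteq> 0"
    from I obtain f' where a: "k' = f' - T \<and> f' \<le> f \<and> min f T \<le> f' \<and> frame gtmps s F9 h h2 \<and> bnk n h2 s L f' B"
      unfolding I_def by (elim exE)
    then have fr: "frame gtmps s F9 h h2" and bk: "bnk n h2 s L f' B" by simp_all
    note K = keep[OF fr]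
    have f9: "mm h2 s (9, 0, 0, 0) = f'" "mm h2 s (8, 0, 0, 0) = B" "bankst n B (mm h2 s) (cont L f')" "f' \<le> length L"
      using bk by (simp_all add: bnk_def)
    have fT: "T < f'" using gd K f9 by (simp split: if_splits)
    obtain f1 where f1: "f' = Suc f1" using fT by (cases f') simp_all
    have k'0: "k' > 0" and fL: "f1 < length L" using a fT f9(4) f1 by simp_all
    have A2: "arr n (mm h2 2) L" using A K by simp
    note e = arrD1[OF A fL]
    have s4: "s < 4" using sl by simp
    have 1: "wp (scomp (load_code (hminus fill (HC 1)))) (stime (load_code (hminus fill (HC 1))))
     (\<lambda>h'. rg h' ''s'' = fst (L ! f1) \<and> rg h' ''h'' = snd (L ! f1) \<and> rg h' ''B'' = B \<and>
     mm h' = mm h2 \<and> (\<forall>x. x \<notin> {''l'', ''s'', ''h'', ''B''} \<longrightarrow> rg h' x = rg h2 x)) h2"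
      by (rule wp_scom[OF _ load_wps[OF K(1) s4 _ _ fL T(2) A2 f9(2) B]]) (use K f9 f1 n_pos s4 in \<open>simp_all add: load_code_def hstat_def\<close>)
    have 2: "wp (Seq (edge_com unit_del) (scomp (set_fill (hminus fill (HC 1))))) (te + stime (set_fill (hminus fill (HC 1)))) (I (k' - 1)) h3"
      if h3: "rg h3 ''s'' = fst (L ! f1) \<and> rg h3 ''h'' = snd (L ! f1) \<and> rg h3 ''B'' = B \<and>
        mm h3 = mm h2 \<and> (\<forall>x. x \<notin> {''l'', ''s'', ''h'', ''B''} \<longrightarrow> rg h3 x = rg h2 x)" for h3
    proof -
      have r3: "rg h3 ''s'' = fst (L ! f1)" "rg h3 ''h'' = snd (L ! f1)" "rg h3 ''B'' = B" "mm h3 = mm h2"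
        "\<forall>x. x \<notin> {''l'', ''s'', ''h'', ''B''} \<longrightarrow> rg h3 x = rg h2 x" using h3 by - (elim conjE, assumption)+
      have s3: "rg h3 ''sl'' = s" using r3(5) K(1) by simp
      have fr3: "frame gtmps s F9 h h3"
        by (rule frame_trans[OF fr frame_load[OF r3(4,5), of s]]) simp_all
      have es: "cont L f' = add_mset {fst (L ! f1), snd (L ! f1)} (cont L f1)"
        using cont_Suc[OF fL] by (simp add: eset_def f1)
      have okS: "okB n Z te B (cont L f')"
        by (rule okB_mono[OF ok cont_mono]) (use fT a in simp_all)
      have b3: "bankst n B (mm h3 s) (cont L f')" using f9 r3 by simp
      have ne: "fst (L ! f1) \<noteq> snd (L ! f1)" using e(7) by simp
      have inE: "{fst (L ! f1), snd (L ! f1)} \<in># cont L f'" unfolding es by simp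
      have ed: "cont L f' - {#{fst (L ! f1), snd (L ! f1)}#} = cont L f1" unfolding es by simp
      have 21: "wp (edge_com unit_del) te (\<lambda>h'. bankst n B (mm h' s) (cont L f1) \<and> frame etmps s F8 h3 h') h3"
        using okB_del_wp[OF s3 s4 r3(3,1) e(5) r3(2) e(6) ne b3 inE okS] unfolding ed .
      show ?thesis
      proof (rule wp_seq[OF 21])
        fix h4 assume h4: "bankst n B (mm h4 s) (cont L f1) \<and> frame etmps s F8 h3 h4"
        then have f34: "frame etmps s F8 h3 h4" and b4: "bankst n B (mm h4 s) (cont L f1)" by simp_all
        have fr4: "frame gtmps s F9 h h4" by (rule frame_trans[OF fr3 frame_e[OF f34]]) simp_all
        have v4: "mm h4 s (9, 0, 0, 0) = Suc f1" "mm h4 s (8, 0, 0, 0) = B"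
          using frame_fld[OF f34, of 9] frame_fld[OF f34, of 8] f9 r3 f1 by simp_all
        define h5 where "h5 = setm h4 s (9, 0, 0, 0) f1"
        have fr5: "frame gtmps s F9 h h5" unfolding h5_def by (rule frame_trans[OF fr4 frame_fill]) simp_all
        have "bnk n h5 s L f1 B" unfolding bnk_def h5_def
          using v4 fL b4 by (simp add: mm_setm bankst_set_fill)
        then have "I (k' - 1) h5" unfolding I_def
          by (intro exI[of _ f1]) (use fr5 a fT f1 in simp)
        then show "wp (scomp (set_fill (hminus fill (HC 1)))) (stime (set_fill (hminus fill (HC 1)))) (I (k' - 1)) h4"
          by (intro wp_scom) (use keep[OF fr4] v4 s4 n_pos fL T in \<open>simp_all add: set_fill_def h5_def hstat_def\<close>)
      qed
    qed
    have "wp (Seq (scomp (load_code (hminus fill (HC 1)))) (Seq (edge_com unit_del) (scomp (set_fill (hminus fill (HC 1)))))) tb (I (k' - 1)) h2"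
      unfolding tb_def by (rule wp_seq[OF 1], rule 2)
    then show "k' > 0 \<and> wp (Seq (scomp (load_code (hminus fill (HC 1)))) (Seq (edge_com unit_del) (scomp (set_fill (hminus fill (HC 1)))))) tb (I (k' - 1)) h2"
      using k'0 by simp
  next
    fix k' h2 assume I: "I k' h2" and gd: "hval (hless (HV ''T'') fill) h2 = 0"
    from I obtain f' where a: "k' = f' - T \<and> f' \<le> f \<and> min f T \<le> f' \<and> frame gtmps s F9 h h2 \<and> bnk n h2 s L f' B"
      unfolding I_def by (elim exE)
    then have fr: "frame gtmps s F9 h h2" and bk: "bnk n h2 s L f' B" by simp_all
    have "\<not> T < f'" using gd keep[OF fr] bk by (simp add: bnk_def split: if_splits)
    moreover have "f' \<le> f" "min f T \<le> f'" using a by simp_all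
    ultimately have "f' = min f T" by linarith
    then show "bnk n h2 s L (min f T) B \<and> frame gtmps s F9 h h2" using bk fr by simp
  qed
  then show ?thesis
  proof (rule wp_mono)
    let ?c = "tb + 1 + exp_cost (hcomp (hless (HV ''T'') fill))"
    have c: "?c \<le> step_time te" by (simp add: tb_def step_time_def)
    have "(f - T) * ?c + 1 + exp_cost (hcomp (hless (HV ''T'') fill)) \<le> (f - T) * ?c + ?c" by simp
    also have "\<dots> \<le> k * step_time te + step_time te" by (intro add_mono mult_le_mono k c)
    finally show "(f - T) * ?c + 1 + exp_cost (hcomp (hless (HV ''T'') fill)) \<le> (k + 1) * step_time te" by simp
  qed
qed

end

section \<open>Removing an entry of the edge array from a bank\<close>

definition swap_com :: com where
  "swap_com = Seq (scomp (load_code (HV ''x''))) (Seq (edge_com unit_del)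
     (Seq (scomp (load_code (hminus (HV ''m'') (HC 1)))) (edge_com unit_ins)))"

text \<open>Shrinking to at most \<open>m - 1\<close> entries first takes the last entry of the
  array out of the bank, so that it is free to replace entry \<open>x\<close>. Register
  \<open>m\<close> still holds the old number of edges here.\<close>

definition drop_com :: com where
  "drop_com = Seq (scomp (SA ''T'' (hminus (HV ''m'') (HC 1)))) (Seq shrink_com
     (Cond (hcomp (hless (HV ''x'') fill)) swap_com Skip))"

definition drop_time :: "nat \<Rightarrow> nat" where
  "drop_time te = stime (SA ''T'' (hminus (HV ''m'') (HC 1))) + (2 * step_time te + (1 + exp_cost (hcomp (hless (HV ''x'') fill)) +
     (stime (load_code (HV ''x'')) + (te + (stime (load_code (hminus (HV ''m'') (HC 1))) + te)) + 1)))"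

definition dtmps :: "string set" where "dtmps = insert ''T'' gtmps"

lemma drop_sstat [simp]: "sstat (load_code (hminus (HV ''m'') (HC 1)))" "hstat (hless (HV ''x'') fill)"
  "sstat (SA ''T'' (hminus (HV ''m'') (HC 1)))"
  by (simp_all add: load_code_def hstat_def)

context ram
begin

lemma wp_skip: "Q h \<Longrightarrow> wp Skip 1 Q h"
  using wp_scom[of SN Q h] by simp

lemma frame_g_d: "frame gtmps s F9 h h' \<Longrightarrow> frame dtmps s F9 h h'"
  by (erule frame_mono) (auto simp: dtmps_def)

text \<open>Deleting before inserting keeps the content inside the edge multiset of the full array,
  for which \<open>okB\<close> is available.\<close>

lemma swap_wp:
  assumes sl: "rg h ''sl'' = s" "s < 2" and m: "rg h ''m'' = Suc m" "Suc m = length L" "length L \<le> Z"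
    and x: "rg h ''x'' = x" "x < f" "f \<le> m" and A: "arr n (mm h 2) L" and b: "bnk n h s L f B" and B: "B \<le> Z"
    and ok: "okB n Z te B (cont L (length L))"
  shows "wp swap_com (stime (load_code (HV ''x'')) + (te + (stime (load_code (hminus (HV ''m'') (HC 1))) + te)))
    (\<lambda>h'. bnk n h' s (del_at L x) f B \<and> frame gtmps s F9 h h') h"
proof -
  have s4: "s < 4" using sl by simp
  have xL: "x < length L" and mL: "m < length L" using x m by simp_all
  have b0: "mm h s (9, 0, 0, 0) = f" "mm h s (8, 0, 0, 0) = B" "bankst n B (mm h s) (cont L f)"
    using b by (simp_all add: bnk_def)
  let ?ex = "{fst (L ! x), snd (L ! x)}" and ?em = "{fst (L ! m), snd (L ! m)}"
  have inx: "?ex \<in># cont L f"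
  proof -
    have "L ! x \<in> set (take f L)" using x xL by (auto simp: in_set_conv_nth intro!: exI[of _ x])
    then show ?thesis unfolding cont_def eset_def by force
  qed
  have c2: "add_mset ?em (cont L f - {#?ex#}) = cont (del_at L x) f"
    using cont_del_le[OF m(2) x(3) xL] x(2) by (simp add: eset_def)
  have full: "cont L (length L) = add_mset ?em (cont L m)" using cont_Suc[OF mL] m(2) by (simp add: eset_def)
  have sub: "cont L f - {#?ex#} \<subseteq># cont L m"
    using cont_mono[OF x(3), of L] diff_subset_eq_self subset_mset.order_trans by blast
  have okx: "okB n Z te B (cont L f)" by (rule okB_mono[OF ok cont_mono]) (use x mL in simp)
  have okm: "okB n Z te B (add_mset ?em (cont L f - {#?ex#}))"
    by (rule okB_mono[OF ok]) (use sub full in simp)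
  note ex = arrD1[OF A xL] and em = arrD1[OF A mL]
  have nex: "fst (L ! x) \<noteq> snd (L ! x)" "fst (L ! m) \<noteq> snd (L ! m)" using ex(7) em(7) by simp_all
  define R where "R p h1 h2 \<longleftrightarrow> rg h2 ''s'' = fst (L ! p) \<and> rg h2 ''h'' = snd (L ! p) \<and> rg h2 ''B'' = B \<and>
     mm h2 = mm h1 \<and> (\<forall>x. x \<notin> {''l'', ''s'', ''h'', ''B''} \<longrightarrow> rg h2 x = rg h1 x)" for p h1 h2
  have Rd: "rg h2 ''s'' = fst (L ! p)" "rg h2 ''h'' = snd (L ! p)" "rg h2 ''B'' = B" "mm h2 = mm h1"
    "\<forall>x. x \<notin> {''l'', ''s'', ''h'', ''B''} \<longrightarrow> rg h2 x = rg h1 x" if "R p h1 h2" for p h1 h2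
    using that unfolding R_def by - (elim conjE, assumption)+
  have 1: "wp (scomp (load_code (HV ''x''))) (stime (load_code (HV ''x''))) (R x h) h"
    unfolding R_def
    by (rule wp_scom[OF _ load_wps[OF sl(1) s4 _ _ xL m(3) A b0(2) B]]) (use x in simp_all)
  have 2: "wp (Seq (edge_com unit_del) (Seq (scomp (load_code (hminus (HV ''m'') (HC 1)))) (edge_com unit_ins)))
    (te + (stime (load_code (hminus (HV ''m'') (HC 1))) + te))
    (\<lambda>h'. bnk n h' s (del_at L x) f B \<and> frame gtmps s F9 h h') h1" if r: "R x h h1" for h1
  proof -
    note r1 = Rd[OF r]
    have s1: "rg h1 ''sl'' = s" using r1(5) sl by simp
    have f1: "frame gtmps s F9 h h1" by (rule frame_load[OF r1(4,5)])
    have b1: "bankst n B (mm h1 s) (cont L f)" using b0 r1 by simp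
    have 21: "wp (edge_com unit_del) te (\<lambda>h'. bankst n B (mm h' s) (cont L f - {#?ex#}) \<and> frame etmps s F8 h1 h') h1"
      by (rule okB_del_wp[OF s1 s4 r1(3,1) ex(5) r1(2) ex(6) nex(1) b1 inx okx])
    show ?thesis
    proof (rule wp_seq[OF 21])
      fix h2 assume h2: "bankst n B (mm h2 s) (cont L f - {#?ex#}) \<and> frame etmps s F8 h1 h2"
      then have f12: "frame etmps s F8 h1 h2" and b2: "bankst n B (mm h2 s) (cont L f - {#?ex#})" by simp_all
      have f2: "frame gtmps s F9 h h2" by (rule frame_trans[OF f1 frame_e[OF f12]]) simp_all
      have k2: "rg h2 ''sl'' = s" "rg h2 ''m'' = Suc m" "mm h2 2 = mm h 2"
        using frame_reg[OF f2 gtmps_facts(1)] frame_reg[OF f2 gtmps_facts(3)] frame_slot[OF f2, of 2] sl m by simp_all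
      have A2: "arr n (mm h2 2) L" using A k2 by simp
      have v2: "mm h2 s (8, 0, 0, 0) = B" "mm h2 s (9, 0, 0, 0) = f"
        using frame_fld[OF f12, of 8] frame_fld[OF f12, of 9] b0 r1 by simp_all
      have 22: "wp (scomp (load_code (hminus (HV ''m'') (HC 1)))) (stime (load_code (hminus (HV ''m'') (HC 1)))) (R m h2) h2"
        unfolding R_def
        by (rule wp_scom[OF _ load_wps[OF k2(1) s4 _ _ mL m(3) A2 v2(1) B]]) (use k2 in \<open>simp_all add: load_code_def hstat_def\<close>)
      have 23: "wp (edge_com unit_ins) te (\<lambda>h'. bnk n h' s (del_at L x) f B \<and> frame gtmps s F9 h h') h3"
        if r': "R m h2 h3" for h3
      proof -
        note r3 = Rd[OF r']
        have s3: "rg h3 ''sl'' = s" using r3(5) k2 by simp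
        have f3: "frame gtmps s F9 h h3" by (rule frame_trans[OF f2 frame_load[OF r3(4,5)]]) simp_all
        have b3: "bankst n B (mm h3 s) (cont L f - {#?ex#})" using b2 r3 by simp
        have "wp (edge_com unit_ins) te (\<lambda>h'. bankst n B (mm h' s) (cont (del_at L x) f) \<and> frame etmps s F8 h3 h') h3"
          using okB_ins_wp[OF s3 s4 r3(3,1) em(5) r3(2) em(6) nex(2) b3 okm] unfolding c2 .
        then show ?thesis
        proof (rule wp_mono)
          fix h4 assume h4: "bankst n B (mm h4 s) (cont (del_at L x) f) \<and> frame etmps s F8 h3 h4"
          then have f34: "frame etmps s F8 h3 h4" by simp
          have "frame gtmps s F9 h h4" by (rule frame_trans[OF f3 frame_e[OF f34]]) simp_all
          moreover have "mm h4 s (8, 0, 0, 0) = B" "mm h4 s (9, 0, 0, 0) = f"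
            using frame_fld[OF f34, of 8] frame_fld[OF f34, of 9] v2 r3 by simp_all
          moreover have "f \<le> length (del_at L x)" using x(3) m(2)[symmetric] by (simp add: del_at_def)
          ultimately show "bnk n h4 s (del_at L x) f B \<and> frame gtmps s F9 h h4" using h4 by (simp add: bnk_def)
        qed simp
      qed
      show "wp (Seq (scomp (load_code (hminus (HV ''m'') (HC 1)))) (edge_com unit_ins))
        (stime (load_code (hminus (HV ''m'') (HC 1))) + te)
        (\<lambda>h'. bnk n h' s (del_at L x) f B \<and> frame gtmps s F9 h h') h2"
        by (rule wp_seq[OF 22], rule 23)
    qed
  qed
  show ?thesis unfolding swap_com_def by (rule wp_seq[OF 1], rule 2)
qed

lemma drop_wp:
  assumes sl: "rg h ''sl'' = s" "s < 2" and m: "rg h ''m'' = Suc m" "Suc m = length L" "length L \<le> Z"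
    and x: "rg h ''x'' = x" "x < length L" and A: "arr n (mm h 2) L" and b: "bnk n h s L f B" and B: "B \<le> Z"
    and ok: "0 < f \<Longrightarrow> okB n Z te B (cont L (length L))"
  shows "wp drop_com (drop_time te)
    (\<lambda>h'. bnk n h' s (del_at L x) (min f m) B \<and> frame dtmps s F9 h h') h"
proof -
  define h1 where "h1 = setr h ''T'' m"
  have mZ: "m \<le> Z" using m(2,3) by linarith
  have 1: "wp (scomp (SA ''T'' (hminus (HV ''m'') (HC 1)))) (stime (SA ''T'' (hminus (HV ''m'') (HC 1)))) (\<lambda>h'. h' = h1) h"
    by (rule wp_scom) (use m(1) mZ in \<open>simp_all add: h1_def hstat_def\<close>)
  have k1: "rg h1 ''sl'' = s" "rg h1 ''T'' = m" "rg h1 ''m'' = Suc m" "rg h1 ''x'' = x" "mm h1 = mm h"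
    using sl m x by (simp_all add: h1_def rg_setr)
  have f1: "frame dtmps s F9 h h1" by (simp add: h1_def frame_def dtmps_def rg_setr)
  have A1: "arr n (mm h1 2) L" and b1: "bnk n h1 s L f B" using A b k1 by (simp_all add: bnk_def)
  have fl: "f \<le> length L" using b by (simp add: bnk_def)
  have s4: "s < 4" using sl by simp
  have 2: "wp shrink_com ((1 + 1) * step_time te) (\<lambda>h'. bnk n h' s L (min f m) B \<and> frame gtmps s F9 h1 h') h1"
    by (rule shrink_wp[OF k1(1) sl(2) k1(2) m(3) A1 b1 B])
      (use fl m(2) in \<open>simp_all add: okB_mono[OF ok cont_mono]\<close>)
  have 3: "wp (Cond (hcomp (hless (HV ''x'') fill)) swap_com Skip)
     (1 + exp_cost (hcomp (hless (HV ''x'') fill)) +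
       (stime (load_code (HV ''x'')) + (te + (stime (load_code (hminus (HV ''m'') (HC 1))) + te)) + 1))
     (\<lambda>h'. bnk n h' s (del_at L x) (min f m) B \<and> frame dtmps s F9 h h') h2"
    if h2: "bnk n h2 s L (min f m) B \<and> frame gtmps s F9 h1 h2" for h2
  proof -
    have b2: "bnk n h2 s L (min f m) B" and f12: "frame gtmps s F9 h1 h2" using h2 by simp_all
    have f2: "frame dtmps s F9 h h2" by (rule frame_trans[OF f1 frame_g_d[OF f12]]) simp_all
    have k2: "rg h2 ''sl'' = s" "rg h2 ''m'' = Suc m" "rg h2 ''x'' = x" "mm h2 2 = mm h 2"
      using frame_reg[OF f12 gtmps_facts(1)] frame_reg[OF f12 gtmps_facts(3)] frame_reg[OF f12 gtmps_facts(4)]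
        frame_slot[OF f12, of 2] k1 sl by simp_all
    have A2: "arr n (mm h2 2) L" using A k2 by simp
    have v2: "mm h2 s (9, 0, 0, 0) = min f m" using b2 by (simp add: bnk_def)
    show ?thesis
    proof (rule wp_cond)
      show "hok n (hless (HV ''x'') fill) h2" using k2 s4 n_pos by simp
    next
      assume "hval (hless (HV ''x'') fill) h2 \<noteq> 0"
      then have xf: "x < min f m" using k2 v2 by (simp split: if_splits)
      have "okB n Z te B (cont L (length L))" using ok xf by simp
      from swap_wp[OF k2(1) sl(2) k2(2) m(2,3) k2(3) xf min.cobounded2 A2 b2 B this]
      show "wp swap_com (stime (load_code (HV ''x'')) + (te + (stime (load_code (hminus (HV ''m'') (HC 1))) + te)) + 1)
         (\<lambda>h'. bnk n h' s (del_at L x) (min f m) B \<and> frame dtmps s F9 h h') h2"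
      proof (rule wp_mono)
        fix h3 assume h3: "bnk n h3 s (del_at L x) (min f m) B \<and> frame gtmps s F9 h2 h3"
        then have f23: "frame gtmps s F9 h2 h3" ..
        have "frame dtmps s F9 h h3" by (rule frame_trans[OF f2 frame_g_d[OF f23]]) simp_all
        then show "bnk n h3 s (del_at L x) (min f m) B \<and> frame dtmps s F9 h h3" using h3 by simp
      qed simp
    next
      assume "hval (hless (HV ''x'') fill) h2 = 0"
      then have xf: "\<not> x < min f m" using k2 v2 by (simp split: if_splits)
      have "cont (del_at L x) (min f m) = cont L (min f m)"
        using cont_del_le[OF m(2) min.cobounded2 x(2), of f] xf by (simp only: if_False)
      moreover have "min f m \<le> length (del_at L x)" using m(2)[symmetric] by (simp add: del_at_def)
      ultimately have "bnk n h2 s (del_at L x) (min f m) B" using b2 unfolding bnk_def by simp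
      then have "wp Skip 1 (\<lambda>h'. bnk n h' s (del_at L x) (min f m) B \<and> frame dtmps s F9 h h') h2"
        using f2 by (intro wp_skip) simp
      then show "wp Skip (stime (load_code (HV ''x'')) + (te + (stime (load_code (hminus (HV ''m'') (HC 1))) + te)) + 1)
         (\<lambda>h'. bnk n h' s (del_at L x) (min f m) B \<and> frame dtmps s F9 h h') h2"
        by (rule wp_mono) simp_all
    qed simp
  qed
  have 4: "wp (Seq shrink_com (Cond (hcomp (hless (HV ''x'') fill)) swap_com Skip))
     (2 * step_time te + (1 + exp_cost (hcomp (hless (HV ''x'') fill)) +
       (stime (load_code (HV ''x'')) + (te + (stime (load_code (hminus (HV ''m'') (HC 1))) + te)) + 1)))
     (\<lambda>h'. bnk n h' s (del_at L x) (min f m) B \<and> frame dtmps s F9 h h') h1"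
    by (rule wp_seq[OF 2[unfolded one_add_one]], rule 3)
  show ?thesis unfolding drop_com_def drop_time_def by (rule wp_seq[OF 1]) (simp only: 4)
qed

end

section \<open>Stages\<close>

text \<open>Stage \<open>j\<close> lasts while \<open>Pst j \<le> m < 4 ^ Suc j\<close>; the exception \<open>Pst 0 = 0\<close> makes the empty
  graph belong to stage 0. The new orientation of the stage, in slot \<open>j mod 2\<close>, is to contain the first
  \<open>tnew m j\<close> edges: none for \<open>m = Pst j\<close>, all from \<open>m = 2 * Pst j\<close> on. The old one, which was the new
  one of stage \<open>j - 1\<close>, is to contain \<open>told m j\<close> edges: all up to \<open>m = 2 * Pst j\<close>, none from
  \<open>m = 3 * Pst j\<close> on. So one of them is always complete, and the slots can change roles at the ends
  of the stage. An update changes both targets by at most 3.\<close>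

definition Pst :: "nat \<Rightarrow> nat" where "Pst j = (if j = 0 then 0 else 4 ^ j)"

definition tnew :: "nat \<Rightarrow> nat \<Rightarrow> nat" where "tnew m j = min m (2 * (m - Pst j))"

definition told :: "nat \<Rightarrow> nat \<Rightarrow> nat" where
  "told m j = (if 2 * m < 6 * Pst j then min m (6 * Pst j - 2 * m) else 0)"

definition nextj :: "nat \<Rightarrow> nat \<Rightarrow> nat" where
  "nextj j m = (if \<not> m < 4 ^ Suc j then Suc j else if m < Pst j then j - 1 else j)"

definition near :: "nat \<Rightarrow> nat \<Rightarrow> bool" where "near a b \<longleftrightarrow> a \<le> b + 3 \<and> b \<le> a + 3"

text \<open>The minima are there because a deletion has already clipped both prefixes to
  \<open>m'\<close>. In the last two cases the slots exchange roles: one of them is empty and its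
  new target is 0, and the other already has nearly the length that its new role demands.\<close>

lemma stage_arith:
  assumes m: "Pst j \<le> m" "m < 4 ^ Suc j" and m': "m' = Suc m \<or> m = Suc m'"
  defines "j' \<equiv> nextj j m'"
  shows "Pst j' \<le> m'" "m' < 4 ^ Suc j'"
    "(j' = j \<and> near (min (tnew m j) m') (tnew m' j) \<and> near (min (told m j) m') (told m' j)) \<or>
     (j' = Suc j \<and> told m j = 0 \<and> tnew m' j' = 0 \<and> near (min (tnew m j) m') (told m' j')) \<or>
     (j = Suc j' \<and> min (tnew m j) m' = 0 \<and> told m' j' = 0 \<and> near (min (told m j) m') (tnew m' j'))"
proof -
  consider (up) "\<not> m' < 4 ^ Suc j" | (down) "m' < 4 ^ Suc j" "m' < Pst j" | (same) "m' < 4 ^ Suc j" "\<not> m' < Pst j" by blast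
  then have "Pst j' \<le> m' \<and> m' < 4 ^ Suc j' \<and>
    ((j' = j \<and> near (min (tnew m j) m') (tnew m' j) \<and> near (min (told m j) m') (told m' j)) \<or>
     (j' = Suc j \<and> told m j = 0 \<and> tnew m' j' = 0 \<and> near (min (tnew m j) m') (told m' j')) \<or>
     (j = Suc j' \<and> min (tnew m j) m' = 0 \<and> told m' j' = 0 \<and> near (min (told m j) m') (tnew m' j')))"
  proof cases
    case up
    then have jj: "j' = Suc j" by (simp add: j'_def nextj_def)
    define Q where "Q = (4 :: nat) ^ j"
    have Q: "1 \<le> Q" by (simp add: Q_def)
    have mm: "m' = 4 * Q" "m = 4 * Q - 1" using up m m' by (auto simp: Q_def)
    have P: "Pst j = 0 \<or> Pst j = Q" "Pst (Suc j) = 4 * Q" by (simp_all add: Pst_def Q_def)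
    have "told m j = 0" using P(1) mm Q unfolding told_def by auto
    moreover have "tnew m' (Suc j) = 0" using P(2) mm by (simp add: tnew_def)
    moreover have "min (tnew m j) m' = 4 * Q - 1" using P(1) mm Q unfolding tnew_def by auto
    moreover have "told m' (Suc j) = 4 * Q" using P(2) mm Q by (simp add: told_def)
    moreover have "m' < 4 ^ Suc (Suc j)" using mm Q by (simp add: Q_def)
    moreover have "near (4 * Q - 1) (4 * Q)" unfolding near_def by linarith
    ultimately show ?thesis using jj P(2) mm by simp
  next
    case down
    have j0: "j \<noteq> 0" using down(2) by (cases j) (simp_all add: Pst_def)
    have "j' = j - 1" using down unfolding j'_def nextj_def by (simp only: if_True if_False simp_thms)
    then have jj: "j = Suc j'" using j0 by simp
    define Q where "Q = (4 :: nat) ^ j'"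
    have Q: "1 \<le> Q" by (simp add: Q_def)
    have Pj: "Pst j = 4 * Q" by (simp add: Pst_def jj Q_def)
    have mm: "m = 4 * Q" "m' = 4 * Q - 1" using down m m' Pj by auto
    have P: "Pst j' = 0 \<or> Pst j' = Q" by (simp add: Pst_def Q_def)
    have "min (tnew m j) m' = 0" using Pj mm by (simp add: tnew_def)
    moreover have "told m' j' = 0" using P mm Q unfolding told_def by auto
    moreover have "min (told m j) m' = 4 * Q - 1" using Pj mm Q by (simp add: told_def)
    moreover have "tnew m' j' = 4 * Q - 1" using P mm Q unfolding tnew_def by auto
    moreover have "m' < 4 ^ Suc j'" using mm Q by (simp add: Q_def)
    moreover have "Pst j' \<le> m'" using P mm Q by auto
    moreover have "near (4 * Q - 1) (4 * Q - 1)" unfolding near_def by linarith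
    ultimately show ?thesis using jj by simp
  next
    case same
    then have jj: "j' = j" by (simp add: j'_def nextj_def)
    have "near (min (tnew m j) m') (tnew m' j)" using m' same(2) m(1) unfolding near_def tnew_def min_def by auto
    moreover have "near (min (told m j) m') (told m' j)" using m' same(2) m(1) unfolding near_def told_def min_def by auto
    ultimately show ?thesis using jj same by simp
  qed
  then show "Pst j' \<le> m'" "m' < 4 ^ Suc j'"
    "(j' = j \<and> near (min (tnew m j) m') (tnew m' j) \<and> near (min (told m j) m') (told m' j)) \<or>
     (j' = Suc j \<and> told m j = 0 \<and> tnew m' j' = 0 \<and> near (min (tnew m j) m') (told m' j')) \<or>
     (j = Suc j' \<and> min (tnew m j) m' = 0 \<and> told m' j' = 0 \<and> near (min (told m j) m') (tnew m' j'))" by blast+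
qed

lemma full_slot:
  assumes "Pst j \<le> m" "tnew m j \<noteq> m"
  shows "told m j = m"
  using assms unfolding tnew_def told_def min_def by (auto split: if_splits)

section \<open>The update program and its invariant\<close>

definition gput :: "nat \<Rightarrow> hexp \<Rightarrow> hexp \<Rightarrow> hexp \<Rightarrow> hexp \<Rightarrow> scom" where
  "gput f a b c e = SS f (HC 2) a b c e"

definition minmax_code :: scom where
  "minmax_code = SI (hless (HV ''u'') (HV ''v'')) (SQ (SA ''L'' (HV ''u'')) (SA ''H'' (HV ''v'')))
     (SQ (SA ''L'' (HV ''v'')) (SA ''H'' (HV ''u'')))"

definition ins_code :: scom where
  "ins_code = SQ minmax_code (SQ (SA ''x'' (HL 3 (HC 2) (HV ''L'') (HV ''H'') (HC 0)))
     (SQ (gput 0 (HC 0) (HC 0) (HV ''m'') (HV ''L'')) (SQ (gput 1 (HC 0) (HC 0) (HV ''m'') (HV ''H''))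
     (SQ (gput 2 (HC 0) (HC 0) (HV ''m'') (HV ''x'')) (SQ (gput 4 (HV ''L'') (HV ''H'') (HV ''x'') (HV ''m''))
     (SQ (gput 3 (HV ''L'') (HV ''H'') (HC 0) (hplus (HV ''x'') (HC 1))) (SA ''m'' (hplus (HV ''m'') (HC 1)))))))))"

definition predel_code :: scom where
  "predel_code = SQ minmax_code (SQ (SA ''d'' (hminus (HL 3 (HC 2) (HV ''L'') (HV ''H'') (HC 0)) (HC 1)))
     (SQ (SA ''x'' (HL 4 (HC 2) (HV ''L'') (HV ''H'') (HV ''d''))) (SA ''sl'' (HC 0))))"

definition postdel_code :: scom where
  "postdel_code = SQ (gput 3 (HV ''L'') (HV ''H'') (HC 0) (HV ''d'')) (SQ (SA ''m'' (hminus (HV ''m'') (HC 1)))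
     (SQ (SA ''a'' (gl 0 (HV ''m''))) (SQ (SA ''b'' (gl 1 (HV ''m''))) (SQ (SA ''k'' (gl 2 (HV ''m'')))
     (SQ (gput 0 (HC 0) (HC 0) (HV ''x'') (HV ''a'')) (SQ (gput 1 (HC 0) (HC 0) (HV ''x'') (HV ''b''))
     (SQ (gput 2 (HC 0) (HC 0) (HV ''x'') (HV ''k'')) (gput 4 (HV ''a'') (HV ''b'') (HV ''k'') (HV ''x'')))))))))"

text \<open>Both banks drop the edge before the array changes, because they still read entry
  \<open>x\<close> and the last entry from it.\<close>

definition del_com :: com where
  "del_com = Seq (scomp predel_code) (Seq drop_com (Seq (scomp (SA ''sl'' (HC 1))) (Seq drop_com (scomp postdel_code))))"

text \<open>The comparisons of \<open>P\<close> with 0 and 4 treat the exceptional value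
  \<open>Pst 0 = 0\<close>: \<open>d\<close> is to be \<open>4 ^ Suc j\<close> in every stage, and
  from \<open>P = 4\<close> the step down has to yield 0 instead of 1.\<close>

definition stage_code :: scom where
  "stage_code = SQ (SA ''d'' (hplus (htimes (HC 4) (HV ''P'')) (htimes (HC 4) (heq (HV ''P'') (HC 0)))))
     (SQ (SI (hless (HV ''m'') (HV ''d'')) SN (SQ (SA ''P'' (HV ''d'')) (SA ''j'' (hplus (HV ''j'') (HC 1)))))
         (SI (hless (HV ''m'') (HV ''P''))
           (SQ (SA ''P'' (htimes (hdiv (HV ''P'') (HC 4)) (hless (HC 4) (HV ''P'')))) (SA ''j'' (hminus (HV ''j'') (HC 1)))) SN))"

text \<open>The level is \<open>2 * j + 5\<close> for the new and \<open>2 * j + 3\<close> for the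
  old orientation. These agree when the stage changes and the roles are exchanged, and
  \<open>m < 4 ^ Suc j\<close> makes \<open>2 * m < 2 ^ l\<close> hold for both.\<close>

definition set_par :: "nat \<Rightarrow> scom" where
  "set_par c = put 8 (HC 0) (HC 0) (HC 0) (htimes (HC 32) (htimes (htimes (HV ''inv_eps'') (HV ''inv_eps''))
     (hplus (htimes (HC 2) (HV ''j'')) (HC c))))"

definition prep_new :: scom where
  "prep_new = SQ (SA ''sl'' (HB Mod (HV ''j'') (HC 2))) (SQ (set_par 5)
     (SQ (SA ''T'' (htimes (HC 2) (hminus (HV ''m'') (HV ''P''))))
         (SI (hless (HV ''m'') (HV ''T'')) (SA ''T'' (HV ''m'')) SN)))"

definition prep_old :: scom where
  "prep_old = SQ (SA ''sl'' (hminus (HC 1) (HB Mod (HV ''j'') (HC 2)))) (SQ (set_par 3)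
     (SI (hless (htimes (HC 2) (HV ''m'')) (htimes (HC 6) (HV ''P'')))
       (SQ (SA ''T'' (hminus (htimes (HC 6) (HV ''P'')) (htimes (HC 2) (HV ''m''))))
         (SI (hless (HV ''m'') (HV ''T'')) (SA ''T'' (HV ''m'')) SN))
       (SA ''T'' (HC 0))))"

text \<open>If the prefix of the new orientation is not the whole array, that of the old one is.
  \<open>den\<close> is \<open>B - 1\<close> because the estimate adds 1 to the denominator.\<close>

definition est_code :: scom where
  "est_code = SQ (SA ''sl'' (HB Mod (HV ''j'') (HC 2))) (SQ (SI (heq fill (HV ''m'')) SN (SA ''sl'' (hminus (HC 1) (HV ''sl''))))
     (SQ (SA ''num'' (fld 7 (HC 0) (HC 0) (HC 0))) (SA ''den'' (hminus (fld 8 (HC 0) (HC 0) (HC 0)) (HC 1)))))"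

definition adj_com :: "scom \<Rightarrow> com \<Rightarrow> com" where
  "adj_com prep rest = Seq (scomp prep) (Seq grow_com (Seq shrink_com rest))"

definition update_com :: com where
  "update_com = Seq (Cond (hcomp (HV ''op'')) del_com (scomp ins_code)) (Seq (scomp stage_code)
     (adj_com prep_new (adj_com prep_old (scomp est_code))))"

lemma update_sstat [simp]: "sstat ins_code" "sstat predel_code" "sstat postdel_code" "sstat stage_code"
  "sstat prep_new" "sstat prep_old" "sstat est_code" "sstat (SA ''sl'' (HC 1))" "hstat (HV ''op'')"
  by (simp_all add: ins_code_def predel_code_def postdel_code_def stage_code_def prep_new_def prep_old_def
      est_code_def minmax_code_def gput_def set_par_def hstat_def)

definition bet :: "nat \<Rightarrow> nat \<Rightarrow> nat" where "bet K l = 32 * K ^ 2 * l"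

text \<open>The parameter is prescribed for nonempty prefixes only: an emptied bank keeps the
  parameter of its former role until that is overwritten.\<close>

definition slt :: "nat \<Rightarrow> hstate \<Rightarrow> nat \<Rightarrow> elist \<Rightarrow> nat \<Rightarrow> nat \<Rightarrow> bool" where
  "slt n h s L f beta \<longleftrightarrow> (\<exists>B. bnk n h s L f B \<and> (0 < f \<longrightarrow> B = beta))"

definition top :: "nat \<Rightarrow> nat \<Rightarrow> hstate \<Rightarrow> elist \<Rightarrow> nat \<Rightarrow> bool" where
  "top n K h L j \<longleftrightarrow> arr n (mm h 2) L \<and> rg h ''m'' = length L \<and> rg h ''j'' = j \<and> rg h ''P'' = Pst j \<and> rg h ''inv_eps'' = K"

definition invar :: "nat \<Rightarrow> nat \<Rightarrow> hstate \<Rightarrow> elist \<Rightarrow> nat \<Rightarrow> bool" where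
  "invar n K h L j \<longleftrightarrow> top n K h L j \<and> Pst j \<le> length L \<and> length L < 4 ^ Suc j \<and>
     slt n h (j mod 2) L (tnew (length L) j) (bet K (2 * j + 5)) \<and>
     slt n h (1 - j mod 2) L (told (length L) j) (bet K (2 * j + 3))"

text \<open>The state after the array has changed, with the stage and the targets still those for
  the former number \<open>m\<close> of edges.\<close>

definition phase1 :: "nat \<Rightarrow> nat \<Rightarrow> nat \<Rightarrow> hstate \<Rightarrow> elist \<Rightarrow> nat \<Rightarrow> bool" where
  "phase1 n K m h L j \<longleftrightarrow> top n K h L j \<and>
     slt n h (j mod 2) L (min (tnew m j) (length L)) (bet K (2 * j + 5)) \<and>
     slt n h (1 - j mod 2) L (min (told m j) (length L)) (bet K (2 * j + 3))"

definition est_ok :: "nat \<Rightarrow> nat \<Rightarrow> hstate \<Rightarrow> elist \<Rightarrow> bool" where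
  "est_ok n K h L \<longleftrightarrow> (\<exists>s l. bankst n (bet K l) (mm h s) (cont L (length L)) \<and> rg h ''num'' = mm h s (7, 0, 0, 0) \<and>
     rg h ''den'' + 1 = bet K l \<and> 1 \<le> l \<and> 2 * length L < 2 ^ l)"

definition okL :: "nat \<Rightarrow> nat \<Rightarrow> nat \<Rightarrow> nat \<Rightarrow> elist \<Rightarrow> bool" where
  "okL n Z te K L \<longleftrightarrow> 6 * length L + 8 \<le> Z \<and> (\<forall>j l. Pst j \<le> length L \<longrightarrow> length L < 4 ^ Suc j \<longrightarrow> l = 2 * j + 3 \<or> l = 2 * j + 5 \<longrightarrow>
     okB n Z te (bet K l) (cont L (length L)) \<and> bet K l \<le> Z)"

lemma slt_mono: "slt n h s L f beta \<Longrightarrow> mm h' s = mm h s \<Longrightarrow> slt n h' s L f beta"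
  by (simp add: slt_def bnk_def)

lemma bnk_length: "bnk n h s L f B \<Longrightarrow> f \<le> length L"
  by (simp add: bnk_def)

lemma slots: "(j :: nat) mod 2 < 2" "1 - j mod 2 < 2" "j mod 2 \<noteq> 1 - j mod 2" "j mod 2 \<noteq> 2" "1 - j mod 2 \<noteq> 2"
  "Suc j mod 2 = 1 - j mod 2" "1 - Suc j mod 2 = j mod 2" "s < 2 \<Longrightarrow> s = j mod 2 \<or> s = 1 - j mod 2"
  by presburger+

lemma eset_del:
  assumes "Suc m = length L" "x < length L"
  shows "mset (map eset (del_at L x)) = mset (map eset L) - {#eset (L ! x)#}"
proof -
  have len: "length (del_at L x) = m" using assms(1)[symmetric] by (simp add: del_at_def)
  have L: "mset (map eset L) = add_mset (eset (L ! m)) (cont L m)"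
    using cont_Suc[of m L] assms(1) cont_all[of L] by simp
  have d: "mset (map eset (del_at L x)) = cont (del_at L x) m" using cont_all[of "del_at L x"] len by simp
  show ?thesis
  proof (cases "x < m")
    case True
    have "L ! x \<in> set (take m L)" using True assms by (auto simp: in_set_conv_nth intro!: exI[of _ x])
    then have inx: "eset (L ! x) \<in># cont L m" unfolding cont_def by simp
    have "cont (del_at L x) m = add_mset (eset (L ! m)) (cont L m - {#eset (L ! x)#})"
      using cont_del_le[OF assms(1) order_refl assms(2)] True by (simp only: if_True)
    then show ?thesis unfolding d L using inx by (simp add: multi_drop_mem_not_eq add_mset_remove_trivial_If insert_DiffM2)
  next
    case False
    then have "x = m" using assms by simp
    then show ?thesis unfolding d L using cont_del_le[OF assms(1) order_refl assms(2)] by simp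
  qed
qed

definition adj_time :: "nat \<Rightarrow> nat" where
  "adj_time te = stime prep_new + stime prep_old + 8 * step_time te"

definition del_time :: "nat \<Rightarrow> nat" where
  "del_time te = stime predel_code + (drop_time te + (stime (SA ''sl'' (HC 1)) + (drop_time te + stime postdel_code)))"

definition update_time :: "nat \<Rightarrow> nat" where
  "update_time te = 1 + exp_cost (hcomp (HV ''op'')) + (del_time te + stime ins_code) +
     (stime stage_code + (adj_time te + (adj_time te + stime est_code)))"

context ram
begin

lemma stage_wp:
  assumes p: "phase1 n K m h L j" and m: "Pst j \<le> m" "m < 4 ^ Suc j" "length L = Suc m \<or> m = Suc (length L)"
    and Z: "6 * length L + 8 \<le> Z"
  shows "wps stage_code (\<lambda>h'. let j' = nextj j (length L) in top n K h' L j' \<and> Pst j' \<le> length L \<and> length L < 4 ^ Suc j' \<and>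
     (\<exists>f. slt n h' (j' mod 2) L f (bet K (2 * j' + 5)) \<and> near f (tnew (length L) j')) \<and>
     (\<exists>f. slt n h' (1 - j' mod 2) L f (bet K (2 * j' + 3)) \<and> near f (told (length L) j'))) h"
proof -
  have t: "arr n (mm h 2) L" "rg h ''m'' = length L" "rg h ''j'' = j" "rg h ''P'' = Pst j" "rg h ''inv_eps'' = K"
    using p by (simp_all add: phase1_def top_def)
  note S = stage_arith[OF m]
  define j' where "j' = nextj j (length L)"
  have d: "4 * Pst j + 4 * of_bool (Pst j = 0) = 4 ^ Suc j" by (simp add: Pst_def)
  have d2: "4 * Pst j + 4 * of_bool (Pst j = 0) = (4 :: nat) * 4 ^ j" using d by simp
  have Pj: "Pst j \<le> length L + 1" using m by auto
  have jP: "j \<le> Pst j"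
  proof -
    have "i < 4 ^ i" for i :: nat by (induction i) auto
    from this[of j] show ?thesis by (cases "j = 0") (simp_all add: Pst_def)
  qed
  have Zs: "Suc j \<le> Z" "4 * Pst j + 4 \<le> Z" "Pst j \<le> Z" using Pj jP Z by linarith+
  have up: "nextj j (length L) = Suc j" "\<not> length L < 4 ^ Suc j" if "\<not> length L < 4 * 4 ^ j"
    using that by (simp_all add: nextj_def)
  have noup: "\<not> length L < Pst (Suc j)" if "\<not> length L < 4 * 4 ^ j" using that by (simp add: Pst_def)
  have PS: "Pst (Suc j) = 4 * 4 ^ j" by (simp add: Pst_def)
  have down: "nextj j (length L) = j - 1" if "length L < 4 * 4 ^ j" "length L < Pst j"
    using that by (simp add: nextj_def)
  have same: "nextj j (length L) = j" if "length L < 4 * 4 ^ j" "\<not> length L < Pst j"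
    using that by (simp add: nextj_def)
  have Pd: "Pst j div 4 * of_bool (4 < Pst j) = Pst (j - 1)" "1 \<le> j" if "length L < Pst j"
  proof -
    show "1 \<le> j" using that by (cases j) (simp_all add: Pst_def)
    show "Pst j div 4 * of_bool (4 < Pst j) = Pst (j - 1)"
    proof (cases j)
      case (Suc i)
      have "4 < (4 :: nat) * 4 ^ i \<longleftrightarrow> i \<noteq> 0"
      proof (cases i)
        case (Suc k)
        have "(1 :: nat) \<le> 4 ^ k" by simp
        then have "4 < (4 :: nat) * (4 * 4 ^ k)" by linarith
        then show ?thesis using Suc by simp
      qed simp
      then show ?thesis by (simp add: Pst_def Suc)
    qed (use that in \<open>simp add: Pst_def\<close>)
  qed
  have 1: "wps stage_code (\<lambda>h'. mm h' = mm h \<and> rg h' ''j'' = j' \<and> rg h' ''P'' = Pst j' \<and>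
     rg h' ''m'' = length L \<and> rg h' ''inv_eps'' = K) h"
  proof (cases "length L < 4 * 4 ^ j")
    case True
    have dZ: "4 * 4 ^ j \<le> Z" using Zs(2) d2[symmetric] by (cases "Pst j = 0") simp_all
    show ?thesis
    proof (cases "length L < Pst j")
      case F: True
      have Z': "Pst (j - 1) \<le> Z" using Pd(1)[OF F, symmetric] Zs(3) by (simp add: order.trans[OF div_le_dividend])
      show ?thesis using t True F dZ Zs Z' down[OF True F] Pd[OF F] unfolding j'_def stage_code_def
        by (simp add: rg_setr d2)
    next
      case F: False
      then show ?thesis using t True F dZ Zs same[OF True F] unfolding j'_def stage_code_def
        by (simp add: rg_setr d2)
    qed
  next
    case False
    have dZ: "4 * 4 ^ j \<le> Z" using False Z by linarith
    show ?thesis using t False dZ Zs up[OF False] unfolding j'_def stage_code_def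
      by (simp add: rg_setr d2 PS)
  qed
  have sl: "slt n h (j mod 2) L (min (tnew m j) (length L)) (bet K (2 * j + 5))"
     "slt n h (1 - j mod 2) L (min (told m j) (length L)) (bet K (2 * j + 3))"
    using p by (simp_all add: phase1_def)
  have zero: "slt n h' s L 0 b'" if "slt n h' s L 0 b" for h' s b b' using that by (simp add: slt_def)
  have tz: "told m j = 0 \<Longrightarrow> min (told m j) (length L) = 0" by simp
  show ?thesis
  proof (rule wps_mono[OF 1])
    fix h' assume h': "mm h' = mm h \<and> rg h' ''j'' = j' \<and> rg h' ''P'' = Pst j' \<and>
     rg h' ''m'' = length L \<and> rg h' ''inv_eps'' = K"
    have s': "slt n h' s L f b" if "slt n h s L f b" for s f b using slt_mono[OF that] h' by simp
    have tp: "top n K h' L j'" using h' t by (simp add: top_def)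
    from S(3)[folded j'_def] have "(\<exists>f. slt n h' (j' mod 2) L f (bet K (2 * j' + 5)) \<and> near f (tnew (length L) j')) \<and>
     (\<exists>f. slt n h' (1 - j' mod 2) L f (bet K (2 * j' + 3)) \<and> near f (told (length L) j'))"
    proof (elim disjE)
      assume a: "j' = j \<and> near (min (tnew m j) (length L)) (tnew (length L) j) \<and> near (min (told m j) (length L)) (told (length L) j)"
      show ?thesis using a s'[OF sl(1)] s'[OF sl(2)] by blast
    next
      assume a: "j' = Suc j \<and> told m j = 0 \<and> tnew (length L) j' = 0 \<and> near (min (tnew m j) (length L)) (told (length L) j')"
      \<comment> \<open>A change of stage flips the parity of \<open>j\<close>, and
        \<open>2 * j' + 3 = 2 * j + 5\<close>. So the slots exchange their roles without any data
        being moved.\<close>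
      have s1: "1 - j' mod 2 = j mod 2" "j' mod 2 = 1 - j mod 2" using a slots(6,7) by simp_all
      have e: "2 * j' + 3 = 2 * j + 5" using a by simp
      have z: "min (told m j) (length L) = 0" using a by simp
      have "slt n h' (j' mod 2) L 0 (bet K (2 * j' + 5))"
        unfolding s1(2) by (rule zero[OF s'[OF sl(2), unfolded z]])
      moreover have "tnew (length L) j' = 0" using a by blast
      then have "near 0 (tnew (length L) j')" by (simp add: near_def)
      moreover have "slt n h' (1 - j' mod 2) L (min (tnew m j) (length L)) (bet K (2 * j' + 3))"
        unfolding e s1(1) by (rule s'[OF sl(1)])
      ultimately show ?thesis using a by blast
    next
      assume a: "j = Suc j' \<and> min (tnew m j) (length L) = 0 \<and> told (length L) j' = 0 \<and> near (min (told m j) (length L)) (tnew (length L) j')"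
      have s1: "1 - j' mod 2 = j mod 2" "j' mod 2 = 1 - j mod 2" using a slots(6,7)[of j'] by simp_all
      have e: "2 * j' + 5 = 2 * j + 3" using a by simp
      have z: "min (tnew m j) (length L) = 0" using a by blast
      have "slt n h' (1 - j' mod 2) L 0 (bet K (2 * j' + 3))"
        unfolding s1(1) by (rule zero[OF s'[OF sl(1), unfolded z]])
      moreover have "told (length L) j' = 0" using a by blast
      then have "near 0 (told (length L) j')" by (simp add: near_def)
      moreover have "slt n h' (j' mod 2) L (min (told m j) (length L)) (bet K (2 * j' + 5))"
        unfolding e s1(2) by (rule s'[OF sl(2)])
      ultimately show ?thesis using a by blast
    qed
    then show "let j' = nextj j (length L) in top n K h' L j' \<and> Pst j' \<le> length L \<and> length L < 4 ^ Suc j' \<and>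
     (\<exists>f. slt n h' (j' mod 2) L f (bet K (2 * j' + 5)) \<and> near f (tnew (length L) j')) \<and>
     (\<exists>f. slt n h' (1 - j' mod 2) L f (bet K (2 * j' + 3)) \<and> near f (told (length L) j'))"
      unfolding j'_def[symmetric] Let_def using tp S(1,2)[folded j'_def] by simp
  qed
qed

text \<open>The length is within 3 of its target, from above or from below, so both loops are run
  and at most one of them acts. Overwriting the parameter is harmless, since it changes only if the
  bank is empty.\<close>

lemma adj_wp:
  assumes prep: "wps prep (\<lambda>h'. h' = setr (setr (setm h s (8, 0, 0, 0) beta) ''sl'' s) ''T'' T) h" "sstat prep"
     "stime prep \<le> stime prep_new + stime prep_old"
    and s: "s < 2" and T: "T \<le> length L" "length L \<le> Z"
    and A: "arr n (mm h 2) L" and b: "slt n h s L f beta" and B: "beta \<le> Z" and nr: "near f T"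
    and ok: "okB n Z te beta (cont L (length L))"
    and rest: "\<And>h'. bnk n h' s L T beta \<Longrightarrow> frame (insert ''sl'' dtmps) s (insert 8 F9) h h' \<Longrightarrow> wp rest tr Q h'"
  shows "wp (adj_com prep rest) (adj_time te + tr) Q h"
proof -
  define h1 where "h1 = setr (setr (setm h s (8, 0, 0, 0) beta) ''sl'' s) ''T'' T"
  obtain B0 where B0: "bnk n h s L f B0" "0 < f \<longrightarrow> B0 = beta" using b by (auto simp: slt_def)
  have "bankst n beta (mm h s) (cont L f)"
  proof (cases "f = 0")
    case True
    then have "bankst n B0 (mm h s) {#}" using B0(1) by (simp add: bnk_def cont_def)
    from bankst_zero(2)[OF this] show ?thesis using True by (simp add: cont_def)
  next
    case False
    then show ?thesis using B0 by (simp add: bnk_def)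
  qed
  then have "bankst n beta ((mm h s)((8, 0, 0, 0) := beta)) (cont L f)" by (rule bankst_cong) simp
  then have b1: "bnk n h1 s L f beta" using B0(1) by (simp add: bnk_def h1_def mm_setm)
  have k1: "rg h1 ''sl'' = s" "rg h1 ''T'' = T" "mm h1 2 = mm h 2" using s by (simp_all add: h1_def rg_setr mm_setm)
  have A1: "arr n (mm h1 2) L" using A k1 by simp
  have f1: "frame (insert ''sl'' dtmps) s (insert 8 F9) h h1"
    by (simp add: h1_def frame_def rg_setr mm_setm dtmps_def)
  have fl: "f \<le> length L" using b1 by (simp add: bnk_def)
  have nT: "T - f \<le> 3" "max f T - T \<le> 3" using nr unfolding near_def by linarith+
  have 1: "wp (scomp prep) (stime prep) (\<lambda>h'. h' = h1) h" unfolding h1_def by (rule wp_scom[OF prep(2,1)])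
  have okT: "okB n Z te beta (cont L T)" by (rule okB_mono[OF ok cont_mono[OF T(1)]])
  have 2: "wp grow_com ((3 + 1) * step_time te) (\<lambda>h'. bnk n h' s L (max f T) beta \<and> frame gtmps s F9 h1 h') h1"
    by (rule grow_wp[OF k1(1) s k1(2) T A1 b1 B okT nT(1)])
  have gd: "frame (insert ''sl'' dtmps) s (insert 8 F9) h2 h3" if "frame gtmps s F9 h2 h3" for h2 h3
    using frame_g_d[OF that] by (rule frame_mono) auto
  have 3: "wp (Seq shrink_com rest) ((3 + 1) * step_time te + tr) Q h2"
    if h2: "bnk n h2 s L (max f T) beta \<and> frame gtmps s F9 h1 h2" for h2
  proof -
    have b2: "bnk n h2 s L (max f T) beta" and f12: "frame gtmps s F9 h1 h2" using h2 by simp_all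
    have k2: "rg h2 ''sl'' = s" "rg h2 ''T'' = T" "mm h2 2 = mm h 2"
      using frame_reg[OF f12 gtmps_facts(1)] frame_reg[OF f12 gtmps_facts(2)] frame_slot[OF f12, of 2] k1 s by simp_all
    have A2: "arr n (mm h2 2) L" using A k2 by simp
    have okm: "okB n Z te beta (cont L (max f T))" by (rule okB_mono[OF ok cont_mono]) (use fl T in simp)
    have f2: "frame (insert ''sl'' dtmps) s (insert 8 F9) h h2" by (rule frame_trans[OF f1 gd[OF f12]]) simp_all
    have 31: "wp shrink_com ((3 + 1) * step_time te) (\<lambda>h'. bnk n h' s L (min (max f T) T) beta \<and> frame gtmps s F9 h2 h') h2"
      by (rule shrink_wp[OF k2(1) s k2(2) T(2) A2 b2 B okm nT(2)])
    show ?thesis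
    proof (rule wp_seq[OF 31])
      fix h3 assume h3: "bnk n h3 s L (min (max f T) T) beta \<and> frame gtmps s F9 h2 h3"
      have "min (max f T) T = T" by simp
      then have "bnk n h3 s L T beta" using h3 by simp
      moreover have "frame (insert ''sl'' dtmps) s (insert 8 F9) h h3"
        by (rule frame_trans[OF f2 gd[OF conjunct2[OF h3]]]) simp_all
      ultimately show "wp rest tr Q h3" by (rule rest)
    qed
  qed
  have 4: "wp (Seq grow_com (Seq shrink_com rest)) ((3 + 1) * step_time te + ((3 + 1) * step_time te + tr)) Q h1"
    by (rule wp_seq[OF 2], rule 3)
  have "wp (adj_com prep rest) (stime prep + ((3 + 1) * step_time te + ((3 + 1) * step_time te + tr))) Q h"
    unfolding adj_com_def by (rule wp_seq[OF 1]) (simp only: 4)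
  then show ?thesis by (rule wp_mono) (use prep(3) in \<open>simp_all add: adj_time_def\<close>)
qed

lemma adjust_wp:
  assumes t: "top n K h L j" and P: "Pst j \<le> length L" "length L < 4 ^ Suc j" and K: "1 \<le> K"
    and sn: "slt n h (j mod 2) L fn (bet K (2 * j + 5))" "near fn (tnew (length L) j)"
    and so: "slt n h (1 - j mod 2) L fo (bet K (2 * j + 3))" "near fo (told (length L) j)"
    and ok: "okL n Z te K L"
  shows "wp (adj_com prep_new (adj_com prep_old (scomp est_code))) (adj_time te + (adj_time te + stime est_code))
    (\<lambda>h'. invar n K h' L j \<and> est_ok n K h' L) h"
proof -
  let ?m = "length L"
  have A: "arr n (mm h 2) L" and r: "rg h ''m'' = ?m" "rg h ''j'' = j" "rg h ''P'' = Pst j" "rg h ''inv_eps'' = K"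
    using t by (simp_all add: top_def)
  have Z: "6 * ?m + 8 \<le> Z" and okn: "okB n Z te (bet K (2 * j + 5)) (cont L ?m)" "bet K (2 * j + 5) \<le> Z"
    and oko: "okB n Z te (bet K (2 * j + 3)) (cont L ?m)" "bet K (2 * j + 3) \<le> Z"
    using ok P unfolding okL_def by simp_all
  have mZ: "?m \<le> Z" using Z by simp
  have bt: "32 * (K * K * (2 * j + c)) = bet K (2 * j + c)" for c by (simp add: bet_def power2_eq_square mult.assoc)
  have keep: "rg h' x = rg h x" if "frame (insert ''sl'' dtmps) s (insert 8 F9) h h'" "x \<in> {''m'', ''j'', ''P'', ''inv_eps''}" for s h' x
    using frame_reg[OF that(1), of x] that(2) by (auto simp: dtmps_def gtmps_def etmps_def ctmps_def stmps_def tmps_def)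
  have Tn: "tnew ?m j \<le> ?m" and To: "told ?m j \<le> ?m" by (simp_all add: tnew_def told_def)
  have zero_n: "j mod 2 < 4" "1 - j mod 2 < 4" using slots(1,2)[of j] by simp_all
  have sw1: "wps prep_new (\<lambda>h'. h' = setr (setr (setm h (j mod 2) (8, 0, 0, 0) (bet K (2 * j + 5))) ''sl'' (j mod 2)) ''T'' (tnew ?m j)) h"
  proof (cases "?m < 2 * (?m - Pst j)")
    case True
    then show ?thesis using r okn(2) Z P n_pos zero_n bt[of 5, symmetric]
      by (simp add: prep_new_def set_par_def rg_setr setr_def setm_def fun_upd_twist tnew_def)
  next
    case False
    then show ?thesis using r okn(2) Z P n_pos zero_n bt[of 5, symmetric]
      by (simp add: prep_new_def set_par_def rg_setr setr_def setm_def fun_upd_twist tnew_def min_def)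
  qed
  show ?thesis
  proof (rule adj_wp[OF sw1 _ _ slots(1) Tn mZ A sn(1) okn(2) sn(2) okn(1)])
    fix h1 assume b1: "bnk n h1 (j mod 2) L (tnew ?m j) (bet K (2 * j + 5))"
      and f1: "frame (insert ''sl'' dtmps) (j mod 2) (insert 8 F9) h h1"
    have r1: "rg h1 ''m'' = ?m" "rg h1 ''j'' = j" "rg h1 ''P'' = Pst j" "rg h1 ''inv_eps'' = K"
      using keep[OF f1] r by simp_all
    have A1: "arr n (mm h1 2) L" using A frame_slot[OF f1 slots(4)[symmetric]] by simp
    have so1: "slt n h1 (1 - j mod 2) L fo (bet K (2 * j + 3))"
      using slt_mono[OF so(1)] frame_slot[OF f1 slots(3)[symmetric]] by simp
    have jm: "j mod 2 \<le> Suc 0" "6 * Pst j - 2 * ?m \<le> Z" using slots(1)[of j] P(1) Z by (simp, linarith)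
    have sw2: "wps prep_old (\<lambda>h'. h' = setr (setr (setm h1 (1 - j mod 2) (8, 0, 0, 0) (bet K (2 * j + 3))) ''sl'' (1 - j mod 2)) ''T'' (told ?m j)) h1"
    proof (cases "2 * ?m < 6 * Pst j")
      case True
      then show ?thesis using jm r1 oko(2) Z P n_pos zero_n bt[of 3, symmetric]
        by (cases "?m < 6 * Pst j - 2 * ?m") (simp_all add: prep_old_def set_par_def rg_setr setr_def setm_def fun_upd_twist told_def min_def)
    next
      case False
      then show ?thesis using jm r1 oko(2) Z P n_pos zero_n bt[of 3, symmetric]
        by (simp add: prep_old_def set_par_def rg_setr setr_def setm_def fun_upd_twist told_def)
    qed
    show "wp (adj_com prep_old (scomp est_code)) (adj_time te + stime est_code) (\<lambda>h'. invar n K h' L j \<and> est_ok n K h' L) h1"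
    proof (rule adj_wp[OF sw2 _ _ slots(2) To mZ A1 so1 oko(2) so(2) oko(1)])
      fix h2 assume b2: "bnk n h2 (1 - j mod 2) L (told ?m j) (bet K (2 * j + 3))"
        and f2: "frame (insert ''sl'' dtmps) (1 - j mod 2) (insert 8 F9) h1 h2"
      have r2: "rg h2 ''m'' = ?m" "rg h2 ''j'' = j" "rg h2 ''P'' = Pst j" "rg h2 ''inv_eps'' = K"
        using r1 frame_reg[OF f2] by (simp_all add: dtmps_def gtmps_def etmps_def ctmps_def stmps_def tmps_def)
      have A2: "arr n (mm h2 2) L" using A1 frame_slot[OF f2 slots(5)[symmetric]] by simp
      have b12: "bnk n h2 (j mod 2) L (tnew ?m j) (bet K (2 * j + 5))"
        using b1 frame_slot[OF f2 slots(3)] by (simp add: bnk_def)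
      define s where "s = (if tnew ?m j = ?m then j mod 2 else 1 - j mod 2)"
      define l where "l = (if tnew ?m j = ?m then 2 * j + 5 else 2 * j + 3)"
      have bs: "bnk n h2 s L ?m (bet K l)"
        using b12 b2 full_slot[OF P(1)] unfolding s_def l_def by (cases "tnew ?m j = ?m") simp_all
      have v: "mm h2 (j mod 2) (9, 0, 0, 0) = tnew ?m j" "mm h2 s (8, 0, 0, 0) = bet K l" "bankst n (bet K l) (mm h2 s) (cont L ?m)"
        using b12 bs by (simp_all add: bnk_def)
      have s4: "s < 4" using zero_n by (simp add: s_def)
      have l1: "1 \<le> l" by (simp add: l_def)
      have bl: "1 \<le> bet K l" using K l1 by (simp add: bet_def)
      have lpow: "2 * ?m < 2 ^ l"
      proof -
        have "2 * ?m < 2 * 4 ^ Suc j" using P(2) by simp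
        also have "(2 :: nat) * 4 ^ Suc j = 2 ^ (2 * j + 3)" by (simp add: power_mult power_add)
        also have "\<dots> \<le> 2 ^ l" by (rule power_increasing) (simp_all add: l_def)
        finally show ?thesis .
      qed
      show "wp (scomp est_code) (stime est_code) (\<lambda>h'. invar n K h' L j \<and> est_ok n K h' L) h2"
      proof (rule wp_bounded)
        assume bd: "bounded h2"
        have numZ: "mm h2 s (7, 0, 0, 0) \<le> Z" "bet K l \<le> Z"
          using boundedD(3)[OF bd s4, of 7 0 0 0] boundedD(3)[OF bd s4, of 8 0 0 0] n_pos v by simp_all
        have numZ1: "bet K l - Suc 0 \<le> Z" using numZ(2) by simp
        have e: "wps est_code (\<lambda>h'. mm h' = mm h2 \<and> rg h' ''num'' = mm h2 s (7, 0, 0, 0) \<and> rg h' ''den'' = bet K l - 1 \<and>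
          (\<forall>x. x \<in> {''m'', ''j'', ''P'', ''inv_eps''} \<longrightarrow> rg h' x = rg h2 x)) h2"
          using jm(1) numZ1 r2 v(1,2) numZ bl n_pos zero_n s4 Z Z_ge
          by (cases "tnew ?m j = ?m") (simp_all add: est_code_def rg_setr s_def l_def)
        show ?thesis
        proof (rule wp_scom[OF _ wps_mono[OF e]])
          fix h3 assume h3: "mm h3 = mm h2 \<and> rg h3 ''num'' = mm h2 s (7, 0, 0, 0) \<and> rg h3 ''den'' = bet K l - 1 \<and>
            (\<forall>x. x \<in> {''m'', ''j'', ''P'', ''inv_eps''} \<longrightarrow> rg h3 x = rg h2 x)"
          have "top n K h3 L j" using h3 r2 A2 by (simp add: top_def)
          moreover have "slt n h3 (j mod 2) L (tnew ?m j) (bet K (2 * j + 5))"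
            using b12 h3 by (simp add: slt_def bnk_def)
          moreover have "slt n h3 (1 - j mod 2) L (told ?m j) (bet K (2 * j + 3))"
            using b2 h3 by (simp add: slt_def bnk_def)
          moreover have "est_ok n K h3 L" unfolding est_ok_def
            by (intro exI[of _ s] exI[of _ l]) (use v(3) h3 l1 lpow bl in simp)
          ultimately show "invar n K h3 L j \<and> est_ok n K h3 L" using P by (simp add: invar_def)
        qed simp
      qed
    qed simp_all
  qed simp_all
qed

lemma ins_wps:
  assumes I: "invar n K h L j" and uv: "rg h ''u'' = u" "rg h ''v'' = v" "u < n" "v < n" "u \<noteq> v"
    and Z: "length L + 1 \<le> Z"
  shows "wps ins_code (\<lambda>h'. phase1 n K (length L) h' (L @ [(min u v, max u v)]) j) h"
proof -
  let ?m = "length L"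
  have t: "arr n (mm h 2) L" "rg h ''m'' = ?m" "rg h ''j'' = j" "rg h ''P'' = Pst j" "rg h ''inv_eps'' = K"
    using I by (simp_all add: invar_def top_def)
  define lo hi where "lo = min u v" and "hi = max u v"
  have lh: "lo < hi" "hi < n" "lo < n" using uv by (simp_all add: lo_def hi_def)
  define G where "G = mm h 2"
  define G' where "G' = G((0, 0, 0, ?m) := lo, (1, 0, 0, ?m) := hi, (2, 0, 0, ?m) := G (3, lo, hi, 0),
      (4, lo, hi, G (3, lo, hi, 0)) := ?m, (3, lo, hi, 0) := Suc (G (3, lo, hi, 0)))"
  have A': "arr n G' (L @ [(lo, hi)])" by (rule arr_snoc[OF t(1)[folded G_def] lh(1,2) G'_def])
  have muZ: "Suc (G (3, lo, hi, 0)) \<le> Z" using arr_mult_le[OF t(1)[folded G_def] lh(3,2)] Z by simp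
  have loZ: "lo \<le> Z" "hi \<le> Z" using lh n_le by simp_all
  have w: "wps ins_code (\<lambda>h'. mm h' = (mm h)(2 := G') \<and> rg h' ''m'' = Suc ?m \<and> rg h' ''j'' = j \<and>
      rg h' ''P'' = Pst j \<and> rg h' ''inv_eps'' = K) h"
  proof (cases "u < v")
    case True
    then have e: "lo = u" "hi = v" by (simp_all add: lo_def hi_def)
    show ?thesis using True t uv muZ loZ Z n_pos lh unfolding G'_def G_def e
      by (simp add: ins_code_def minmax_code_def gput_def rg_setr setm_def)
  next
    case False
    then have e: "lo = v" "hi = u" using uv by (simp_all add: lo_def hi_def)
    show ?thesis using False t uv muZ loZ Z n_pos lh unfolding G'_def G_def e
      by (simp add: ins_code_def minmax_code_def gput_def rg_setr setm_def)
  qed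
  show ?thesis
  proof (rule wps_mono[OF w])
    fix h' assume h': "mm h' = (mm h)(2 := G') \<and> rg h' ''m'' = Suc ?m \<and> rg h' ''j'' = j \<and>
      rg h' ''P'' = Pst j \<and> rg h' ''inv_eps'' = K"
    have sl: "slt n h' s (L @ [(lo, hi)]) (min f (length (L @ [(lo, hi)]))) b" if a: "slt n h s L f b" "s \<noteq> 2" for s f b
    proof -
      obtain B where B: "bnk n h s L f B" "0 < f \<longrightarrow> B = b" using a(1) by (auto simp: slt_def)
      have f: "f \<le> ?m" by (rule bnk_length[OF B(1)])
      then have "min f (length (L @ [(lo, hi)])) = f" by simp
      moreover have "bnk n h' s (L @ [(lo, hi)]) f B"
        using B(1) h' a(2) f by (simp add: bnk_def cont_append)
      ultimately show ?thesis using B(2) by (auto simp: slt_def)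
    qed
    have "top n K h' (L @ [(lo, hi)]) j" using h' A' by (simp add: top_def)
    moreover have "slt n h' (j mod 2) (L @ [(lo, hi)]) (min (tnew ?m j) (length (L @ [(lo, hi)]))) (bet K (2 * j + 5))"
      by (rule sl[OF _ slots(4)]) (use I in \<open>simp add: invar_def\<close>)
    moreover have "slt n h' (1 - j mod 2) (L @ [(lo, hi)]) (min (told ?m j) (length (L @ [(lo, hi)]))) (bet K (2 * j + 3))"
      by (rule sl[OF _ slots(5)]) (use I in \<open>simp add: invar_def\<close>)
    ultimately show "phase1 n K ?m h' (L @ [(min u v, max u v)]) j"
      unfolding phase1_def lo_def hi_def by blast
  qed
qed

lemma del_wp:
  assumes I: "invar n K h L j" and uv: "rg h ''u'' = u" "rg h ''v'' = v" "u < n" "v < n" "u \<noteq> v"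
    and E: "{u, v} \<in># mset (map eset L)" and ok: "okL n Z te K L" and bd: "bounded h"
  shows "\<exists>x < length L. eset (L ! x) = {u, v} \<and>
    wp del_com (del_time te) (\<lambda>h'. phase1 n K (length L) h' (del_at L x) j) h"
proof -
  have t: "arr n (mm h 2) L" "rg h ''m'' = length L" "rg h ''j'' = j" "rg h ''P'' = Pst j" "rg h ''inv_eps'' = K"
    using I by (simp_all add: invar_def top_def)
  define lo hi where "lo = min u v" and "hi = max u v"
  have lh: "lo < hi" "hi < n" "lo < n" using uv by (simp_all add: lo_def hi_def)
  define G where "G = mm h 2"
  obtain p where p: "p < length L" "eset (L ! p) = {u, v}" using E by (auto simp: in_set_conv_nth)
  note ap = arrD1[OF t(1)[folded G_def] p(1)]
  have Lp: "fst (L ! p) = lo" "snd (L ! p) = hi"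
    using p(2) ap(7) uv(5) unfolding eset_def doubleton_eq_iff lo_def hi_def by (auto simp: min_def max_def)
  have mu: "0 < G (3, lo, hi, 0)" using ap(3) unfolding Lp by simp
  \<comment> \<open>The last copy of the pair is the one to be deleted, so the numbers of the
    remaining copies stay consecutive.\<close>
  then obtain d where d: "Suc d = G (3, lo, hi, 0)" by (metis gr0_implies_Suc)
  define x where "x = G (4, lo, hi, d)"
  note ax = arrD2[OF t(1)[folded G_def] lh(3,2), of d, unfolded d[symmetric], OF lessI, folded x_def]
  have xL: "x < length L" by (rule ax(1))
  have ex: "eset (L ! x) = {u, v}" using ax(2) by (auto simp: eset_def lo_def hi_def min_def max_def)
  obtain m where m: "Suc m = length L" using xL by (cases L) auto
  have Pm: "Pst j \<le> length L" "length L < 4 ^ Suc j" using I by (simp_all add: invar_def)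
  have Z: "6 * length L + 8 \<le> Z" and okn: "okB n Z te (bet K (2 * j + 5)) (cont L (length L))"
    and oko: "okB n Z te (bet K (2 * j + 3)) (cont L (length L))"
    using ok Pm unfolding okL_def by simp_all
  have mZ: "length L \<le> Z" "x \<le> Z" "d \<le> Z" "m \<le> Z"
    using Z xL m d arr_mult_le[OF t(1)[folded G_def] lh(3,2)] by linarith+
  have loZ: "lo \<le> Z" "hi \<le> Z" using lh n_le by simp_all
  define beta where "beta s = (if s = j mod 2 then bet K (2 * j + 5) else bet K (2 * j + 3))" for s
  define ff where "ff s = (if s = j mod 2 then tnew (length L) j else told (length L) j)" for s
  have okb: "okB n Z te (beta s) (cont L (length L))" for s using okn oko by (simp add: beta_def)
  have sl: "slt n h s L (ff s) (beta s)" if "s < 2" for s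
  proof (cases "s = j mod 2")
    case True
    then show ?thesis using I by (simp add: invar_def ff_def beta_def)
  next
    case False
    then have "s = 1 - j mod 2" using slots(8)[OF that, of j] by blast
    then show ?thesis using I slots(3)[of j] by (simp add: invar_def ff_def beta_def)
  qed
  obtain B0 where B0: "bnk n h 0 L (ff 0) B0" "0 < ff 0 \<longrightarrow> B0 = beta 0" using sl[of 0] by (auto simp: slt_def)
  obtain B1 where B1: "bnk n h 1 L (ff 1) B1" "0 < ff 1 \<longrightarrow> B1 = beta 1" using sl[of 1] by (auto simp: slt_def)
  \<comment> \<open>An empty slot may hold any parameter, so its size is known only from the
    boundedness of the memory.\<close>
  have BZ: "B0 \<le> Z" "B1 \<le> Z"
    using B0(1) B1(1) boundedD(3)[OF bd, of 0 8 0 0 0] boundedD(3)[OF bd, of 1 8 0 0 0] n_pos by (simp_all add: bnk_def)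
  let ?R = "{''m'', ''j'', ''P'', ''inv_eps'', ''L'', ''H'', ''x'', ''d''}"
  have keep: "rg h2 y = rg h1 y" if "frame dtmps s F9 h1 h2" "y \<in> ?R \<union> {''sl''}" for h1 h2 s y
    using frame_reg[OF that(1), of y] that(2) by (auto simp: dtmps_def gtmps_def etmps_def ctmps_def stmps_def tmps_def)
  define st where "st h' \<longleftrightarrow> rg h' ''m'' = Suc m \<and> rg h' ''j'' = j \<and> rg h' ''P'' = Pst j \<and> rg h' ''inv_eps'' = K \<and>
     rg h' ''L'' = lo \<and> rg h' ''H'' = hi \<and> rg h' ''x'' = x \<and> rg h' ''d'' = d" for h'
  have st_keep: "st h2" if "st h1" "frame dtmps s F9 h1 h2" for h1 h2 s
    using that(1) keep[OF that(2)] unfolding st_def by simp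
  have 1: "wp (scomp predel_code) (stime predel_code) (\<lambda>h'. mm h' = mm h \<and> st h' \<and> rg h' ''sl'' = 0) h"
  proof (rule wp_scom)
    have dd: "mm h 2 (3, lo, hi, 0) - Suc 0 = d" "Suc 0 \<le> mm h 2 (3, lo, hi, 0)" "mm h 2 (4, lo, hi, d) = x"
      using d by (simp_all add: G_def x_def)
    show "wps predel_code (\<lambda>h'. mm h' = mm h \<and> st h' \<and> rg h' ''sl'' = 0) h"
    proof (cases "u < v")
      case True
      then have e: "lo = u" "hi = v" by (simp_all add: lo_def hi_def)
      show ?thesis using True t uv dd loZ mZ m n_pos lh unfolding e
        by (simp add: predel_code_def minmax_code_def rg_setr st_def e)
    next
      case False
      then have e: "lo = v" "hi = u" using uv by (simp_all add: lo_def hi_def)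
      show ?thesis using False t uv dd loZ mZ m n_pos lh unfolding e
        by (simp add: predel_code_def minmax_code_def rg_setr st_def e)
    qed
  qed simp
  have 2: "wp (Seq drop_com (Seq (scomp (SA ''sl'' (HC 1))) (Seq drop_com (scomp postdel_code))))
    (drop_time te + (stime (SA ''sl'' (HC 1)) + (drop_time te + stime postdel_code)))
    (\<lambda>h'. phase1 n K (length L) h' (del_at L x) j) h1"
    if h1: "mm h1 = mm h \<and> st h1 \<and> rg h1 ''sl'' = 0" for h1
  proof -
    have s1: "st h1" using h1 by blast
    have r1: "rg h1 ''sl'' = 0" "rg h1 ''m'' = Suc m" "rg h1 ''x'' = x" using h1 s1 by (simp_all add: st_def)
    have A1: "arr n (mm h1 2) L" and b1: "bnk n h1 0 L (ff 0) B0" "bnk n h1 1 L (ff 1) B1"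
      using h1 t B0 B1 by (simp_all add: bnk_def)
    have ok0: "okB n Z te B0 (cont L (length L))" if "0 < ff 0" using B0(2) that okb by simp
    have ok1: "okB n Z te B1 (cont L (length L))" if "0 < ff 1" using B1(2) that okb by simp
    have 21: "wp drop_com (drop_time te) (\<lambda>h'. bnk n h' 0 (del_at L x) (min (ff 0) m) B0 \<and> frame dtmps 0 F9 h1 h') h1"
      by (rule drop_wp[OF r1(1) _ r1(2) m mZ(1) r1(3) xL A1 b1(1) BZ(1) ok0]) simp_all
    have 22: "wp (Seq (scomp (SA ''sl'' (HC 1))) (Seq drop_com (scomp postdel_code)))
      (stime (SA ''sl'' (HC 1)) + (drop_time te + stime postdel_code))
      (\<lambda>h'. phase1 n K (length L) h' (del_at L x) j) h2"
      if h2: "bnk n h2 0 (del_at L x) (min (ff 0) m) B0 \<and> frame dtmps 0 F9 h1 h2" for h2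
    proof -
      have f12: "frame dtmps 0 F9 h1 h2" using h2 by blast
      have s2: "st h2" by (rule st_keep[OF s1 f12])
      define h3 where "h3 = setr h2 ''sl'' 1"
      have s3: "st h3" using s2 by (simp add: st_def h3_def rg_setr)
      have r3: "rg h3 ''sl'' = 1" "rg h3 ''m'' = Suc m" "rg h3 ''x'' = x" "mm h3 = mm h2"
        using s3 by (simp_all add: st_def) (simp_all add: h3_def rg_setr)
      have A3: "arr n (mm h3 2) L" and b3: "bnk n h3 1 L (ff 1) B1"
        using A1 b1(2) r3 frame_slot[OF f12] by (simp_all add: bnk_def)
      have b30: "bnk n h3 0 (del_at L x) (min (ff 0) m) B0" using h2 r3 by (simp add: bnk_def)
      have 31: "wp (scomp (SA ''sl'' (HC 1))) (stime (SA ''sl'' (HC 1))) (\<lambda>h'. h' = h3) h2"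
        by (rule wp_scom) (use Z_ge in \<open>simp_all add: h3_def hstat_def\<close>)
      have 32: "wp drop_com (drop_time te) (\<lambda>h'. bnk n h' 1 (del_at L x) (min (ff 1) m) B1 \<and> frame dtmps 1 F9 h3 h') h3"
        by (rule drop_wp[OF r3(1) _ r3(2) m mZ(1) r3(3) xL A3 b3 BZ(2) ok1]) simp_all
      have 33: "wp (scomp postdel_code) (stime postdel_code) (\<lambda>h'. phase1 n K (length L) h' (del_at L x) j) h4"
        if h4: "bnk n h4 1 (del_at L x) (min (ff 1) m) B1 \<and> frame dtmps 1 F9 h3 h4" for h4
      proof -
        have f34: "frame dtmps 1 F9 h3 h4" using h4 by blast
        have s4: "st h4" by (rule st_keep[OF s3 f34])
        have G4: "mm h4 2 = G" using frame_slot[OF f34, of 2] frame_slot[OF f12, of 2] r3(4) h1 by (simp add: G_def)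
        have b40: "bnk n h4 0 (del_at L x) (min (ff 0) m) B0" using b30 frame_slot[OF f34, of 0] by (simp add: bnk_def)
        define a b k where "a = G (0, 0, 0, m)" and "b = G (1, 0, 0, m)" and "k = G (2, 0, 0, m)"
        have mL: "m < length L" using m by simp
        note z = arrD1[OF t(1)[folded G_def] mL, folded a_def b_def k_def]
        have ab: "a < n" "b < n" "k < G (3, a, b, 0)" using z by simp_all
        have kZ: "a \<le> Z" "b \<le> Z" "k \<le> Z"
          using ab n_le mZ(1) arr_mult_le[OF t(1)[folded G_def] ab(1,2)] by linarith+
        define G' where "G' = G((3, lo, hi, 0) := d, (0, 0, 0, x) := a, (1, 0, 0, x) := b, (2, 0, 0, x) := k, (4, a, b, k) := x)"
        have A': "arr n G' (del_at L x)"
          by (rule arr_del[OF t(1)[folded G_def] lh(3,2) d x_def m a_def b_def k_def G'_def])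
        have w: "wps postdel_code (\<lambda>h'. mm h' = (mm h4)(2 := G') \<and> rg h' ''m'' = m \<and> rg h' ''j'' = j \<and>
           rg h' ''P'' = Pst j \<and> rg h' ''inv_eps'' = K) h4"
          using s4 G4 kZ mZ lh n_pos ab a_def b_def k_def
          by (simp add: postdel_code_def gput_def rg_setr setm_def st_def G'_def)
        have len: "length (del_at L x) = m" using m[symmetric] by (simp add: del_at_def)
        show ?thesis
        proof (rule wp_scom[OF _ wps_mono[OF w]])
          fix h5 assume h5: "mm h5 = (mm h4)(2 := G') \<and> rg h5 ''m'' = m \<and> rg h5 ''j'' = j \<and>
            rg h5 ''P'' = Pst j \<and> rg h5 ''inv_eps'' = K"
          have sl5: "slt n h5 s (del_at L x) (min (ff s) m) (beta s)" if "s < 2" for s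
          proof -
            have "s = 0 \<or> s = 1" using that by linarith
            then show ?thesis
            proof
              assume s: "s = 0"
              have "bnk n h5 0 (del_at L x) (min (ff 0) m) B0" using b40 h5 by (simp add: bnk_def)
              then show ?thesis unfolding s slt_def using B0(2) by (intro exI[of _ B0]) simp
            next
              assume s: "s = 1"
              have "bnk n h5 1 (del_at L x) (min (ff 1) m) B1" using h4 h5 by (simp add: bnk_def)
              then show ?thesis unfolding s slt_def using B1(2) by (intro exI[of _ B1]) simp
            qed
          qed
          have "top n K h5 (del_at L x) j" using h5 A' len by (simp add: top_def)
          moreover have "slt n h5 (j mod 2) (del_at L x) (min (tnew (length L) j) (length (del_at L x))) (bet K (2 * j + 5))"
            using sl5[OF slots(1)[of j]] by (simp add: ff_def beta_def len)
          moreover have "slt n h5 (1 - j mod 2) (del_at L x) (min (told (length L) j) (length (del_at L x))) (bet K (2 * j + 3))"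
            using sl5[OF slots(2)[of j]] slots(3)[of j] by (simp add: ff_def beta_def len)
          ultimately show "phase1 n K (length L) h5 (del_at L x) j" unfolding phase1_def by blast
        qed simp
      qed
      have 34: "wp (Seq drop_com (scomp postdel_code)) (drop_time te + stime postdel_code)
        (\<lambda>h'. phase1 n K (length L) h' (del_at L x) j) h3"
        by (rule wp_seq[OF 32], rule 33)
      show ?thesis by (rule wp_seq[OF 31]) (simp only: 34)
    qed
    show ?thesis by (rule wp_seq[OF 21], rule 22)
  qed
  have "wp del_com (del_time te) (\<lambda>h'. phase1 n K (length L) h' (del_at L x) j) h"
    unfolding del_com_def del_time_def by (rule wp_seq[OF 1], rule 2)
  then show ?thesis using xL ex by blast
qed

lemma update_wp:
  assumes c: "wp c tc (\<lambda>h'. phase1 n K m h' L j) h"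
    and m: "Pst j \<le> m" "m < 4 ^ Suc j" "length L = Suc m \<or> m = Suc (length L)" and K: "1 \<le> K"
    and ok: "okL n Z te K L"
  shows "wp (Seq c (Seq (scomp stage_code) (adj_com prep_new (adj_com prep_old (scomp est_code)))))
    (tc + (stime stage_code + (adj_time te + (adj_time te + stime est_code))))
    (\<lambda>h'. (\<exists>j'. invar n K h' L j') \<and> est_ok n K h' L) h"
proof -
  have Z: "6 * length L + 8 \<le> Z" using ok by (simp add: okL_def)
  define j' where "j' = nextj j (length L)"
  show ?thesis
  proof (rule wp_seq[OF c])
    fix h1 assume p: "phase1 n K m h1 L j"
    note S = stage_wp[OF p m Z]
    show "wp (Seq (scomp stage_code) (adj_com prep_new (adj_com prep_old (scomp est_code))))
      (stime stage_code + (adj_time te + (adj_time te + stime est_code)))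
      (\<lambda>h'. (\<exists>j'. invar n K h' L j') \<and> est_ok n K h' L) h1"
    proof (rule wp_seq[OF wp_scom[OF _ S]])
      fix h2 assume "let j' = nextj j (length L) in top n K h2 L j' \<and> Pst j' \<le> length L \<and> length L < 4 ^ Suc j' \<and>
       (\<exists>f. slt n h2 (j' mod 2) L f (bet K (2 * j' + 5)) \<and> near f (tnew (length L) j')) \<and>
       (\<exists>f. slt n h2 (1 - j' mod 2) L f (bet K (2 * j' + 3)) \<and> near f (told (length L) j'))"
      then have a: "top n K h2 L j'" "Pst j' \<le> length L" "length L < 4 ^ Suc j'"
       "\<exists>f. slt n h2 (j' mod 2) L f (bet K (2 * j' + 5)) \<and> near f (tnew (length L) j')"
       "\<exists>f. slt n h2 (1 - j' mod 2) L f (bet K (2 * j' + 3)) \<and> near f (told (length L) j')"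
        unfolding Let_def j'_def[symmetric] by - (elim conjE, assumption)+
      obtain fn where fn: "slt n h2 (j' mod 2) L fn (bet K (2 * j' + 5))" "near fn (tnew (length L) j')" using a(4) by blast
      obtain fo where fo: "slt n h2 (1 - j' mod 2) L fo (bet K (2 * j' + 3))" "near fo (told (length L) j')" using a(5) by blast
      have "wp (adj_com prep_new (adj_com prep_old (scomp est_code))) (adj_time te + (adj_time te + stime est_code))
        (\<lambda>h'. invar n K h' L j' \<and> est_ok n K h' L) h2"
        by (rule adjust_wp[OF a(1-3) K fn fo ok])
      then show "wp (adj_com prep_new (adj_com prep_old (scomp est_code))) (adj_time te + (adj_time te + stime est_code))
        (\<lambda>h'. (\<exists>j'. invar n K h' L j') \<and> est_ok n K h' L) h2"
        by (rule wp_mono) (simp, blast)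
    qed simp
  qed
qed

end

section \<open>Time, word size and correctness\<close>

lemma lin_bound: "(a :: nat) + k * b \<le> (a + b) * (k + 1)"
  by (simp add: algebra_simps)

text \<open>An edge operation runs through \<open>B\<close> units, each with at most
  \<open>N\<close> reversals along a chain, each of which looks at up to \<open>k\<close> owned
  edges. Everything else costs a constant per iteration.\<close>

lemma edge_time_bound: "\<exists>C. \<forall>k N B. edge_time k N B \<le> C * ((k + 1) * (N + 1) * (B + 1))"
proof -
  obtain c1 where c1: "tail_time k \<le> c1 * (k + 1)" for k
  proof
    let ?a = "stime fixab_code + 1 + exp_cost (hcomp notify_guard)"
      and ?b = "stime notify_body + 1 + exp_cost (hcomp notify_guard)"
    show "tail_time k \<le> (?a + ?b) * (k + 1)" for k
      using lin_bound[of ?a k ?b] by (simp add: tail_time_def)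
  qed
  obtain c2 where c2: "search_time k \<le> c2 * (k + 1)" for k
  proof
    let ?a = "stime scan_init + 1 + exp_cost (hcomp scan_guard) + stime probe_ins + stime probe_del"
      and ?b = "stime scan_ins + stime scan_del + 1 + exp_cost (hcomp scan_guard)"
    show "search_time k \<le> (?a + ?b) * (k + 1)" for k
      using lin_bound[of ?a k ?b] by (simp add: search_time_def)
  qed
  have const: "a \<le> a * (k + 1)" for a k :: nat by simp
  obtain c3 where c3: "arc_time k \<le> c3 * (k + 1)" for k
  proof
    show "arc_time k \<le> (stime addu_code + stime remu_code + c1) * (k + 1)" for k
      using c1[of k] const[of "stime addu_code + stime remu_code" k]
      unfolding arc_time_def distrib_right by linarith
  qed
  obtain c4 where c4: "xfer_time k \<le> c4 * (k + 1)" for k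
  proof
    let ?a = "2 * stime (xfer1 ''c'' ''y'') + stime (SA ''c'' (HV ''y''))"
    show "xfer_time k \<le> (?a + c3 + c3) * (k + 1)" for k
      using c3[of k] const[of ?a k] unfolding xfer_time_def distrib_right by linarith
  qed
  define e where "e = 1 + exp_cost (hcomp (HV ''z''))"
  obtain c5 where c5: "chain_time k N \<le> c5 * ((k + 1) * (N + 1))" for k N
  proof
    show "chain_time k N \<le> (c2 + e + (c4 + c2 + e)) * ((k + 1) * (N + 1))" for k N
    proof -
      have "chain_time k N = search_time k + e + N * (xfer_time k + search_time k + e)"
        by (simp add: chain_time_def e_def)
      also have "\<dots> \<le> (c2 + e) * (k + 1) + N * ((c4 + c2 + e) * (k + 1))"
        using c2[of k] c4[of k] const[of e k] unfolding distrib_right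
        by (intro add_mono mult_le_mono2) linarith+
      also have "\<dots> \<le> ((c2 + e) * (k + 1) + (c4 + c2 + e) * (k + 1)) * (N + 1)" by (rule lin_bound)
      finally show ?thesis by (simp only: distrib_right[symmetric] mult.assoc)
    qed
  qed
  obtain c6 where c6: "unit_time k N \<le> c6 * ((k + 1) * (N + 1))" for k N
  proof
    show "unit_time k N \<le> (2 * pick_time + c3 + c5) * ((k + 1) * (N + 1))" for k N
    proof -
      have "k + 1 \<le> (k + 1) * (N + 1)" by simp
      then have "c3 * (k + 1) \<le> c3 * ((k + 1) * (N + 1))" by (rule mult_le_mono2)
      moreover have "2 * pick_time \<le> 2 * pick_time * ((k + 1) * (N + 1))" by simp
      ultimately show ?thesis using c3[of k] c5[of k N] unfolding unit_time_def distrib_right[of _ _ "(k + 1) * (N + 1)"]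
        by linarith
    qed
  qed
  define g where "g = 1 + exp_cost (hcomp loop_guard)"
  have "edge_time k N B \<le> (stime (SA ''t'' (HC 0)) + g + (c6 + stime loop_step + g)) * ((k + 1) * (N + 1) * (B + 1))" for k N B
  proof -
    let ?M = "(k + 1) * (N + 1)"
    have "edge_time k N B = stime (SA ''t'' (HC 0)) + g + B * (unit_time k N + (stime loop_step + g))"
      by (simp add: edge_time_def g_def)
    also have "\<dots> \<le> (stime (SA ''t'' (HC 0)) + g) * ?M + B * (c6 * ?M + (stime loop_step + g) * ?M)"
      using c6[of k N] by (intro add_mono mult_le_mono2) simp_all
    also have "\<dots> \<le> ((stime (SA ''t'' (HC 0)) + g) * ?M + (c6 * ?M + (stime loop_step + g) * ?M)) * (B + 1)"
      by (rule lin_bound)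
    finally show ?thesis by (simp only: distrib_right[symmetric] mult.assoc add.assoc)
  qed
  then show ?thesis by blast
qed

lemma edge_time_mono:
  assumes "k \<le> k'" "N \<le> N'" "B \<le> B'"
  shows "edge_time k N B \<le> edge_time k' N' B'"
proof -
  have 1: "tail_time k \<le> tail_time k'" by (rule tail_time_mono[OF assms(1)])
  have 2: "arc_time k \<le> arc_time k'" using 1 by (simp add: arc_time_def)
  have 3: "search_time k \<le> search_time k'"
    unfolding search_time_def by (intro add_mono mult_le_mono1 assms(1) order_refl)
  have 4: "xfer_time k \<le> xfer_time k'" using 2 by (simp add: xfer_time_def)
  have 5: "chain_time k N \<le> chain_time k' N'"
    unfolding chain_time_def by (intro add_mono mult_le_mono assms order_refl 3 4)
  have 6: "unit_time k N \<le> unit_time k' N'" unfolding unit_time_def by (intro add_mono 2 5 order_refl)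
  show ?thesis unfolding edge_time_def by (intro add_mono mult_le_mono assms order_refl 6)
qed

text \<open>All parts are affine in the cost \<open>te\<close> of an edge operation. The slope 24 is
  the number of edge operations charged: 8 for dropping an edge from both banks and 8 for the
  adjustment of each bank.\<close>

lemma update_time_bound: "\<exists>C. \<forall>te. update_time te \<le> C * (te + 1)"
proof -
  define s where "s = step_time 0"
  have st: "step_time te = s + te" for te by (simp add: s_def step_time_def)
  define a where "a = drop_time 0"
  have dr: "drop_time te = a + 4 * te" for te by (simp add: a_def drop_time_def st)
  have gen: "1 + c1 + (c2 + (a + 4 * te + (c3 + (a + 4 * te + c4))) + c5) +
      (c6 + (c7 + c8 + 8 * (s + te) + (c7 + c8 + 8 * (s + te) + c9))) =
    1 + c1 + (c2 + (a + 4 * 0 + (c3 + (a + 4 * 0 + c4))) + c5) +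
      (c6 + (c7 + c8 + 8 * (s + 0) + (c7 + c8 + 8 * (s + 0) + c9))) + te * 24"
    for te c1 c2 c3 c4 c5 c6 c7 c8 c9 :: nat by simp
  have eq: "update_time te = update_time 0 + te * 24" for te
    unfolding update_time_def del_time_def adj_time_def dr st by (rule gen)
  have "update_time te \<le> (update_time 0 + 24) * (te + 1)" for te
    unfolding eq[of te] by (rule lin_bound)
  then show ?thesis by blast
qed

lemma Pst_ge: "j \<le> Pst j"
proof -
  have "i < 4 ^ i" for i :: nat by (induction i) auto
  from this[of j] show ?thesis by (cases "j = 0") (simp_all add: Pst_def)
qed

text \<open>Stage \<open>j > 0\<close> requires at least \<open>4 ^ j\<close> edges. The slack of 1
  is there because \<open>m\<close> counts the edges before an update, and the stage may be the one
  after an insertion.\<close>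

lemma stage_le_log:
  assumes "Pst j \<le> m + 1"
  shows "real (2 * j + 5) \<le> 6 * log 2 (real m + 2)"
proof -
  have one: "1 \<le> log 2 (real m + 2)" by (simp add: le_log_iff)
  have "real (2 * j) \<le> log 2 (real m + 2)"
  proof (cases "j = 0")
    case False
    then have "(4 :: nat) ^ j \<le> m + 1" using assms by (simp add: Pst_def)
    then have "real (4 ^ j) \<le> real (m + 1)" by (rule of_nat_mono)
    then have "(2 :: real) ^ (2 * j) \<le> real m + 2" by (simp add: power_mult)
    also have "(2 :: real) ^ (2 * j) = 2 powr real (2 * j)" by (rule powr_realpow[symmetric]) simp
    finally show ?thesis by (subst le_log_iff) simp_all
  qed (use one in simp)
  then show ?thesis using one by linarith
qed

context ram
begin

text \<open>The factor \<open>1 + 1 / K\<close> is at most 2, and the final summand of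
  \<open>Dm\<close> is the room for one unit in transit.\<close>

lemma okB_I:
  fixes r :: real
  assumes K: "1 \<le> K" "1 \<le> l" and E: "edges_ok n E" "dense_le n E r" "1 / 2 \<le> r" "2 * size E < 2 ^ l"
    and Dm: "Dm = nat \<lfloor>2 * real (bet K l) * r\<rfloor> + 1" "4 * Dm + 16 \<le> Z"
    and Ob: "2 * Dm div bet K l + 1 \<le> Ob" and N: "pot (bet K l) Dm \<le> real N"
    and te: "edge_time Ob N (bet K l) \<le> te"
  shows "okB n Z te (bet K l) E"
proof -
  have B0: "0 < bet K l" using K by (simp add: bet_def)
  have "deg n x p + 1 \<le> Dm" if x: "inside n x" "good n (bet K l) x" "\<forall>p q. wt x p q \<le> bet K l * count E {p, q}" "p < n" for x p
  proof -
    have "real (deg n x p) \<le> (1 + 1 / real K) * (real (bet K l) * r)"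
      by (rule deg_upper[OF K bet_def E x(1,2) _ x(4)]) (use x(3) in simp)
    also have "\<dots> \<le> 2 * (real (bet K l) * r)"
      by (rule mult_right_mono) (use K E(3) in \<open>simp_all add: field_simps\<close>)
    finally have "real (deg n x p) \<le> 2 * real (bet K l) * r" by simp
    then have "deg n x p \<le> nat \<lfloor>2 * real (bet K l) * r\<rfloor>" by (rule le_nat_floor)
    then show ?thesis by (simp add: Dm(1))
  qed
  then show ?thesis unfolding okB_def using B0 Dm(2) Ob N te
    by (intro exI[of _ Dm] exI[of _ Ob] exI[of _ N]) simp
qed

text \<open>The density bound \<open>r\<close> enters twice: \<open>r \<le> \<rho>\<close> limits
  the number of owned edges, while \<open>r \<le> m + 1\<close> keeps the logarithm of the largest
  degree, and with it the length of a chain, in terms of \<open>m\<close> however large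
  \<open>\<rho>\<close> is.\<close>

lemma okL_I:
  fixes r \<rho> :: real and m K :: nat
  defines "Lg \<equiv> log 2 (real m + 2)"
  defines "te \<equiv> edge_time (nat \<lfloor>10 * \<rho>\<rfloor>) (nat \<lceil>1152 * real K ^ 2 * Lg ^ 2\<rceil>) (nat \<lfloor>192 * real K ^ 2 * Lg\<rfloor>)"
  assumes K: "1 \<le> K" and L: "pairs_ok n L" "dense_le n (mset (map eset L)) r" "length L \<le> m + 1"
    and r: "1 / 2 \<le> r" "r \<le> \<rho>" "r \<le> real m + 1"
    and Z: "8 * (32 * K ^ 2 * (2 * m + 7)) * (m + 1) + 20 \<le> Z"
  shows "okL n Z te K L"
proof -
  have one: "1 \<le> Lg" by (simp add: Lg_def le_log_iff)
  have K1: "1 \<le> real K ^ 2" using K by (simp add: one_le_power)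
  have "okB n Z te (bet K l) (cont L (length L)) \<and> bet K l \<le> Z"
    if j: "Pst j \<le> length L" "length L < 4 ^ Suc j" "l = 2 * j + 3 \<or> l = 2 * j + 5" for j l
  proof -
    define B where "B = bet K l"
    have l1: "1 \<le> l" using j(3) by auto
    have B0: "1 \<le> B" using K l1 by (simp add: B_def bet_def)
    have "real l \<le> real (2 * j + 5)" using j(3) by auto
    also have "\<dots> \<le> 6 * Lg" unfolding Lg_def by (rule stage_le_log) (use j(1) L(3) in simp)
    finally have lL: "real l \<le> 6 * Lg" .
    have lm: "l \<le> 2 * m + 7" using j(1,3) Pst_ge[of j] L(3) by linarith
    have B1: "B \<le> 32 * K ^ 2 * (2 * m + 7)" unfolding B_def bet_def using lm by (rule mult_le_mono2)
    have rB: "real B = 32 * real K ^ 2 * real l" by (simp add: B_def bet_def)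
    have BL: "real B \<le> 192 * real K ^ 2 * Lg"
      unfolding rB using mult_left_mono[OF lL, of "32 * real K ^ 2"] by simp
    define Dm where "Dm = nat \<lfloor>2 * real B * r\<rfloor> + 1"
    have rp: "0 \<le> 2 * real B * r" using r(1) by simp
    have Dr: "real Dm \<le> 2 * real B * r + 1" using of_nat_floor[OF rp] by (simp add: Dm_def)
    have "2 * real B * r \<le> 2 * real B * (real m + 1)" by (rule mult_left_mono[OF r(3)]) simp
    then have "real Dm \<le> 2 * real B * (real m + 1) + 1" using Dr by linarith
    also have "2 * real B * (real m + 1) + 1 = real (2 * B * (m + 1) + 1)" by (simp add: algebra_simps)
    finally have "Dm \<le> 2 * B * (m + 1) + 1" by (simp only: of_nat_le_iff)
    moreover have "B * (m + 1) \<le> 32 * K ^ 2 * (2 * m + 7) * (m + 1)" by (rule mult_le_mono1[OF B1])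
    ultimately have DZ: "4 * Dm + 16 \<le> Z" using Z by simp
    have "B * 1 \<le> B * (m + 1)" by (rule mult_le_mono2) simp
    then have BZ: "B \<le> Z" using \<open>B * (m + 1) \<le> 32 * K ^ 2 * (2 * m + 7) * (m + 1)\<close> Z by simp
    have DB: "real Dm / real B \<le> 2 * r + 1"
    proof -
      have "real Dm \<le> (2 * r + 1) * real B" using Dr B0 by (simp add: algebra_simps)
      then show ?thesis using B0 by (simp add: divide_le_eq)
    qed
    \<comment> \<open>The left side is at most \<open>4 * r + 3\<close>, and 3 is at most
      \<open>6 * \<rho>\<close>.\<close>
    have Ob: "2 * Dm div B + 1 \<le> nat \<lfloor>10 * \<rho>\<rfloor>"
    proof (rule le_nat_floor)
      have "real (2 * Dm div B) \<le> real (2 * Dm) / real B" by (rule of_nat_div_le_of_nat)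
      also have "\<dots> = 2 * (real Dm / real B)" by simp
      also have "\<dots> \<le> 2 * (2 * r + 1)" by (rule mult_left_mono[OF DB]) simp
      finally show "real (2 * Dm div B + 1) \<le> 10 * \<rho>" using r by simp
    qed
    have "1 + real Dm / real B \<le> 2 * (real m + 2)" using DB r(3) by simp
    then have "ln (1 + real Dm / real B) \<le> ln (2 * (real m + 2))"
      by (intro ln_mono) (simp_all add: add_pos_nonneg)
    also have "\<dots> = ln 2 + ln (real m + 2)" by (rule ln_mult_pos) simp_all
    also have "ln (real m + 2) = Lg * ln 2" by (simp add: Lg_def log_def)
    also have "ln 2 + Lg * ln 2 \<le> Lg + Lg"
    proof (rule add_mono)
      have l2: "ln 2 \<le> (1 :: real)" using ln_le_minus_one[of 2] by simp
      then show "ln 2 \<le> Lg" using one by simp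
      show "Lg * ln 2 \<le> Lg" using mult_left_mono[OF l2, of Lg] one by simp
    qed
    finally have lnb: "ln (1 + real Dm / real B) \<le> 2 * Lg" by simp
    \<comment> \<open>The constant 1152 is the product of 3 from \<open>pot\<close>, 2 from the
      bound on the logarithm, and 192 from the bound on \<open>B\<close>, where 192 is 32 times the
      6 of \<open>stage_le_log\<close>.\<close>
    have "pot B Dm \<le> 3 * real B * (2 * Lg)" unfolding pot_def by (rule mult_left_mono[OF lnb]) simp
    also have "\<dots> = 6 * Lg * real B" by simp
    also have "\<dots> \<le> 6 * Lg * (192 * real K ^ 2 * Lg)" by (rule mult_left_mono[OF BL]) (use one in simp)
    also have "\<dots> = 1152 * real K ^ 2 * Lg ^ 2" by (simp add: power2_eq_square)
    also have "\<dots> \<le> real (nat \<lceil>1152 * real K ^ 2 * Lg ^ 2\<rceil>)" by (rule real_nat_ceiling_ge)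
    finally have N: "pot B Dm \<le> real (nat \<lceil>1152 * real K ^ 2 * Lg ^ 2\<rceil>)" .
    have BB: "B \<le> nat \<lfloor>192 * real K ^ 2 * Lg\<rfloor>" by (rule le_nat_floor[OF BL])
    have te: "edge_time (nat \<lfloor>10 * \<rho>\<rfloor>) (nat \<lceil>1152 * real K ^ 2 * Lg ^ 2\<rceil>) B \<le> te"
      unfolding te_def by (rule edge_time_mono[OF order_refl order_refl BB])
    have size: "2 * size (cont L (length L)) < 2 ^ l"
    proof -
      have "2 * length L < 2 * 4 ^ Suc j" using j(2) by simp
      also have "(2 :: nat) * 4 ^ Suc j = 2 ^ (2 * j + 3)" by (simp add: power_mult power_add)
      also have "\<dots> \<le> 2 ^ l" by (rule power_increasing) (use j(3) in auto)
      finally show ?thesis by (simp add: size_cont)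
    qed
    have "okB n Z te (bet K l) (cont L (length L))"
      by (rule okB_I[OF K l1 cont_edges_ok[OF L(1)] L(2)[folded cont_all] r(1) size Dm_def[unfolded B_def] DZ
          Ob[unfolded B_def] N[unfolded B_def] te[unfolded B_def]])
    then show ?thesis using BZ by (simp add: B_def)
  qed
  moreover have "6 * length L + 8 \<le> Z"
  proof -
    have "1 \<le> K ^ 2" using K by simp
    then have "32 * 1 * (2 * m + 7) \<le> 32 * K ^ 2 * (2 * m + 7)" by (intro mult_le_mono) simp_all
    moreover have "32 * K ^ 2 * (2 * m + 7) * 1 \<le> 32 * K ^ 2 * (2 * m + 7) * (m + 1)" by (rule mult_le_mono2) simp
    ultimately have "32 * (2 * m + 7) \<le> Z" using Z by simp
    then show ?thesis using L(3) by simp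
  qed
  ultimately show ?thesis unfolding okL_def by blast
qed

end

text \<open>The three factors multiply to the order of \<open>\<rho> * K ^ 4 * Lg ^ 3\<close>. Since
  \<open>\<epsilon> \<le> 1\<close> gives \<open>K \<le> 2 / \<epsilon>\<close>, the summand
  \<open>1 / \<epsilon> ^ 4\<close> of \<open>time_bound\<close> absorbs the product; the constant
  is 12 times 1154 times 193 times 16, rounded up.\<close>

lemma time_final:
  fixes \<rho> \<epsilon> :: real and m K C C' :: nat
  assumes C: "\<And>k N B. edge_time k N B \<le> C * ((k + 1) * (N + 1) * (B + 1))" "\<And>te. update_time te \<le> C' * (te + 1)"
    and \<epsilon>: "0 < \<epsilon>" "\<epsilon> \<le> 1" and \<rho>: "1 / 2 \<le> \<rho>" and K: "K = nat \<lceil>1 / \<epsilon>\<rceil>"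
  defines "Lg \<equiv> log 2 (real m + 2)"
  shows "real (update_time (edge_time (nat \<lfloor>10 * \<rho>\<rfloor>) (nat \<lceil>1152 * real K ^ 2 * Lg ^ 2\<rceil>) (nat \<lfloor>192 * real K ^ 2 * Lg\<rfloor>)))
    \<le> real C' * (real C + 1) * 50000000 * time_bound \<epsilon> \<rho> m"
proof -
  let ?k = "nat \<lfloor>10 * \<rho>\<rfloor>" and ?N = "nat \<lceil>1152 * real K ^ 2 * Lg ^ 2\<rceil>" and ?B = "nat \<lfloor>192 * real K ^ 2 * Lg\<rfloor>"
  have one: "1 \<le> Lg" by (simp add: Lg_def le_log_iff)
  have e1: "1 \<le> 1 / \<epsilon>" using \<epsilon> by simp
  have Kr: "real K \<le> 2 / \<epsilon>"
  proof -
    have "real K < 1 / \<epsilon> + 1" unfolding K using e1 by linarith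
    then show ?thesis using e1 by simp
  qed
  have K1: "1 \<le> real K" unfolding K using e1 by linarith
  have K2: "1 \<le> real K ^ 2" using K1 by (rule one_le_power)
  have L2: "1 \<le> Lg ^ 2" using one by (rule one_le_power)
  have KL: "1 \<le> real K ^ 2 * Lg" "1 \<le> real K ^ 2 * Lg ^ 2"
    using mult_mono[OF K2 one] mult_mono[OF K2 L2] by simp_all
  have "real ?k \<le> 10 * \<rho>" by (rule of_nat_floor) (use \<rho> in simp)
  then have 1: "real (?k + 1) \<le> 12 * \<rho>" using \<rho> unfolding of_nat_add by linarith
  have "real (nat \<lceil>x\<rceil>) \<le> x + 1" if "0 \<le> x" for x :: real using that by linarith
  from this[of "1152 * real K ^ 2 * Lg ^ 2"] have N: "real ?N \<le> 1152 * real K ^ 2 * Lg ^ 2 + 1" by simp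
  have 2: "real (?N + 1) \<le> 1154 * (real K ^ 2 * Lg ^ 2)" using KL(2) N by linarith
  have "real ?B \<le> 192 * real K ^ 2 * Lg" by (rule of_nat_floor) (use one in simp)
  then have 3: "real (?B + 1) \<le> 193 * (real K ^ 2 * Lg)" using KL(1) unfolding of_nat_add by simp
  have "real ((?k + 1) * (?N + 1) * (?B + 1)) \<le> (12 * \<rho>) * (1154 * (real K ^ 2 * Lg ^ 2)) * (193 * (real K ^ 2 * Lg))"
    unfolding of_nat_mult by (intro mult_mono 1 2 3 of_nat_0_le_iff mult_nonneg_nonneg) (use \<rho> one in simp_all)
  also have "\<dots> = 2672664 * (\<rho> * real K ^ 4 * Lg ^ 3)" by (simp add: power2_eq_square power3_eq_cube power4_eq_xxxx)
  also have "\<dots> \<le> 2672664 * (\<rho> * (2 / \<epsilon>) ^ 4 * Lg ^ 3)"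
    by (intro mult_left_mono mult_right_mono power_mono Kr) (use \<rho> one in simp_all)
  also have "\<dots> = 42762624 * (1 / \<epsilon> ^ 4 * \<rho> * Lg ^ 3)" by (simp add: power_divide)
  also have "\<dots> \<le> 42762624 * ((\<rho> / \<epsilon> ^ 2 + 1 / \<epsilon> ^ 4) * \<rho> * Lg ^ 3)"
    by (intro mult_left_mono mult_right_mono) (use \<rho> one \<epsilon> in simp_all)
  finally have M: "real ((?k + 1) * (?N + 1) * (?B + 1)) \<le> 42762624 * time_bound \<epsilon> \<rho> m"
    by (simp add: time_bound_def Lg_def)
  have tb: "0 \<le> time_bound \<epsilon> \<rho> m"
    unfolding time_bound_def Lg_def[symmetric] using \<rho> \<epsilon> one by (intro mult_nonneg_nonneg add_nonneg_nonneg) simp_all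
  let ?M = "(?k + 1) * (?N + 1) * (?B + 1)"
  have "update_time (edge_time ?k ?N ?B) \<le> C' * (edge_time ?k ?N ?B + 1)" by (rule C(2))
  also have "\<dots> \<le> C' * (C * ?M + ?M)" by (intro mult_le_mono2 add_mono C(1)) simp
  finally have "real (update_time (edge_time ?k ?N ?B)) \<le> real (C' * (C * ?M + ?M))" by (rule of_nat_mono)
  also have "\<dots> = real C' * (real C + 1) * real ?M" by (simp add: algebra_simps)
  also have "\<dots> \<le> real C' * (real C + 1) * (42762624 * time_bound \<epsilon> \<rho> m)" by (rule mult_left_mono[OF M]) simp
  also have "\<dots> \<le> real C' * (real C + 1) * (50000000 * time_bound \<epsilon> \<rho> m)"
    by (intro mult_left_mono mult_right_mono tb) simp_all
  finally show ?thesis by (simp only: mult.assoc)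
qed

section \<open>Densities and the quality of the estimate\<close>

lemma finite_densities:
  "finite ((\<lambda>S. real (size (induced_edges E S)) / real (card S)) ` {S. S \<subseteq> {..<n} \<and> S \<noteq> {}})"
proof -
  have "{S. S \<subseteq> {..<n} \<and> S \<noteq> {}} \<subseteq> Pow {..<n}" by blast
  then have "finite {S. S \<subseteq> {..<n} \<and> S \<noteq> {}}" by (rule finite_subset) simp
  then show ?thesis by (rule finite_imageI)
qed

lemma card_subset_pos:
  assumes "S \<subseteq> {..<n :: nat}" "S \<noteq> {}"
  shows "0 < card S"
  using assms finite_subset[OF assms(1)] by (simp add: card_gt_0_iff)

lemma max_density_leI:
  assumes "0 < n" "dense_le n E d"
  shows "max_density {..<n} E \<le> d"
  unfolding max_density_def
proof (rule Max.boundedI[OF finite_densities])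
  have "{..<n} \<in> {S. S \<subseteq> {..<n} \<and> S \<noteq> {}}" using assms(1) by auto
  then show "(\<lambda>S. real (size (induced_edges E S)) / real (card S)) ` {S. S \<subseteq> {..<n} \<and> S \<noteq> {}} \<noteq> {}" by blast
next
  fix y assume "y \<in> (\<lambda>S. real (size (induced_edges E S)) / real (card S)) ` {S. S \<subseteq> {..<n} \<and> S \<noteq> {}}"
  then obtain S where S: "S \<subseteq> {..<n}" "S \<noteq> {}" "y = real (size (induced_edges E S)) / real (card S)" by blast
  have "real (size (induced_edges E S)) \<le> d * real (card S)" using assms(2) S(1,2) by (simp add: dense_le_def)
  then show "y \<le> d" using card_subset_pos[OF S(1,2)] unfolding S(3) by (simp add: divide_le_eq)
qed

lemma dense_max: "dense_le n E (max_density {..<n} E)"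
  unfolding dense_le_def
proof (intro allI impI)
  fix S assume S: "S \<subseteq> {..<n}" "S \<noteq> {}"
  have "real (size (induced_edges E S)) / real (card S) \<le> max_density {..<n} E"
    unfolding max_density_def by (rule Max_ge[OF finite_densities]) (use S in blast)
  then show "real (size (induced_edges E S)) \<le> max_density {..<n} E * real (card S)"
    using card_subset_pos[OF S] by (simp add: divide_le_eq)
qed

lemma max_density_nonneg:
  assumes "0 < n"
  shows "0 \<le> max_density {..<n} E"
proof -
  have "{..<n} \<noteq> {}" using assms by auto
  then have "real (size (induced_edges E {..<n})) \<le> max_density {..<n} E * real (card {..<n})"
    using dense_max[of n E] unfolding dense_le_def by blast
  then have "0 \<le> max_density {..<n} E * real n" using order_trans[OF of_nat_0_le_iff] by simp
  then show ?thesis using assms by (simp add: zero_le_mult_iff)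
qed

lemma max_density_empty:
  assumes "0 < n"
  shows "max_density {..<n} {#} = 0"
proof (rule antisym[OF _ max_density_nonneg[OF assms]])
  show "max_density {..<n} {#} \<le> 0"
    by (rule max_density_leI[OF assms]) (simp add: dense_le_def induced_edges_def)
qed

text \<open>The two endpoints of the edge alone have density at least 1/2. This is the source of the
  lower bounds by which additive errors are absorbed.\<close>

lemma max_density_half:
  assumes E: "edges_ok n E" "e \<in># E"
  shows "1 / 2 \<le> max_density {..<n} E"
proof -
  obtain u v where uv: "u < n" "v < n" "u \<noteq> v" "e = {u, v}" using E unfolding edges_ok_def by blast
  have "e \<in># induced_edges E {u, v}" using E(2) uv(4) by (simp add: induced_edges_def)
  then have "1 \<le> size (induced_edges E {u, v})" by (cases "induced_edges E {u, v}") auto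
  moreover have "real (size (induced_edges E {u, v})) \<le> max_density {..<n} E * real (card {u, v})"
    using dense_max[of n E, unfolded dense_le_def, rule_format, of "{u, v}"] uv by simp
  ultimately show ?thesis using uv(3) by simp
qed

text \<open>A nonempty set has at least one vertex, so the number of edges bounds every density as
  well.\<close>

lemma dense_le_minI:
  assumes "max_density {..<n} E \<le> \<rho>" "real (size E) \<le> k"
  shows "dense_le n E (min \<rho> k)"
  unfolding dense_le_def
proof (intro allI impI)
  fix S assume S: "S \<subseteq> {..<n}" "S \<noteq> {}"
  have c: "1 \<le> real (card S)" using card_subset_pos[OF S] by simp
  have "real (size (induced_edges E S)) \<le> max_density {..<n} E * real (card S)"
    using dense_max[of n E] S by (simp add: dense_le_def)
  also have "\<dots> \<le> \<rho> * real (card S)" by (rule mult_right_mono[OF assms(1)]) simp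
  finally have 1: "real (size (induced_edges E S)) \<le> \<rho> * real (card S)" .
  have "size (induced_edges E S) \<le> size E" unfolding induced_edges_def by (rule size_filter_mset_lesseq)
  then have k: "real (size (induced_edges E S)) \<le> k" using assms(2) by linarith
  have "0 \<le> k" using assms(2) by linarith
  then have "k * 1 \<le> k * real (card S)" using c by (intro mult_left_mono)
  then have 2: "real (size (induced_edges E S)) \<le> k * real (card S)" using k by linarith
  show "real (size (induced_edges E S)) \<le> min \<rho> k * real (card S)"
    using 1 2 by (cases "\<rho> \<le> k") (simp_all add: min_def)
qed

lemma est_approx:
  assumes est: "est_ok n K h L" and L: "pairs_ok n L" and K: "1 \<le> K" "1 / real K \<le> \<epsilon>" and n: "0 < n"
    and s: "fst s = rg h"
  shows "is_approx \<epsilon> (max_density {..<n} (mset (map eset L))) (estimate s)"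
proof -
  let ?E = "mset (map eset L)" and ?\<rho> = "max_density {..<n} (mset (map eset L))"
  obtain sl l where b: "bankst n (bet K l) (mm h sl) (cont L (length L))" "rg h ''num'' = mm h sl (7, 0, 0, 0)"
    "rg h ''den'' + 1 = bet K l" "1 \<le> l" "2 * length L < 2 ^ l"
    using est unfolding est_ok_def by (elim exE conjE)
  note b1 = b(1)[unfolded cont_all]
  let ?d = "mm h sl (7, 0, 0, 0)" and ?B = "bet K l"
  have E: "edges_ok n ?E" using cont_edges_ok[OF L, of "length L"] by (simp only: cont_all)
  have B: "0 < ?B" using K b(4) by (simp add: bet_def)
  have "real (rg h ''den'') + 1 = real ?B" using b(3) by (metis of_nat_add of_nat_1)
  then have e: "estimate s = real ?d / real ?B" by (simp add: estimate_def s b(2))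
  have "dense_le n ?E (real ?d / real ?B)"
    unfolding dense_le_def
  proof (intro allI impI)
    fix S assume S: "S \<subseteq> {..<n}" "S \<noteq> {}"
    have "real (?B * size (induced_edges ?E S)) \<le> real (?d * card S)"
      by (rule of_nat_mono[OF bankst_lower[OF b1 E S(1)]])
    then show "real (size (induced_edges ?E S)) \<le> real ?d / real ?B * real (card S)"
      using B by (simp add: field_simps)
  qed
  then have lo: "?\<rho> \<le> estimate s" unfolding e by (rule max_density_leI[OF n])
  have up: "estimate s \<le> (1 + \<epsilon>) * ?\<rho>"
  \<comment> \<open>The empty graph is treated apart because its density 0 lies below the bound 1/2
    that \<open>bankst_upper\<close> asks for.\<close>
  proof (cases "L = []")
    case True
    then have "?d = 0" using bankst_zero(1) b1 by simp
    then show ?thesis using True by (simp add: e max_density_empty[OF n])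
  next
    case False
    then have "eset (hd L) \<in># ?E" by simp
    then have h: "1 / 2 \<le> ?\<rho>" by (rule max_density_half[OF E])
    have "real ?d \<le> (1 + 1 / real K) * (real ?B * ?\<rho>)"
      by (rule bankst_upper[OF b1 K(1) b(4) bet_def E dense_max h]) (simp add: b(5))
    also have "\<dots> \<le> (1 + \<epsilon>) * (real ?B * ?\<rho>)" by (rule mult_right_mono) (use K(2) h in simp_all)
    finally show ?thesis unfolding e using B by (simp add: divide_le_eq algebra_simps)
  qed
  show ?thesis using lo up by (simp add: is_approx_def)
qed

lemma pairs_ok_del:
  assumes "pairs_ok n L" "x < length L"
  shows "pairs_ok n (del_at L x)"
proof -
  have ne: "L \<noteq> []" using assms(2) by auto
  have "set (del_at L x) \<subseteq> set (L[x := last L])" unfolding del_at_def by (meson in_set_butlastD subsetI)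
  also have "\<dots> \<subseteq> insert (last L) (set L)" by (rule set_update_subset_insert)
  also have "\<dots> = set L" using ne by (simp add: insert_absorb)
  finally show ?thesis using assms(1) unfolding pairs_ok_def by blast
qed

context ram
begin

text \<open>The condition \<open>ok'\<close> ranges over all lists with the right edges, since the
  order in which a deletion leaves the array is not determined by the edge multiset.\<close>

lemma update_step:
  assumes rel: "rel s h" and I: "invar n K h L j" and K: "1 \<le> K"
    and valid: "valid_update {..<n} (mset (map eset L)) up"
    and ok: "okL n Z te K L" and len: "length L + 1 \<le> Z"
    and ok': "\<And>L'. pairs_ok n L' \<Longrightarrow> mset (map eset L') = apply_update up (mset (map eset L)) \<Longrightarrow> okL n Z te K L'"
  shows "\<exists>t s' h' L' j'. exec w update_com (announce up s) t s' \<and> t \<le> update_time te \<and> rel s' h' \<and>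
    invar n K h' L' j' \<and> est_ok n K h' L' \<and> mset (map eset L') = apply_update up (mset (map eset L))"
proof -
  let ?E = "mset (map eset L)"
  obtain op u v where a: "announce up s = ((fst s)(''op'' := op, ''u'' := u, ''v'' := v), snd s)"
    "op \<le> 1" "u < n" "v < n" "u \<noteq> v" "op = 0 \<Longrightarrow> up = Insert u v" "op \<noteq> 0 \<Longrightarrow> up = Delete u v \<and> {u, v} \<in># ?E"
  proof (cases up)
    case (Insert u v)
    then show ?thesis using that[of 0 u v] valid by simp
  next
    case (Delete u v)
    then show ?thesis using that[of 1 u v] valid by simp
  qed
  define h0 where "h0 = HS ((rg h)(''op'' := op, ''u'' := u, ''v'' := v)) (mm h)"
  have "op \<le> Z" "u \<le> Z" "v \<le> Z" using a(2-4) n_le Z_ge by simp_all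
  then have r0: "rel (announce up s) h0" using rel unfolding a(1) by (simp add: rel_def bounded_def h0_def)
  then have bd: "bounded h0" by (simp add: rel_def)
  have I0: "invar n K h0 L j" using I by (simp add: h0_def invar_def top_def slt_def bnk_def)
  have uv: "rg h0 ''u'' = u" "rg h0 ''v'' = v" and op: "rg h0 ''op'' = op" by (simp_all add: h0_def)
  have P: "pairs_ok n L" using I by (simp add: invar_def top_def arr_def)
  have J: "Pst j \<le> length L" "length L < 4 ^ Suc j" using I by (simp_all add: invar_def)
  let ?c = "Cond (hcomp (HV ''op'')) del_com (scomp ins_code)"
  let ?T = "del_time te + stime ins_code"
  have hs: "hstat (HV ''op'')" "hok n (HV ''op'') h0" by simp_all
  have "\<exists>L'. wp ?c (1 + exp_cost (hcomp (HV ''op'')) + ?T) (\<lambda>h'. phase1 n K (length L) h' L' j) h0 \<and>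
     mset (map eset L') = apply_update up ?E \<and> (length L' = Suc (length L) \<or> length L = Suc (length L')) \<and> pairs_ok n L'"
  proof (cases "op = 0")
    case True
    let ?L = "L @ [(min u v, max u v)]"
    have "wp (scomp ins_code) ?T (\<lambda>h'. phase1 n K (length L) h' ?L j) h0"
      by (rule wp_mono[OF wp_scom[OF _ ins_wps[OF I0 uv a(3-5) len]]]) simp_all
    then have 1: "wp ?c (1 + exp_cost (hcomp (HV ''op'')) + ?T) (\<lambda>h'. phase1 n K (length L) h' ?L j) h0"
      by (intro wp_cond hs) (use True op in simp_all)
    have e: "eset (min u v, max u v) = {u, v}" by (cases "u \<le> v") (auto simp: eset_def)
    have "pairs_ok n ?L" using P a(3-5) by (auto simp: pairs_ok_def)
    then show ?thesis using 1 e a(6)[OF True] by (intro exI[of _ ?L]) simp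
  next
    case False
    obtain x where x: "x < length L" "eset (L ! x) = {u, v}"
      "wp del_com (del_time te) (\<lambda>h'. phase1 n K (length L) h' (del_at L x) j) h0"
      using del_wp[OF I0 uv a(3-5) conjunct2[OF a(7)[OF False]] ok bd] by blast
    have "wp del_com ?T (\<lambda>h'. phase1 n K (length L) h' (del_at L x) j) h0"
      by (rule wp_mono[OF x(3)]) simp_all
    then have 1: "wp ?c (1 + exp_cost (hcomp (HV ''op'')) + ?T) (\<lambda>h'. phase1 n K (length L) h' (del_at L x) j) h0"
      by (intro wp_cond hs) (use False op in simp_all)
    have m: "Suc (length L - 1) = length L" using x(1) by simp
    have e: "mset (map eset (del_at L x)) = ?E - {#{u, v}#}" using eset_del[OF m x(1)] unfolding x(2) .
    have l: "length L = Suc (length (del_at L x))" using m by (simp add: del_at_def)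
    show ?thesis using 1 e l pairs_ok_del[OF P x(1)] a(7)[OF False] by (intro exI[of _ "del_at L x"]) simp
  qed
  then obtain L' where L': "wp ?c (1 + exp_cost (hcomp (HV ''op'')) + ?T) (\<lambda>h'. phase1 n K (length L) h' L' j) h0"
     "mset (map eset L') = apply_update up ?E" "length L' = Suc (length L) \<or> length L = Suc (length L')" "pairs_ok n L'"
    by blast
  note U = update_wp[OF L'(1) J L'(3) K ok'[OF L'(4,2)]]
  have "wp update_com (update_time te) (\<lambda>h'. (\<exists>j'. invar n K h' L' j') \<and> est_ok n K h' L') h0"
    using U unfolding update_com_def update_time_def .
  then obtain t s' h' where "exec w update_com (announce up s) t s'" "t \<le> update_time te" "rel s' h'"
    "\<exists>j'. invar n K h' L' j'" "est_ok n K h' L'"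
    using r0 unfolding wp_def by blast
  then show ?thesis using L'(2) by blast
qed

end

text \<open>Let \<open>b\<close> be the sum inside the logarithm of \<open>word_size_ok\<close>. As
  \<open>1000 \<le> q ^ 5\<close> and \<open>q \<le> b ^ 2\<close>, the left side is at most
  \<open>q ^ 540 \<le> b ^ 1080\<close>, and one further factor makes the inequality strict. This is
  the origin of 1081.\<close>

lemma word_size_bound:
  assumes "word_size_ok 1081 w n M \<epsilon> \<rho>" "0 < \<epsilon>" "\<epsilon> \<le> 1" "0 \<le> \<rho>" "0 < n"
  defines "q \<equiv> nat \<lceil>real n + real M + 1 / \<epsilon> + \<rho> + 2\<rceil>"
  shows "(1000 * q ^ 4) ^ 60 < 2 ^ w"
proof -
  define b where "b = real n + real M + 1 / \<epsilon> + \<rho> + 2"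
  have "1 \<le> 1 / \<epsilon>" using assms(2,3) by simp
  then have b4: "4 \<le> b" using assms(4,5) by (simp add: b_def)
  have q: "q = nat \<lceil>b\<rceil>" by (simp add: q_def b_def)
  have q4: "4 \<le> q" using b4 unfolding q by linarith
  have "real q \<le> b + 1" using b4 unfolding q by linarith
  also have "\<dots> \<le> b * 2" using b4 by simp
  also have "\<dots> \<le> b * b" by (rule mult_left_mono) (use b4 in simp_all)
  finally have qb: "real q \<le> b ^ 2" by (simp add: power2_eq_square)
  have "(4 :: nat) ^ 5 \<le> q ^ 5" by (rule power_mono[OF q4]) simp
  then have "1000 \<le> q ^ 5" by simp
  then have "1000 * q ^ 4 \<le> q ^ 5 * q ^ 4" by (rule mult_le_mono1)
  also have "\<dots> = q ^ 9" by (simp flip: power_add)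
  finally have "(1000 * q ^ 4) ^ 60 \<le> (q ^ 9) ^ 60" by (rule power_mono) simp
  then have "(1000 * q ^ 4) ^ 60 \<le> q ^ 540" by (simp flip: power_mult)
  then have "real ((1000 * q ^ 4) ^ 60) \<le> real (q ^ 540)" by (rule of_nat_mono)
  also have "\<dots> = real q ^ 540" by (rule of_nat_power)
  also have "\<dots> \<le> (b ^ 2) ^ 540" by (rule power_mono[OF qb]) simp
  also have "\<dots> = b ^ 1080" by (simp flip: power_mult)
  also have "\<dots> < b ^ 1081" by (rule power_strict_increasing) (use b4 in simp_all)
  also have "\<dots> = b powr real 1081" by (rule powr_realpow[symmetric]) (use b4 in simp)
  also have "\<dots> = (2 powr log 2 b) powr real 1081" using b4 by simp
  also have "\<dots> = 2 powr (real 1081 * log 2 b)" by (simp only: powr_powr mult.commute)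
  also have "\<dots> \<le> 2 powr real w"
    by (rule powr_mono) (use assms(1) in \<open>simp_all add: word_size_ok_def b_def\<close>)
  also have "\<dots> = real (2 ^ w)" by (simp add: powr_realpow)
  finally show ?thesis by (simp only: of_nat_less_iff)
qed

text \<open>The left side is the requirement on \<open>Z\<close> in \<open>okL_I\<close>; the fourth
  power accounts for \<open>K ^ 2\<close> and two factors linear in \<open>m\<close>.\<close>

lemma space_bound:
  assumes "K \<le> q" "m + 2 \<le> q" "4 \<le> (q :: nat)"
  shows "8 * (32 * K ^ 2 * (2 * m + 7)) * (m + 1) + 20 \<le> 1000 * q ^ 4"
proof -
  have K: "K ^ 2 \<le> q ^ 2" by (rule power_mono[OF assms(1)]) simp
  have a: "2 * m + 7 \<le> 3 * q" "m + 1 \<le> q" using assms(2,3) by linarith+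
  have "8 * (32 * K ^ 2 * (2 * m + 7)) * (m + 1) \<le> 8 * (32 * q ^ 2 * (3 * q)) * q"
    by (intro mult_le_mono order_refl K a)
  also have "\<dots> = 768 * q ^ 4" by (simp add: power2_eq_square power4_eq_xxxx)
  finally have 1: "8 * (32 * K ^ 2 * (2 * m + 7)) * (m + 1) \<le> 768 * q ^ 4" .
  have "1 ^ 4 \<le> q ^ 4" by (rule power_mono) (use assms(3) in simp_all)
  then show ?thesis using 1 by simp
qed

lemma edges_after_Suc:
  "i < length us \<Longrightarrow> edges_after us (Suc i) = apply_update (us ! i) (edges_after us i)"
  by (simp add: edges_after_def take_Suc_conv_app_nth)

lemma update_com_correct:
  assumes C: "\<And>k N B. edge_time k N B \<le> C * ((k + 1) * (N + 1) * (B + 1))" "\<And>te. update_time te \<le> C' * (te + 1)"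
    and n: "0 < n" and \<epsilon>: "0 < \<epsilon>" "\<epsilon> \<le> 1" and valid: "valid_updates {..<n} us"
    and dens: "\<forall>i \<le> length us. max_density {..<n} (edges_after us i) \<le> \<rho>"
    and size: "\<forall>i \<le> length us. size (edges_after us i) \<le> M"
    and ws: "word_size_ok 1081 w n M \<epsilon> \<rho>"
  shows "\<exists>st :: nat \<Rightarrow> state.
    st 0 = init_state n \<epsilon> \<rho> \<and>
    (\<forall>i \<le> length us. is_approx \<epsilon> (max_density {..<n} (edges_after us i)) (estimate (st i))) \<and>
    (\<forall>i < length us. \<exists>t. exec w update_com (announce (us ! i) (st i)) t (st (Suc i)) \<and>
       real t \<le> real C' * (real C + 1) * 50000000 * time_bound \<epsilon> \<rho> (size (edges_after us i)))"
proof -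
  have e0: "edges_after us 0 = {#}" by (simp add: edges_after_def)
  have \<rho>0: "0 \<le> \<rho>" using dens[rule_format, of 0] max_density_nonneg[OF n] by (rule order_trans[rotated]) simp
  define K q Z where "K = nat \<lceil>1 / \<epsilon>\<rceil>" and "q = nat \<lceil>real n + real M + 1 / \<epsilon> + \<rho> + 2\<rceil>"
    and "Z = 1000 * q ^ 4"
  have e1: "1 \<le> 1 / \<epsilon>" using \<epsilon> by simp
  have K1: "1 \<le> K" using e1 unfolding K_def by linarith
  have "1 / \<epsilon> \<le> real K" unfolding K_def by (rule real_nat_ceiling_ge)
  then have Ke: "1 / real K \<le> \<epsilon>" using K1 \<epsilon> by (simp add: field_simps)
  have q: "4 \<le> q" "n \<le> q" "M + 2 \<le> q" "K \<le> q" "nat \<lceil>\<rho>\<rceil> \<le> q"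
    using e1 n \<rho>0 unfolding q_def K_def by linarith+
  have "q ^ 1 \<le> q ^ 4" by (rule power_increasing) (use q(1) in simp_all)
  then have qZ: "q \<le> Z" "64 \<le> Z" using q(1) by (simp_all add: Z_def)
  have "Z ^ 60 < 2 ^ w" unfolding Z_def q_def by (rule word_size_bound[OF ws \<epsilon> \<rho>0 n])
  then interpret ram n w Z by unfold_locales (use n q(2) qZ in simp_all)
  define good where "good i s \<longleftrightarrow> (\<exists>h L j. rel s h \<and> invar n K h L j \<and> mset (map eset L) = edges_after us i) \<and>
    is_approx \<epsilon> (max_density {..<n} (edges_after us i)) (estimate s)" for i s
  let ?bnd = "\<lambda>i. real C' * (real C + 1) * 50000000 * time_bound \<epsilon> \<rho> (size (edges_after us i))"
  have init: "good 0 (init_state n \<epsilon> \<rho>)"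
  proof -
    let ?h = "HS (fst (init_state n \<epsilon> \<rho>)) (\<lambda>_ _. 0)"
    have "rel (init_state n \<epsilon> \<rho>) ?h" using q(2,4,5) qZ(1) by (simp add: rel_def bounded_def init_state_def K_def)
    moreover have "invar n K ?h [] 0"
      by (simp add: invar_def top_def slt_def bnk_def arr_def pairs_ok_def Pst_def tnew_def told_def cont_def bankst_init
          init_state_def K_def)
    moreover have "is_approx \<epsilon> (max_density {..<n} (edges_after us 0)) (estimate (init_state n \<epsilon> \<rho>))"
      by (simp add: e0 max_density_empty[OF n] is_approx_def estimate_def init_state_def)
    ultimately show ?thesis unfolding good_def e0 by (metis list.map(1) mset.simps(1))
  qed
  have step: "\<exists>s'. good (Suc i) s' \<and> (\<exists>t. exec w update_com (announce (us ! i) s) t s' \<and> real t \<le> ?bnd i)"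
    if i: "i < length us" and g: "good i s" for i s
  proof -
    obtain h L j where r: "rel s h" and I: "invar n K h L j" and L: "mset (map eset L) = edges_after us i"
      using g unfolding good_def by blast
    let ?E = "edges_after us i" and ?E' = "edges_after us (Suc i)"
    define m where "m = size ?E"
    have m: "m = length L" unfolding m_def L[symmetric] by simp
    have mM: "m \<le> M" using size i by (simp add: m_def)
    have P: "pairs_ok n L" using I by (simp add: invar_def top_def arr_def)
    have E: "edges_ok n ?E" using cont_edges_ok[OF P, of "length L"] by (simp only: cont_all L)
    have v: "valid_update {..<n} ?E (us ! i)" using valid i by (simp add: valid_updates_def)
    have E': "?E' = apply_update (us ! i) ?E" by (rule edges_after_Suc[OF i])
    have sE': "size ?E' \<le> m + 1" unfolding E' m_def
      by (cases "us ! i") (simp_all add: le_Suc_eq diff_le_self size_Diff_singleton_if)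
    have d: "max_density {..<n} ?E \<le> \<rho>" "max_density {..<n} ?E' \<le> \<rho>" using dens i by simp_all
    \<comment> \<open>There is an update, so the graph before it or the graph after it has an edge,
      and \<open>\<rho>\<close> bounds the densities of both.\<close>
    have \<rho>: "1 / 2 \<le> \<rho>"
    proof (cases "us ! i")
      case (Insert a b)
      then have "edges_ok n ?E'" using E v unfolding E' edges_ok_def by auto
      moreover have "{a, b} \<in># ?E'" unfolding E' Insert by simp
      ultimately show ?thesis using max_density_half d(2) order_trans by blast
    next
      case (Delete a b)
      then have "{a, b} \<in># ?E" using v by simp
      then show ?thesis using max_density_half[OF E] d(1) order_trans by blast
    qed
    define Lg where "Lg = log 2 (real m + 2)"
    define te where "te = edge_time (nat \<lfloor>10 * \<rho>\<rfloor>) (nat \<lceil>1152 * real K ^ 2 * Lg ^ 2\<rceil>) (nat \<lfloor>192 * real K ^ 2 * Lg\<rfloor>)"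
    have rr: "1 / 2 \<le> min \<rho> (real m + 1)" "min \<rho> (real m + 1) \<le> \<rho>" "min \<rho> (real m + 1) \<le> real m + 1"
      using \<rho> by simp_all
    have Z: "8 * (32 * K ^ 2 * (2 * m + 7)) * (m + 1) + 20 \<le> Z"
      unfolding Z_def by (rule space_bound[OF q(4) _ q(1)]) (use mM q(3) in simp)
    have okL: "okL n Z te K L'"
      if p: "pairs_ok n L'" "max_density {..<n} (mset (map eset L')) \<le> \<rho>" "length L' \<le> m + 1" for L'
      unfolding te_def Lg_def
      by (rule okL_I[OF K1 p(1) dense_le_minI[OF p(2)] p(3) rr Z]) (use p(3) in simp)
    have ok: "okL n Z te K L" by (rule okL[OF P d(1)[folded L]]) (simp add: m)
    have ok': "okL n Z te K L'" if "pairs_ok n L'" "mset (map eset L') = apply_update (us ! i) (mset (map eset L))" for L'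
    proof -
      have a: "mset (map eset L') = ?E'" unfolding that(2) L E' ..
      then have "length L' = size ?E'" by (metis length_map size_mset)
      then show ?thesis by (intro okL[OF that(1) d(2)[folded a]]) (use sE' in simp)
    qed
    have "length L + 1 \<le> Z" using mM q(3) qZ(1) m by simp
    from update_step[OF r I K1 v[folded L] ok this ok']
    obtain t s' h' L' j' where s': "exec w update_com (announce (us ! i) s) t s'" "t \<le> update_time te" "rel s' h'"
      "invar n K h' L' j'" "est_ok n K h' L'" "mset (map eset L') = apply_update (us ! i) (mset (map eset L))"
      by blast
    have L': "mset (map eset L') = ?E'" unfolding s'(6) L E' ..
    have P': "pairs_ok n L'" using s'(4) by (simp add: invar_def top_def arr_def)
    have "is_approx \<epsilon> (max_density {..<n} ?E') (estimate s')"
      unfolding L'[symmetric] by (rule est_approx[OF s'(5) P' K1 Ke n]) (use s'(3) in \<open>simp add: rel_def\<close>)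
    then have "good (Suc i) s'" unfolding good_def using s'(3,4) L' by blast
    moreover have "real t \<le> real (update_time te)" using s'(2) by simp
    then have "real t \<le> ?bnd i"
      using time_final[OF C \<epsilon> \<rho> K_def, of m, folded Lg_def, folded te_def] unfolding m_def by (rule order_trans)
    ultimately show ?thesis using s'(1) by blast
  qed
  \<comment> \<open>Dependent choice asks for a successor of every state, so the requirements are
    conditional on \<open>i\<close>; beyond the last update any state will do.\<close>
  have "\<exists>st. \<forall>i. ((i \<le> length us \<longrightarrow> good i (st i)) \<and> (i = 0 \<longrightarrow> st i = init_state n \<epsilon> \<rho>)) \<and>
    (i < length us \<longrightarrow> (\<exists>t. exec w update_com (announce (us ! i) (st i)) t (st (Suc i)) \<and> real t \<le> ?bnd i))"
  proof (rule dependent_nat_choice)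
    show "\<exists>x. (0 \<le> length us \<longrightarrow> good 0 x) \<and> (0 = 0 \<longrightarrow> x = init_state n \<epsilon> \<rho>)" using init by blast
  next
    fix s i assume a: "(i \<le> length us \<longrightarrow> good i s) \<and> (i = 0 \<longrightarrow> s = init_state n \<epsilon> \<rho>)"
    show "\<exists>s'. ((Suc i \<le> length us \<longrightarrow> good (Suc i) s') \<and> (Suc i = 0 \<longrightarrow> s' = init_state n \<epsilon> \<rho>)) \<and>
      (i < length us \<longrightarrow> (\<exists>t. exec w update_com (announce (us ! i) s) t s' \<and> real t \<le> ?bnd i))"
    proof (cases "i < length us")
      case True
      then show ?thesis using step[OF True, of s] a by auto
    qed simp
  qed
  then obtain st where st: "\<And>i. i \<le> length us \<Longrightarrow> good i (st i)" "st 0 = init_state n \<epsilon> \<rho>"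
    "\<And>i. i < length us \<Longrightarrow> \<exists>t. exec w update_com (announce (us ! i) (st i)) t (st (Suc i)) \<and> real t \<le> ?bnd i"
    by blast
  have "is_approx \<epsilon> (max_density {..<n} (edges_after us i)) (estimate (st i))" if "i \<le> length us" for i
    using st(1)[OF that] by (simp add: good_def)
  then show ?thesis using st(2,3) by blast
qed

theorem theorem3:
  "\<exists>(P :: com) (c :: nat) (C :: real).
     \<forall>(n :: nat) (\<epsilon> :: real) (\<rho> :: real) (us :: update list) (M :: nat) (w :: nat).
       0 < n \<longrightarrow> 0 < \<epsilon> \<longrightarrow> \<epsilon> \<le> 1 \<longrightarrow>
       valid_updates {..<n} us \<longrightarrow>
       (\<forall>i \<le> length us. max_density {..<n} (edges_after us i) \<le> \<rho>) \<longrightarrow>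
       (\<forall>i \<le> length us. size (edges_after us i) \<le> M) \<longrightarrow>
       word_size_ok c w n M \<epsilon> \<rho> \<longrightarrow>
       (\<exists>st :: nat \<Rightarrow> state.
          st 0 = init_state n \<epsilon> \<rho> \<and>
          (\<forall>i \<le> length us.
             is_approx \<epsilon> (max_density {..<n} (edges_after us i)) (estimate (st i))) \<and>
          (\<forall>i < length us. \<exists>t.
             exec w P (announce (us ! i) (st i)) t (st (Suc i)) \<and>
             real t \<le> C * time_bound \<epsilon> \<rho> (size (edges_after us i))))"
proof -
  obtain C where C: "\<And>k N B. edge_time k N B \<le> C * ((k + 1) * (N + 1) * (B + 1))" using edge_time_bound by blast
  obtain C' where C': "\<And>te. update_time te \<le> C' * (te + 1)" using update_time_bound by blast
  show ?thesis
  proof (intro exI[of _ update_com] exI[of _ "1081 :: nat"] exI[of _ "real C' * (real C + 1) * 50000000"] allI impI)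
    fix n M w :: nat and \<epsilon> \<rho> :: real and us :: "update list"
    assume a: "0 < n" "0 < \<epsilon>" "\<epsilon> \<le> 1" "valid_updates {..<n} us"
      "\<forall>i \<le> length us. max_density {..<n} (edges_after us i) \<le> \<rho>"
      "\<forall>i \<le> length us. size (edges_after us i) \<le> M" "word_size_ok 1081 w n M \<epsilon> \<rho>"
    show "\<exists>st :: nat \<Rightarrow> state. st 0 = init_state n \<epsilon> \<rho> \<and>
        (\<forall>i \<le> length us. is_approx \<epsilon> (max_density {..<n} (edges_after us i)) (estimate (st i))) \<and>
        (\<forall>i < length us. \<exists>t. exec w update_com (announce (us ! i) (st i)) t (st (Suc i)) \<and>
           real t \<le> real C' * (real C + 1) * 50000000 * time_bound \<epsilon> \<rho> (size (edges_after us i)))"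
      by (rule update_com_correct[OF C C' a])
  qed
qed

end
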